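(* Let $G$ be an $n$-vertex $2$-connected near triangulation that is not isomorphic to any of the following seven graphs: $K_4^-$, $K_4$, $W_5$, $G_6^1$, $G_6^2$, $G_6^3$, $G_8^1$ (as defined in the context). Then $\overrightarrow{\mathrm{diam}}(G)\le \lceil n/2\rceil$.
   Context: A near triangulation is a plane graph in which every face except possibly the outer face is bounded by a triangle; here it is $2$-connected, so the outer face is bounded by a cycle (the outer cycle). For a directed graph $D$, $d_D(u,v)$ is the length of a shortest directed path from $u$ to $v$ and $\mathrm{diam}(D)=\max_{u,v} d_D(u,v)$. An orientation of an undirected graph assigns a direction to each edge; the oriented diameter $\overrightarrow{\mathrm{diam}}(G)$ of a bridgeless graph $G$ is the minimum of $\mathrm{diam}(D)$ over all strongly connected orientations $D$ of $G$. The excluded graphs: $K_4^-$ is $K_4$ minus one edge; $W_5$ is the wheel obtained by joining a new vertex to all vertices of a $5$-cycle; $G_6^1$ and $G_6^2$ are the two maximal outerplanar graphs on $6$ vertices given by (i) the fan, i.e. a path on $5$ vertices plus a vertex adjacent to all of them, and (ii) the hexagon $v_1v_2v_3v_4v_5v_6v_1$ with chords $v_1v_3, v_1v_4, v_4v_6$; $G_6^3$ is the graph on vertices $a,b,c,x,y,z$ with edges $ab,bc,ca,xa,xb,xc,by,cy,yz,bz$ (embedded with outer cycle $abzyca$, $x$ interior, inner faces $abx,bcx,cax,bcy,byz$), i.e. $K_4$ with a copy of $K_4^-$ glued along an edge; $G_8^1$ is the unique maximal outerplanar graph on $8$ vertices whose oriented diameter exceeds $4$ (it is one of the exceptional graphs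 in the theorem of Wang, Chen, Dankelmann, Guo, Surmacs and Volkmann that every maximal outerplanar graph on $n\ge 3$ vertices other than $K_4^-$, $G_6^1$, $G_6^2$, $G_8^1$ has oriented diameter at most $\lceil n/2\rceil$). *)

theory Defs
  imports "HOL-Analysis.Analysis"
begin

section \<open>Simple graphs\<close>

text \<open>A finite simple graph: finite vertex set V and a symmetric irreflexive
  adjacency relation E living on V.\<close>
definition simple_graph :: "'a set \<Rightarrow> ('a \<Rightarrow> 'a \<Rightarrow> bool) \<Rightarrow> bool" where
  "simple_graph V E \<longleftrightarrow> finite V \<and>
     (\<forall>u v. E u v \<longrightarrow> u \<in> V \<and> v \<in> V \<and> u \<noteq> v \<and> E v u)"

definition edge_rel :: "'a set \<Rightarrow> ('a \<Rightarrow> 'a \<Rightarrow> bool) \<Rightarrow> ('a \<times> 'a) set" where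
  "edge_rel W E = {(u, v). u \<in> W \<and> v \<in> W \<and> E u v}"

text \<open>Connectivity of the subgraph induced by W.\<close>
definition connected_graph :: "'a set \<Rightarrow> ('a \<Rightarrow> 'a \<Rightarrow> bool) \<Rightarrow> bool" where
  "connected_graph W E \<longleftrightarrow> (\<forall>u\<in>W. \<forall>v\<in>W. (u, v) \<in> (edge_rel W E)\<^sup>*)"

text \<open>2-connected: at least 3 vertices, connected, and no cut vertex.\<close>
definition two_connected :: "'a set \<Rightarrow> ('a \<Rightarrow> 'a \<Rightarrow> bool) \<Rightarrow> bool" where
  "two_connected V E \<longleftrightarrow> card V \<ge> 3 \<and> connected_graph V E \<and>
     (\<forall>x\<in>V. connected_graph (V - {x}) E)"

definition isomorphic ::
  "'a set \<Rightarrow> ('a \<Rightarrow> 'a \<Rightarrow> bool) \<Rightarrow> 'b set \<Rightarrow> ('b \<Rightarrow> 'b \<Rightarrow> bool) \<Rightarrow> bool" where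
  "isomorphic V E V' E' \<longleftrightarrow>
     (\<exists>f. bij_betw f V V' \<and> (\<forall>u\<in>V. \<forall>v\<in>V. E u v \<longleftrightarrow> E' (f u) (f v)))"

section \<open>Orientations and oriented diameter\<close>

text \<open>An orientation of (V,E): a set of arcs containing exactly one of (u,v),(v,u)
  for every edge uv, and nothing else.\<close>
definition orientations :: "'a set \<Rightarrow> ('a \<Rightarrow> 'a \<Rightarrow> bool) \<Rightarrow> ('a \<times> 'a) set set" where
  "orientations V E = {A. A \<subseteq> edge_rel V E \<and>
      (\<forall>u\<in>V. \<forall>v\<in>V. E u v \<longrightarrow> ((u, v) \<in> A \<longleftrightarrow> (v, u) \<notin> A))}"

definition strongly_connected :: "'a set \<Rightarrow> ('a \<times> 'a) set \<Rightarrow> bool" where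
  "strongly_connected V A \<longleftrightarrow> (\<forall>u\<in>V. \<forall>v\<in>V. (u, v) \<in> A\<^sup>*)"

text \<open>d_D(u,v): length of a shortest directed path (walk) from u to v.\<close>
definition dir_dist :: "('a \<times> 'a) set \<Rightarrow> 'a \<Rightarrow> 'a \<Rightarrow> nat" where
  "dir_dist A u v = (LEAST k. (u, v) \<in> A ^^ k)"

definition dir_diam :: "'a set \<Rightarrow> ('a \<times> 'a) set \<Rightarrow> nat" where
  "dir_diam V A = Max {dir_dist A u v | u v. u \<in> V \<and> v \<in> V}"

definition oriented_diam :: "'a set \<Rightarrow> ('a \<Rightarrow> 'a \<Rightarrow> bool) \<Rightarrow> nat" where
  "oriented_diam V E =
     Min {dir_diam V A | A. A \<in> orientations V E \<and> strongly_connected V A}"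

section \<open>Plane graphs and near triangulations\<close>

text \<open>A plane embedding of (V,E) in the plane (= complex numbers): distinct points
  p v for the vertices, and for each edge uv an arc c u v from p u to p v
  (the same point set in both directions); arcs avoid the other vertices and
  two distinct edges meet only in common end vertices.\<close>
definition plane_embedding ::
  "'a set \<Rightarrow> ('a \<Rightarrow> 'a \<Rightarrow> bool) \<Rightarrow> ('a \<Rightarrow> complex) \<Rightarrow> ('a \<Rightarrow> 'a \<Rightarrow> real \<Rightarrow> complex) \<Rightarrow> bool" where
  "plane_embedding V E p c \<longleftrightarrow> inj_on p V \<and>
     (\<forall>u v. E u v \<longrightarrow> arc (c u v) \<and> pathstart (c u v) = p u \<and> pathfinish (c u v) = p v
            \<and> path_image (c v u) = path_image (c u v)) \<and>
     (\<forall>u v w. E u v \<longrightarrow> w \<in> V \<longrightarrow> w \<noteq> u \<longrightarrow> w \<noteq> v \<longrightarrow> p w \<notin> path_image (c u v)) \<and>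
     (\<forall>u v x y. E u v \<longrightarrow> E x y \<longrightarrow> {u, v} \<noteq> {x, y} \<longrightarrow>
            path_image (c u v) \<inter> path_image (c x y) \<subseteq> p ` ({u, v} \<inter> {x, y}))"

definition drawing ::
  "'a set \<Rightarrow> ('a \<Rightarrow> 'a \<Rightarrow> bool) \<Rightarrow> ('a \<Rightarrow> complex) \<Rightarrow> ('a \<Rightarrow> 'a \<Rightarrow> real \<Rightarrow> complex) \<Rightarrow> complex set" where
  "drawing V E p c = p ` V \<union> \<Union> {path_image (c u v) | u v. E u v}"

text \<open>Faces: the connected components of the complement of the drawing.\<close>
definition faces ::
  "'a set \<Rightarrow> ('a \<Rightarrow> 'a \<Rightarrow> bool) \<Rightarrow> ('a \<Rightarrow> complex) \<Rightarrow> ('a \<Rightarrow> 'a \<Rightarrow> real \<Rightarrow> complex) \<Rightarrow> complex set set" where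
  "faces V E p c = {connected_component_set (- drawing V E p c) z | z. z \<notin> drawing V E p c}"

text \<open>Near triangulation: every face except the outer (unbounded) one is bounded by
  a triangle, i.e. its frontier is exactly the drawn triangle a b d.\<close>
definition near_triangulation ::
  "'a set \<Rightarrow> ('a \<Rightarrow> 'a \<Rightarrow> bool) \<Rightarrow> ('a \<Rightarrow> complex) \<Rightarrow> ('a \<Rightarrow> 'a \<Rightarrow> real \<Rightarrow> complex) \<Rightarrow> bool" where
  "near_triangulation V E p c \<longleftrightarrow>
     (\<forall>F \<in> faces V E p c. bounded F \<longrightarrow>
        (\<exists>a b d. E a b \<and> E b d \<and> E d a \<and>
           frontier F = path_image (c a b) \<union> path_image (c b d) \<union> path_image (c d a)))"

section \<open>The excluded graphs (on vertices 0,1,...)\<close>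

definition graph_of :: "nat \<Rightarrow> (nat \<times> nat) list \<Rightarrow> nat set \<times> (nat \<Rightarrow> nat \<Rightarrow> bool)" where
  "graph_of n es = ({..<n}, \<lambda>u v. (u, v) \<in> set es \<or> (v, u) \<in> set es)"

definition K4_minus where "K4_minus = graph_of 4 [(0,1),(0,2),(0,3),(1,2),(1,3)]"
definition K4 where "K4 = graph_of 4 [(0,1),(0,2),(0,3),(1,2),(1,3),(2,3)]"
text \<open>W5: 5-cycle 0..4 plus hub 5.\<close>
definition W5 where
  "W5 = graph_of 6 [(0,1),(1,2),(2,3),(3,4),(4,0),(5,0),(5,1),(5,2),(5,3),(5,4)]"
text \<open>G_6^1: fan, path 0-1-2-3-4 plus apex 5.\<close>
definition G61 where
  "G61 = graph_of 6 [(0,1),(1,2),(2,3),(3,4),(5,0),(5,1),(5,2),(5,3),(5,4)]"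
text \<open>G_6^2: hexagon v1..v6, renamed v_i = i-1, with chords v1v3, v1v4, v4v6.\<close>
definition G62 where
  "G62 = graph_of 6 [(0,1),(1,2),(2,3),(3,4),(4,5),(5,0),(0,2),(0,3),(3,5)]"
text \<open>G_6^3: a=0,b=1,c=2,x=3,y=4,z=5; edges ab,bc,ca,xa,xb,xc,by,cy,yz,bz.\<close>
definition G63 where
  "G63 = graph_of 6 [(0,1),(1,2),(2,0),(3,0),(3,1),(3,2),(1,4),(2,4),(4,5),(1,5)]"
text \<open>G_8^1: the unique maximal outerplanar graph on 8 vertices with oriented diameter
  exceeding 4 (found by exhaustive search): octagon 0..7 with chords 17,27,37,35,36.\<close>
definition G81 where
  "G81 = graph_of 8 [(0,1),(1,2),(2,3),(3,4),(4,5),(5,6),(6,7),(7,0),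
                     (1,7),(2,7),(3,7),(3,5),(3,6)]"

definition iso_to :: "'a set \<Rightarrow> ('a \<Rightarrow> 'a \<Rightarrow> bool) \<Rightarrow> nat set \<times> (nat \<Rightarrow> nat \<Rightarrow> bool) \<Rightarrow> bool" where
  "iso_to V E H \<longleftrightarrow> isomorphic V E (fst H) (snd H)"

end

theory Submission
  imports Defs
begin

text \<open>
The Jordan curve theorem turns the drawing into a combinatorial triangulated disc: deleting a boundary
edge \<open>uv\<close> with inner face \<open>uvw\<close> leaves a smaller disc if \<open>w\<close> is an inner vertex, and two discs (or
edges) meeting in \<open>w\<close> otherwise.

Writing \<open>k = \<lceil>n/2\<rceil>\<close>, every such disc either contains a spanning 2-tree, or has four vertices that can
be deleted so that a graph glued from discs along boundary edges remains, each deleted vertex having two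
adjacent neighbours there. In the latter case induct: given an orientation in which all distances are at most
\<open>k - 2\<close>, except that those out of one vertex \<open>s\<close> may be \<open>k - 1\<close>, orient a path \<open>a \<rightarrow> x \<rightarrow> b\<close> with \<open>b \<noteq> s\<close>
through every deleted vertex \<open>x\<close>.

For 2-trees on \<open>n \<ge> 9\<close> vertices, an odd \<open>n\<close> is reduced to \<open>n - 1\<close> by deleting one simplicial vertex;
for even \<open>n\<close> there are four simplicial vertices to delete, or else the 2-tree ends in two consecutive
simplicial deletions whose removal lowers \<open>n\<close> by two. The cases \<open>n \<le> 8\<close> are settled by the
list of all 2-trees and explicit orientations, checked by symbolic evaluation. The
only exceptional 2-tree not on the list of excluded graphs, three triangles on a common edge with an ear, is
not a triangulated disc: each of its three vertices of degree two would contribute a boundary edge at the same vertex.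
\<close>

section \<open>Jordan arcs\<close>

text \<open>Four deleted vertices lower ceil(n/2) by exactly 2, and 2 is the price of new vertices
  however many are added at once: one arc to leave one of them and one arc to reach another. The
  induction cannot insist on remainders that meet the bound, since the exceptional 2-trees on 6 and
  8 vertices occur as remainders. They satisfy the weaker hypothesis with one slow start vertex
  \<open>s\<close>, and \<open>s\<close> can be avoided because every new vertex has two neighbours
  to choose from. The topological part only has to deliver a recursive description of discs. The
  dichotomy on discs is then proved relative to a set \<open>Y\<close> of boundary edges on which
  further pieces may be glued: each edge of \<open>Y\<close> counts as one deletable vertex still to
  come, so the count of four survives cutting a disc into pieces. A 2-tree with fewer than four
  simplicial vertices is handled by trading 2 vertices for 1 unit; there the orientation already
  found may have to be changed near the end of the 2-tree.\<close>

definition arcset :: "complex set \<Rightarrow> complex \<Rightarrow> complex \<Rightarrow> bool" where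
  "arcset A a b \<longleftrightarrow> (\<exists>g. arc g \<and> path_image g = A \<and> pathstart g = a \<and> pathfinish g = b)"

lemma arcset_rev: "arcset A a b \<Longrightarrow> arcset A b a"
  unfolding arcset_def by (metis arc_reversepath path_image_reversepath pathfinish_reversepath pathstart_reversepath)

lemma arcset_ends: assumes "arcset A a b" shows "a \<in> A" "b \<in> A" "a \<noteq> b" "compact A" "connected A" "A \<noteq> {a, b}"
proof -
  obtain g where g: "arc g" "path_image g = A" "pathstart g = a" "pathfinish g = b"
    using assms unfolding arcset_def by blast
  show "a \<in> A" "b \<in> A" "a \<noteq> b" using g arc_distinct_ends[OF g(1)] by auto
  show "compact A" "connected A" using g by (auto simp: compact_arc_image connected_arc_image)
  show "A \<noteq> {a, b}"
    using nonempty_simple_path_endless[OF arc_imp_simple_path[OF g(1)]] g by auto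
qed

lemma arcset_join:
  assumes "arcset A a b" "arcset B b d" "A \<inter> B \<subseteq> {b}"
  shows "arcset (A \<union> B) a d"
proof -
  obtain g where g: "arc g" "path_image g = A" "pathstart g = a" "pathfinish g = b"
    using assms unfolding arcset_def by blast
  obtain h where h: "arc h" "path_image h = B" "pathstart h = b" "pathfinish h = d"
    using assms unfolding arcset_def by blast
  have "arc (g +++ h)" using g h assms(3) by (intro arc_join) auto
  thus ?thesis unfolding arcset_def
    using g h by (metis path_image_join pathfinish_join pathstart_join)
qed

text \<open>The open arc is the image of the open interval, hence connected and dense in the arc.
  Connectedness will put the interior of an edge on one side of a cycle, and density brings the end
  points into the closure of that side.\<close>

lemma arcset_open:
  assumes "arcset A a b"
  shows "connected (A - {a, b})" "A - {a, b} \<noteq> {}" "A \<subseteq> closure (A - {a, b})"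
proof -
  obtain g where g: "arc g" "path_image g = A" "pathstart g = a" "pathfinish g = b"
    using assms unfolding arcset_def by blast
  have sp: "simple_path g" using g arc_imp_simple_path by blast
  show "connected (A - {a, b})" using connected_simple_path_endless[OF sp] g by simp
  show "A - {a, b} \<noteq> {}" using nonempty_simple_path_endless[OF sp] g by simp
  have e: "A - {a, b} = g ` {0<..<1}" using simple_path_endless[OF sp] g by simp
  have "continuous_on {0..1} g" using g(1) arc_imp_path path_def by blast
  hence c: "continuous_on (closure {0<..<1}) g" by simp
  have "g ` closure {0<..<1} \<subseteq> closure (g ` {0<..<1})"
    by (rule image_closure_subset[OF c]) (auto simp: closure_subset)
  thus "A \<subseteq> closure (A - {a, b})" unfolding e using g(2) by (simp add: path_image_def)
qed

text \<open>One arc reversed and joined to the other is a simple closed curve, so all of this is the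
  Jordan curve theorem. Working with point sets frees the later arguments from the direction of the
  arcs.\<close>

lemma jordan_arcs:
  assumes "arcset A a b" "arcset B a b" "A \<inter> B = {a, b}"
  shows "inside (A \<union> B) \<noteq> {}" "open (inside (A \<union> B))" "connected (inside (A \<union> B))"
    "open (outside (A \<union> B))" "connected (outside (A \<union> B))" "bounded (inside (A \<union> B))"
    "\<not> bounded (outside (A \<union> B))"
    "frontier (inside (A \<union> B)) = A \<union> B" "frontier (outside (A \<union> B)) = A \<union> B"
proof -
  obtain g where g: "arc g" "path_image g = A" "pathstart g = a" "pathfinish g = b"
    using assms unfolding arcset_def by blast
  obtain h where h: "arc h" "path_image h = B" "pathstart h = b" "pathfinish h = a"
    using arcset_rev[OF assms(2)] unfolding arcset_def by blast
  have "simple_path (g +++ h)" using g h assms(3) by (intro simple_path_join_loop) auto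
  moreover have "pathfinish (g +++ h) = pathstart (g +++ h)" using g h by simp
  moreover have "path_image (g +++ h) = A \<union> B" using g h by (simp add: path_image_join)
  ultimately show "inside (A \<union> B) \<noteq> {}" "open (inside (A \<union> B))" "connected (inside (A \<union> B))"
    "open (outside (A \<union> B))" "connected (outside (A \<union> B))" "bounded (inside (A \<union> B))"
    "\<not> bounded (outside (A \<union> B))"
    "frontier (inside (A \<union> B)) = A \<union> B" "frontier (outside (A \<union> B)) = A \<union> B"
    using Jordan_inside_outside[of "g +++ h"] by auto
qed

lemma closure_inside_jordan:
  assumes "arcset A a b" "arcset B a b" "A \<inter> B = {a, b}"
  shows "closure (inside (A \<union> B)) = A \<union> B \<union> inside (A \<union> B)"
  using jordan_arcs[OF assms] by (metis closure_Un_frontier sup_commute)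

text \<open>The cross-cut position of three arcs with common ends. The next lemma treats the
  position in which \<open>C\<close> stays out of the inside of \<open>A \<union> B\<close>.\<close>

lemma theta_split:
  assumes A: "arcset A a b" and B: "arcset B a b" and C: "arcset C a b"
    and AB: "A \<inter> B = {a, b}" and AC: "A \<inter> C = {a, b}" and BC: "B \<inter> C = {a, b}"
    and ne: "C \<inter> inside (A \<union> B) \<noteq> {}"
  shows "inside (A \<union> C) \<inter> inside (B \<union> C) = {}"
    "inside (A \<union> C) \<union> inside (B \<union> C) \<union> (C - {a, b}) = inside (A \<union> B)"
proof -
  obtain f where f: "arc f" "path_image f = A" "pathstart f = a" "pathfinish f = b"
    using A unfolding arcset_def by blast
  obtain g where g: "arc g" "path_image g = B" "pathstart g = a" "pathfinish g = b"
    using B unfolding arcset_def by blast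
  obtain h where h: "arc h" "path_image h = C" "pathstart h = a" "pathfinish h = b"
    using C unfolding arcset_def by blast
  show "inside (A \<union> C) \<inter> inside (B \<union> C) = {}"
    "inside (A \<union> C) \<union> inside (B \<union> C) \<union> (C - {a, b}) = inside (A \<union> B)"
    using split_inside_simple_closed_curve[OF arc_imp_simple_path[OF f(1)] f(3,4)
        arc_imp_simple_path[OF g(1)] g(3,4) arc_imp_simple_path[OF h(1)] h(3,4)]
      f(2) g(2) h(2) AB AC BC ne arcset_ends(3)[OF A] by metis+
qed

text \<open>Of three arcs with common ends one lies between the other two; if it is not
  \<open>C\<close>, it must be \<open>A\<close> or \<open>B\<close>. Otherwise a point
  \<open>q\<close> inside \<open>B \<union> C\<close> would be outside both
  \<open>A \<union> B\<close> and \<open>A \<union> C\<close>. These two curves meet in the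
  connected set \<open>A\<close>, so by Janiszewski's theorem \<open>q\<close> could escape to
  infinity without crossing any of the three arcs.\<close>

lemma theta_outside:
  assumes A: "arcset A a b" and B: "arcset B a b" and C: "arcset C a b"
    and AB: "A \<inter> B = {a, b}" and AC: "A \<inter> C = {a, b}" and BC: "B \<inter> C = {a, b}"
    and out: "C \<inter> inside (A \<union> B) = {}"
  shows "A \<inter> inside (B \<union> C) \<noteq> {} \<or> B \<inter> inside (A \<union> C) \<noteq> {}"
proof (rule ccontr)
  assume "\<not> ?thesis"
  hence 1: "A \<inter> inside (B \<union> C) = {}" and 2: "B \<inter> inside (A \<union> C) = {}" by auto
  note jAB = jordan_arcs[OF A B AB] and jAC = jordan_arcs[OF A C AC] and jBC = jordan_arcs[OF B C BC]
  obtain q where q: "q \<in> inside (B \<union> C)" using jBC(1) by blast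
  \<comment> \<open>\<open>D\<close> is one of \<open>B\<close>, \<open>C\<close> and
    \<open>D'\<close> the other. The connected inside of \<open>B \<union> C\<close> misses
    \<open>A \<union> D\<close>. If it lay inside that curve, its closure would put
    \<open>D'\<close> into the closed region, and the disjointness hypotheses would leave only the
    two ends for \<open>D'\<close>.\<close>
  have sub: "inside (B \<union> C) \<subseteq> outside (A \<union> D)"
    if D: "arcset D a b" "A \<inter> D = {a, b}" "D \<inter> inside (B \<union> C) = {}" "D' \<inter> inside (A \<union> D) = {}"
        "D' \<inter> D = {a,b}" "B \<union> C = D \<union> D'" "A \<inter> D' = {a,b}" "arcset D' a b" for D D'
  proof (rule ccontr)
    note jAD = jordan_arcs[OF A D(1,2)]
    assume "\<not> ?thesis"
    then obtain r where r: "r \<in> inside (B \<union> C)" "r \<notin> outside (A \<union> D)" by blast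
    have rAD: "inside (B \<union> C) \<inter> (A \<union> D) = {}" using 1 D by blast
    hence "r \<in> inside (A \<union> D)" using r inside_Un_outside[of "A \<union> D"] by blast
    moreover have "inside (B \<union> C) \<inter> outside (A \<union> D) = {} \<or> inside (B \<union> C) \<inter> inside (A \<union> D) = {}"
      using jBC(3) jAD(2,4) rAD inside_Un_outside[of "A \<union> D"] inside_Int_outside[of "A \<union> D"]
      unfolding connected_def by blast
    ultimately have "inside (B \<union> C) \<subseteq> inside (A \<union> D)"
      using r rAD inside_Un_outside[of "A \<union> D"] by blast
    hence "closure (inside (B \<union> C)) \<subseteq> closure (inside (A \<union> D))" by (rule closure_mono)
    hence "B \<union> C \<subseteq> A \<union> D \<union> inside (A \<union> D)"
      unfolding closure_inside_jordan[OF B C BC] closure_inside_jordan[OF A D(1,2)] by (rule order_trans[rotated]) (rule Un_upper1)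
    hence "D' \<subseteq> A \<union> D \<union> inside (A \<union> D)" unfolding D(6) by (rule order_trans[rotated]) (rule Un_upper2)
    hence "D' \<subseteq> (A \<inter> D') \<union> (D' \<inter> D) \<union> (D' \<inter> inside (A \<union> D))" by (intro subsetI) auto
    hence "D' \<subseteq> {a, b}" unfolding D(4,5,7) by simp
    thus False using arcset_ends(1,2,6)[OF D(8)] by auto
  qed
  have dBC: "B \<inter> inside (B \<union> C) = {}" "C \<inter> inside (B \<union> C) = {}"
    using inside_no_overlap[of "B \<union> C"] by blast+
  have qAB: "q \<in> outside (A \<union> B)"
    by (rule subsetD[OF sub[where D'=C] q]) (use B AB out AC BC C dBC in auto)
  have qAC: "q \<in> outside (A \<union> C)"
    by (rule subsetD[OF sub[where D'=B] q]) (use B AB 2 AC BC C dBC in auto)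
  have cp: "compact A" "compact B" "compact C" using A B C arcset_ends by auto
  have "bounded (A \<union> B \<union> C)" using cp by (simp add: compact_imp_bounded)
  hence "outside (A \<union> B \<union> C) \<noteq> {}" by (rule outside_bounded_nonempty)
  \<comment> \<open>\<open>w\<close> stands for infinity: it lies outside all three closed curves at
    once.\<close>
  then obtain w where w: "w \<in> outside (A \<union> B \<union> C)" by blast
  have w1: "w \<in> outside (A \<union> B)" "w \<in> outside (A \<union> C)" "w \<in> outside (B \<union> C)"
    using w outside_mono[of "A \<union> B" "A \<union> B \<union> C"] outside_mono[of "A \<union> C" "A \<union> B \<union> C"]
      outside_mono[of "B \<union> C" "A \<union> B \<union> C"] by auto
  have "connected_component (- ((A \<union> B) \<union> (A \<union> C))) q w"
  proof (rule Janiszewski)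
    show "compact (A \<union> B)" "closed (A \<union> C)" using cp by (auto intro: compact_imp_closed)
    have "(A \<union> B) \<inter> (A \<union> C) = A" using AB AC BC by blast
    thus "connected ((A \<union> B) \<inter> (A \<union> C))" using A arcset_ends by simp
    show "connected_component (- (A \<union> B)) q w"
      unfolding connected_component_def using jAB(5) qAB w1 outside_no_overlap[of "A \<union> B"] by blast
    show "connected_component (- (A \<union> C)) q w"
      unfolding connected_component_def using jAC(5) qAC w1 outside_no_overlap[of "A \<union> C"] by blast
  qed
  hence "connected_component (- (B \<union> C)) q w"
    by (rule connected_component_of_subset) auto
  hence "q \<in> outside (B \<union> C)" using w1(3) by (metis outside_same_component connected_component_sym)
  thus False using q inside_Int_outside by blast
qed

section \<open>Plane graphs\<close>

fun pe :: "'a list \<Rightarrow> 'a set set" where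
  "pe (x # y # zs) = insert {x, y} (pe (y # zs))"
| "pe _ = {}"

lemma pe_append: "xs \<noteq> [] \<Longrightarrow> ys \<noteq> [] \<Longrightarrow> pe (xs @ ys) = pe xs \<union> {{last xs, hd ys}} \<union> pe ys"
proof (induction xs)
  case (Cons x xs)
  then show ?case by (cases xs; cases ys) auto
qed simp

lemma pe_Cons: "ys \<noteq> [] \<Longrightarrow> pe (x # ys) = insert {x, hd ys} (pe ys)"
  by (cases ys) auto

lemma pe_rev: "pe (rev xs) = pe xs"
proof (induction xs rule: pe.induct)
  case (1 x y zs)
  have "pe (rev (x # y # zs)) = pe (rev (y # zs) @ [x])" by simp
  also have "\<dots> = pe (rev (y # zs)) \<union> {{y, x}}" by (subst pe_append) auto
  finally show ?case using 1 by (auto simp: insert_commute)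
qed auto

lemma Union_pe: "length xs \<ge> 2 \<Longrightarrow> \<Union> (pe xs) = set xs"
proof (induction xs rule: pe.induct)
  case (1 x y zs)
  then show ?case by (cases zs) auto
qed auto

lemma pe_sub: "e \<in> pe xs \<Longrightarrow> e \<subseteq> set xs"
  by (induction xs rule: pe.induct) auto

lemma pe_nth: "e \<in> pe xs \<Longrightarrow> \<exists>A B. xs = A @ B \<and> A \<noteq> [] \<and> B \<noteq> [] \<and> e = {last A, hd B}"
proof (induction xs rule: pe.induct)
  case (1 x y zs)
  show ?case
  proof (cases "e = {x, y}")
    case True
    have "x # y # zs = [x] @ (y # zs)" by simp
    thus ?thesis using True by (metis hd_Cons_tl last.simps list.distinct(1) list.sel(1))
  next
    case False
    then obtain A B where "y # zs = A @ B" "A \<noteq> []" "B \<noteq> []" "e = {last A, hd B}" using 1 by auto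
    moreover from this have "x # y # zs = (x # A) @ B" by simp
    ultimately show ?thesis by (metis last_ConsR list.distinct(1))
  qed
qed auto

section \<open>Plane graphs: drawn edges, paths and cycles\<close>

locale plane =
  fixes V :: "'a set" and E :: "'a \<Rightarrow> 'a \<Rightarrow> bool"
    and p :: "'a \<Rightarrow> complex" and c :: "'a \<Rightarrow> 'a \<Rightarrow> real \<Rightarrow> complex"
  assumes graph: "simple_graph V E" and embedding: "plane_embedding V E p c"
begin

lemma finV: "finite V" using graph unfolding simple_graph_def by blast
lemma Edge: "E u v \<Longrightarrow> u \<in> V" "E u v \<Longrightarrow> v \<in> V" "E u v \<Longrightarrow> u \<noteq> v" "E u v \<Longrightarrow> E v u"
  using graph unfolding simple_graph_def by blast+
lemma injp: "inj_on p V" using embedding unfolding plane_embedding_def by blast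
definition EE :: "'a set set" where "EE = {{u, v} | u v. E u v}"
text \<open>The union over both orders of the end points makes the drawn edge depend on the
  unordered pair only; for an edge both summands are the same point set.\<close>

definition ei :: "'a set \<Rightarrow> complex set" where
  "ei e = \<Union> {path_image (c u v) | u v. E u v \<and> e = {u, v}}"

lemma EE_iff: "{u, v} \<in> EE \<longleftrightarrow> E u v"
  unfolding EE_def using Edge(4) by (auto simp: doubleton_eq_iff)
lemma EE_cases: assumes "e \<in> EE" obtains u v where "e = {u, v}" "E u v" "u \<noteq> v" "u \<in> V" "v \<in> V"
  using assms Edge unfolding EE_def by blast
lemma finite_EE: "finite EE"
proof -
  have "EE \<subseteq> Pow V" unfolding EE_def using Edge by blast
  thus ?thesis using finV finite_subset by blast
qed

lemma ei_pair: assumes "E u v" shows "ei {u, v} = path_image (c u v)"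
proof -
  have "path_image (c v u) = path_image (c u v)" using embedding assms unfolding plane_embedding_def by blast
  hence "{path_image (c x y) | x y. E x y \<and> {u, v} = {x, y}} = {path_image (c u v)}"
    using assms Edge(4) by (auto simp: doubleton_eq_iff)
  thus ?thesis unfolding ei_def by simp
qed

lemma ei_arc: assumes "E u v" shows "arcset (ei {u, v}) (p u) (p v)"
  unfolding ei_pair[OF assms] arcset_def using embedding assms unfolding plane_embedding_def by blast

lemma ei_vertex: assumes "e \<in> EE" "w \<in> V" shows "p w \<in> ei e \<longleftrightarrow> w \<in> e"
proof -
  obtain u v where e: "e = {u, v}" "E u v" using assms(1) by (elim EE_cases)
  have "w = u \<or> w = v" if "p w \<in> path_image (c u v)"
    using embedding e(2) assms(2) that unfolding plane_embedding_def by blast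
  thus ?thesis using e ei_pair arcset_ends(1,2)[OF ei_arc[OF e(2)]] by auto
qed

lemma ei_Int: assumes "e \<in> EE" "f \<in> EE" "e \<noteq> f" shows "ei e \<inter> ei f \<subseteq> p ` (e \<inter> f)"
proof -
  obtain u v where e: "e = {u, v}" "E u v" using assms(1) by (elim EE_cases)
  obtain x y where f: "f = {x, y}" "E x y" using assms(2) by (elim EE_cases)
  show ?thesis unfolding e f ei_pair[OF e(2)] ei_pair[OF f(2)]
    using embedding e f assms(3) unfolding plane_embedding_def by blast
qed

definition J :: "'a set set \<Rightarrow> complex set" where "J Z = \<Union> (ei ` Z)"

lemma J_Un: "J (Z \<union> W) = J Z \<union> J W" unfolding J_def by blast
lemma J_insert: "J (insert e Z) = ei e \<union> J Z" unfolding J_def by blast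
lemma J_empty: "J {} = {}" unfolding J_def by blast

lemma EE_V: assumes "Z \<subseteq> EE" shows "\<Union> Z \<subseteq> V"
proof
  fix x assume "x \<in> \<Union> Z"
  then obtain e where e: "x \<in> e" "e \<in> EE" using assms by blast
  then obtain u v where "e = {u, v}" "u \<in> V" "v \<in> V" by (elim EE_cases)
  thus "x \<in> V" using e by blast
qed

lemma J_vertex: "Z \<subseteq> EE \<Longrightarrow> w \<in> V \<Longrightarrow> p w \<in> J Z \<longleftrightarrow> w \<in> \<Union> Z"
  unfolding J_def using ei_vertex by blast

text \<open>Distinct edges meet only in common ends, so this turns questions about intersections of
  curves into questions about vertex sets.\<close>

lemma J_Int: assumes "Z \<subseteq> EE" "W \<subseteq> EE" "Z \<inter> W = {}"
  shows "J Z \<inter> J W = p ` (\<Union> Z \<inter> \<Union> W)"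
proof
  show "J Z \<inter> J W \<subseteq> p ` (\<Union> Z \<inter> \<Union> W)"
  proof
    fix z assume "z \<in> J Z \<inter> J W"
    then obtain e f where ef: "e \<in> Z" "f \<in> W" "z \<in> ei e" "z \<in> ei f" unfolding J_def by blast
    hence "z \<in> p ` (e \<inter> f)" using ei_Int[of e f] assms by blast
    thus "z \<in> p ` (\<Union> Z \<inter> \<Union> W)" using ef by blast
  qed
  have "\<Union> Z \<subseteq> V" using EE_V assms by blast
  thus "p ` (\<Union> Z \<inter> \<Union> W) \<subseteq> J Z \<inter> J W" using J_vertex assms by blast
qed

definition dei :: "'a set \<Rightarrow> complex set" where "dei e = ei e - p ` e"

lemma dei: assumes "e \<in> EE"
  shows "connected (dei e)" "dei e \<noteq> {}" "ei e \<subseteq> closure (dei e)"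
proof -
  obtain u v where e: "e = {u, v}" "E u v" using assms(1) by (elim EE_cases)
  show "connected (dei e)" "dei e \<noteq> {}" "ei e \<subseteq> closure (dei e)"
    using arcset_open[OF ei_arc[OF e(2)]] unfolding dei_def e by auto
qed

lemma dei_J: assumes "e \<in> EE" "Z \<subseteq> EE" "e \<notin> Z" shows "dei e \<inter> J Z = {}"
  using J_Int[of "{e}" Z] assms unfolding dei_def J_insert J_empty by auto

lemma J_compact: "Z \<subseteq> EE \<Longrightarrow> compact (J Z)"
proof -
  assume Z: "Z \<subseteq> EE"
  hence "finite Z" using finite_EE finite_subset by blast
  moreover have "compact (ei e)" if "e \<in> Z" for e
  proof -
    have "e \<in> EE" using that Z by blast
    then obtain u v where e: "e = {u, v}" "E u v" by (elim EE_cases)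
    thus ?thesis using arcset_ends(4)[OF ei_arc[OF e(2)]] by simp
  qed
  ultimately show ?thesis unfolding J_def by (intro compact_Union) auto
qed

text \<open>The condition \<open>a \<noteq> b\<close> excludes the path with a single vertex, whose
  drawing would not be an arc.\<close>

definition gp :: "'a \<Rightarrow> 'a \<Rightarrow> 'a list \<Rightarrow> bool" where
  "gp a b xs \<longleftrightarrow> xs \<noteq> [] \<and> distinct xs \<and> successively E xs \<and> hd xs = a \<and> last xs = b \<and> a \<noteq> b"

lemma gp_len: "gp a b xs \<Longrightarrow> length xs \<ge> 2"
  unfolding gp_def by (cases xs rule: pe.cases) auto

lemma gp_set: "gp a b xs \<Longrightarrow> a \<in> set xs" "gp a b xs \<Longrightarrow> b \<in> set xs" "gp a b xs \<Longrightarrow> a \<noteq> b"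
  "gp a b xs \<Longrightarrow> \<Union> (pe xs) = set xs"
  using gp_len Union_pe unfolding gp_def by (auto intro: hd_in_set last_in_set)

lemma pe_EE: "successively E xs \<Longrightarrow> pe xs \<subseteq> EE"
  by (induction xs rule: pe.induct) (auto simp: EE_iff)

lemma gp_EE: "gp a b xs \<Longrightarrow> pe xs \<subseteq> EE" unfolding gp_def using pe_EE by blast

lemma gp_rev: "gp a b xs \<Longrightarrow> gp b a (rev xs)"
proof -
  have "successively (\<lambda>x y. E y x) xs = successively E xs"
    using Edge(4) by (intro successively_cong) auto
  thus "gp a b xs \<Longrightarrow> gp b a (rev xs)" unfolding gp_def by (auto simp: hd_rev last_rev)
qed

text \<open>Edges are put in front one at a time: by \<open>J_Int\<close> the new edge meets the
  rest of the path in the joining vertex only.\<close>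

lemma gp_arc: "gp a b xs \<Longrightarrow> arcset (J (pe xs)) (p a) (p b)"
proof (induction xs arbitrary: a rule: pe.induct)
  case (1 x y zs)
  have Exy: "E x y" "x = a" using 1(2) unfolding gp_def by auto
  show ?case
  proof (cases "zs = []")
    case True
    thus ?thesis using 1(2) Exy ei_arc[OF Exy(1)] unfolding gp_def by (simp add: J_insert J_empty)
  next
    case False
    have gp': "gp y b (y # zs)" using 1(2) False last_in_set[OF False] unfolding gp_def by auto
    have "pe (y # zs) \<subseteq> EE" using gp_EE[OF gp'] .
    moreover have "{x, y} \<notin> pe (y # zs)" using 1(2) pe_sub[of "{x,y}" "y # zs"] unfolding gp_def by auto
    ultimately have "ei {x, y} \<inter> J (pe (y # zs)) = p ` ({x, y} \<inter> set (y # zs))"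
      using J_Int[of "{{x, y}}" "pe (y # zs)"] gp_set(4)[OF gp'] Exy by (simp add: J_insert J_empty EE_iff)
    also have "{x, y} \<inter> set (y # zs) = {y}" using 1(2) unfolding gp_def by auto
    finally have "arcset (ei {x, y} \<union> J (pe (y # zs))) (p x) (p b)"
      by (intro arcset_join[OF ei_arc[OF Exy(1)] 1(1)[OF gp']]) auto
    thus ?thesis using Exy by (simp add: J_insert)
  qed
qed (auto simp: gp_def)

section \<open>Closed regions of cycles and their division by an inner path\<close>

definition R :: "'a set set \<Rightarrow> complex set" where "R Z = J Z \<union> inside (J Z)"
definition S :: "'a set set \<Rightarrow> 'a set" where "S Z = {v \<in> V. p v \<in> R Z}"
definition F :: "'a set set \<Rightarrow> 'a set set" where "F Z = {e \<in> EE. ei e \<subseteq> R Z}"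

text \<open>A cycle in the form that the three-arc lemmas ask for. Edge-disjointness rules out that
  both paths are the single edge \<open>ab\<close>.\<close>

definition two_paths :: "'a \<Rightarrow> 'a \<Rightarrow> 'a list \<Rightarrow> 'a list \<Rightarrow> bool" where
  "two_paths a b xs ys \<longleftrightarrow> gp a b xs \<and> gp a b ys \<and> set xs \<inter> set ys = {a, b} \<and> pe xs \<inter> pe ys = {}"

lemma two_paths_arcs: assumes "two_paths a b xs ys"
  shows "arcset (J (pe xs)) (p a) (p b)" "arcset (J (pe ys)) (p a) (p b)"
    "J (pe xs) \<inter> J (pe ys) = {p a, p b}"
proof -
  show "arcset (J (pe xs)) (p a) (p b)" "arcset (J (pe ys)) (p a) (p b)"
    using assms gp_arc unfolding two_paths_def by auto
  show "J (pe xs) \<inter> J (pe ys) = {p a, p b}"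
    using assms J_Int[of "pe xs" "pe ys"] gp_EE gp_set(4)
    unfolding two_paths_def by (metis image_empty image_insert)
qed

definition cyc :: "'a set set \<Rightarrow> bool" where
  "cyc Z \<longleftrightarrow> (\<exists>a b xs ys. two_paths a b xs ys \<and> Z = pe xs \<union> pe ys)"

lemma cyc_jordan:
  assumes "cyc Z"
  shows "Z \<subseteq> EE" "inside (J Z) \<noteq> {}" "open (inside (J Z))" "connected (inside (J Z))"
    "open (outside (J Z))" "connected (outside (J Z))" "bounded (inside (J Z))"
    "frontier (inside (J Z)) = J Z" "closure (inside (J Z)) = J Z \<union> inside (J Z)"
    "closure (outside (J Z)) = J Z \<union> outside (J Z)" "\<not> bounded (outside (J Z))"
proof -
  obtain a b xs ys where *: "two_paths a b xs ys" "Z = pe xs \<union> pe ys" using assms unfolding cyc_def by blast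
  note A = two_paths_arcs[OF *(1)]
  show "Z \<subseteq> EE" using * gp_EE unfolding two_paths_def by auto
  show "inside (J Z) \<noteq> {}" "open (inside (J Z))" "connected (inside (J Z))"
    "open (outside (J Z))" "connected (outside (J Z))" "bounded (inside (J Z))"
    "frontier (inside (J Z)) = J Z" "\<not> bounded (outside (J Z))"
    using jordan_arcs[OF A] unfolding *(2) J_Un by auto
  show "closure (inside (J Z)) = J Z \<union> inside (J Z)"
    using closure_inside_jordan[OF A] unfolding *(2) J_Un .
  show "closure (outside (J Z)) = J Z \<union> outside (J Z)"
    using jordan_arcs[OF A] unfolding *(2) J_Un by (metis closure_Un_frontier sup_commute)
qed

text \<open>The open edge is connected and misses the closed curve.\<close>

lemma edge_side:
  assumes "cyc Z" "e \<in> EE" "e \<notin> Z"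
  shows "dei e \<subseteq> inside (J Z) \<or> dei e \<subseteq> outside (J Z)"
proof -
  have "dei e \<inter> J Z = {}" using dei_J assms cyc_jordan(1) by blast
  hence sub: "dei e \<subseteq> inside (J Z) \<union> outside (J Z)" using inside_Un_outside[of "J Z"] by blast
  hence "inside (J Z) \<inter> dei e = {} \<or> outside (J Z) \<inter> dei e = {}"
    using connectedD[OF dei(1)[OF assms(2)], of "inside (J Z)" "outside (J Z)"] cyc_jordan[OF assms(1)]
      inside_Int_outside[of "J Z"] by blast
  thus ?thesis using sub by blast
qed

text \<open>For an edge off the cycle the open part decides: it is dense in the edge, so the ends
  follow by taking closures.\<close>

lemma F_iff: assumes "cyc Z" "e \<in> EE" "e \<notin> Z" shows "e \<in> F Z \<longleftrightarrow> dei e \<subseteq> inside (J Z)"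
proof
  assume "e \<in> F Z"
  hence "dei e \<subseteq> J Z \<union> inside (J Z)" unfolding F_def dei_def R_def by blast
  thus "dei e \<subseteq> inside (J Z)" using dei_J[OF assms(2) cyc_jordan(1)[OF assms(1)] assms(3)] by blast
next
  assume "dei e \<subseteq> inside (J Z)"
  hence "ei e \<subseteq> closure (inside (J Z))" using dei(3)[OF assms(2)] closure_mono by blast
  thus "e \<in> F Z" unfolding F_def R_def cyc_jordan(9)[OF assms(1)] using assms(2) by blast
qed

lemma Z_F: "cyc Z \<Longrightarrow> Z \<subseteq> F Z" using cyc_jordan(1) unfolding F_def R_def J_def by blast
lemma Z_S: "cyc Z \<Longrightarrow> \<Union> Z \<subseteq> S Z" using cyc_jordan(1)[of Z] EE_V[of Z] J_vertex[of Z] unfolding S_def R_def by blast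
lemma F_S: assumes "cyc Z" "e \<in> F Z" shows "e \<subseteq> S Z"
proof
  fix v assume v: "v \<in> e"
  have e: "e \<in> EE" "ei e \<subseteq> R Z" using assms unfolding F_def by auto
  have "v \<in> V" using v EE_V[of "{e}"] e by auto
  moreover have "p v \<in> ei e" using v ei_vertex e \<open>v \<in> V\<close> by blast
  ultimately show "v \<in> S Z" using e unfolding S_def by blast
qed
lemma F_EE: "F Z \<subseteq> EE" unfolding F_def by blast

text \<open>The set algebra of the next lemma: \<open>X\<close>, \<open>Y\<close>, \<open>W\<close>
  are three drawn paths, \<open>A\<close> and \<open>B\<close> the insides on the two sides of
  \<open>W\<close>, and \<open>I\<close> the inside of the outer cycle.\<close>

lemma theta_sets:
  assumes "A \<inter> B = {}" and I: "A \<union> B \<union> (W - {a, b}) = I" and "I \<inter> (X \<union> Y) = {}"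
    and "A \<inter> (X \<union> W) = {}" and "B \<inter> (Y \<union> W) = {}" and ab: "X \<inter> Y = {a, b}" "a \<in> W" "b \<in> W"
  shows "(X \<union> Y) \<union> I = (X \<union> W \<union> A) \<union> (Y \<union> W \<union> B)"
    and "(X \<union> W \<union> A) \<inter> (Y \<union> W \<union> B) = W"
proof -
  have "a \<in> X" "b \<in> X" using ab by blast+
  thus "(X \<union> Y) \<union> I = (X \<union> W \<union> A) \<union> (Y \<union> W \<union> B)" unfolding I[symmetric] by auto
  have AI: "A \<subseteq> I" "B \<subseteq> I" using I by auto
  show "(X \<union> W \<union> A) \<inter> (Y \<union> W \<union> B) = W"
  proof (intro equalityI subsetI)
    fix z assume z: "z \<in> (X \<union> W \<union> A) \<inter> (Y \<union> W \<union> B)"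
    show "z \<in> W"
    proof (rule ccontr)
      assume "z \<notin> W"
      hence "z \<in> X \<inter> Y" using z AI assms(1,3) by auto
      thus False using ab \<open>z \<notin> W\<close> by auto
    qed
  qed auto
qed

text \<open>The combinatorial form of cutting a region along an inner path \<open>ws\<close>. An
  edge cannot straddle the cut, because its open part is connected and would be covered by two
  disjoint open sets.\<close>

lemma theta:
  assumes xy: "two_paths a b xs ys" and xw: "two_paths a b xs ws" and yw: "two_paths a b ys ws"
    and ne: "J (pe ws) \<inter> inside (J (pe xs \<union> pe ys)) \<noteq> {}"
  shows "inside (J (pe xs \<union> pe ws)) \<inter> inside (J (pe ys \<union> pe ws)) = {}"
    "S (pe xs \<union> pe ys) = S (pe xs \<union> pe ws) \<union> S (pe ys \<union> pe ws)"
    "S (pe xs \<union> pe ws) \<inter> S (pe ys \<union> pe ws) = set ws"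
    "F (pe xs \<union> pe ys) = F (pe xs \<union> pe ws) \<union> F (pe ys \<union> pe ws)"
    "F (pe xs \<union> pe ws) \<inter> F (pe ys \<union> pe ws) = pe ws"
proof -
  let ?X = "J (pe xs)" and ?Y = "J (pe ys)" and ?W = "J (pe ws)"
  note A = two_paths_arcs[OF xy] and B = two_paths_arcs[OF xw] and C = two_paths_arcs[OF yw]
  have cxy: "cyc (pe xs \<union> pe ys)" and cxw: "cyc (pe xs \<union> pe ws)" and cyw: "cyc (pe ys \<union> pe ws)"
    using xy xw yw unfolding cyc_def by blast+
  note T = theta_split[OF A(1,2) B(2) A(3) B(3) C(3) ne[unfolded J_Un]]
  show "inside (J (pe xs \<union> pe ws)) \<inter> inside (J (pe ys \<union> pe ws)) = {}" using T unfolding J_Un by simp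
  have ab: "p a \<in> ?X" "p b \<in> ?X" "p a \<in> ?Y" "p b \<in> ?Y" "p a \<in> ?W" "p b \<in> ?W"
    using arcset_ends[OF A(1)] arcset_ends[OF A(2)] arcset_ends[OF B(2)] by auto
  note sets = theta_sets[OF T inside_no_overlap inside_no_overlap inside_no_overlap A(3) ab(5,6)]
  have all: "R (pe xs \<union> pe ys) = R (pe xs \<union> pe ws) \<union> R (pe ys \<union> pe ws)"
    using sets(1) unfolding R_def J_Un .
  have int: "R (pe xs \<union> pe ws) \<inter> R (pe ys \<union> pe ws) = ?W"
    using sets(2) unfolding R_def J_Un .
  have EEs: "pe xs \<subseteq> EE" "pe ys \<subseteq> EE" "pe ws \<subseteq> EE"
    using cyc_jordan(1)[OF cxy] cyc_jordan(1)[OF cyw] by auto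
  show "S (pe xs \<union> pe ys) = S (pe xs \<union> pe ws) \<union> S (pe ys \<union> pe ws)"
    unfolding S_def all by blast
  have "S (pe xs \<union> pe ws) \<inter> S (pe ys \<union> pe ws) = {v \<in> V. p v \<in> ?W}"
    unfolding S_def int[symmetric] by blast
  also have "\<dots> = set ws" using J_vertex[OF EEs(3)] gp_set(4)[of a b ws] EE_V[OF EEs(3)] xw
    unfolding two_paths_def by auto
  finally show "S (pe xs \<union> pe ws) \<inter> S (pe ys \<union> pe ws) = set ws" .
  show "F (pe xs \<union> pe ys) = F (pe xs \<union> pe ws) \<union> F (pe ys \<union> pe ws)"
  proof
    show "F (pe xs \<union> pe ws) \<union> F (pe ys \<union> pe ws) \<subseteq> F (pe xs \<union> pe ys)"
      unfolding F_def all by blast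
    show "F (pe xs \<union> pe ys) \<subseteq> F (pe xs \<union> pe ws) \<union> F (pe ys \<union> pe ws)"
    proof
      fix e assume e: "e \<in> F (pe xs \<union> pe ys)"
      show "e \<in> F (pe xs \<union> pe ws) \<union> F (pe ys \<union> pe ws)"
      proof (cases "e \<in> pe xs \<union> pe ys \<union> pe ws")
        case True
        thus ?thesis using Z_F[OF cxw] Z_F[OF cyw] by blast
      next
        case False
        have eE: "e \<in> EE" using e F_EE by blast
        have i: "dei e \<subseteq> inside (J (pe xs \<union> pe ys))" using F_iff[OF cxy eE] e False by blast
        have "dei e \<inter> ?W = {}" using dei_J[OF eE EEs(3)] False by blast
        hence u: "dei e \<subseteq> inside (?X \<union> ?W) \<union> inside (?Y \<union> ?W)" using i unfolding J_Un T(2)[symmetric] by blast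
        have "inside (?X \<union> ?W) \<inter> dei e = {} \<or> inside (?Y \<union> ?W) \<inter> dei e = {}"
          using connectedD[OF dei(1)[OF eE] cyc_jordan(3)[OF cxw, unfolded J_Un] cyc_jordan(3)[OF cyw, unfolded J_Un]]
            u T(1) by (metis (no_types, lifting) Int_empty_left)
        hence "dei e \<subseteq> inside (?X \<union> ?W) \<or> dei e \<subseteq> inside (?Y \<union> ?W)" using u by blast
        thus ?thesis using F_iff[OF cxw eE] F_iff[OF cyw eE] False unfolding J_Un by auto
      qed
    qed
  qed
  show "F (pe xs \<union> pe ws) \<inter> F (pe ys \<union> pe ws) = pe ws"
  proof
    show "pe ws \<subseteq> F (pe xs \<union> pe ws) \<inter> F (pe ys \<union> pe ws)" using Z_F[OF cxw] Z_F[OF cyw] by blast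
    show "F (pe xs \<union> pe ws) \<inter> F (pe ys \<union> pe ws) \<subseteq> pe ws"
    proof
      fix e assume e: "e \<in> F (pe xs \<union> pe ws) \<inter> F (pe ys \<union> pe ws)"
      hence eE: "e \<in> EE" using F_EE by blast
      have "ei e \<subseteq> ?W" using e int unfolding F_def by blast
      hence "dei e \<inter> ?W \<noteq> {}" using dei(2)[OF eE] unfolding dei_def by blast
      thus "e \<in> pe ws" using dei_J[OF eE EEs(3)] by blast
    qed
  qed
qed

end

section \<open>Triangulated discs\<close>

text \<open>\<open>Z\<close> are the boundary edges, \<open>S\<close> the vertices and
  \<open>F\<close> all edges. The alternative is demanded for every boundary edge, in both orders of
  its ends, so that later inductions may start at whichever edge suits them. In its second half
  \<open>Z1\<close> and \<open>Z2\<close> are the boundary stretches from \<open>u\<close> and from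
  \<open>v\<close> to the apex \<open>w\<close>: a stretch that is a single edge leaves a bare edge,
  any other is closed by \<open>uw\<close> or \<open>vw\<close> to the boundary of a smaller
  disc.\<close>

inductive disc :: "'a set set \<Rightarrow> 'a set \<Rightarrow> 'a set set \<Rightarrow> bool" where
  step: "finite S \<Longrightarrow> Z \<noteq> {} \<Longrightarrow> Z \<subseteq> F \<Longrightarrow> (\<And>e. e \<in> F \<Longrightarrow> card e = 2 \<and> e \<subseteq> S) \<Longrightarrow>
   (\<And>u v. {u, v} \<in> Z \<Longrightarrow> u \<noteq> v \<Longrightarrow>
      (\<exists>w. w \<in> S \<and> w \<notin> \<Union> Z \<and> {u, w} \<in> F \<and> {v, w} \<in> F \<and>
          disc (insert {u, w} (insert {v, w} (Z - {{u, v}}))) S (F - {{u, v}})) \<or>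
      (\<exists>w Z1 S1 F1 Z2 S2 F2. w \<in> \<Union> Z \<and> w \<noteq> u \<and> w \<noteq> v \<and> {u, w} \<in> F \<and> {v, w} \<in> F \<and>
          Z = insert {u, v} (Z1 \<union> Z2) \<and> S = S1 \<union> S2 \<and> S1 \<inter> S2 = {w} \<and> u \<in> S1 \<and> v \<in> S2 \<and> F = insert {u, v} (F1 \<union> F2) \<and>
          (Z1 = {{u, w}} \<and> S1 = {u, w} \<and> F1 = {{u, w}} \<or> {u, w} \<notin> Z1 \<and> disc (insert {u, w} Z1) S1 F1) \<and>
          (Z2 = {{v, w}} \<and> S2 = {v, w} \<and> F2 = {{v, w}} \<or> {v, w} \<notin> Z2 \<and> disc (insert {v, w} Z2) S2 F2)))
   \<Longrightarrow> disc Z S F"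

section \<open>Near triangulations\<close>

locale near_tri = plane +
  assumes near: "near_triangulation V E p c" and conn2: "two_connected V E"
begin

lemma drawing_eq: "drawing V E p c = p ` V \<union> J EE"
proof -
  have "J EE = \<Union> {path_image (c u v) | u v. E u v}"
  proof (intro equalityI subsetI)
    fix z assume "z \<in> J EE"
    then obtain e where e: "e \<in> EE" "z \<in> ei e" unfolding J_def by blast
    then obtain u v where "e = {u, v}" "E u v" by (elim EE_cases)
    thus "z \<in> \<Union> {path_image (c u v) | u v. E u v}" using e ei_pair by blast
  next
    fix z assume "z \<in> \<Union> {path_image (c u v) | u v. E u v}"
    then obtain u v where "E u v" "z \<in> path_image (c u v)" by blast
    thus "z \<in> J EE" unfolding J_def using ei_pair[of u v] EE_iff[of u v] by blast
  qed
  thus ?thesis unfolding drawing_def by simp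
qed

text \<open>A cycle seen as a path closed by one edge, which singles out the boundary edge at which
  the recursion of \<open>disc\<close> works.\<close>

definition ring :: "'a set set \<Rightarrow> bool" where
  "ring Z \<longleftrightarrow> (\<exists>u v xs. gp u v xs \<and> E u v \<and> {u, v} \<notin> pe xs \<and> Z = insert {u, v} (pe xs))"

lemma gp_edge: "E u v \<Longrightarrow> gp u v [u, v]" unfolding gp_def using Edge by simp

lemma two_paths_edge: "gp u v xs \<Longrightarrow> E u v \<Longrightarrow> {u, v} \<notin> pe xs \<Longrightarrow> two_paths u v [u, v] xs"
  unfolding two_paths_def using gp_edge gp_set[of u v xs] by auto

lemma two_paths_sym: "two_paths u v xs ys \<Longrightarrow> two_paths u v ys xs"
  unfolding two_paths_def by blast

lemma ring_cyc: assumes "ring Z" shows "cyc Z"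
proof -
  obtain u v xs where "gp u v xs" "E u v" "{u, v} \<notin> pe xs" "Z = insert {u, v} (pe xs)"
    using assms unfolding ring_def by blast
  moreover from this have "Z = pe [u, v] \<union> pe xs" by simp
  ultimately show ?thesis using two_paths_edge unfolding cyc_def by blast
qed

text \<open>Any edge of the cycle can be the closing one: the path is cut at that edge and its two
  parts are joined through the old closing edge.\<close>

lemma ring_rotate:
  assumes "ring Z" "{x, y} \<in> Z"
  obtains xs where "gp x y xs" "E x y" "{x, y} \<notin> pe xs" "Z = insert {x, y} (pe xs)"
proof -
  note T = that
  \<comment> \<open>Matching the unordered pair is enough, since reversing the path handles the
    other order of \<open>x\<close> and \<open>y\<close>.\<close>
  have R: thesis if g: "gp a b xs" "E a b" "{a, b} \<notin> pe xs" "Z = insert {a, b} (pe xs)" "{x, y} = {a, b}" for a b xs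
  proof (cases "x = a \<and> y = b")
    case True thus thesis using T[of xs] g by simp
  next
    case False
    hence *: "x = b" "y = a" using g(5) by (auto simp: doubleton_eq_iff)
    show thesis
    proof (rule T)
      show "gp x y (rev xs)" using gp_rev g * by blast
      show "E x y" using Edge(4)[OF g(2)] * by simp
      show "{x, y} \<notin> pe (rev xs)" "Z = insert {x, y} (pe (rev xs))"
        using g * pe_rev[of xs] by (auto simp: insert_commute)
    qed
  qed
  obtain u v xs where g: "gp u v xs" "E u v" "{u, v} \<notin> pe xs" "Z = insert {u, v} (pe xs)"
    using assms(1) unfolding ring_def by blast
  show thesis
  proof (cases "{x, y} = {u, v}")
    case True thus thesis using R g by blast
  next
    case False
    hence "{x, y} \<in> pe xs" using assms(2) g by blast
    then obtain A B where AB: "xs = A @ B" "A \<noteq> []" "B \<noteq> []" "{x, y} = {last A, hd B}" using pe_nth by metis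
    have d: "distinct (A @ B)" "successively E (A @ B)" "hd A = u" "last B = v"
      using g(1) AB unfolding gp_def by auto
    have ne: "last A \<noteq> hd B" using d(1) AB by (metis distinct_append disjoint_iff hd_in_set last_in_set)
    have Elb: "E (last A) (hd B)" using d(2) AB unfolding successively_append_iff by simp
    show thesis
    proof (rule R)
      show "gp (hd B) (last A) (B @ A)" unfolding gp_def
        using d AB ne Edge(4)[OF g(2)] by (auto simp: successively_append_iff)
      show "E (hd B) (last A)" using Edge(4) Elb .
      have nA: "{hd B, last A} \<notin> pe A" using pe_sub[of "{hd B, last A}" A] d(1) AB by (auto dest: hd_in_set)
      have nB: "{hd B, last A} \<notin> pe B" using pe_sub[of "{hd B, last A}" B] d(1) AB by (auto dest: last_in_set)
      have eq: "pe (B @ A) = pe B \<union> {{v, u}} \<union> pe A" using pe_append[of B A] AB d by simp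
      show "{hd B, last A} \<notin> pe (B @ A)" unfolding eq using nA nB False AB(4) by (auto simp: insert_commute)
      have "pe xs = pe A \<union> {{last A, hd B}} \<union> pe B" unfolding AB(1) using pe_append AB by blast
      thus "Z = insert {hd B, last A} (pe (B @ A))" unfolding eq g(4) by (auto simp: insert_commute)
      show "{x, y} = {hd B, last A}" using AB by (auto simp: insert_commute)
    qed
  qed
qed

text \<open>The last edge of \<open>ys\<close> becomes the closing edge; the rest of
  \<open>ys\<close> walked backwards and continued by \<open>xs\<close> is the path.\<close>

lemma two_paths_ring: assumes "two_paths a b xs ys" shows "ring (pe xs \<union> pe ys)"
proof -
  have g: "gp a b xs" "gp a b ys" "set xs \<inter> set ys = {a, b}" "pe xs \<inter> pe ys = {}"
    using assms unfolding two_paths_def by auto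
  obtain xs' where xs: "xs = a # xs'" "xs' \<noteq> []" using g(1) unfolding gp_def by (cases xs) (auto split: if_splits)
  obtain ys' where ys1: "ys = ys' @ [b]" using g(2) unfolding gp_def by (metis append_butlast_last_id)
  have "ys' \<noteq> []" using g(2) ys1 unfolding gp_def by auto
  note ys = ys1 this
  have h: "hd ys' = a" "distinct ys'" "b \<notin> set ys'" "successively E ys'" "E (last ys') b"
    using g(2) ys unfolding gp_def by (auto simp: successively_append_iff)
  have k: "last xs' = b" "distinct xs'" "a \<notin> set xs'" "successively E xs'" "E a (hd xs')"
    using g(1) xs unfolding gp_def by (auto simp: successively_Cons)
  have "False" if x: "x \<in> set ys'" "x \<in> set xs'" for x
  proof -
    have "x \<in> set xs \<inter> set ys" using x xs ys by simp
    hence "x \<in> {a, b}" unfolding g(3) .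
    thus False using x h(3) k(3) by auto
  qed
  hence disj: "set ys' \<inter> set xs' = {}" by blast
  have peq: "pe (rev ys' @ xs') = pe ys' \<union> pe xs"
    using pe_append[of "rev ys'" xs'] ys xs h pe_Cons[of xs' a] by (simp add: last_rev pe_rev)
  have peys: "pe ys = pe ys' \<union> {{last ys', b}}" using pe_append[of ys' "[b]"] ys by simp
  have "gp (last ys') b (rev ys' @ xs')" unfolding gp_def
    using h k xs ys disj gp_rev[of a "last ys'" ys']
    by (auto simp: successively_append_iff hd_rev last_rev hd_append dest: last_in_set intro: successively_mono Edge(4))
  moreover have "{last ys', b} \<notin> pe (rev ys' @ xs')" unfolding peq
    using g(4) peys pe_sub[of "{last ys', b}" ys'] h(3) by auto
  ultimately show ?thesis unfolding ring_def using h(5) peq peys by blast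
qed

text \<open>A point \<open>q\<close> inside the cycle and close to an inner point of the edge
  \<open>uv\<close> lies in a bounded face, whose frontier is a triangle. The segment from
  \<open>q\<close> to the edge can leave this face only through \<open>uv\<close>, so
  \<open>uv\<close> is a side of the triangle. The face turns out to be the whole inside of the
  triangle, which therefore contains no further vertex or edge.\<close>

lemma face:
  assumes Z: "cyc Z" and uv: "{u, v} \<in> Z"
  obtains w where "E u w" "E v w" "w \<noteq> u" "w \<noteq> v" "w \<in> S Z" "{{u, v}, {u, w}, {v, w}} \<subseteq> F Z"
    "S {{u, v}, {u, w}, {v, w}} = {u, v, w}" "F {{u, v}, {u, w}, {v, w}} = {{u, v}, {u, w}, {v, w}}"
proof -
  note JZ = cyc_jordan[OF Z]
  let ?e = "{u, v}"
  have e: "?e \<in> EE" using JZ(1) uv by blast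
  hence Euv: "E u v" by (simp add: EE_iff)
  obtain z where z: "z \<in> dei ?e" using dei(2)[OF e] by blast
  have zJ: "z \<in> J Z" using z uv unfolding dei_def J_def by blast
  let ?K = "p ` V \<union> J (EE - {?e})"
  have "z \<notin> p ` V" using z ei_vertex[OF e] unfolding dei_def by blast
  moreover have "z \<notin> J (EE - {?e})" using dei_J[OF e, of "EE - {?e}"] z by blast
  ultimately have zK: "z \<in> - ?K" by blast
  have "compact (p ` V)" using finV by (simp add: finite_imp_compact)
  hence cl: "closed (p ` V)" "closed (J EE)" "closed (J (EE - {?e}))"
    using J_compact by (auto intro: compact_imp_closed)
  hence "open (- ?K)" by (intro open_Compl closed_Un)
  \<comment> \<open>Within distance \<open>r\<close> of \<open>z\<close> the drawing consists of
    points of the edge \<open>uv\<close> only.\<close>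
  then obtain r where r: "r > 0" "ball z r \<subseteq> - ?K" using zK open_contains_ball by meson
  have "z \<in> closure (inside (J Z))" using zJ JZ(9) by blast
  then obtain q where q: "q \<in> inside (J Z)" "dist q z < r" using r(1) closure_approachable by blast
  have qb: "q \<in> ball z r" using q by (simp add: dist_commute)
  have dr: "drawing V E p c = ?K \<union> ei ?e" unfolding drawing_eq J_def using e by blast
  have "ei ?e \<subseteq> J Z" using uv unfolding J_def by blast
  hence "q \<notin> ei ?e" using q inside_no_overlap by blast
  hence qd: "q \<notin> drawing V E p c" using qb r(2) unfolding dr by blast
  define Fc where "Fc = connected_component_set (- drawing V E p c) q"
  have Fcd: "Fc \<subseteq> - drawing V E p c" unfolding Fc_def by (rule connected_component_subset)
  have qF: "q \<in> Fc" unfolding Fc_def using qd by simp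
  have Fcon: "connected Fc" unfolding Fc_def by simp
  have ZD: "J Z \<subseteq> drawing V E p c" unfolding drawing_eq J_def using JZ(1) by blast
  have Fin: "Fc \<subseteq> inside (J Z)"
  proof
    fix x assume x: "x \<in> Fc"
    have "connected_component (- J Z) q x"
      using x ZD unfolding Fc_def by (auto intro: connected_component_of_subset)
    thus "x \<in> inside (J Z)" using q(1) inside_same_component by blast
  qed
  have Fb: "bounded Fc" using Fin JZ(7) bounded_subset by blast
  have "Fc \<in> faces V E p c" unfolding faces_def Fc_def using qd by blast
  then obtain a b d where abd: "E a b" "E b d" "E d a"
    "frontier Fc = path_image (c a b) \<union> path_image (c b d) \<union> path_image (c d a)"
    using near Fb unfolding near_triangulation_def by blast
  define T where "T = {{a, b}, {b, d}, {d, a}}"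
  have fr: "frontier Fc = J T"
    unfolding abd(4) T_def J_insert J_empty ei_pair[OF abd(1)] ei_pair[OF abd(2)] ei_pair[OF abd(3)] by auto
  have TE: "T \<subseteq> EE" unfolding T_def using abd by (simp add: EE_iff)
  have "closed_segment q z \<inter> frontier Fc \<noteq> {}"
  proof (rule connected_Int_frontier)
    show "closed_segment q z \<inter> Fc \<noteq> {}" using qF by auto
    have "z \<in> drawing V E p c" using zJ ZD by blast
    thus "closed_segment q z - Fc \<noteq> {}" using Fcd by auto
  qed simp
  then obtain y where y: "y \<in> closed_segment q z" "y \<in> J T" using fr by blast
  have "closed_segment q z \<subseteq> ball z r" using qb r(1) by (intro closed_segment_subset) auto
  hence "y \<notin> J (EE - {?e})" using y r(2) by blast
  hence eT: "?e \<in> T" using y(2) TE unfolding J_def by blast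
  have ne: "a \<noteq> b" "b \<noteq> d" "d \<noteq> a" using abd Edge by auto
  obtain w where w: "T = {?e, {u, w}, {v, w}}" "w \<noteq> u" "w \<noteq> v"
  proof -
    from eT consider "?e = {a, b}" | "?e = {b, d}" | "?e = {d, a}" unfolding T_def by blast
    thus thesis
    proof cases
      case 1
      hence "u = a \<and> v = b \<or> u = b \<and> v = a" by (auto simp: doubleton_eq_iff)
      thus thesis using ne by (intro that[of d]) (auto simp: T_def insert_commute)
    next
      case 2
      hence "u = b \<and> v = d \<or> u = d \<and> v = b" by (auto simp: doubleton_eq_iff)
      thus thesis using ne by (intro that[of a]) (auto simp: T_def insert_commute)
    next
      case 3
      hence "u = d \<and> v = a \<or> u = a \<and> v = d" by (auto simp: doubleton_eq_iff)
      thus thesis using ne by (intro that[of b]) (auto simp: T_def insert_commute)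
    qed
  qed
  have Ew: "E u w" "E v w" using TE w by (auto simp: EE_iff)
  have "two_paths u v [u, v] [u, w, v]"
    using Ew Edge(4)[OF Ew(2)] w Euv Edge(3)[OF Euv] by (intro two_paths_edge) (auto simp: gp_def doubleton_eq_iff)
  hence cT: "cyc T" unfolding cyc_def w(1) by (intro exI[of _ u] exI[of _ v] exI[of _ "[u,v]"] exI[of _ "[u,w,v]"]) (auto simp: insert_commute)
  note JT = cyc_jordan[OF cT]
  have FT: "Fc \<inter> J T = {}" using Fcd TE unfolding drawing_eq J_def by blast
  \<comment> \<open>Otherwise the connected outside, which misses the frontier of \<open>Fc\<close>,
    would be contained in the bounded face \<open>Fc\<close>.\<close>
  have no: "Fc \<inter> outside (J T) = {}"
  proof (rule ccontr)
    assume a: "Fc \<inter> outside (J T) \<noteq> {}"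
    have "outside (J T) \<subseteq> Fc"
    proof (rule ccontr)
      assume "\<not> ?thesis"
      hence "outside (J T) \<inter> frontier Fc \<noteq> {}" using a JT(6) by (intro connected_Int_frontier) auto
      thus False using fr outside_no_overlap[of "J T"] by blast
    qed
    thus False using Fb JT(11) bounded_subset by blast
  qed
  have Fi: "Fc \<subseteq> inside (J T)" using no FT inside_Un_outside[of "J T"] by blast
  have "inside (J T) \<subseteq> Fc"
  proof (rule ccontr)
    assume "\<not> ?thesis"
    hence "inside (J T) \<inter> frontier Fc \<noteq> {}" using Fi qF JT(4) by (intro connected_Int_frontier) auto
    thus False using fr inside_no_overlap[of "J T"] by blast
  qed
  hence iT: "inside (J T) = Fc" using Fi by blast
  have ST: "S T = \<Union> T"
  proof
    show "\<Union> T \<subseteq> S T" using Z_S[OF cT] .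
    show "S T \<subseteq> \<Union> T"
    proof
      fix x assume "x \<in> S T"
      hence x: "x \<in> V" "p x \<in> J T \<union> Fc" unfolding S_def R_def iT by auto
      have "p x \<notin> Fc" using Fcd x(1) unfolding drawing_eq by blast
      thus "x \<in> \<Union> T" using x J_vertex[OF TE] by blast
    qed
  qed
  have FTT: "F T = T"
  proof
    show "T \<subseteq> F T" using Z_F[OF cT] .
    show "F T \<subseteq> T"
    proof
      fix f assume "f \<in> F T"
      hence f: "f \<in> EE" "ei f \<subseteq> J T \<union> Fc" unfolding F_def R_def iT by auto
      have "ei f \<inter> Fc = {}" using Fcd f(1) unfolding drawing_eq J_def by blast
      hence "ei f \<subseteq> J T" using f by blast
      hence "dei f \<inter> J T \<noteq> {}" using dei(2)[OF f(1)] unfolding dei_def by blast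
      thus "f \<in> T" using dei_J[OF f(1) TE] by blast
    qed
  qed
  have "J T \<subseteq> closure Fc" unfolding fr[symmetric] frontier_def by auto
  also have "\<dots> \<subseteq> R Z" using closure_mono[OF Fin] JZ(9) unfolding R_def by simp
  finally have TF: "T \<subseteq> F Z" unfolding F_def J_def using TE by blast
  show thesis
  proof (rule that)
    show "E u w" "E v w" "w \<noteq> u" "w \<noteq> v" using Ew w by auto
    have "{u, w} \<in> F Z" using TF w by blast
    thus "w \<in> S Z" using F_S[OF Z] by blast
    show "{{u, v}, {u, w}, {v, w}} \<subseteq> F Z" using TF w by simp
    show "S {{u, v}, {u, w}, {v, w}} = {u, v, w}" using ST unfolding w(1) by auto
    show "F {{u, v}, {u, w}, {v, w}} = {{u, v}, {u, w}, {v, w}}" using FTT unfolding w(1) .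
  qed
qed

end

context near_tri begin

lemma gp_short: assumes "gp a b xs" "{a, b} \<in> pe xs" shows "xs = [a, b]"
proof -
  obtain y zs where xs: "xs = a # y # zs" using assms unfolding gp_def by (cases xs rule: pe.cases) auto
  have d: "a \<noteq> y" "a \<notin> set zs" "y \<notin> set zs" "distinct zs" "last (y # zs) = b"
    using assms(1) unfolding xs gp_def by auto
  have "{a, b} \<notin> pe (y # zs)" using pe_sub[of "{a, b}" "y # zs"] d by auto
  hence "{a, b} = {a, y}" using assms(2) unfolding xs by simp
  hence "b = y" using d(1) by (auto simp: doubleton_eq_iff)
  hence "zs = []" using d by (metis last_ConsR last_in_set)
  thus ?thesis using xs \<open>b = y\<close> by simp
qed

lemma ring_F_card: assumes "ring Z" "e \<in> F Z" shows "card e = 2 \<and> e \<subseteq> S Z"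
proof -
  have "e \<in> EE" using assms(2) F_EE by blast
  then obtain u v where "e = {u, v}" "u \<noteq> v" by (elim EE_cases)
  thus ?thesis using F_S[OF ring_cyc[OF assms(1)] assms(2)] by simp
qed

lemma ring_edge: assumes "gp a b P" "E a b" "{a, b} \<notin> pe P" shows "ring (insert {a, b} (pe P))"
  using assms unfolding ring_def by blast

text \<open>The case of \<open>theta\<close> in which the inner path is one edge; both parts are
  again cycles closed by that edge.\<close>

lemma chord:
  assumes PQ: "two_paths a b P Q" and ab: "{a, b} \<in> F (pe P \<union> pe Q)" "{a, b} \<notin> pe P \<union> pe Q"
  shows "ring (insert {a, b} (pe P))" "ring (insert {a, b} (pe Q))"
    "S (pe P \<union> pe Q) = S (insert {a, b} (pe P)) \<union> S (insert {a, b} (pe Q))"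
    "S (insert {a, b} (pe P)) \<inter> S (insert {a, b} (pe Q)) = {a, b}"
    "F (pe P \<union> pe Q) = F (insert {a, b} (pe P)) \<union> F (insert {a, b} (pe Q))"
    "F (insert {a, b} (pe P)) \<inter> F (insert {a, b} (pe Q)) = {{a, b}}"
proof -
  have g: "gp a b P" "gp a b Q" using PQ unfolding two_paths_def by auto
  have e: "{a, b} \<in> EE" using ab(1) F_EE by blast
  hence E: "E a b" by (simp add: EE_iff)
  show "ring (insert {a, b} (pe P))" "ring (insert {a, b} (pe Q))" using ring_edge g E ab(2) by auto
  have PW: "two_paths a b P [a, b]" "two_paths a b Q [a, b]"
    using two_paths_sym[OF two_paths_edge] g E ab(2) by auto
  have c: "cyc (pe P \<union> pe Q)" using PQ unfolding cyc_def by blast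
  have "dei {a, b} \<subseteq> inside (J (pe P \<union> pe Q))" using F_iff[OF c e ab(2)] ab(1) by blast
  hence "J (pe [a, b]) \<inter> inside (J (pe P \<union> pe Q)) \<noteq> {}"
    using dei(2)[OF e] unfolding dei_def by (auto simp: J_insert J_empty)
  note T = theta[OF PQ PW this]
  have eq: "pe P \<union> pe [a, b] = insert {a, b} (pe P)" "pe Q \<union> pe [a, b] = insert {a, b} (pe Q)" by auto
  show "S (pe P \<union> pe Q) = S (insert {a, b} (pe P)) \<union> S (insert {a, b} (pe Q))"
    "S (insert {a, b} (pe P)) \<inter> S (insert {a, b} (pe Q)) = {a, b}"
    "F (pe P \<union> pe Q) = F (insert {a, b} (pe P)) \<union> F (insert {a, b} (pe Q))"
    "F (insert {a, b} (pe P)) \<inter> F (insert {a, b} (pe Q)) = {{a, b}}"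
    using T(2-5) unfolding eq by auto
qed

lemma Int_single: "A \<inter> B = {y} \<Longrightarrow> x \<in> B \<Longrightarrow> x \<noteq> y \<Longrightarrow> x \<notin> A" "A \<inter> B = {y} \<Longrightarrow> y \<in> A"
  for A B :: "'b set" by blast+
lemma Int_pair: "A \<inter> B = {x, y} \<Longrightarrow> x \<in> A" "A \<inter> B = {x, y} \<Longrightarrow> y \<in> A"
  "A \<inter> B = {x, y} \<Longrightarrow> z \<in> B \<Longrightarrow> z \<noteq> x \<Longrightarrow> z \<noteq> y \<Longrightarrow> z \<notin> A" for A B :: "'b set" by blast+
lemma Int_sub: "A \<inter> Q = {x, y} \<Longrightarrow> B \<subseteq> Q \<Longrightarrow> y \<in> B \<Longrightarrow> x \<notin> B \<Longrightarrow> A \<inter> B = {y}"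
  for A B :: "'b set" by (intro equalityI subsetI) auto
lemma perm3: "{f, g, h} = {h, g, f}" by auto
lemma absorb_Un: "A = B \<union> C \<Longrightarrow> B \<inter> C = D \<Longrightarrow> B \<subseteq> D \<Longrightarrow> A = C" by blast
lemma Diff_Un: "A = B \<union> C \<Longrightarrow> B \<inter> C = D \<Longrightarrow> B = insert x D \<Longrightarrow> x \<notin> D \<Longrightarrow> C = A - {x}"
  "A = B \<union> C \<Longrightarrow> B \<inter> C = D \<Longrightarrow> B = insert x D \<Longrightarrow> x \<notin> D \<Longrightarrow> x \<notin> C" by blast+

text \<open>Induction on the number of edges in the region; \<open>face\<close> supplies the apex
  \<open>w\<close> at \<open>uv\<close>. If \<open>w\<close> is off the cycle, the path
  \<open>u\<close>, \<open>w\<close>, \<open>v\<close> cuts off the empty triangle. If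
  \<open>w\<close> is on the cycle, each of \<open>uw\<close> and \<open>vw\<close> is a boundary
  edge or a chord, and at most two chord cuts separate the triangle from the pieces beside
  it.\<close>

lemma ring_disc: "ring Z \<Longrightarrow> disc Z (S Z) (F Z)"
proof (induction "card (F Z)" arbitrary: Z rule: less_induct)
  case less
  note Zr = less.prems
  note Zc = ring_cyc[OF Zr]
  have finF: "finite (F W)" for W using F_EE finite_EE finite_subset by blast
  have IH: "disc W (S W) (F W)" if "ring W" "F W \<subseteq> F Z" "e \<in> F Z" "e \<notin> F W" for W e
    using less.hyps[of W] that finF[of Z] by (metis psubsetI psubset_card_mono)
  show ?case
  proof (rule disc.step)
    show "finite (S Z)" using finV unfolding S_def by simp
    show "Z \<noteq> {}" using Zr unfolding ring_def by blast
    show "Z \<subseteq> F Z" using Z_F[OF Zc] .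
    show "card e = 2 \<and> e \<subseteq> S Z" if "e \<in> F Z" for e using ring_F_card Zr that by blast
    fix u v assume uv: "{u, v} \<in> Z" "u \<noteq> v"
    obtain w where w: "E u w" "E v w" "w \<noteq> u" "w \<noteq> v" "w \<in> S Z" "{{u, v}, {u, w}, {v, w}} \<subseteq> F Z"
      and ST: "S {{u, v}, {u, w}, {v, w}} = {u, v, w}"
      and FT: "F {{u, v}, {u, w}, {v, w}} = {{u, v}, {u, w}, {v, w}}" using face[OF Zc uv(1)] by metis
    obtain xs where xs: "gp u v xs" "E u v" "{u, v} \<notin> pe xs" "Z = insert {u, v} (pe xs)"
      using ring_rotate[OF Zr uv(1)] by metis
    have UZ: "\<Union> Z = set xs" using gp_set[OF xs(1)] unfolding xs(4) by auto
    have dist: "{u, w} \<noteq> {u, v}" "{v, w} \<noteq> {u, v}" "{u, w} \<noteq> {v, w}" using w uv by (auto simp: doubleton_eq_iff)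
    show "(\<exists>w. w \<in> S Z \<and> w \<notin> \<Union> Z \<and> {u, w} \<in> F Z \<and> {v, w} \<in> F Z \<and>
          disc (insert {u, w} (insert {v, w} (Z - {{u, v}}))) (S Z) (F Z - {{u, v}})) \<or>
      (\<exists>w Z1 S1 F1 Z2 S2 F2. w \<in> \<Union> Z \<and> w \<noteq> u \<and> w \<noteq> v \<and> {u, w} \<in> F Z \<and> {v, w} \<in> F Z \<and>
          Z = insert {u, v} (Z1 \<union> Z2) \<and> S Z = S1 \<union> S2 \<and> S1 \<inter> S2 = {w} \<and> u \<in> S1 \<and> v \<in> S2 \<and> F Z = insert {u, v} (F1 \<union> F2) \<and>
          (Z1 = {{u, w}} \<and> S1 = {u, w} \<and> F1 = {{u, w}} \<or> {u, w} \<notin> Z1 \<and> disc (insert {u, w} Z1) S1 F1) \<and>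
          (Z2 = {{v, w}} \<and> S2 = {v, w} \<and> F2 = {{v, w}} \<or> {v, w} \<notin> Z2 \<and> disc (insert {v, w} Z2) S2 F2))"
      (is "?Int \<or> ?Spl")
    proof (cases "w \<in> \<Union> Z")
      case False
      have "w \<notin> set xs" using False UZ by simp
      hence nx: "{u, w} \<notin> pe xs" "{v, w} \<notin> pe xs" using pe_sub[of _ xs] by blast+
      have 1: "two_paths u v [u, v] xs" using two_paths_edge xs by blast
      have g: "gp u v [u, w, v]" using w uv Edge(4)[OF w(2)] unfolding gp_def by auto
      have 2: "two_paths u v [u, v] [u, w, v]" using g dist xs(2) by (intro two_paths_edge) (auto simp: insert_commute)
      have 3: "two_paths u v xs [u, w, v]" unfolding two_paths_def
        using g xs(1) \<open>w \<notin> set xs\<close> nx gp_set[OF xs(1)] by (auto simp: insert_commute)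
      let ?W = "pe xs \<union> pe [u, w, v]" and ?T = "{{u, v}, {u, w}, {v, w}}"
      have eq: "pe [u, v] \<union> pe xs = Z" "pe [u, v] \<union> pe [u, w, v] = ?T"
        using xs(4) by (auto simp: insert_commute)
      have uwE: "{u, w} \<in> EE" "{u, w} \<notin> Z" using w(1) nx dist xs(4) by (auto simp: EE_iff)
      have "dei {u, w} \<subseteq> inside (J Z)" using F_iff[OF Zc uwE] w(6) by blast
      moreover have "dei {u, w} \<subseteq> J (pe [u, w, v])" unfolding dei_def by (auto simp: J_insert)
      ultimately have "J (pe [u, w, v]) \<inter> inside (J (pe [u, v] \<union> pe xs)) \<noteq> {}"
        using dei(2)[OF uwE(1)] unfolding eq by blast
      note T = theta[OF 1 2 3 this, unfolded eq ST FT]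
      \<comment> \<open>The triangle on one side of the cut is empty, so the other side keeps all
        vertices and all edges except \<open>uv\<close>.\<close>
      have SW: "S Z = S ?W" by (rule absorb_Un[OF T(2,3)]) auto
      have FW: "F ?W = F Z - {{u, v}}" "{u, v} \<notin> F ?W"
        by (rule Diff_Un[OF T(4,5)]; use dist in \<open>simp add: insert_commute\<close>)+
      note uvW = FW(2)
      have "ring ?W" using two_paths_ring[OF 3] .
      hence "disc ?W (S ?W) (F ?W)" using IH[of ?W "{u, v}"] uvW FW w(6) by auto
      moreover have "?W = insert {u, w} (insert {v, w} (Z - {{u, v}}))"
        using xs by (auto simp: insert_commute)
      ultimately have ?Int using False w(5,6) unfolding SW FW(1)[symmetric] by (intro exI[of _ w]) simp
      thus ?thesis by blast
    next
      case True
      hence "w \<in> set xs" using UZ by simp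
      then obtain A' B' where AB: "xs = A' @ w # B'" by (meson split_list)
      let ?A = "A' @ [w]" and ?B = "w # B'" and ?T = "{{u, v}, {u, w}, {v, w}}"
      have ne: "A' \<noteq> []" "B' \<noteq> []" using xs(1) w AB unfolding gp_def by auto
      have gA: "gp u w ?A" and gB: "gp w v ?B"
        using xs(1) w ne AB unfolding gp_def by (auto simp: successively_append_iff successively_Cons)
      have dj: "set ?A \<inter> set ?B = {w}" "u \<notin> set ?B" "v \<notin> set ?A"
      proof -
        have d: "distinct (A' @ w # B')" using xs(1) AB unfolding gp_def by simp
        show "set ?A \<inter> set ?B = {w}" using d by auto
        show "u \<notin> set ?B" "v \<notin> set ?A" using gp_set[OF gA] gp_set[OF gB] d w by auto
      qed
      have pxs: "pe xs = pe ?A \<union> pe ?B"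
        using pe_append[of A' "[w]"] pe_append[of A' ?B] ne AB by auto
      have uA: "{v, w} \<notin> pe ?A" "{u, v} \<notin> pe ?A" using pe_sub[of _ ?A] dj by blast+
      have uB: "{u, w} \<notin> pe ?B" "{u, v} \<notin> pe ?B" using pe_sub[of _ ?B] dj by blast+
      have dAB: "pe ?A \<inter> pe ?B = {}"
      proof (rule ccontr)
        assume "\<not> ?thesis"
        then obtain e where e: "e \<in> pe ?A" "e \<in> pe ?B" by blast
        hence "e \<subseteq> {w}" using pe_sub[of e] dj(1) by blast
        moreover have "card e = 2" using e(1) gp_EE[OF gA] by (metis EE_cases card_2_iff subsetD)
        ultimately show False using card_mono[of "{w}" e] by simp
      qed
      have triA: "?A = [u, w]" if "{u, w} \<in> Z"
        using that gp_short[OF gA] uB dist unfolding xs(4) pxs by auto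
      have triB: "?B = [w, v]" if "{v, w} \<in> Z"
        using that gp_short[OF gB] uA dist unfolding xs(4) pxs by (auto simp: insert_commute)
      \<comment> \<open>The two ways around the cycle from \<open>u\<close> to \<open>w\<close> are
        \<open>?A\<close> and this path, which starts with \<open>uv\<close>.\<close>
      have gC: "gp u w (u # rev ?B)"
      proof -
        have "gp v w (rev ?B)" using gp_rev[OF gB] .
        thus ?thesis using xs(2) dj w unfolding gp_def by (auto simp: successively_Cons)
      qed
      have pC: "pe (u # rev ?B) = insert {u, v} (pe ?B)"
      proof -
        have "hd (rev ?B) = v" using gB unfolding gp_def hd_rev by blast
        thus ?thesis using pe_Cons[of "rev ?B" u] unfolding pe_rev by simp
      qed
      have tA: "two_paths u w ?A (u # rev ?B)" unfolding two_paths_def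
        using gA gC dj dAB uA gp_set[OF gA] unfolding pC by auto
      have ZA: "Z = pe ?A \<union> pe (u # rev ?B)" unfolding pC xs(4) pxs by auto
      have uwF: "{u, w} \<in> F Z" "{v, w} \<in> F Z" "{u, v} \<in> F Z" using w(6) by blast+
      have sw: "{w, v} = {v, w}" "{w, u} = {u, w}" by (rule insert_commute)+
      have dist2: "{u, v} \<noteq> {w, v}" using dist(2) sw(1) by metis
      have spl: ?Spl
        if "Z = insert {u, v} (Z1 \<union> Z2)" "S Z = S1 \<union> S2" "S1 \<inter> S2 = {w}" "u \<in> S1" "v \<in> S2"
          "F Z = insert {u, v} (F1 \<union> F2)"
          "Z1 = {{u, w}} \<and> S1 = {u, w} \<and> F1 = {{u, w}} \<or> {u, w} \<notin> Z1 \<and> disc (insert {u, w} Z1) S1 F1"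
          "Z2 = {{v, w}} \<and> S2 = {v, w} \<and> F2 = {{v, w}} \<or> {v, w} \<notin> Z2 \<and> disc (insert {v, w} Z2) S2 F2"
        for Z1 S1 F1 Z2 S2 F2
        by (rule exI[of _ w], rule exI[of _ Z1], rule exI[of _ S1], rule exI[of _ F1], rule exI[of _ Z2],
            rule exI[of _ S2], rule exI[of _ F2], intro conjI) (fact True w uwF that)+
      show ?thesis
      proof (cases "{u, w} \<in> Z")
        case uwZ: True
        note A = triA[OF uwZ]
        show ?thesis
        proof (cases "{v, w} \<in> Z")
          case vwZ: True
          have Zeq: "Z = ?T" unfolding xs(4) pxs A triB[OF vwZ] by (auto simp: insert_commute)
          have ?Spl
          proof (rule spl)
            show "Z = insert {u, v} ({{u, w}} \<union> {{v, w}})" unfolding Zeq by blast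
            show "S Z = {u, w} \<union> {v, w}" unfolding Zeq ST by blast
            show "{u, w} \<inter> {v, w} = {w}" using uv(2) by blast
            show "F Z = insert {u, v} ({{u, w}} \<union> {{v, w}})" unfolding Zeq FT by blast
          qed simp_all
          thus ?thesis by blast
        next
          case vwZ: False
          \<comment> \<open>Only \<open>vw\<close> is a chord: one cut separates the triangle from
            the piece on the side of \<open>v\<close>.\<close>
          have g3: "gp w v [w, u, v]" using w uv xs(2) Edge(4)[OF w(1)] unfolding gp_def by auto
          have t3: "two_paths w v ?B [w, u, v]" unfolding two_paths_def
            using gB g3 dj(2) uB gp_set[OF gB] by (auto simp: insert_commute)
          have Z3: "Z = pe ?B \<union> pe [w, u, v]" unfolding xs(4) pxs A by (auto simp: insert_commute)
          have "{w, v} \<in> F (pe ?B \<union> pe [w, u, v])" "{w, v} \<notin> pe ?B \<union> pe [w, u, v]"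
            using w(6) vwZ unfolding Z3[symmetric] by (auto simp: insert_commute)
          note c = chord[OF t3 this]
          have eT: "insert {w, v} (pe [w, u, v]) = ?T"
            unfolding pe.simps insert_commute[of w v "{}"] insert_commute[of w u "{}"] by (rule perm3)
          let ?Z2 = "insert {w, v} (pe ?B)"
          have c': "S Z = S ?Z2 \<union> {u, v, w}" "S ?Z2 \<inter> {u, v, w} = {w, v}"
              "F Z = F ?Z2 \<union> ?T" "F ?Z2 \<inter> ?T = {{w, v}}"
            using c(3-6) unfolding Z3[symmetric] eT ST FT by - (assumption+)
          have uv2: "{u, v} \<notin> F ?Z2" by (rule Int_single(1)[OF c'(4) _ dist2]) simp
          have d2: "disc ?Z2 (S ?Z2) (F ?Z2)" using IH[OF c(1), of "{u, v}"] uv2 c'(3) uwF by blast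
          have wu1: "{v, w} \<in> F ?Z2" using Int_single(2)[OF c'(4)] sw(1) by metis
          note wu = wu1 Int_pair(2)[OF c'(2)] Int_pair(1)[OF c'(2)]
          have ?Spl
          proof (rule spl)
            show "Z = insert {u, v} ({{u, w}} \<union> pe ?B)" unfolding xs(4) pxs A by simp
            show "S Z = {u, w} \<union> S ?Z2" unfolding c'(1) using wu by auto
            show "{u, w} \<inter> S ?Z2 = {w}" using c'(2) uv(2) w wu by auto
            show "v \<in> S ?Z2" by (rule wu)
            show "F Z = insert {u, v} ({{u, w}} \<union> F ?Z2)" unfolding c'(3) using wu(1) by auto
            show "pe ?B = {{v, w}} \<and> S ?Z2 = {v, w} \<and> F ?Z2 = {{v, w}} \<or> {v, w} \<notin> pe ?B \<and> disc (insert {v, w} (pe ?B)) (S ?Z2) (F ?Z2)"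
              using d2 vwZ unfolding xs(4) pxs sw by blast
          qed simp_all
          thus ?thesis by blast
        qed
      next
        case uwZ: False
        \<comment> \<open>The cut along \<open>uw\<close>: \<open>?Z1\<close> bounds the piece on
          the side of \<open>u\<close>, while \<open>?Q\<close> keeps the triangle and everything on
          the side of \<open>v\<close>.\<close>
        have "{u, w} \<in> F (pe ?A \<union> pe (u # rev ?B))" "{u, w} \<notin> pe ?A \<union> pe (u # rev ?B)"
          using w(6) uwZ unfolding ZA[symmetric] by auto
        note c = chord[OF tA this]
        note c' = c(3-6)[folded ZA]
        let ?Z1 = "insert {u, w} (pe ?A)" and ?Q = "insert {u, w} (pe (u # rev ?B))"
        have "v \<in> \<Union> ?Q" unfolding pC by simp
        hence vQ: "v \<in> S ?Q" by (rule subsetD[OF Z_S[OF ring_cyc[OF c(2)]]])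
        have v1: "v \<notin> S ?Z1" by (rule Int_pair(3)[OF c'(2) vQ]; use w uv in simp)
        have uv1: "{u, v} \<notin> F ?Z1" "{v, w} \<notin> F ?Z1"
          using v1 ring_F_card[OF c(1), of "{u, v}"] ring_F_card[OF c(1), of "{v, w}"] by auto
        have d1: "disc ?Z1 (S ?Z1) (F ?Z1)" using IH[OF c(1), of "{u, v}"] uv1(1) c'(3) uwF by blast
        note wu1 = Int_single(2)[OF c'(4)] Int_pair(1)[OF c'(2)] Int_pair(2)[OF c'(2)]
        show ?thesis
        proof (cases "{v, w} \<in> Z")
          case vwZ: True
          have eT: "?Q = ?T" unfolding pC triB[OF vwZ] by (auto simp: insert_commute)
          note c'' = c'[unfolded eT ST FT]
          have ?Spl
          proof (rule spl)
            show "Z = insert {u, v} (pe ?A \<union> {{v, w}})" unfolding xs(4) pxs triB[OF vwZ] using sw by simp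
            show "S Z = S ?Z1 \<union> {v, w}" unfolding c''(1) using wu1 by auto
            show "S ?Z1 \<inter> {v, w} = {w}" using v1 wu1 by auto
            show "u \<in> S ?Z1" by (rule wu1)
            show "F Z = insert {u, v} (F ?Z1 \<union> {{v, w}})" unfolding c''(3) using wu1(1) by auto
            show "pe ?A = {{u, w}} \<and> S ?Z1 = {u, w} \<and> F ?Z1 = {{u, w}} \<or> {u, w} \<notin> pe ?A \<and> disc (insert {u, w} (pe ?A)) (S ?Z1) (F ?Z1)"
              using d1 uwZ unfolding xs(4) pxs by blast
          qed simp_all
          thus ?thesis by blast
        next
          case vwZ: False
          \<comment> \<open>Both edges are chords, so a second cut along \<open>wv\<close> takes the
            triangle off \<open>?Q\<close>.\<close>
          have g3: "gp w v [w, u, v]" using w uv xs(2) Edge(4)[OF w(1)] unfolding gp_def by auto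
          have t3: "two_paths w v ?B [w, u, v]" unfolding two_paths_def
            using gB g3 dj(2) uB gp_set[OF gB] by (auto simp: insert_commute)
          have Q3: "?Q = pe ?B \<union> pe [w, u, v]" unfolding pC by (auto simp: insert_commute)
          have nQ: "{w, v} \<notin> ?Q" using vwZ dist unfolding pC xs(4) pxs by (auto simp: insert_commute)
          have "{v, w} \<in> F ?Q" using uwF(2) uv1(2) unfolding c'(3) by simp
          hence wvQ: "{w, v} \<in> F ?Q" unfolding sw(1) .
          note k = chord[OF t3 wvQ[unfolded Q3] nQ[unfolded Q3]]
          have eT: "insert {w, v} (pe [w, u, v]) = ?T"
            unfolding pe.simps insert_commute[of w v "{}"] insert_commute[of w u "{}"] by (rule perm3)
          let ?Z2 = "insert {w, v} (pe ?B)"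
          have k': "S ?Q = S ?Z2 \<union> {u, v, w}" "S ?Z2 \<inter> {u, v, w} = {w, v}"
              "F ?Q = F ?Z2 \<union> ?T" "F ?Z2 \<inter> ?T = {{w, v}}"
            using k(3-6) unfolding Q3[symmetric] eT ST FT by - (assumption+)
          have uv2: "{u, v} \<notin> F ?Z2" by (rule Int_single(1)[OF k'(4) _ dist2]) simp
          have d2: "disc ?Z2 (S ?Z2) (F ?Z2)" using IH[OF k(1), of "{u, v}"] uv2 c'(3) k'(3) uwF by blast
          have wu21: "{v, w} \<in> F ?Z2" using Int_single(2)[OF k'(4)] sw(1) by metis
          have wu22: "u \<notin> S ?Z2" by (rule Int_pair(3)[OF k'(2)]; use w uv in simp)
          note wu2 = wu21 Int_pair(2)[OF k'(2)] Int_pair(1)[OF k'(2)] wu22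
          have s12: "S ?Z1 \<inter> S ?Z2 = {w}"
          proof -
            have "S ?Z2 \<subseteq> S ?Q" unfolding k'(1) by (rule Un_upper1)
            from Int_sub[OF c'(2) this wu2(3,4)] show ?thesis .
          qed
          have ?Spl
          proof (rule spl)
            show "Z = insert {u, v} (pe ?A \<union> pe ?B)" unfolding xs(4) pxs by simp
            show "S Z = S ?Z1 \<union> S ?Z2" unfolding c'(1) k'(1) using wu1 wu2 by auto
            show "S ?Z1 \<inter> S ?Z2 = {w}" by (rule s12)
            show "u \<in> S ?Z1" "v \<in> S ?Z2" by (fact wu1 wu2)+
            show "F Z = insert {u, v} (F ?Z1 \<union> F ?Z2)" unfolding c'(3) k'(3) using wu1(1) wu2(1) by auto
            show "pe ?A = {{u, w}} \<and> S ?Z1 = {u, w} \<and> F ?Z1 = {{u, w}} \<or> {u, w} \<notin> pe ?A \<and> disc (insert {u, w} (pe ?A)) (S ?Z1) (F ?Z1)"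
              using d1 uwZ unfolding xs(4) pxs by blast
            show "pe ?B = {{v, w}} \<and> S ?Z2 = {v, w} \<and> F ?Z2 = {{v, w}} \<or> {v, w} \<notin> pe ?B \<and> disc (insert {v, w} (pe ?B)) (S ?Z2) (F ?Z2)"
              using d2 vwZ unfolding xs(4) pxs sw by blast
          qed
          thus ?thesis by blast
        qed
      qed
    qed
  qed
qed

end

section \<open>A cycle enclosing the whole graph, from 2-connectedness\<close>

context near_tri begin

lemma card_V: "card V \<ge> 3" using conn2 unfolding two_connected_def by blast

lemma conn_del: "x \<in> V \<Longrightarrow> u \<in> V - {x} \<Longrightarrow> v \<in> V - {x} \<Longrightarrow> (u, v) \<in> (edge_rel (V - {x}) E)\<^sup>*"
  using conn2 unfolding two_connected_def connected_graph_def by blast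

lemma conn: "u \<in> V \<Longrightarrow> v \<in> V \<Longrightarrow> (u, v) \<in> (edge_rel V E)\<^sup>*"
  using conn2 unfolding two_connected_def connected_graph_def by blast

text \<open>A walk is shortened to a path by cutting at a repeated vertex. The second conclusion
  remembers that every edge comes from \<open>r\<close>, which is how a forbidden edge or vertex is
  shown to be avoided.\<close>

lemma rtrancl_gp:
  assumes "(a, b) \<in> r\<^sup>*" "a \<noteq> b" "\<And>x y. (x, y) \<in> r \<Longrightarrow> E x y"
  obtains xs where "gp a b xs" "\<And>x y. {x, y} \<in> pe xs \<Longrightarrow> (x, y) \<in> r \<or> (y, x) \<in> r"
proof -
  have "a = b \<or> (\<exists>xs. gp a b xs \<and> (\<forall>x y. {x, y} \<in> pe xs \<longrightarrow> (x, y) \<in> r \<or> (y, x) \<in> r))"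
    using assms(1)
  proof (induction rule: converse_rtrancl_induct)
    case (step y z)
    show ?case
    proof (cases "y = b")
      case False
      have Eyz: "E y z" using assms(3) step(1) .
      show ?thesis
      proof (cases "z = b")
        case True
        hence "gp y b [y, b]" using gp_edge Eyz by simp
        moreover have "\<forall>x w. {x, w} \<in> pe [y, b] \<longrightarrow> (x, w) \<in> r \<or> (w, x) \<in> r"
          using step(1) True by (auto simp: doubleton_eq_iff)
        ultimately show ?thesis by blast
      next
        case zb: False
        then obtain xs where xs: "gp z b xs" "\<forall>x y. {x, y} \<in> pe xs \<longrightarrow> (x, y) \<in> r \<or> (y, x) \<in> r" using step(3) by blast
        show ?thesis
        proof (cases "y \<in> set xs")
          case True
          then obtain A B where AB: "xs = A @ y # B" by (meson split_list)
          have "gp y b (y # B)" using xs(1) False unfolding AB gp_def by (auto simp: successively_append_iff)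
          moreover have "pe (y # B) \<subseteq> pe xs" unfolding AB by (cases "A = []") (auto simp: pe_append)
          ultimately show ?thesis using xs(2) by blast
        next
          case nin: False
          have "gp y b (y # xs)" using xs(1) False nin Eyz unfolding gp_def by (auto simp: successively_Cons)
          moreover have "pe (y # xs) = insert {y, z} (pe xs)" using pe_Cons[of xs y] xs(1) unfolding gp_def by auto
          ultimately show ?thesis using xs(2) step(1)
            by (intro disjI2 exI[of _ "y # xs"]) (auto simp: doubleton_eq_iff)
        qed
      qed
    qed simp
  qed simp
  thus thesis using assms(2) that by blast
qed

text \<open>Take an edge \<open>uv\<close> and a third vertex \<open>t\<close>. Without
  \<open>v\<close> one still gets from \<open>u\<close> to \<open>t\<close>, and without
  \<open>u\<close> from \<open>t\<close> to \<open>v\<close>. Neither walk can use the edge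
  \<open>uv\<close>, so together they contain a path that closes up with it.\<close>

lemma exists_ring: "\<exists>Z. ring Z"
proof -
  obtain u where u: "u \<in> V" using card_V by fastforce
  have "\<not> V \<subseteq> {u}" using card_V card_mono[of "{u}" V] by auto
  then obtain t0 where "t0 \<in> V" "t0 \<noteq> u" by blast
  hence "(u, t0) \<in> (edge_rel V E)\<^sup>*" using conn u by blast
  then obtain v where uv: "E u v" using \<open>t0 \<noteq> u\<close> by (metis (no_types, lifting) converse_rtranclE edge_rel_def mem_Collect_eq case_prodD)
  have v: "v \<in> V" "v \<noteq> u" using Edge uv by auto
  have "\<not> V \<subseteq> {u, v}" using card_V card_mono[of "{u, v}" V] v by auto
  then obtain t where t: "t \<in> V" "t \<noteq> u" "t \<noteq> v" by blast
  let ?r = "edge_rel (V - {u}) E \<union> edge_rel (V - {v}) E"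
  have "(u, t) \<in> (edge_rel (V - {v}) E)\<^sup>*" using conn_del[of v] v u t by blast
  moreover have "(t, v) \<in> (edge_rel (V - {u}) E)\<^sup>*" using conn_del[of u] v u t by blast
  ultimately have "(u, v) \<in> ?r\<^sup>*"
    by (meson Un_upper1 Un_upper2 rtrancl_mono rtrancl_trans subsetD)
  then obtain xs where xs: "gp u v xs" "\<And>x y. {x, y} \<in> pe xs \<Longrightarrow> (x, y) \<in> ?r \<or> (y, x) \<in> ?r"
    using rtrancl_gp[of u v ?r] v(2) unfolding edge_rel_def by blast
  have "{u, v} \<notin> pe xs" using xs(2)[of u v] unfolding edge_rel_def by blast
  thus ?thesis unfolding ring_def using xs(1) uv by blast
qed

lemma ring_vertex_edge: assumes "ring Z" "x \<in> \<Union> Z" obtains y where "{x, y} \<in> Z"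
proof -
  obtain e where e: "e \<in> Z" "x \<in> e" using assms by blast
  have "e \<in> EE" using e cyc_jordan(1)[OF ring_cyc[OF assms(1)]] by blast
  then obtain u v where "e = {u, v}" by (elim EE_cases)
  thus thesis using e that by (auto simp: insert_commute)
qed

lemma ring_two_paths:
  assumes Z: "ring Z" and x: "x \<in> \<Union> Z" and z: "z \<in> \<Union> Z" "z \<noteq> x"
  obtains P Q where "two_paths x z P Q" "Z = pe P \<union> pe Q"
proof -
  obtain y where "{x, y} \<in> Z" using ring_vertex_edge[OF Z x] .
  then obtain xs where xs: "gp x y xs" "E x y" "{x, y} \<notin> pe xs" "Z = insert {x, y} (pe xs)"
    using ring_rotate[OF Z] by metis
  have "\<Union> Z = set xs" using gp_set[OF xs(1)] unfolding xs(4) by auto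
  then obtain A B where AB: "xs = A @ z # B" using z by (metis split_list)
  have A: "A \<noteq> []" using xs(1) z(2) AB unfolding gp_def by auto
  have gA: "gp x z (A @ [z])" using xs(1) z(2) A unfolding AB gp_def by (auto simp: successively_append_iff)
  have d: "distinct (A @ z # B)" "successively E (z # B)" "last (z # B) = y"
    using xs(1) unfolding AB gp_def by (auto simp: successively_append_iff)
  have xA: "x \<in> set A" using xs(1) A unfolding AB gp_def by auto
  have "successively E (rev (z # B))" unfolding successively_rev
    by (rule successively_mono[OF d(2)]) (rule Edge(4))
  hence s: "successively E (x # rev (z # B))" using xs(2) d(3) unfolding successively_Cons hd_rev by blast
  have gQ: "gp x z (x # rev (z # B))" using s d xA z(2) unfolding gp_def by (auto simp: last_rev)
  have pQ: "pe (x # rev (z # B)) = insert {x, y} (pe (z # B))"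
    using pe_Cons[of "rev (z # B)" x] d(3) unfolding pe_rev hd_rev by (simp only: rev_is_Nil_conv) simp
  have pxs: "pe xs = pe (A @ [z]) \<union> pe (z # B)"
    using pe_append[of A "[z]"] pe_append[of A "z # B"] A AB by auto
  have "pe (A @ [z]) \<inter> pe (z # B) = {}"
  proof (rule ccontr)
    assume "\<not> ?thesis"
    then obtain e where e: "e \<in> pe (A @ [z])" "e \<in> pe (z # B)" by blast
    hence "e \<subseteq> {z}" using pe_sub[of e "A @ [z]"] pe_sub[of e "z # B"] d(1) by auto
    moreover have "e \<in> EE" using e(1) gp_EE[OF gA] by blast
    then obtain u v where "e = {u, v}" "u \<noteq> v" by (elim EE_cases)
    ultimately show False by auto
  qed
  hence "two_paths x z (A @ [z]) (x # rev (z # B))" unfolding two_paths_def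
    using gA gQ pQ xs(3) pxs d(1) xA by auto
  moreover have "Z = pe (A @ [z]) \<union> pe (x # rev (z # B))" unfolding pQ xs(4) pxs by auto
  ultimately show thesis using that by blast
qed

lemma first_hit:
  assumes "gp y z ys" "z \<in> W" "y \<notin> W"
  obtains z' ys' where "gp y z' ys'" "z' \<in> W" "set ys' \<inter> W = {z'}" "set ys' \<subseteq> set ys" "pe ys' \<subseteq> pe ys"
proof -
  have "\<exists>a\<in>set ys. a \<in> W" using gp_set(2)[OF assms(1)] assms(2) by blast
  from split_list_first_prop[OF this]
  obtain A a B where ys: "ys = A @ a # B" "a \<in> W" "\<forall>x\<in>set A. x \<notin> W" by blast
  have A: "A \<noteq> []" using ys assms(1,3) unfolding gp_def by auto
  show thesis
  proof (rule that)
    show "gp y a (A @ [a])" using assms(1,3) ys A unfolding gp_def by (auto simp: successively_append_iff)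
    show "a \<in> W" using ys by blast
    show "set (A @ [a]) \<inter> W = {a}" using ys by auto
    show "set (A @ [a]) \<subseteq> set ys" using ys by auto
    show "pe (A @ [a]) \<subseteq> pe ys" using pe_append[of A "[a]"] pe_append[of A "a # B"] A ys by auto
  qed
qed

text \<open>The two halves \<open>P\<close>, \<open>Q\<close> of the cycle and the ear
  \<open>zs\<close> are three arcs with common ends, and the ear stays out of the inside. By
  \<open>theta_outside\<close> one half enters the inside of the cycle formed by the other half and
  the ear, so that cycle encloses the old region and gains the ear.\<close>

lemma ear_bigger:
  assumes Z: "ring Z" and zs: "gp x z zs" "set zs \<inter> \<Union> Z = {x, z}" and out: "pe zs \<inter> F Z = {}"
  shows "\<exists>Z'. ring Z' \<and> F Z \<subset> F Z'"
proof -
  have "x \<in> \<Union> Z" "z \<in> \<Union> Z" "z \<noteq> x" using zs gp_set[OF zs(1)] by auto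
  then obtain P Q where PQ: "two_paths x z P Q" "Z = pe P \<union> pe Q" using ring_two_paths[OF Z] by metis
  have UZ: "\<Union> Z = set P \<union> set Q" using PQ gp_set(4) unfolding two_paths_def by (simp only: Union_Un_distrib) metis
  have gPQ: "gp x z P" "gp x z Q" "set P \<inter> set Q = {x, z}" "pe P \<inter> pe Q = {}" using PQ unfolding two_paths_def by auto
  have nz: "pe zs \<inter> Z = {}" using out Z_F[OF ring_cyc[OF Z]] by blast
  have endsP: "x \<in> set P" "z \<in> set P" "x \<in> set Q" "z \<in> set Q" using gp_set gPQ by metis+
  have "set P \<inter> set zs = {x, z}" "set Q \<inter> set zs = {x, z}" using zs(2) endsP gp_set(1,2)[OF zs(1)] unfolding UZ by blast+
  hence Pz: "two_paths x z P zs" and Qz: "two_paths x z Q zs"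
    unfolding two_paths_def using zs(1) gPQ nz PQ(2) by blast+
  have Zc: "cyc Z" using ring_cyc[OF Z] .
  have out': "J (pe zs) \<inter> inside (J (pe P \<union> pe Q)) = {}"
  proof (rule ccontr)
    assume "\<not> ?thesis"
    then obtain e where e: "e \<in> pe zs" "ei e \<inter> inside (J Z) \<noteq> {}" unfolding PQ(2)[symmetric] J_def by blast
    have eE: "e \<in> EE" "e \<notin> Z" using e(1) gp_EE[OF zs(1)] nz by blast+
    have "\<not> dei e \<subseteq> inside (J Z)" using F_iff[OF Zc eE] e(1) out by blast
    hence "dei e \<subseteq> outside (J Z)" using edge_side[OF Zc eE] by blast
    hence "ei e \<subseteq> J Z \<union> outside (J Z)" using dei(3)[OF eE(1)] closure_mono cyc_jordan(10)[OF Zc] by blast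
    thus False using e(2) inside_no_overlap[of "J Z"] inside_Int_outside[of "J Z"] by blast
  qed
  have main: ?thesis if t: "two_paths x z P' Q'" "Z = pe P' \<union> pe Q'" "two_paths x z P' zs" "two_paths x z Q' zs"
      "J (pe P') \<inter> inside (J (pe Q' \<union> pe zs)) \<noteq> {}" for P' Q'
  proof -
    have "F (pe Q' \<union> pe zs) = F (pe Q' \<union> pe P') \<union> F (pe zs \<union> pe P')"
      using theta(4)[OF t(4) two_paths_sym[OF t(1)] two_paths_sym[OF t(3)] t(5)] .
    hence sub: "F Z \<subseteq> F (pe Q' \<union> pe zs)" unfolding t(2) by (simp add: Un_commute)
    have r: "ring (pe Q' \<union> pe zs)" using two_paths_ring[OF t(4)] .
    have "pe zs \<noteq> {}" using gp_set[OF zs(1)] by auto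
    moreover have "pe zs \<subseteq> F (pe Q' \<union> pe zs)" using Z_F[OF ring_cyc[OF r]] by blast
    ultimately show ?thesis using sub r out by blast
  qed
  note a = two_paths_arcs[OF PQ(1)] two_paths_arcs(2,3)[OF Pz] two_paths_arcs(3)[OF Qz]
  have "J (pe P) \<inter> inside (J (pe Q) \<union> J (pe zs)) \<noteq> {} \<or> J (pe Q) \<inter> inside (J (pe P) \<union> J (pe zs)) \<noteq> {}"
    by (rule theta_outside[OF a(1,2,4,3,5,6) out'[unfolded J_Un]])
  thus ?thesis
  proof
    assume "J (pe P) \<inter> inside (J (pe Q) \<union> J (pe zs)) \<noteq> {}"
    thus ?thesis using main[OF PQ Pz Qz] unfolding J_Un by blast
  next
    assume "J (pe Q) \<inter> inside (J (pe P) \<union> J (pe zs)) \<noteq> {}"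
    thus ?thesis using main[OF two_paths_sym[OF PQ(1)] _ Qz Pz] PQ(2) unfolding J_Un by (simp add: Un_commute)
  qed
qed

text \<open>From a vertex strictly inside no edge leads out: the open edge would lie outside, but
  \<open>p x\<close> belongs to its closure.\<close>

lemma outer_vertex:
  assumes Z: "ring Z" and e: "E x y" "x \<in> S Z" "{x, y} \<notin> F Z" shows "x \<in> \<Union> Z"
proof (rule ccontr)
  assume nx: "x \<notin> \<Union> Z"
  note Zc = ring_cyc[OF Z]
  have eE: "{x, y} \<in> EE" "{x, y} \<notin> Z" using e Z_F[OF Zc] by (auto simp: EE_iff)
  have "p x \<notin> J Z" using J_vertex[OF cyc_jordan(1)[OF Zc]] nx e Edge by blast
  hence px: "p x \<in> inside (J Z)" using e(2) unfolding S_def R_def by blast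
  have "dei {x, y} \<subseteq> outside (J Z)" using edge_side[OF Zc eE] F_iff[OF Zc eE] e(3) by blast
  hence "ei {x, y} \<subseteq> J Z \<union> outside (J Z)" using dei(3)[OF eE(1)] closure_mono cyc_jordan(10)[OF Zc] by blast
  moreover have "p x \<in> ei {x, y}" using ei_vertex[OF eE(1)] e Edge by blast
  ultimately show False using px inside_no_overlap[of "J Z"] inside_Int_outside[of "J Z"] by blast
qed

text \<open>The ear meets the curve at its end \<open>z\<close> only, so by connectedness it stays
  on the side where it starts.\<close>

lemma ear_outside:
  assumes Z: "ring Z" and zs: "gp y z zs" "set zs \<inter> \<Union> Z = {z}" and pyo: "p y \<in> outside (J Z)"
  shows "J (pe zs) - {p z} \<subseteq> outside (J Z)"
proof -
  note Zc = ring_cyc[OF Z]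
  note az = gp_arc[OF zs(1)]
  have "pe zs \<inter> Z = {}"
  proof (rule ccontr)
    assume "\<not> ?thesis"
    then obtain h where h: "h \<in> pe zs" "h \<in> Z" by blast
    have "h \<subseteq> set zs" "h \<subseteq> \<Union> Z" using pe_sub[OF h(1)] h(2) by auto
    hence "h \<subseteq> set zs \<inter> \<Union> Z" by simp
    hence hz: "h \<subseteq> {z}" unfolding zs(2) .
    have "h \<in> F Z" by (rule subsetD[OF Z_F[OF Zc] h(2)])
    hence "card h = 2" using ring_F_card[OF Z] by simp
    thus False using card_mono[OF _ hz] by simp
  qed
  from J_Int[OF gp_EE[OF zs(1)] cyc_jordan(1)[OF Zc] this]
  have JJ: "J (pe zs) \<inter> J Z = {p z}" unfolding gp_set(4)[OF zs(1)] zs(2) by simp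
  let ?A = "J (pe zs) - {p y, p z}"
  note con = arcset_open(1)[OF az] and cl = arcset_open(3)[OF az]
  have sub: "?A \<subseteq> inside (J Z) \<union> outside (J Z)"
  proof
    fix q assume q: "q \<in> ?A"
    have "q \<notin> J Z"
    proof
      assume "q \<in> J Z"
      with q have "q \<in> J (pe zs) \<inter> J Z" by simp
      thus False using q unfolding JJ by simp
    qed
    thus "q \<in> inside (J Z) \<union> outside (J Z)" unfolding inside_Un_outside by simp
  qed
  have "p y \<in> closure ?A" using cl arcset_ends(1)[OF az] by (rule subsetD)
  with pyo have mem: "p y \<in> outside (J Z) \<inter> closure ?A" by simp
  have ne: "outside (J Z) \<inter> ?A \<noteq> {}"
  proof
    assume "outside (J Z) \<inter> ?A = {}"
    with open_Int_closure_eq_empty[OF cyc_jordan(5)[OF Zc], of ?A]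
    have "outside (J Z) \<inter> closure ?A = {}" by (rule iffD2)
    thus False using mem by simp
  qed
  have "inside (J Z) \<inter> outside (J Z) \<inter> ?A = {}" unfolding inside_Int_outside by simp
  from connectedD[OF con cyc_jordan(3)[OF Zc] cyc_jordan(5)[OF Zc] this sub] ne
  have io: "inside (J Z) \<inter> ?A = {}" by simp
  show ?thesis
  proof
    fix q assume q: "q \<in> J (pe zs) - {p z}"
    show "q \<in> outside (J Z)"
    proof (cases "q = p y")
      case False
      hence qA: "q \<in> ?A" using q by simp
      have "q \<notin> inside (J Z)" using io qA by (metis IntI empty_iff)
      with subsetD[OF sub qA] show ?thesis by (meson UnE)
    qed (use pyo in simp)
  qed
qed


text \<open>The edge \<open>xy\<close> leaves the region. If \<open>y\<close> is not on the cycle,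
  it can still reach the rest of the cycle after \<open>x\<close> is deleted, and its first arrival
  there completes an ear. The absence of a cut vertex is what makes the ear end somewhere other than
  \<open>x\<close>.\<close>

lemma extend_ring:
  assumes Z: "ring Z" and e: "E x y" "x \<in> S Z" "{x, y} \<notin> F Z"
  shows "\<exists>Z'. ring Z' \<and> F Z \<subset> F Z'"
proof -
  note Zc = ring_cyc[OF Z]
  have xZ: "x \<in> \<Union> Z" using outer_vertex[OF assms] .
  have V: "x \<in> V" "y \<in> V" "x \<noteq> y" using Edge e by auto
  show ?thesis
  proof (cases "y \<in> \<Union> Z")
    case True
    show ?thesis using gp_edge[OF e(1)] xZ True e(3) by (intro ear_bigger[OF Z, of x y "[x, y]"]) auto
  next
    case False
    obtain x' where "{x, x'} \<in> Z" using ring_vertex_edge[OF Z xZ] .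
    moreover from this have "E x x'" using cyc_jordan(1)[OF Zc] EE_iff[of x x'] by blast
    ultimately have x': "x' \<in> \<Union> Z" "x' \<in> V" "x' \<noteq> x" using Edge[of x x'] by auto
    have "(y, x') \<in> (edge_rel (V - {x}) E)\<^sup>*" using conn_del[of x y x'] V x' by blast
    moreover have "y \<noteq> x'" using False x' by blast
    ultimately obtain ys where ys: "gp y x' ys" "\<And>a b. {a, b} \<in> pe ys \<Longrightarrow> (a, b) \<in> edge_rel (V - {x}) E \<or> (b, a) \<in> edge_rel (V - {x}) E"
      using rtrancl_gp[of y x' "edge_rel (V - {x}) E"] unfolding edge_rel_def by blast
    have xys: "x \<notin> set ys"
    proof
      assume "x \<in> set ys"
      then obtain f where f: "f \<in> pe ys" "x \<in> f" using gp_set(4)[OF ys(1)] by blast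
      have "f \<in> EE" using f gp_EE[OF ys(1)] by blast
      then obtain a b where "f = {a, b}" by (elim EE_cases)
      thus False using ys(2)[of a b] f unfolding edge_rel_def by blast
    qed
    obtain z zs where zs: "gp y z zs" "z \<in> \<Union> Z" "set zs \<inter> \<Union> Z = {z}" "set zs \<subseteq> set ys"
      using first_hit[OF ys(1) x'(1) False] by metis
    have pyo: "p y \<in> outside (J Z)"
    proof -
      have eE: "{x, y} \<in> EE" "{x, y} \<notin> Z" using e Z_F[OF Zc] by (auto simp: EE_iff)
      have "dei {x, y} \<subseteq> outside (J Z)" using edge_side[OF Zc eE] F_iff[OF Zc eE] e(3) by blast
      hence "ei {x, y} \<subseteq> closure (outside (J Z))" using dei(3)[OF eE(1)] closure_mono by (metis order_trans)
      moreover have "p y \<in> ei {x, y}" using ei_vertex[OF eE(1) V(2)] by simp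
      moreover have "p y \<notin> J Z" using J_vertex[OF cyc_jordan(1)[OF Zc] V(2)] False by simp
      ultimately show ?thesis unfolding cyc_jordan(10)[OF Zc] by (metis UnE subsetD)
    qed
    have g: "gp x z (x # zs)" using zs xys e(1) unfolding gp_def by (auto simp: successively_Cons)
    show ?thesis
    proof (rule ear_bigger[OF Z g])
      show "set (x # zs) \<inter> \<Union> Z = {x, z}" using zs xZ by auto
      show "pe (x # zs) \<inter> F Z = {}"
      proof (rule ccontr)
        assume "\<not> ?thesis"
        then obtain f where f: "f \<in> pe (x # zs)" "f \<in> F Z" by blast
        show False
        proof (cases "f = {x, y}")
          case False
          hence fz: "f \<in> pe zs" using f(1) pe_Cons[of zs x] zs(1) unfolding gp_def by auto
          have nZ: "f \<notin> Z"
          proof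
            assume "f \<in> Z"
            hence "f \<subseteq> {z}" using pe_sub[OF fz] zs(3) by blast
            moreover have "card f = 2" using ring_F_card[OF Z f(2)] by blast
            ultimately show False using card_mono[of "{z}" f] by simp
          qed
          have fE: "f \<in> EE" using f(2) F_EE by blast
          have 1: "dei f \<subseteq> inside (J Z)" using F_iff[OF Zc fE nZ] f(2) by blast
          have 2: "J (pe zs) - {p z} \<subseteq> outside (J Z)" using ear_outside[OF Z zs(1,3) pyo] .
          have 3: "dei f \<subseteq> J (pe zs)" using fz unfolding dei_def J_def by blast
          have 4: "dei f \<inter> J Z = {}" using dei_J[OF fE cyc_jordan(1)[OF Zc] nZ] .
          have "z \<in> V" using zs(2) EE_V[OF cyc_jordan(1)[OF Zc]] by blast
          hence 5: "p z \<in> J Z" using J_vertex[OF cyc_jordan(1)[OF Zc]] zs(2) by blast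
          obtain q where q: "q \<in> dei f" using dei(2)[OF fE] by blast
          hence "q \<noteq> p z" using 4 5 by (metis disjoint_iff)
          moreover have "q \<in> J (pe zs)" using q 3 by (rule subsetD[rotated])
          ultimately have "q \<in> outside (J Z)" using 2 by blast
          moreover have "q \<in> inside (J Z)" using q 1 by (rule subsetD[rotated])
          ultimately show False using inside_Int_outside[of "J Z"] by (metis IntI empty_iff)
        qed (use e(3) f(2) in simp)
      qed
    qed
  qed
qed

text \<open>If the region of a cycle has a maximal set of edges, no edge leaves it by
  \<open>extend_ring\<close>; connectedness then puts the whole graph into the region, and
  \<open>ring_disc\<close> applies.\<close>

theorem near_tri_disc: "\<exists>Z. disc Z V EE"
proof -
  have "{F Z | Z. ring Z} \<subseteq> Pow EE" using F_EE by (intro subsetI) (elim CollectE exE conjE, simp)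
  moreover have "finite (Pow EE)" using finite_EE by simp
  ultimately have "finite {F Z | Z. ring Z}" by (rule finite_subset)
  moreover obtain Z0 where "ring Z0" using exists_ring by (elim exE)
  hence "F Z0 \<in> {F Z | Z. ring Z}" by (intro CollectI exI conjI) (rule refl)
  hence "{F Z | Z. ring Z} \<noteq> {}" by (metis empty_iff)
  ultimately have "\<exists>M\<in>{F Z | Z. ring Z}. \<forall>N\<in>{F Z | Z. ring Z}. M \<subseteq> N \<longrightarrow> M = N"
    by (rule finite_has_maximal)
  then obtain M where M: "M \<in> {F Z | Z. ring Z}" "\<forall>N\<in>{F Z | Z. ring Z}. M \<subseteq> N \<longrightarrow> M = N" by (elim bexE)
  from M(1) obtain Z where Z: "M = F Z" "ring Z" by (elim CollectE exE conjE)
  have mx: "\<not> F Z \<subset> F Z'" if "ring Z'" for Z'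
  proof
    assume less: "F Z \<subset> F Z'"
    have "F Z' \<in> {F Z | Z. ring Z}" using that by (intro CollectI exI conjI) (rule refl)
    from bspec[OF M(2)[unfolded Z(1)] this] have "F Z = F Z'" using less by simp
    thus False using less by simp
  qed
  note Zc = ring_cyc[OF Z(2)]
  have ext: "{x, y} \<in> F Z" if "E x y" "x \<in> S Z" for x y
  proof (rule ccontr)
    assume "{x, y} \<notin> F Z"
    from extend_ring[OF Z(2) that this] obtain Z' where "ring Z'" "F Z \<subset> F Z'" by (elim exE conjE)
    thus False using mx[of Z'] by simp
  qed
  have "S Z = V"
  proof
    show "S Z \<subseteq> V" unfolding S_def by blast
    obtain u v xs where "Z = insert {u, v} (pe xs)" using Z(2) unfolding ring_def by metis
    hence "u \<in> \<Union> Z" by simp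
    hence x: "u \<in> S Z" by (rule subsetD[OF Z_S[OF Zc]])
    show "V \<subseteq> S Z"
    proof
      fix y assume "y \<in> V"
      moreover have "u \<in> V" using x unfolding S_def by blast
      ultimately have "(u, y) \<in> (edge_rel V E)\<^sup>*" by (intro conn)
      thus "y \<in> S Z"
      proof (induction rule: rtrancl_induct)
        case (step a b)
        from step(2) have "E a b" unfolding edge_rel_def by simp
        from F_S[OF Zc ext[OF this step(3)]] have "{a, b} \<subseteq> S Z" .
        thus ?case by simp
      qed (rule x)
    qed
  qed
  moreover have "F Z = EE"
  proof
    show "F Z \<subseteq> EE" by (rule F_EE)
    show "EE \<subseteq> F Z"
    proof
      fix e assume "e \<in> EE"
      then obtain u v where "e = {u, v}" "E u v" "u \<in> V" by (elim EE_cases)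
      thus "e \<in> F Z" using ext[of u v] \<open>S Z = V\<close> by simp
    qed
  qed
  ultimately have "disc Z V EE" using ring_disc[OF Z(2)] by simp
  thus ?thesis by (rule exI)
qed

end

section \<open>2-trees\<close>

inductive tt :: "'a set \<Rightarrow> 'a set set \<Rightarrow> bool" where
  base: "a \<noteq> b \<Longrightarrow> tt {a, b} {{a, b}}"
| add: "tt S F \<Longrightarrow> {a, b} \<in> F \<Longrightarrow> a \<noteq> b \<Longrightarrow> x \<notin> S \<Longrightarrow> tt (insert x S) (insert {x, a} (insert {x, b} F))"

definition N :: "'a set set \<Rightarrow> 'a \<Rightarrow> 'a set" where "N F v = {u. u \<noteq> v \<and> {v, u} \<in> F}"
definition rs :: "'a set set \<Rightarrow> 'a set \<Rightarrow> 'a set set" where "rs F W = {e \<in> F. e \<subseteq> W}"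
text \<open>Degree two serves as the test for being deletable: by \<open>tt_del\<close> the two
  neighbours in a 2-tree are then adjacent and the rest is again a 2-tree.\<close>

definition simp2 :: "'a set \<Rightarrow> 'a set set \<Rightarrow> 'a set" where "simp2 S F = {v \<in> S. card (N F v) = 2}"

lemma mem_N: "u \<in> N F v \<longleftrightarrow> u \<noteq> v \<and> {v, u} \<in> F" unfolding N_def by simp
lemma N_sym: "u \<in> N F v \<longleftrightarrow> v \<in> N F u" unfolding mem_N by (metis insert_commute)
lemma rs_sub: "rs F W \<subseteq> F" unfolding rs_def by blast
lemma rs_rs: "rs (rs F W) U = rs F (W \<inter> U)" unfolding rs_def by auto
lemma N_rs: "v \<in> W \<Longrightarrow> N (rs F W) v = N F v \<inter> W" unfolding N_def rs_def by auto

lemma tt_edge_sub2: "tt S F \<Longrightarrow> e \<in> F \<Longrightarrow> e \<subseteq> S \<and> card e = 2"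
proof (induction arbitrary: e rule: tt.induct)
  case (add S F a b x)
  have ab: "{a, b} \<subseteq> S" using add.IH[OF add.hyps(2)] by simp
  from add.prems consider "e = {x, a}" | "e = {x, b}" | "e \<in> F" by (elim insertE)
  thus ?case
  proof cases
    case 3 thus ?thesis using add.IH[of e] by (simp add: subset_insertI2)
  next
    case 1
    have "x \<noteq> a" using ab add.hyps(4) by auto
    thus ?thesis using 1 ab by simp
  next
    case 2
    have "x \<noteq> b" using ab add.hyps(4) by auto
    thus ?thesis using 2 ab by simp
  qed
qed auto

lemma tt_edge_sub: "tt S F \<Longrightarrow> e \<in> F \<Longrightarrow> e \<subseteq> S" using tt_edge_sub2[of S F e] by simp

lemma tt_edge2: assumes "tt S F" "{a, b} \<in> F" shows "a \<noteq> b \<and> a \<in> S \<and> b \<in> S"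
proof -
  have "card {a, b} = 2" "{a, b} \<subseteq> S" using tt_edge_sub2[OF assms] by simp_all
  thus ?thesis by (cases "a = b") simp_all
qed

lemma tt_edge: assumes "tt S F" "e \<in> F" shows "\<exists>a b. e = {a, b} \<and> a \<noteq> b \<and> a \<in> S \<and> b \<in> S"
proof -
  have "card e = 2" "e \<subseteq> S" using tt_edge_sub2[OF assms] by simp_all
  then obtain a b where "e = {a, b}" "a \<noteq> b" unfolding card_2_iff by (elim exE conjE)
  thus ?thesis using \<open>e \<subseteq> S\<close> by simp metis
qed

lemma tt_fin: "tt S F \<Longrightarrow> finite S" by (induction rule: tt.induct) auto
lemma tt_card: "tt S F \<Longrightarrow> card S \<ge> 2"
proof (induction rule: tt.induct)
  case (add S F a b x) thus ?case using tt_fin[OF add.hyps(1)] by simp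
qed simp
lemma N_S: "tt S F \<Longrightarrow> N F v \<subseteq> S"
  unfolding N_def by (intro subsetI, elim CollectE conjE) (simp add: tt_edge2)
lemma N_fin: "tt S F \<Longrightarrow> finite (N F v)" by (rule finite_subset[OF N_S tt_fin])

lemma N_add_new: assumes "tt S F" "x \<notin> S" "a \<in> S" "b \<in> S"
  shows "N (insert {x, a} (insert {x, b} F)) x = {a, b}"
proof -
  have "{x, u} \<notin> F" for u using tt_edge2[OF assms(1), of x u] assms(2) by metis
  thus ?thesis using assms unfolding N_def by (auto simp: doubleton_eq_iff)
qed

lemma N_add_old: assumes "tt S F" "x \<notin> S" "a \<in> S" "b \<in> S" "v \<in> S"
  shows "N (insert {x, a} (insert {x, b} F)) v = N F v \<union> (if v \<in> {a, b} then {x} else {})"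
  using assms unfolding N_def by (auto simp: doubleton_eq_iff)

lemma rs_self: "tt S F \<Longrightarrow> rs F S = F" unfolding rs_def using tt_edge_sub by blast

lemma rs_add: assumes "tt S F" "x \<notin> S"
  shows "rs (insert {x, a} (insert {x, b} F)) S = F"
  using rs_self[OF assms(1)] assms(2) unfolding rs_def by auto

lemma tt_deg: "tt S F \<Longrightarrow> card S \<ge> 3 \<Longrightarrow> v \<in> S \<Longrightarrow> card (N F v) \<ge> 2"
proof (induction arbitrary: v rule: tt.induct)
  case (add S F a b x)
  note ab = tt_edge2[OF add.hyps(1,2)]
  show ?case
  proof (cases "v = x")
    case True thus ?thesis using N_add_new[OF add.hyps(1,4)] ab by simp
  next
    case False
    hence v: "v \<in> S" using add by simp
    note N = N_add_old[OF add.hyps(1,4) _ _ v, of a b]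
    have fin: "finite (N F v)" using N_fin[OF add.hyps(1)] .
    show ?thesis
    proof (cases "card S \<ge> 3")
      case True
      have "card (N F v) \<ge> 2" using add.IH[OF True v] .
      also have "card (N F v) \<le> card (N (insert {x, a} (insert {x, b} F)) v)"
        using N ab fin by (intro card_mono) auto
      finally show ?thesis .
    next
      case False
      hence "card S = 2" using tt_card[OF add.hyps(1)] by simp
      moreover have "{a, b} \<subseteq> S" using ab by simp
      ultimately have S: "S = {a, b}" using ab tt_fin[OF add.hyps(1)] by (intro card_subset_eq[symmetric]) auto
      have "v = a \<or> v = b" using v S by simp
      thus ?thesis
      proof
        assume "v = a"
        hence "{b, x} \<subseteq> N (insert {x, a} (insert {x, b} F)) v" using N ab add.hyps(2) unfolding mem_N N_def by auto
        moreover have "b \<noteq> x" using ab add.hyps(4) by auto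
        hence "card {b, x} = 2" by simp
        ultimately show ?thesis using N ab fin by (metis card_mono finite_Un finite.emptyI finite.insertI)
      next
        assume "v = b"
        hence "{a, x} \<subseteq> N (insert {x, a} (insert {x, b} F)) v" using N ab add.hyps(2) unfolding N_def by (auto simp: insert_commute)
        moreover have "a \<noteq> x" using ab add.hyps(4) by auto
        hence "card {a, x} = 2" by simp
        ultimately show ?thesis using N ab fin by (metis card_mono finite_Un finite.emptyI finite.insertI)
      qed
    qed
  qed
qed simp

text \<open>Any vertex of degree two could have been added last. If \<open>v\<close> is not on the
  edge \<open>ab\<close> that carries the newest vertex \<open>x\<close>, deleting \<open>v\<close>
  commutes with adding \<open>x\<close>. If it is, \<open>v\<close> had degree one before, so the
  old 2-tree was a single edge and the new one is a triangle.\<close>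

lemma tt_del: "tt S F \<Longrightarrow> v \<in> S \<Longrightarrow> N F v = {p, q} \<Longrightarrow> p \<noteq> q \<Longrightarrow> tt (S - {v}) (rs F (S - {v})) \<and> {p, q} \<in> F"
proof (induction arbitrary: v p q rule: tt.induct)
  case (base a b)
  have "N {{a, b}} v \<subseteq> {a, b} - {v}" unfolding N_def by (auto simp: doubleton_eq_iff)
  hence "{p, q} \<subseteq> {a, b} - {v}" using base.prems(2) by simp
  hence "card {p, q} \<le> card ({a, b} - {v})" by (intro card_mono) simp_all
  also have "card ({a, b} - {v}) < card {a, b}" using base.prems(1) by (intro card_Diff1_less) simp_all
  finally show ?case using base.prems(3) base.hyps by simp
next
  case (add S F a b x)
  note ab = tt_edge2[OF add.hyps(1,2)]
  let ?F = "insert {x, a} (insert {x, b} F)"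
  show ?case
  proof (cases "v = x")
    case True
    hence "{p, q} = {a, b}" using N_add_new[OF add.hyps(1,4)] ab add.prems by simp
    moreover have "insert x S - {v} = S" using True add.hyps(4) by simp
    ultimately show ?thesis using True rs_add[OF add.hyps(1,4)] add.hyps(1,2) by auto
  next
    case False
    hence v: "v \<in> S" using add.prems by simp
    note N = N_add_old[OF add.hyps(1,4) _ _ v, of a b]
    show ?thesis
    proof (cases "v \<in> {a, b}")
      case False
      hence "N F v = {p, q}" using N ab add.prems by simp
      hence IH: "tt (S - {v}) (rs F (S - {v}))" "{p, q} \<in> F" using add.IH[OF v _ add.prems(3)] by auto
      have e: "{a, b} \<in> rs F (S - {v})" using add.hyps(2) ab False unfolding rs_def by auto
      have "tt (insert x (S - {v})) (insert {x, a} (insert {x, b} (rs F (S - {v}))))"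
        using tt.add[OF IH(1) e] ab add.hyps(4) by simp
      moreover have "insert x (S - {v}) = insert x S - {v}" using \<open>v \<noteq> x\<close> by auto
      moreover have "insert {x, a} (insert {x, b} (rs F (S - {v}))) = rs ?F (insert x S - {v})"
      proof -
        have "e \<in> F \<Longrightarrow> e \<subseteq> insert x S - {v} \<longleftrightarrow> e \<subseteq> S - {v}" for e
          using tt_edge_sub[OF add.hyps(1)] add.hyps(4) by blast
        moreover have "a \<noteq> v" "b \<noteq> v" using False by auto
        ultimately show ?thesis using ab \<open>v \<noteq> x\<close> unfolding rs_def by auto
      qed
      ultimately show ?thesis using IH(2) by simp
    next
      case True
      have Nv: "insert x (N F v) = {p, q}" using N ab add.prems True by simp
      have "x \<notin> N F v" using N_S[OF add.hyps(1)] add.hyps(4) by blast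
      have "card (N F v) = 1"
      proof -
        have "card (insert x (N F v)) = 2" unfolding Nv using add.prems by simp
        thus ?thesis using \<open>x \<notin> N F v\<close> N_fin[OF add.hyps(1)] by simp
      qed
      hence "\<not> card S \<ge> 3" using tt_deg[OF add.hyps(1) _ v] by auto
      hence "card S = 2" using tt_card[OF add.hyps(1)] by simp
      moreover have "{a, b} \<subseteq> S" using ab by simp
      ultimately have S: "S = {a, b}" using ab tt_fin[OF add.hyps(1)] by (intro card_subset_eq[symmetric]) auto
      have F: "F = {{a, b}}"
      proof (intro equalityI subsetI)
        fix e assume "e \<in> F"
        hence "e \<subseteq> {a, b}" "card e = 2" using tt_edge_sub2[OF add.hyps(1)] S by simp_all
        hence "e = {a, b}" using ab by (intro card_subset_eq) simp_all
        thus "e \<in> {{a, b}}" by simp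
      qed (use add.hyps(2) in simp)
      \<comment> \<open>\<open>w\<close> is the other end of the single old edge; deleting
        \<open>v\<close> from the triangle leaves the edge \<open>xw\<close>.\<close>
      define w where "w = (if v = a then b else a)"
      have w: "{a, b} = {v, w}" "w \<noteq> v"
      proof -
        show "{a, b} = {v, w}"
        proof (cases "v = a")
          case False
          hence "v = b" using True by simp
          thus ?thesis using False unfolding w_def by (simp add: insert_commute)
        qed (simp add: w_def)
        show "w \<noteq> v" using True ab unfolding w_def by (simp split: if_splits) blast
      qed
      have xw: "x \<noteq> w" "w \<in> S" "x \<noteq> v" using S add.hyps(4) w(1) v by (metis insertI1 insertI2)+
      have "N F v = {w}"
      proof (rule set_eqI)
        fix u
        have "u \<in> N F v \<longleftrightarrow> u \<noteq> v \<and> {v, u} = {v, w}" unfolding mem_N F w(1) by simp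
        also have "\<dots> \<longleftrightarrow> u = w" using w(2) by (metis doubleton_eq_iff)
        finally show "u \<in> N F v \<longleftrightarrow> u \<in> {w}" by simp
      qed
      hence pq: "{p, q} = {x, w}" using Nv by simp
      have S': "insert x S - {v} = {x, w}" unfolding S w(1) using xw w(2) by (simp add: insert_Diff_if)
      have "{{x, a}, {x, b}} = {{x, v}, {x, w}}"
      proof (cases "v = a")
        case False
        hence "v = b" "w = a" using True w_def by simp_all
        thus ?thesis by (simp add: insert_commute)
      qed (simp add: w_def)
      hence fF: "?F = {{x, v}, {x, w}, {v, w}}" unfolding F w(1) by (metis insert_is_Un sup_assoc)
      have r: "rs {{x, v}, {x, w}, {v, w}} {x, w} = {{x, w}}"
      proof (intro equalityI subsetI)
        fix e assume "e \<in> rs {{x, v}, {x, w}, {v, w}} {x, w}"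
        hence "e \<in> {{x, v}, {x, w}, {v, w}}" "e \<subseteq> {x, w}" unfolding rs_def by simp_all
        thus "e \<in> {{x, w}}" using xw w(2) by (elim insertE) simp_all
      qed (simp add: rs_def)
      show ?thesis unfolding S' pq unfolding fF r using tt.base[OF xw(1)] by simp
    qed
  qed
qed

lemma simp2_N: "v \<in> simp2 S F \<Longrightarrow> \<exists>p q. N F v = {p, q} \<and> p \<noteq> q"
  unfolding simp2_def by (auto simp: card_2_iff)

lemma tt_del_simp2: "tt S F \<Longrightarrow> v \<in> simp2 S F \<Longrightarrow> tt (S - {v}) (rs F (S - {v}))"
  using tt_del simp2_N unfolding simp2_def by (metis (no_types, lifting) mem_Collect_eq)

text \<open>Deleting \<open>u\<close> would leave an adjacent \<open>v\<close> with degree one in a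
  2-tree on at least three vertices.\<close>

lemma simp2_nonadj:
  assumes "tt S F" "card S \<ge> 4" "u \<in> simp2 S F" "v \<in> simp2 S F"
  shows "u \<notin> N F v"
proof
  assume uv: "u \<in> N F v"
  hence ne: "u \<noteq> v" unfolding mem_N by simp
  obtain p q where pq: "N F v = {p, q}" "p \<noteq> q" using simp2_N assms by metis
  have t: "tt (S - {u}) (rs F (S - {u}))" using tt_del_simp2 assms by metis
  have uvS: "u \<in> S" "v \<in> S" using assms unfolding simp2_def by auto
  have "card (S - {u}) \<ge> 3" using assms(2) uvS tt_fin[OF assms(1)] by simp
  hence "card (N (rs F (S - {u})) v) \<ge> 2" using tt_deg[OF t] uvS ne by simp
  moreover have "N (rs F (S - {u})) v \<subseteq> N F v - {u}" using N_rs[of v "S - {u}" F] uvS ne by auto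
  ultimately have "card (N F v - {u}) \<ge> 2" using card_mono[of "N F v - {u}"] N_fin[OF assms(1)] by (metis finite_Diff le_trans)
  moreover have "card (N F v - {u}) = 1" using assms(4) uv N_fin[OF assms(1)] unfolding simp2_def by simp
  ultimately show False by simp
qed

text \<open>The newest vertex \<open>x\<close> serves unless it lies on \<open>pq\<close>. In that
  case the induction hypothesis for the edge \<open>ab\<close> carrying \<open>x\<close> gives a
  vertex off \<open>ab\<close>, whose degree \<open>x\<close> does not change; the remaining
  possibility is a triangle.\<close>

lemma simp2_avoid: "tt S F \<Longrightarrow> card S \<ge> 3 \<Longrightarrow> {p, q} \<in> F \<Longrightarrow> \<exists>v\<in>simp2 S F. v \<noteq> p \<and> v \<noteq> q"
proof (induction arbitrary: p q rule: tt.induct)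
  case (base a b)
  thus ?case by (auto simp: card_insert_if split: if_splits)
next
  case (add S F a b x)
  note ab = tt_edge2[OF add.hyps(1,2)]
  let ?F = "insert {x, a} (insert {x, b} F)"
  note Nx = N_add_new[OF add.hyps(1,4), of a b]
  have xs: "x \<in> simp2 (insert x S) ?F" using Nx ab unfolding simp2_def by simp
  show ?case
  proof (cases "x \<noteq> p \<and> x \<noteq> q")
    case True thus ?thesis using xs by metis
  next
    case False
    have "{p, q} \<notin> F" using False tt_edge2[OF add.hyps(1), of p q] add.hyps(4) by blast
    hence "{p, q} = {x, a} \<or> {p, q} = {x, b}" using add.prems by blast
    then obtain w where w: "{p, q} = {x, w}" "w \<in> {a, b}" by blast
    have "\<exists>u\<in>S. u \<notin> {a, b} \<and> card (N F u) = 2 \<or> S = {a, b}"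
    proof (cases "card S \<ge> 3")
      case True
      thus ?thesis using add.IH[OF True add.hyps(2)] unfolding simp2_def by auto
    next
      case False
      hence "card S = 2" using tt_card[OF add.hyps(1)] by simp
      moreover have "{a, b} \<subseteq> S" using ab by simp
      ultimately have "S = {a, b}" using ab tt_fin[OF add.hyps(1)] by (intro card_subset_eq[symmetric]) auto
      thus ?thesis using ab by auto
    qed
    then obtain u where u: "u \<in> S" "u \<notin> {a, b} \<and> card (N F u) = 2 \<or> S = {a, b}" by blast
    show ?thesis
    proof (cases "S = {a, b}")
      case False
      hence "N ?F u = N F u" using N_add_old[OF add.hyps(1,4) _ _ u(1), of a b] ab u by simp
      hence "u \<in> simp2 (insert x S) ?F" using u False unfolding simp2_def by simp
      moreover have "u \<noteq> x" "u \<noteq> w" using u w add.hyps(4) False by auto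
      ultimately show ?thesis using w(1) by (metis doubleton_eq_iff)
    next
      case True
      define u' where "u' = (if w = a then b else a)"
      have u': "u' \<in> S" "u' \<noteq> w" "{a, b} = {u', w}" using w(2) ab unfolding u'_def by auto
      have "N F u' \<subseteq> S - {u'}" using N_S[OF add.hyps(1), of u'] unfolding N_def by auto
      hence "N F u' \<subseteq> {w}" using True u'(3) by auto
      moreover have "w \<in> N F u'" using add.hyps(2) u' unfolding mem_N u'(3) by simp
      ultimately have "N F u' = {w}" by blast
      hence "N ?F u' = {w, x}" using N_add_old[OF add.hyps(1,4) _ _ u'(1), of a b] ab u' by auto
      moreover have "w \<noteq> x" using w ab add.hyps(4) by auto
      ultimately have "u' \<in> simp2 (insert x S) ?F" using u' unfolding simp2_def by simp
      moreover have "u' \<noteq> x" using u'(1) add.hyps(4) by auto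
      ultimately show ?thesis using w(1) u'(2) by (metis doubleton_eq_iff)
    qed
  qed
qed

lemma two_simp2:
  assumes "tt S F" "card S \<ge> 4"
  obtains u v where "u \<in> simp2 S F" "v \<in> simp2 S F" "u \<noteq> v" "u \<notin> N F v"
proof -
  have "\<exists>e. e \<in> F" using assms(1) by (cases rule: tt.cases) auto
  then obtain a b where "{a, b} \<in> F" using tt_edge[OF assms(1)] by blast
  then obtain u where u: "u \<in> simp2 S F" using simp2_avoid[OF assms(1)] assms(2) by fastforce
  obtain p q where "N F u = {p, q}" using simp2_N[OF u] by blast
  hence "p \<in> N F u" by simp
  hence "{u, p} \<in> F" unfolding mem_N by simp
  then obtain v where v: "v \<in> simp2 S F" "v \<noteq> u" using simp2_avoid[OF assms(1)] assms(2) by fastforce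
  show thesis using that[OF u v(1)] v(2) simp2_nonadj[OF assms u v(1)] by auto
qed

text \<open>The deleted vertices are pairwise nonadjacent, so removing one of them does not affect
  the degrees of the others.\<close>

lemma tt_del_set:
  assumes "tt S F" "X \<subseteq> simp2 S F" "card (S - X) \<ge> 3"
  shows "tt (S - X) (rs F (S - X))"
proof -
  have "finite X" using assms tt_fin[OF assms(1)] unfolding simp2_def by (metis (no_types, lifting) finite_subset mem_Collect_eq subsetI subset_trans)
  thus ?thesis using assms
  proof (induction X arbitrary: S F rule: finite_induct)
    case empty thus ?case using rs_self[OF empty.prems(1)] by simp
  next
    case (insert x X)
    let ?S = "S - {x}" and ?F = "rs F (S - {x})"
    have x: "x \<in> simp2 S F" "x \<in> S" using insert.prems unfolding simp2_def by auto
    have fin: "finite S" using tt_fin insert.prems by blast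
    have eq: "S - insert x X = ?S - X" by blast
    have "card (S - insert x X) \<le> card ?S" using fin by (intro card_mono) auto
    hence c4: "card S \<ge> 4" using insert.prems x(2) fin by simp
    have t: "tt ?S ?F" using tt_del_simp2[OF insert.prems(1) x(1)] .
    have "X \<subseteq> simp2 ?S ?F"
    proof
      fix y assume y: "y \<in> X"
      have ys: "y \<in> simp2 S F" "y \<noteq> x" using y insert by auto
      have "x \<notin> N F y" using simp2_nonadj[OF insert.prems(1) c4 x(1) ys(1)] .
      moreover have yS: "y \<in> ?S" using ys unfolding simp2_def by auto
      ultimately have "N ?F y = N F y" using N_rs[OF yS, of F] N_S[OF insert.prems(1), of y] by auto
      thus "y \<in> simp2 ?S ?F" using ys yS unfolding simp2_def by simp
    qed
    hence "tt (?S - X) (rs ?F (?S - X))" using insert.IH[OF t] insert.prems(3) unfolding eq by simp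
    moreover have "rs ?F (?S - X) = rs F (?S - X)" unfolding rs_rs by (simp add: Int_absorb1 Diff_subset)
    ultimately show ?case unfolding eq by simp
  qed
qed

text \<open>The vertices of the second 2-tree are peeled off and added back to the union;
  \<open>simp2_avoid\<close> supplies one that is not on the common edge.\<close>

lemma tt_glue:
  "tt S2 F2 \<Longrightarrow> tt S1 F1 \<Longrightarrow> S1 \<inter> S2 = {a, b} \<Longrightarrow> {a, b} \<in> F1 \<Longrightarrow> {a, b} \<in> F2 \<Longrightarrow> tt (S1 \<union> S2) (F1 \<union> F2)"
proof (induction "card S2" arbitrary: S2 F2 rule: less_induct)
  case less
  note ab = tt_edge2[OF less.prems(1,5)]
  have fin: "finite S2" using tt_fin less by blast
  show ?case
  proof (cases "card S2 \<ge> 3")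
    case False
    hence "card S2 = 2" using tt_card[OF less.prems(1)] by simp
    moreover have "{a, b} \<subseteq> S2" using ab by simp
    ultimately have S: "S2 = {a, b}" using ab fin by (intro card_subset_eq[symmetric]) auto
    have "e = {a, b}" if "e \<in> F2" for e using tt_edge[OF less.prems(1) that] S by (auto simp: doubleton_eq_iff)
    hence "F1 \<union> F2 = F1" using less.prems(4) by auto
    moreover have "S1 \<union> S2 = S1" using S less.prems(3) by auto
    ultimately show ?thesis using less.prems(2) by simp
  next
    case True
    obtain v where v: "v \<in> simp2 S2 F2" "v \<noteq> a" "v \<noteq> b" using simp2_avoid[OF less.prems(1) True less.prems(5)] by blast
    obtain p q where pq: "N F2 v = {p, q}" "p \<noteq> q" using simp2_N[OF v(1)] by blast
    have vS: "v \<in> S2" using v unfolding simp2_def by simp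
    let ?S = "S2 - {v}" and ?F = "rs F2 (S2 - {v})"
    have d: "tt ?S ?F" "{p, q} \<in> F2" using tt_del[OF less.prems(1) vS pq] by auto
    have pqS: "p \<in> ?S" "q \<in> ?S" using N_S[OF less.prems(1), of v] pq unfolding N_def by auto
    have "card ?S < card S2" by (rule card_Diff1_less[OF fin vS])
    moreover have "S1 \<inter> ?S = {a, b}" using less.prems(3) v by auto
    moreover have "{a, b} \<in> ?F" using less.prems(5) ab v unfolding rs_def by auto
    ultimately have t: "tt (S1 \<union> ?S) (F1 \<union> ?F)" using less.hyps[of ?S ?F] d(1) less.prems by blast
    have "v \<notin> S1" using v vS less.prems(3) by blast
    moreover have "{p, q} \<in> F1 \<union> ?F" using d(2) pqS unfolding rs_def by auto
    ultimately have "tt (insert v (S1 \<union> ?S)) (insert {v, p} (insert {v, q} (F1 \<union> ?F)))"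
      using tt.add[OF t _ pq(2)] by auto
    moreover have "insert v (S1 \<union> ?S) = S1 \<union> S2" using vS by auto
    moreover have "insert {v, p} (insert {v, q} (F1 \<union> ?F)) = F1 \<union> F2"
    proof -
      have vpq: "{v, p} \<in> F2" "{v, q} \<in> F2" using pq(1) unfolding N_def by auto
      have "e \<in> ?F \<or> e = {v, p} \<or> e = {v, q}" if e: "e \<in> F2" for e
      proof (cases "v \<in> e")
        case False
        thus ?thesis using e tt_edge_sub[OF less.prems(1) e] unfolding rs_def by auto
      next
        case True
        obtain u where "e = {v, u}" "u \<noteq> v" using tt_edge[OF less.prems(1) e] True by auto
        hence "u \<in> N F2 v" using e unfolding mem_N by simp
        thus ?thesis using pq \<open>e = {v, u}\<close> by auto
      qed
      thus ?thesis using vpq rs_sub[of F2 ?S] by auto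
    qed
    ultimately show ?thesis by simp
  qed
qed

text \<open>Peel in layers: \<open>s0\<close> are the vertices of degree two, \<open>s1\<close>
  those that appear once \<open>s0\<close> is gone, and \<open>b1\<close>, \<open>b2\<close> two
  nonadjacent ones once \<open>s1\<close> is gone as well. Let \<open>D b\<close> be the vertices of
  \<open>s0\<close> that hang on \<open>b\<close> directly or through \<open>s1\<close>. These sets
  are disjoint for \<open>b1\<close> and \<open>b2\<close>, so with at most three vertices in
  \<open>s0\<close> one of them is a singleton \<open>{x}\<close>; then \<open>x\<close>, its
  neighbour \<open>y\<close> in \<open>s1\<close>, and \<open>b\<close> become deletable in this
  order. The bound 10 leaves 10 - 3 - 3 = 4 vertices in the last layer, as \<open>two_simp2\<close>
  requires.\<close>

lemma star_or_end:
  assumes t: "tt S F" and n: "card S \<ge> 10"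
  shows "card (simp2 S F) \<ge> 4 \<or> (\<exists>x y b. x \<in> simp2 S F \<and> y \<in> N F x \<and> y \<in> simp2 (S - {x}) (rs F (S - {x})) \<and>
    b \<in> N F y \<and> b \<noteq> x \<and> b \<in> simp2 (S - {x} - {y}) (rs F (S - {x} - {y})))"
proof (cases "card (simp2 S F) \<ge> 4")
  case False
  define s0 where "s0 = simp2 S F"
  have fin: "finite S" using tt_fin[OF t] .
  have s0: "s0 \<subseteq> S" "card s0 \<le> 3" "finite s0" using False fin unfolding s0_def simp2_def by (auto intro: finite_subset)
  define S1 F1 where "S1 = S - s0" and "F1 = rs F S1"
  have c1: "card S1 \<ge> 7" using n s0 unfolding S1_def by (simp add: card_Diff_subset)
  have t1: "tt S1 F1" unfolding F1_def S1_def by (rule tt_del_set[OF t]) (use c1 in \<open>auto simp: s0_def S1_def\<close>)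
  have N1: "N F1 v = N F v - s0" if "v \<in> S1" for v
    using N_rs[OF that, of F] N_S[OF t, of v] unfolding F1_def S1_def by auto
  define s1 where "s1 = simp2 S1 F1"
  have down1: "\<exists>x\<in>s0. x \<in> N F y" if "y \<in> s1" for y
  proof (rule ccontr)
    assume "\<not> ?thesis"
    hence "N F y \<inter> s0 = {}" by auto
    moreover have y: "y \<in> S1" "card (N F1 y) = 2" using that unfolding s1_def simp2_def by auto
    ultimately have "card (N F y) = 2" using N1 by (metis Diff_triv)
    hence "y \<in> s0" using y unfolding s0_def simp2_def S1_def by simp
    thus False using y unfolding S1_def by simp
  qed
  \<comment> \<open>The two neighbours of \<open>x\<close> are adjacent, but vertices of
    \<open>s1\<close> are not, so each \<open>x\<close> hangs on at most one vertex of
    \<open>s1\<close>. Hence \<open>s1\<close> is no larger than \<open>s0\<close>.\<close>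
  have uniq1: "y = y'" if "y \<in> s1" "y' \<in> s1" "x \<in> s0" "x \<in> N F y" "x \<in> N F y'" for x y y'
  proof (rule ccontr)
    assume ne: "y \<noteq> y'"
    note prem = that
    obtain p q where pq: "N F x = {p, q}" "p \<noteq> q" using simp2_N prem(3) unfolding s0_def by metis
    have yN: "y \<in> N F x" "y' \<in> N F x" using that N_sym by metis+
    hence "{y, y'} = {p, q}" using pq ne by auto
    moreover have "x \<in> S" using that s0 by auto
    ultimately have "{y, y'} \<in> F" using tt_del[OF t _ pq] by auto
    hence "y \<in> N F1 y'" using that ne unfolding F1_def rs_def N_def s1_def simp2_def by (auto simp: insert_commute)
    thus False using simp2_nonadj[OF t1 _ that(1)[unfolded s1_def] that(2)[unfolded s1_def]] c1 by simp
  qed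
  define S2 F2 where "S2 = S1 - s1" and "F2 = rs F1 S2"
  have s1: "s1 \<subseteq> S1" "finite s1" using tt_fin[OF t1] unfolding s1_def simp2_def by auto
  have cs1: "card s1 \<le> 3"
  proof -
    define f where "f y = (SOME x. x \<in> s0 \<and> x \<in> N F y)" for y
    have f: "f y \<in> s0 \<and> f y \<in> N F y" if "y \<in> s1" for y
      unfolding f_def by (rule someI_ex) (use down1[OF that] in blast)
    have "inj_on f s1" using f uniq1 by (intro inj_onI) metis
    hence "card s1 \<le> card s0" using f s0 by (intro card_inj_on_le[of f]) auto
    thus ?thesis using s0 by simp
  qed
  have c2: "card S2 \<ge> 4" using c1 cs1 s1 unfolding S2_def by (simp add: card_Diff_subset)
  have t2: "tt S2 F2" unfolding F2_def S2_def by (rule tt_del_set[OF t1]) (use c2 in \<open>auto simp: s1_def S2_def\<close>)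
  have N2: "N F2 v = N F v - s0 - s1" if "v \<in> S2" for v
    using N_rs[OF that, of F1] N1[of v] N_S[OF t1, of v] that unfolding F2_def S2_def by auto
  have down2: "\<exists>y\<in>s1. y \<in> N F b" if "b \<in> simp2 S2 F2" for b
  proof (rule ccontr)
    assume "\<not> ?thesis"
    hence "N F b \<inter> s1 = {}" by auto
    moreover have b: "b \<in> S2" "card (N F2 b) = 2" using that unfolding simp2_def by auto
    ultimately have "N F2 b = N F1 b" using N2[OF b(1)] N1[of b] unfolding S2_def by auto
    hence "b \<in> s1" using b unfolding s1_def simp2_def S2_def by simp
    thus False using b unfolding S2_def by simp
  qed
  define D where "D b = {x \<in> s0. x \<in> N F b \<or> (\<exists>y\<in>s1. y \<in> N F b \<and> x \<in> N F y)}" for b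
  obtain b1 b2 where b12: "b1 \<in> simp2 S2 F2" "b2 \<in> simp2 S2 F2" "b1 \<noteq> b2" "b1 \<notin> N F2 b2"
    using two_simp2[OF t2 c2] .
  have bS: "b1 \<in> S2" "b2 \<in> S2" using b12 unfolding simp2_def by auto
  have nadj: "b1 \<notin> N F b2"
    using b12(4) N2[OF bS(2)] bS unfolding S2_def S1_def by auto
  have adj: "u \<in> N F v" if "x \<in> s0" "u \<in> N F x" "v \<in> N F x" "u \<noteq> v" for x u v
  proof -
    note prem = that
    obtain p q where pq: "N F x = {p, q}" "p \<noteq> q" using simp2_N prem(1) unfolding s0_def by metis
    hence "{v, u} = {p, q}" using that by auto
    moreover have "x \<in> S" using that s0 by auto
    ultimately have "{v, u} \<in> F" using tt_del[OF t _ pq] by auto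
    thus ?thesis using that unfolding mem_N by simp
  qed
  have adj1: "u \<in> N F v" if "y \<in> s1" "u \<in> N F y" "v \<in> N F y" "u \<in> S1" "v \<in> S1" "u \<noteq> v" for y u v
  proof -
    note prem = that
    obtain p q where pq: "N F1 y = {p, q}" "p \<noteq> q" using simp2_N prem(1) unfolding s1_def by metis
    have yS: "y \<in> S1" using that s1 by auto
    hence "{v, u} = {p, q}" using that pq N1[OF yS] unfolding S1_def by auto
    hence "{v, u} \<in> F1" using tt_del[OF t1 yS pq] by simp
    thus ?thesis using that rs_sub unfolding mem_N F1_def by blast
  qed
  have yy: False if "y1 \<in> s1" "y2 \<in> s1" "y1 \<in> N F y2" for y1 y2
    using simp2_nonadj[OF t1 _ that(1)[unfolded s1_def] that(2)[unfolded s1_def]] c1 that N1[of y2] s1 unfolding S1_def by auto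
  \<comment> \<open>A common \<open>x\<close> links \<open>b\<close> and \<open>b'\<close> directly
    or through \<open>s1\<close>. Since the two neighbours of a vertex at its deletion are adjacent,
    these links collapse to an edge between \<open>b\<close> and \<open>b'\<close>.\<close>
  have key: False if "x \<in> D b" "x \<in> D b'" "b \<in> S2" "b' \<in> S2" "b \<noteq> b'" "b \<notin> N F b'" for x b b'
  proof -
    have x: "x \<in> s0" using that unfolding D_def by simp
    have bb: "b \<in> S1" "b' \<in> S1" "b \<notin> s1" "b' \<notin> s1" using that unfolding S2_def by auto
    have nb': "b' \<notin> N F b" using that N_sym by metis
    have c: "x \<in> N F b \<or> (\<exists>y\<in>s1. y \<in> N F b \<and> x \<in> N F y)" "x \<in> N F b' \<or> (\<exists>y\<in>s1. y \<in> N F b' \<and> x \<in> N F y)"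
      using that unfolding D_def by auto
    have mixed: False if "x \<in> N F u" "y \<in> s1" "y \<in> N F u'" "x \<in> N F y" "u \<in> S1" "u' \<in> S1" "u \<notin> s1" "u \<noteq> u'" "u \<notin> N F u'" for u u' y
    proof -
      have "u \<noteq> y" using that by auto
      have "u \<in> N F x" "y \<in> N F x" using that N_sym by metis+
      hence "u \<in> N F y" using adj[OF x, of u y] \<open>u \<noteq> y\<close> by simp
      moreover have "u' \<in> N F y" using that N_sym by metis
      ultimately show False using adj1[OF that(2), of u u'] that by blast
    qed
    from c(1) show False
    proof
      assume 1: "x \<in> N F b"
      from c(2) show False
      proof
        assume "x \<in> N F b'"
        hence "b \<in> N F x" "b' \<in> N F x" using 1 N_sym by metis+
        thus False using adj[OF x, of b b'] that by blast
      next
        assume "\<exists>y\<in>s1. y \<in> N F b' \<and> x \<in> N F y"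
        thus False using mixed[OF 1, of _ b'] bb that by blast
      qed
    next
      assume "\<exists>y\<in>s1. y \<in> N F b \<and> x \<in> N F y"
      then obtain y where y: "y \<in> s1" "y \<in> N F b" "x \<in> N F y" by blast
      from c(2) show False
      proof
        assume "x \<in> N F b'"
        thus False using mixed[of b' y b] y bb that nb' by auto
      next
        assume "\<exists>y\<in>s1. y \<in> N F b' \<and> x \<in> N F y"
        then obtain y' where y': "y' \<in> s1" "y' \<in> N F b'" "x \<in> N F y'" by blast
        hence "y = y'" using uniq1 y x by blast
        hence "b \<in> N F y" "b' \<in> N F y" using y y' N_sym by metis+
        thus False using adj1[OF y(1), of b b'] bb that by blast
      qed
    qed
  qed
  have "D b1 \<inter> D b2 = {}" using key[of _ b1 b2] bS b12(3) nadj by blast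
  moreover have "D b1 \<union> D b2 \<subseteq> s0" unfolding D_def by auto
  ultimately have "card (D b1) + card (D b2) \<le> card s0" using s0(3)
    by (metis card_Un_disjoint card_mono finite_Un finite_subset)
  hence "card (D b1) \<le> 1 \<or> card (D b2) \<le> 1" using s0(2) by linarith
  then obtain b where b: "b \<in> simp2 S2 F2" "card (D b) \<le> 1" using b12 by blast
  have bS2: "b \<in> S2" using b unfolding simp2_def by simp
  obtain y where y: "y \<in> s1" "y \<in> N F b" using down2[OF b(1)] by blast
  obtain x where x: "x \<in> s0" "x \<in> N F y" using down1[OF y(1)] by blast
  have xD: "x \<in> D b" using x y unfolding D_def by blast
  have finD: "finite (D b)" using s0(3) unfolding D_def by simp
  have Dx: "D b = {x}"
    using b(2) xD finD by (metis One_nat_def card_le_Suc0_iff_eq insert_absorb insertI1 is_singletonI' is_singleton_the_elem singletonD empty_iff)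
  have yS: "y \<in> S1" using y s1 by auto
  have ySx: "y \<in> S - {x}" using yS x unfolding S1_def by auto
  \<comment> \<open>As \<open>x\<close> is the only vertex in \<open>D b\<close>, deleting
    \<open>x\<close> alone leaves \<open>y\<close> with the same neighbours as deleting all of
    \<open>s0\<close>.\<close>
  have Ny: "N (rs F (S - {x})) y = N F1 y"
  proof -
    have "x' = x" if "x' \<in> N F y" "x' \<in> s0" for x'
    proof -
      have "x' \<in> D b" using that y unfolding D_def by (intro CollectI conjI disjI2 bexI[of _ y]) simp_all
      thus ?thesis using Dx by simp
    qed
    hence "z \<in> N F y \<inter> (S - {x}) \<longleftrightarrow> z \<in> N F y - s0" for z using subsetD[OF N_S[OF t, of y], of z] x(1) by (cases "z \<in> N F y") auto
    thus ?thesis unfolding N_rs[OF ySx, of F] N1[OF yS] by (rule set_eqI)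
  qed
  have y2: "y \<in> simp2 (S - {x}) (rs F (S - {x}))" using ySx y(1) Ny unfolding s1_def simp2_def by simp
  have bx: "b \<noteq> x" "b \<noteq> y" "b \<in> S" using bS2 x y unfolding S2_def S1_def by auto
  hence bSxy: "b \<in> S - {x} - {y}" by simp
  have "N (rs F (S - {x} - {y})) b = N F2 b"
  proof -
    have "x' = x" if "x' \<in> N F b" "x' \<in> s0" for x'
    proof -
      have "x' \<in> D b" using that unfolding D_def by simp
      thus ?thesis using Dx by simp
    qed
    moreover have "y' = y" if "y' \<in> N F b" "y' \<in> s1" for y'
    proof -
      note prem = that
      obtain x' where x': "x' \<in> s0" "x' \<in> N F y'" using down1[OF prem(2)] by blast
      hence "x' \<in> D b" using prem unfolding D_def by (intro CollectI conjI disjI2 bexI[of _ y']) simp_all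
      hence "x' = x" using Dx by simp
      thus ?thesis using uniq1[OF prem(2) y(1) x(1)] x x' by simp
    qed
    ultimately have "z \<in> N F b \<inter> (S - {x} - {y}) \<longleftrightarrow> z \<in> N F b - s0 - s1" for z
      using subsetD[OF N_S[OF t, of b], of z] x(1) y(1) by (cases "z \<in> N F b") auto
    thus ?thesis unfolding N_rs[OF bSxy, of F] N2[OF bS2] by (rule set_eqI)
  qed
  hence b2: "b \<in> simp2 (S - {x} - {y}) (rs F (S - {x} - {y}))" using b(1) bSxy unfolding simp2_def by simp
  have "y \<in> N F x" "b \<in> N F y" using x(2) y(2) N_sym by metis+
  thus ?thesis using x(1) y2 b2 bx unfolding s0_def by blast
qed simp

section \<open>Gluing discs along edges\<close>

text \<open>The piece on one side of the apex in the second alternative of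
  \<open>disc\<close>.\<close>

definition half :: "'a set set \<Rightarrow> 'a set \<Rightarrow> 'a set set \<Rightarrow> 'a \<Rightarrow> 'a \<Rightarrow> bool" where
  "half Z S F u w \<longleftrightarrow> Z = {{u, w}} \<and> S = {u, w} \<and> F = {{u, w}} \<or> {u, w} \<notin> Z \<and> disc (insert {u, w} Z) S F"

lemma disc_basic:
  assumes "disc Z S F"
  shows "finite S" "Z \<noteq> {}" "Z \<subseteq> F" "\<And>e. e \<in> F \<Longrightarrow> card e = 2" "\<And>e. e \<in> F \<Longrightarrow> e \<subseteq> S" "finite F"
proof -
  show 1: "finite S" "Z \<noteq> {}" "Z \<subseteq> F" "\<And>e. e \<in> F \<Longrightarrow> card e = 2" "\<And>e. e \<in> F \<Longrightarrow> e \<subseteq> S"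
    using assms by (cases rule: disc.cases, blast)+
  have "F \<subseteq> Pow S" using 1(5) by blast
  thus "finite F" using 1(1) finite_subset by blast
qed

lemma half_basic:
  assumes "half Z S F u w" "u \<noteq> w"
  shows "finite S" "Z \<subseteq> F" "\<And>e. e \<in> F \<Longrightarrow> card e = 2" "\<And>e. e \<in> F \<Longrightarrow> e \<subseteq> S" "finite F" "{u, w} \<in> F"
proof -
  have "finite S \<and> Z \<subseteq> F \<and> (\<forall>e\<in>F. card e = 2 \<and> e \<subseteq> S) \<and> finite F \<and> {u, w} \<in> F"
    using assms(1)[unfolded half_def]
  proof (elim disjE conjE)
    assume "Z = {{u, w}}" "S = {u, w}" "F = {{u, w}}"
    thus ?thesis using assms(2) by simp
  next
    assume d: "disc (insert {u, w} Z) S F"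
    note b = disc_basic[OF d]
    have "Z \<subseteq> F" "{u, w} \<in> F" using b(3) by simp_all
    thus ?thesis using b(1,4,5,6) by blast
  qed
  thus "finite S" "Z \<subseteq> F" "\<And>e. e \<in> F \<Longrightarrow> card e = 2" "\<And>e. e \<in> F \<Longrightarrow> e \<subseteq> S" "finite F" "{u, w} \<in> F" by blast+
qed

text \<open>The defining alternative at one boundary edge, arranged for case analysis. Every piece
  has fewer edges, so all inductions on discs run over \<open>card F\<close>.\<close>

lemma disc_at:
  assumes d: "disc Z S F" and e: "{u, v} \<in> Z"
  obtains (inner) w where "u \<noteq> v" "w \<in> S" "w \<notin> \<Union> Z" "{u, w} \<in> F" "{v, w} \<in> F" "w \<noteq> u" "w \<noteq> v"
      "disc (insert {u, w} (insert {v, w} (Z - {{u, v}}))) S (F - {{u, v}})" "card (F - {{u, v}}) < card F"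
    | (split) w Z1 S1 F1 Z2 S2 F2 where "u \<noteq> v" "w \<in> \<Union> Z" "w \<noteq> u" "w \<noteq> v" "{u, w} \<in> F" "{v, w} \<in> F"
      "Z = insert {u, v} (Z1 \<union> Z2)" "S = S1 \<union> S2" "S1 \<inter> S2 = {w}" "u \<in> S1" "v \<in> S2" "u \<notin> S2" "v \<notin> S1"
      "F = insert {u, v} (F1 \<union> F2)" "half Z1 S1 F1 u w" "half Z2 S2 F2 v w" "card F1 < card F" "card F2 < card F"
proof -
  note b = disc_basic[OF d]
  have uv: "{u, v} \<in> F" using e b(3) by blast
  have ne: "u \<noteq> v" using b(4)[OF uv] by (cases "u = v") simp_all
  show ?thesis
    using d
  proof (cases rule: disc.cases)
    case step
    from step(5)[OF e ne, folded half_def] show ?thesis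
    proof (elim disjE exE conjE, goal_cases)
      case (1 w)
      have "w \<noteq> u" "w \<noteq> v" using 1(2) e by blast+
      moreover have "card (F - {{u, v}}) < card F" using b(6) uv by (intro card_Diff1_less)
      ultimately show ?case using inner ne 1 by blast
    next
      case (2 w Z1 S1 F1 Z2 S2 F2)
      have w: "w \<in> S1" "w \<in> S2" using 2(8) by blast+
      have vu: "v \<notin> S1" "u \<notin> S2" using 2(2,3,8,9,10) by (metis IntI singletonD)+
      note h1 = half_basic[OF 2(12) 2(2)[symmetric]] and h2 = half_basic[OF 2(13) 2(3)[symmetric]]
      have "{u, v} \<notin> F1" "{u, v} \<notin> F2" using h1(4) h2(4) vu by blast+
      moreover have "F1 \<subseteq> F" "F2 \<subseteq> F" unfolding 2(11) by blast+
      ultimately have "F1 \<subset> F" "F2 \<subset> F" using uv by blast+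
      hence c: "card F1 < card F" "card F2 < card F" using b(6) psubset_card_mono by blast+
      show ?case by (rule split[OF ne 2(1-10) vu(2,1) 2(11-13) c])
    qed
  qed
qed

lemma half_disc_edge:
  assumes h: "half Z S F u w" and e: "e \<in> Z" "e \<noteq> {u, w}"
  shows "disc (insert {u, w} Z) S F" "{u, w} \<notin> Z"
  using h[unfolded half_def] e by blast+

text \<open>Apply the induction hypothesis to the edge \<open>wv\<close> of a smaller disc: the
  neighbour it yields differs from \<open>w\<close>, so the edge found is an old boundary edge, and
  not \<open>uv\<close>.\<close>

lemma disc_boundary_next:
  "disc Z S F \<Longrightarrow> {u, v} \<in> Z \<Longrightarrow> \<exists>x. x \<noteq> u \<and> {v, x} \<in> Z"
proof (induction "card F" arbitrary: Z S F u v rule: less_induct)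
  case less
  show ?case
  proof (cases rule: disc_at[OF less.prems])
    case (1 w)
    from less.hyps[OF 1(9,8), of w v] obtain x where x: "x \<noteq> w" "{v, x} \<in> insert {u, w} (insert {v, w} (Z - {{u, v}}))"
      by (auto simp: insert_commute)
    have "{v, x} \<noteq> {u, w}" "{v, x} \<noteq> {v, w}" using x(1) 1 by (metis doubleton_eq_iff)+
    hence "{v, x} \<in> Z" "{v, x} \<noteq> {u, v}" using x(2) by simp_all
    thus ?thesis by (metis insert_commute)
  next
    case (2 w Z1 S1 F1 Z2 S2 F2)
    show ?thesis
    proof (cases "Z2 = {{v, w}}")
      case True thus ?thesis using 2 by blast
    next
      case False
      hence d: "disc (insert {v, w} Z2) S2 F2" using 2(16) unfolding half_def by blast
      have "{w, v} \<in> insert {v, w} Z2" by (simp add: insert_commute)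
      from less.hyps[OF 2(18) d this] obtain x where x: "x \<noteq> w" "{v, x} \<in> insert {v, w} Z2" by blast
      have "{v, x} \<noteq> {v, w}" using x(1) by (metis doubleton_eq_iff)
      hence z: "{v, x} \<in> Z2" using x(2) by simp
      hence "{v, x} \<subseteq> S2" using half_basic[OF 2(16) 2(4)[symmetric]] by blast
      hence "x \<noteq> u" using 2(12) by blast
      thus ?thesis using z 2(7) by blast
    qed
  qed
qed

text \<open>The definition of \<open>disc\<close> does not mention cycles. That a boundary vertex
  has exactly two boundary edges is recovered here together with
  \<open>disc_boundary_next\<close>.\<close>

lemma disc_boundary_deg:
  "disc Z S F \<Longrightarrow> {a, z} \<in> Z \<Longrightarrow> {z, b} \<in> Z \<Longrightarrow> {z, d} \<in> Z \<Longrightarrow> a = b \<or> a = d \<or> b = d"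
proof (induction "card F" arbitrary: Z S F a z b d rule: less_induct)
  case less
  show ?case
  proof (rule ccontr)
    assume n: "\<not> (a = b \<or> a = d \<or> b = d)"
    have ne: "{z, b} \<noteq> {a, z}" "{z, d} \<noteq> {a, z}" using n by (metis doubleton_eq_iff)+
    show False
    proof (cases rule: disc_at[OF less.prems(1,2)])
      case (1 w)
      let ?Z = "insert {a, w} (insert {z, w} (Z - {{a, z}}))"
      have "{w, z} \<in> ?Z" "{z, b} \<in> ?Z" "{z, d} \<in> ?Z" using less.prems(3,4) ne by (simp_all add: insert_commute[of w z])
      from less.hyps[OF 1(9,8) this] have "w = b \<or> w = d" using n by blast
      thus False using 1(3) less.prems(3,4) by blast
    next
      case (2 w Z1 S1 F1 Z2 S2 F2)
      have "\<And>x. {z, x} \<in> Z1 \<Longrightarrow> False" using half_basic(2,4)[OF 2(15) 2(3)[symmetric]] 2(13) by blast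
      hence z2: "{z, b} \<in> Z2" "{z, d} \<in> Z2" using less.prems(3,4) ne 2(7) by blast+
      have "b \<noteq> w \<or> d \<noteq> w" using n by blast
      hence "{z, b} \<noteq> {z, w} \<or> {z, d} \<noteq> {z, w}" by (metis doubleton_eq_iff)
      hence dz: "disc (insert {z, w} Z2) S2 F2" "{z, w} \<notin> Z2" using half_disc_edge[OF 2(16)] z2 by blast+
      have "{w, z} \<in> insert {z, w} Z2" "{z, b} \<in> insert {z, w} Z2" "{z, d} \<in> insert {z, w} Z2"
        using z2 by (simp_all add: insert_commute[of w z])
      from less.hyps[OF 2(18) dz(1) this] have "w = b \<or> w = d" using n by blast
      thus False using z2 dz(2) by blast
    qed
  qed
qed

text \<open>At some stage an inner vertex is the apex over an edge \<open>uv\<close>, which gives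
  two neighbours; the triangle on the other side of its edge to \<open>u\<close> has a third
  corner.\<close>

lemma disc_inner_deg:
  "disc Z S F \<Longrightarrow> z \<in> S \<Longrightarrow> z \<notin> \<Union> Z \<Longrightarrow> \<exists>a b d. a \<noteq> b \<and> a \<noteq> d \<and> b \<noteq> d \<and> {z, a} \<in> F \<and> {z, b} \<in> F \<and> {z, d} \<in> F"
proof (induction "card F" arbitrary: Z S F rule: less_induct)
  case less
  obtain e where e: "e \<in> Z" using disc_basic(2)[OF less.prems(1)] by blast
  have "card e = 2" using disc_basic(3,4)[OF less.prems(1)] e by blast
  then obtain u v where uv: "{u, v} \<in> Z" using e by (metis card_2_iff)
  show ?case
  proof (cases rule: disc_at[OF less.prems(1) uv])
    case (1 w)
    show ?thesis
    proof (cases "z = w")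
      case False
      have "z \<notin> \<Union> (insert {u, w} (insert {v, w} (Z - {{u, v}})))" using False less.prems(3) uv by blast
      from less.hyps[OF 1(9,8) less.prems(2) this] show ?thesis by blast
    next
      case True
      show ?thesis
      proof (cases rule: disc_at[OF 1(8), of u w])
        case (2 w')
        \<comment> \<open>\<open>uw'\<close> is still an edge after the removal of
          \<open>uv\<close>.\<close>
        have "w' \<noteq> v" using 2(4) by blast
        moreover have "{z, w'} \<in> F" "{z, u} \<in> F" "{z, v} \<in> F" using 2(5) 1(4,5) True by (simp_all add: insert_commute)
        ultimately show ?thesis using 1(1) 2(6) by blast
      next
        case (3 w' Z1 S1 F1 Z2 S2 F2)
        have "w' \<noteq> v" using 3(5) by blast
        moreover have "{z, w'} \<in> F" "{z, u} \<in> F" "{z, v} \<in> F" using 3(6) 1(4,5) True by (simp_all add: insert_commute)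
        ultimately show ?thesis using 1(1) 3(3) by blast
      qed simp
    qed
  next
    case (2 w Z1 S1 F1 Z2 S2 F2)
    have zz: "z \<notin> \<Union> Z1" "z \<notin> \<Union> Z2" "z \<noteq> w" "z \<noteq> u" "z \<noteq> v" using less.prems(3) 2(2,7) by blast+
    from less.prems(2) 2(8) consider "z \<in> S1" | "z \<in> S2" by blast
    thus ?thesis
    proof cases
      case 1
      have d: "disc (insert {u, w} Z1) S1 F1" using 2(15) 1 zz unfolding half_def by blast
      have "z \<notin> \<Union> (insert {u, w} Z1)" using zz by blast
      from less.hyps[OF 2(17) d 1 this] show ?thesis unfolding 2(14) by blast
    next
      case b: 2
      have d: "disc (insert {v, w} Z2) S2 F2" using 2(16) b zz unfolding half_def by blast
      have "z \<notin> \<Union> (insert {v, w} Z2)" using zz by blast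
      from less.hyps[OF 2(18) d b this] show ?thesis unfolding 2(14) by blast
    qed
  qed
qed

text \<open>The triangles around \<open>c\<close> are removed one by one from the side of
  \<open>x\<close>, each inner apex taking over the role of \<open>x\<close>. As \<open>c\<close>
  has no boundary neighbours besides \<open>b\<close> and \<open>x\<close>, this fan can only end at
  \<open>b\<close>, where the split leaves the bare edge \<open>cb\<close> and the part without
  \<open>c\<close>.\<close>

lemma disc_delete:
  "disc Z S F \<Longrightarrow> {b, c} \<in> Z \<Longrightarrow> {c, x} \<in> Z \<Longrightarrow> b \<noteq> x \<Longrightarrow>
   (\<And>z. z \<in> \<Union> Z \<Longrightarrow> z \<noteq> b \<Longrightarrow> z \<noteq> x \<Longrightarrow> {c, z} \<notin> F) \<Longrightarrow>
   S = {b, c, x} \<or> (\<exists>Z' F'. disc Z' (S - {c}) F' \<and> Z - {{b, c}, {c, x}} \<subseteq> Z' \<and> F' \<subseteq> F)"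
proof (induction "card F" arbitrary: Z S F x rule: less_induct)
  case less
  note bas = disc_basic[OF less.prems(1)]
  show ?case
  proof (cases rule: disc_at[OF less.prems(1,3)])
    case (1 w)
    let ?Z = "insert {c, w} (insert {x, w} (Z - {{c, x}}))"
    have wb: "b \<noteq> w" using 1(3) less.prems(2) by blast
    have "{b, c} \<noteq> {c, x}" using less.prems(4) by (metis doubleton_eq_iff)
    hence bc: "{b, c} \<in> ?Z" using less.prems(2) by simp
    have nz: "{c, z} \<notin> F - {{c, x}}" if z: "z \<in> \<Union> ?Z" "z \<noteq> b" "z \<noteq> w" for z
    proof (cases "z = x")
      case False
      have "z \<in> \<Union> Z" using z less.prems(3) by blast
      thus ?thesis using less.prems(5) z False by blast
    qed simp
    have "S \<noteq> {b, c, w}"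
    proof
      assume "S = {b, c, w}"
      moreover have "x \<in> S" using bas(3,5) less.prems(3) by blast
      ultimately show False using 1(1,7) less.prems(4) by blast
    qed
    then obtain Z' F' where *: "disc Z' (S - {c}) F'" "?Z - {{b, c}, {c, w}} \<subseteq> Z'" "F' \<subseteq> F - {{c, x}}"
      using less.hyps[OF 1(9,8) bc insertI1 wb nz] by blast
    have "{c, w} \<notin> Z" using 1(3) by blast
    hence "Z - {{b, c}, {c, x}} \<subseteq> Z'" using *(2) by blast
    thus ?thesis using *(1,3) by blast
  next
    case (2 w Z1 S1 F1 Z2 S2 F2)
    have wb: "w = b" using less.prems(5)[OF 2(2)] 2(4,5) by blast
    note h1 = half_basic[OF 2(15) 2(3)[symmetric]] and h2 = half_basic[OF 2(16) 2(4)[symmetric]]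
    have "{b, c} \<in> insert {c, x} (Z1 \<union> Z2)" using less.prems(2) 2(7) by simp
    moreover have "{b, c} \<notin> Z2" using h2(2,4) 2(12) by blast
    moreover have "{b, c} \<noteq> {c, x}" using less.prems(4) by (metis doubleton_eq_iff)
    ultimately have "{c, b} \<in> Z1" by (metis insertE Un_iff insert_commute)
    hence t: "Z1 = {{c, b}}" "S1 = {c, b}" using 2(15) wb unfolding half_def by blast+
    show ?thesis
    proof (cases "S2 = {x, w}")
      case True thus ?thesis using t 2(8) wb by blast
    next
      case False
      hence d: "disc (insert {x, w} Z2) S2 F2" using 2(16) unfolding half_def by blast
      have S: "S - {c} = S2" unfolding 2(8) t(2) using 2(9,12) wb by blast
      have "Z - {{b, c}, {c, x}} \<subseteq> insert {x, w} Z2"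
      proof
        fix e assume e: "e \<in> Z - {{b, c}, {c, x}}"
        hence "e \<noteq> {c, b}" by (metis DiffD2 insertI1 insert_commute)
        thus "e \<in> insert {x, w} Z2" using e 2(7) t(1) by blast
      qed
      moreover have "F2 \<subseteq> F" using 2(14) by blast
      ultimately show ?thesis using d S by metis
    qed
  qed
qed

text \<open>\<open>Z\<close> are the edges on which more may be glued. The common edge
  \<open>uv\<close> stays in \<open>Z\<close>, so three or more pieces may share an edge and the
  result need not be a disc; by \<open>tt_pd\<close> every 2-tree arises with all its edges still
  available.\<close>

inductive pd :: "'a set set \<Rightarrow> 'a set \<Rightarrow> 'a set set \<Rightarrow> bool" where
  disc: "disc Z S F \<Longrightarrow> pd Z S F"
| edge: "a \<noteq> b \<Longrightarrow> pd {{a, b}} {a, b} {{a, b}}"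
| glue: "pd Z1 S1 F1 \<Longrightarrow> pd Z2 S2 F2 \<Longrightarrow> S1 \<inter> S2 = {u, v} \<Longrightarrow> u \<noteq> v \<Longrightarrow> {u, v} \<in> Z1 \<Longrightarrow> {u, v} \<in> Z2 \<Longrightarrow>
    pd (Z1 \<union> Z2) (S1 \<union> S2) (F1 \<union> F2)"

lemma pd_basic: "pd Z S F \<Longrightarrow> finite S \<and> Z \<subseteq> F \<and> (\<forall>e\<in>F. card e = 2 \<and> e \<subseteq> S)"
proof (induction rule: pd.induct)
  case (disc Z S F)
  show ?case using disc_basic(1,3,4,5)[OF disc] by (intro conjI ballI) assumption+
next
  case (glue Z1 S1 F1 Z2 S2 F2 u v)
  have "Z1 \<union> Z2 \<subseteq> F1 \<union> F2" using glue.IH by (intro Un_mono) simp_all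
  moreover have "card e = 2 \<and> e \<subseteq> S1 \<union> S2" if "e \<in> F1 \<union> F2" for e
    using that
  proof
    assume "e \<in> F1"
    hence "card e = 2" "e \<subseteq> S1" using glue.IH(1) by simp_all
    thus ?thesis by (simp add: le_supI1)
  next
    assume "e \<in> F2"
    hence "card e = 2" "e \<subseteq> S2" using glue.IH(2) by simp_all
    thus ?thesis by (simp add: le_supI2)
  qed
  ultimately show ?case using glue.IH by simp
qed simp

lemma pd_finite: "pd Z S F \<Longrightarrow> finite S" by (drule pd_basic) (elim conjE)
lemma pd_sub: "pd Z S F \<Longrightarrow> Z \<subseteq> F" by (drule pd_basic) (elim conjE)
lemma pd_edge_sub: "pd Z S F \<Longrightarrow> e \<in> F \<Longrightarrow> e \<subseteq> S" by (drule pd_basic) (elim conjE, drule (1) bspec, elim conjE)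

lemma disc_tri:
  assumes "a \<noteq> b" "b \<noteq> c" "a \<noteq> c"
  shows "disc {{a, b}, {b, c}, {a, c}} {a, b, c} {{a, b}, {b, c}, {a, c}}"
proof (rule disc.step)
  fix u v assume uv: "{u, v} \<in> {{a, b}, {b, c}, {a, c}}" "u \<noteq> v"
  obtain w where w: "w \<noteq> u" "w \<noteq> v" "{u, v, w} = {a, b, c}" "{{u, v}, {v, w}, {u, w}} = {{a, b}, {b, c}, {a, c}}"
  proof -
    from uv(1) consider "u = a" "v = b" | "u = b" "v = a" | "u = b" "v = c" | "u = c" "v = b" | "u = a" "v = c" | "u = c" "v = a"
      by (auto simp: doubleton_eq_iff)
    thus ?thesis
    proof cases
      case 1 thus ?thesis using that[of c] assms by blast
    next
      case 2 thus ?thesis using that[of c] assms by (auto simp: insert_commute)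
    next
      case 3 thus ?thesis using that[of a] assms by (auto simp: insert_commute)
    next
      case 4 thus ?thesis using that[of a] assms by (auto simp: insert_commute)
    next
      case 5 thus ?thesis using that[of b] assms by (auto simp: insert_commute)
    next
      case 6 thus ?thesis using that[of b] assms by (auto simp: insert_commute)
    qed
  qed
  have "{u, w} \<in> {{u, v}, {v, w}, {u, w}}" "{v, w} \<in> {{u, v}, {v, w}, {u, w}}" by simp_all
  moreover have "{{u, v}, {v, w}, {u, w}} = insert {u, v} ({{u, w}} \<union> {{v, w}})" by blast
  moreover have "{u, v, w} = {u, w} \<union> {v, w}" by blast
  moreover have "{u, w} \<inter> {v, w} = {w}" using w uv(2) by blast
  moreover have "w \<in> \<Union> {{u, v}, {v, w}, {u, w}}" by blast
  ultimately show "(\<exists>w. w \<in> {a, b, c} \<and> w \<notin> \<Union> {{a, b}, {b, c}, {a, c}} \<and> {u, w} \<in> {{a, b}, {b, c}, {a, c}} \<and> {v, w} \<in> {{a, b}, {b, c}, {a, c}} \<and>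
          disc (insert {u, w} (insert {v, w} ({{a, b}, {b, c}, {a, c}} - {{u, v}}))) {a, b, c} ({{a, b}, {b, c}, {a, c}} - {{u, v}})) \<or>
      (\<exists>w Z1 S1 F1 Z2 S2 F2. w \<in> \<Union> {{a, b}, {b, c}, {a, c}} \<and> w \<noteq> u \<and> w \<noteq> v \<and> {u, w} \<in> {{a, b}, {b, c}, {a, c}} \<and> {v, w} \<in> {{a, b}, {b, c}, {a, c}} \<and>
          {{a, b}, {b, c}, {a, c}} = insert {u, v} (Z1 \<union> Z2) \<and> {a, b, c} = S1 \<union> S2 \<and> S1 \<inter> S2 = {w} \<and> u \<in> S1 \<and> v \<in> S2 \<and> {{a, b}, {b, c}, {a, c}} = insert {u, v} (F1 \<union> F2) \<and>
          (Z1 = {{u, w}} \<and> S1 = {u, w} \<and> F1 = {{u, w}} \<or> {u, w} \<notin> Z1 \<and> disc (insert {u, w} Z1) S1 F1) \<and>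
          (Z2 = {{v, w}} \<and> S2 = {v, w} \<and> F2 = {{v, w}} \<or> {v, w} \<notin> Z2 \<and> disc (insert {v, w} Z2) S2 F2))"
    unfolding w(3)[symmetric] w(4)[symmetric] using w(1,2)
    by (intro disjI2 exI[of _ w] exI[of _ "{{u, w}}"] exI[of _ "{u, w}"] exI[of _ "{{v, w}}"] exI[of _ "{v, w}"] conjI disjI1 refl insertI1) assumption+
qed (use assms in auto)

lemma pd_tri:
  assumes "a \<noteq> b" "b \<noteq> c" "a \<noteq> c"
  shows "pd {{a, b}, {b, c}, {a, c}} {a, b, c} {{a, b}, {b, c}, {a, c}}"
  by (rule pd.disc[OF disc_tri[OF assms]])

lemma tt_tri:
  assumes "a \<noteq> b" "b \<noteq> c" "a \<noteq> c"
  shows "tt {a, b, c} {{a, b}, {b, c}, {a, c}}"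
proof -
  have "tt (insert c {a, b}) (insert {c, a} (insert {c, b} {{a, b}}))"
    by (rule tt.add[OF tt.base]) (use assms in auto)
  moreover have "insert c {a, b} = {a, b, c}" by blast
  moreover have "insert {c, a} (insert {c, b} {{a, b}}) = {{a, b}, {b, c}, {a, c}}" by (auto simp: insert_commute)
  ultimately show ?thesis by metis
qed

lemma pd_ear:
  assumes p: "pd Z S F" and e: "{a, b} \<in> Z" "a \<noteq> b" and x: "x \<notin> S"
  shows "pd (insert {x, a} (insert {x, b} Z)) (insert x S) (insert {x, a} (insert {x, b} F))"
proof -
  have ab: "a \<in> S" "b \<in> S" "Z \<subseteq> F" "{a, b} \<in> F" using pd_basic[OF p] e by blast+
  have xa: "x \<noteq> a" "x \<noteq> b" using ab x by blast+
  have t: "pd {{a, b}, {b, x}, {a, x}} {a, b, x} {{a, b}, {b, x}, {a, x}}" by (rule pd_tri) (use e xa in auto)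
  have "S \<inter> {a, b, x} = {a, b}" using ab x by blast
  from pd.glue[OF p t this e(2,1)]
  have "pd (Z \<union> {{a, b}, {b, x}, {a, x}}) (S \<union> {a, b, x}) (F \<union> {{a, b}, {b, x}, {a, x}})" by blast
  moreover have "Z \<union> {{a, b}, {b, x}, {a, x}} = insert {x, a} (insert {x, b} Z)" using e(1) insert_commute[of x a] insert_commute[of x b] by auto
  moreover have "F \<union> {{a, b}, {b, x}, {a, x}} = insert {x, a} (insert {x, b} F)" using ab(4) insert_commute[of x a] insert_commute[of x b] by auto
  moreover have "S \<union> {a, b, x} = insert x S" using ab by blast
  ultimately show ?thesis by metis
qed

lemma tt_pd: "tt S F \<Longrightarrow> pd F S F"
proof (induction rule: tt.induct)
  case (base a b) thus ?case by (rule pd.edge)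
next
  case (add S F a b x) show ?case by (rule pd_ear[OF add.IH add.hyps(2,3,4)])
qed

section \<open>Spanning 2-tree or four deletable vertices: the dichotomy under gluing\<close>

definition span2 :: "'a set set \<Rightarrow> 'a set \<Rightarrow> 'a set set \<Rightarrow> bool" where
  "span2 Y S F \<longleftrightarrow> (\<exists>F'\<subseteq>F. tt S F' \<and> Y \<subseteq> F')"

text \<open>\<open>X\<close> are vertices to delete, each with two adjacent neighbours in what is
  left. An edge of \<open>Y\<close> is reserved for gluing and counts like a deleted vertex, because
  the piece glued on it can supply one. The 5 is the size at which \<open>tt_AlmS_small\<close>
  starts.\<close>

definition free4 :: "'a set set \<Rightarrow> 'a set \<Rightarrow> 'a set set \<Rightarrow> bool" where
  "free4 Y S F \<longleftrightarrow> (\<exists>X Z F'. X \<subseteq> S - \<Union> Y \<and> pd Z (S - X) F' \<and> F' \<subseteq> F \<and> Y \<subseteq> Z \<and> card X + card Y \<ge> 4 \<and>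
     card (S - X) \<ge> 5 \<and> (\<forall>x\<in>X. \<exists>a b. {a, b} \<in> Z \<and> a \<noteq> b \<and> {x, a} \<in> F \<and> {x, b} \<in> F))"

definition TB :: "'a set set \<Rightarrow> 'a set \<Rightarrow> 'a set set \<Rightarrow> bool" where
  "TB Y S F \<longleftrightarrow> span2 Y S F \<or> free4 Y S F"

lemma TB_mono:
  assumes "TB Y S F" "F \<subseteq> F'" shows "TB Y S F'"
proof -
  from assms(1)[unfolded TB_def] show ?thesis
  proof
    assume "span2 Y S F"
    thus ?thesis unfolding TB_def span2_def using assms(2) by blast
  next
    assume "free4 Y S F"
    then obtain X Z G where X: "X \<subseteq> S - \<Union> Y" "pd Z (S - X) G" "G \<subseteq> F" "Y \<subseteq> Z" "card X + card Y \<ge> 4" "card (S - X) \<ge> 5"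
      "\<forall>x\<in>X. \<exists>a b. {a, b} \<in> Z \<and> a \<noteq> b \<and> {x, a} \<in> F \<and> {x, b} \<in> F"
      unfolding free4_def by (elim exE conjE) (rule that, assumption+)
    have "\<exists>a b. {a, b} \<in> Z \<and> a \<noteq> b \<and> {x, a} \<in> F' \<and> {x, b} \<in> F'" if "x \<in> X" for x
      using bspec[OF X(7) that] assms(2) by blast
    hence "free4 Y S F'" unfolding free4_def using X(3) assms(2)
      by (intro exI[of _ X] exI[of _ Z] exI[of _ G] conjI ballI X(1,2,4,5,6)) simp_all
    thus ?thesis unfolding TB_def by simp
  qed
qed

lemma span2_glue:
  assumes "span2 (insert {a, b} Y1) S1 F1" "span2 (insert {a, b} Y2) S2 F2" "S1 \<inter> S2 = {a, b}"
  shows "span2 (insert {a, b} (Y1 \<union> Y2)) (S1 \<union> S2) (F1 \<union> F2)"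
proof -
  obtain G1 where 1: "G1 \<subseteq> F1" "tt S1 G1" "insert {a, b} Y1 \<subseteq> G1" using assms(1) unfolding span2_def by blast
  obtain G2 where 2: "G2 \<subseteq> F2" "tt S2 G2" "insert {a, b} Y2 \<subseteq> G2" using assms(2) unfolding span2_def by blast
  have "tt (S1 \<union> S2) (G1 \<union> G2)" by (rule tt_glue[OF 2(2) 1(2) assms(3)]) (use 1 2 in blast)+
  thus ?thesis unfolding span2_def using 1 2 by (intro exI[of _ "G1 \<union> G2"]) blast
qed

lemma disj_sub: "U \<subseteq> W \<Longrightarrow> A \<inter> W = {} \<Longrightarrow> A \<subseteq> S \<Longrightarrow> A \<subseteq> S - U" by blast

text \<open>The deletions of the first part carry over. In the second conclusion \<open>ab\<close>
  is no longer reserved and its credit of one is lost. It is replaced by a reserved edge of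
  \<open>Y2\<close> or, if there is none, by a deletion in the second part: a vertex of degree two
  off \<open>ab\<close> in its spanning 2-tree, or its own free vertices.\<close>

lemma free4_glue:
  assumes B: "free4 (insert {a, b} Y1) S1 F1" and T: "TB (insert {a, b} Y2) S2 F2"
    and p2: "pd Z2 S2 F2" "insert {a, b} Y2 \<subseteq> Z2" and f1: "finite S1" and Y1S: "\<And>e. e \<in> Y1 \<Longrightarrow> e \<subseteq> S1"
    and I: "S1 \<inter> S2 = {a, b}" "a \<noteq> b" and S2: "S2 \<noteq> {a, b}" and e: "{a, b} \<notin> Y1" "{a, b} \<notin> Y2"
  shows "free4 (insert {a, b} (Y1 \<union> Y2)) (S1 \<union> S2) (F1 \<union> F2)" "free4 (Y1 \<union> Y2) (S1 \<union> S2) (F1 \<union> F2)"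
proof -
  obtain X Z G where X: "X \<subseteq> S1 - \<Union> (insert {a, b} Y1)" "pd Z (S1 - X) G" "G \<subseteq> F1" "insert {a, b} Y1 \<subseteq> Z"
    "card X + card (insert {a, b} Y1) \<ge> 4" "card (S1 - X) \<ge> 5"
    "\<And>x. x \<in> X \<Longrightarrow> \<exists>a b. {a, b} \<in> Z \<and> a \<noteq> b \<and> {x, a} \<in> F1 \<and> {x, b} \<in> F1"
    using B unfolding free4_def by (elim exE conjE) (rule that, assumption+, erule bspec, assumption)
  note b2 = pd_basic[OF p2(1)]
  have XS1: "X \<subseteq> S1" using X(1) by blast
  have fin: "finite S2" "finite X" using b2 finite_subset[OF XS1 f1] by simp_all
  have Y2S: "e \<subseteq> S2" if "e \<in> Y2" for e
  proof -
    have "e \<in> Z2" using p2(2) that by (meson insertI2 subsetD)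
    hence "e \<in> F2" using b2 by (meson subsetD)
    thus ?thesis using b2 by simp
  qed
  have Y1f: "finite Y1" by (rule finite_subset[of _ "Pow S1"]) (use f1 Y1S in auto)
  have Y2f: "finite Y2" by (rule finite_subset[of _ "Pow S2"]) (use fin Y2S in auto)
  have ab: "a \<in> S1 - X" "b \<in> S1 - X" using X(1) I by blast+
  have XS2: "X \<inter> S2 = {}" using X(1) I by blast
  have "card (insert {a, b} Y1) = Suc (card Y1)" using Y1f e(1) by simp
  hence c3: "card X + card Y1 \<ge> 3" using X(5) by simp
  have dj: "Y1 \<inter> Y2 = {}"
  proof -
    have "y = {a, b}" if "y \<in> Y1" "y \<in> Y2" for y
    proof -
      have "y \<subseteq> S1 \<inter> S2" using Y1S[OF that(1)] Y2S[OF that(2)] by (rule Int_greatest)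
      hence yab: "y \<subseteq> {a, b}" unfolding I(1) .
      have "y \<in> F2" using p2(2) b2 that(2) by blast
      hence "card y = card {a, b}" using b2 I(2) by simp
      thus ?thesis using card_subset_eq[OF _ yab] by simp
    qed
    thus ?thesis using e by blast
  qed
  have cY: "card (Y1 \<union> Y2) = card Y1 + card Y2" using dj Y1f Y2f card_Un_disjoint by blast
  have abZ: "{a, b} \<in> Z" "{a, b} \<in> Z2" using X(4) p2(2) by blast+
  have XY2: "X \<inter> \<Union> Y2 = {}" using XS2 Y2S by blast
  \<comment> \<open>\<open>S'\<close> is what remains of the second part after deleting
    \<open>X'\<close>. It is used with \<open>X'\<close> empty, with one vertex of degree two, and
    with the set that \<open>free4\<close> provides for the second part.\<close>
  have base: "free4 Y' (S1 \<union> S2) (F1 \<union> F2)"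
    if h: "pd Z' S' G'" "{a, b} \<in> Z'" "S' \<subseteq> S2" "{a, b} \<subseteq> S'" "X' = S2 - S'" "G' \<subseteq> F2" "Y2 \<subseteq> Z'"
      "\<And>x. x \<in> X' \<Longrightarrow> \<exists>a b. {a, b} \<in> Z' \<and> a \<noteq> b \<and> {x, a} \<in> F2 \<and> {x, b} \<in> F2"
      "Y' = insert {a, b} (Y1 \<union> Y2) \<or> Y' = Y1 \<union> Y2" "card X + card X' + card Y' \<ge> 4" "X' \<inter> \<Union> Y2 = {}"
    for Y' X' Z' S' G'
  proof -
    have fX': "finite X'" using h(5) fin by blast
    have i: "(S1 - X) \<inter> S' = {a, b}" using I(1) ab h(3,4) by blast
    have "pd (Z \<union> Z') ((S1 - X) \<union> S') (G \<union> G')" by (rule pd.glue[OF X(2) h(1) i I(2) abZ(1) h(2)])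
    moreover have eq: "(S1 - X) \<union> S' = S1 \<union> S2 - (X \<union> X')"
    proof -
      have "S1 \<inter> X' = {}" using I(1) h(4,5) by blast
      thus ?thesis using XS2 h(3,5) by blast
    qed
    ultimately have p: "pd (Z \<union> Z') (S1 \<union> S2 - (X \<union> X')) (G \<union> G')" by simp
    have "card (S1 - X) \<le> card ((S1 - X) \<union> S')" using f1 fin h(3) finite_subset by (intro card_mono) blast+
    hence c5: "card (S1 \<union> S2 - (X \<union> X')) \<ge> 5" using X(6) eq by simp
    have "X \<inter> X' = {}" using XS2 h(5) by blast
    hence "card (X \<union> X') = card X + card X'" using fin fX' card_Un_disjoint by blast
    hence c4: "card (X \<union> X') + card Y' \<ge> 4" using h(10) by simp
    have d1: "X' \<inter> S1 = {}" using I(1) h(4,5) by blast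
    have "x \<notin> \<Union> Y1" if "x \<in> X'" for x using d1 Y1S that by blast
    hence d2: "X' \<inter> \<Union> Y1 = {}" by blast
    have d3: "X' \<inter> {a, b} = {}" using h(4,5) by blast
    have d4: "X \<subseteq> S1" "X \<inter> {a, b} = {}" "X \<inter> \<Union> Y1 = {}" using X(1) by blast+
    have d5: "X' \<subseteq> S2" using h(5) by blast
    have "\<Union> Y' \<subseteq> {a, b} \<union> \<Union> Y1 \<union> \<Union> Y2" using h(9) by (elim disjE) (simp_all only:, blast+)
    moreover have "(X \<union> X') \<inter> ({a, b} \<union> \<Union> Y1 \<union> \<Union> Y2) = {}"
      unfolding Int_Un_distrib Int_Un_distrib2 d2 d3 d4(2,3) XY2 h(11) by simp
    moreover have "X \<union> X' \<subseteq> S1 \<union> S2" using d4(1) d5 by (rule Un_mono)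
    ultimately have XX: "X \<union> X' \<subseteq> S1 \<union> S2 - \<Union> Y'" by (rule disj_sub)
    have YZ: "Y' \<subseteq> Z \<union> Z'" using h(2,7,9) X(4) by blast
    have GG: "G \<union> G' \<subseteq> F1 \<union> F2" using X(3) h(6) by blast
    have at: "\<exists>a b. {a, b} \<in> Z \<union> Z' \<and> a \<noteq> b \<and> {x, a} \<in> F1 \<union> F2 \<and> {x, b} \<in> F1 \<union> F2" if x: "x \<in> X \<union> X'" for x
    proof (cases "x \<in> X")
      case True from X(7)[OF this] show ?thesis by blast
    next
      case False
      hence "x \<in> X'" using x by blast
      from h(8)[OF this] show ?thesis by blast
    qed
    show ?thesis unfolding free4_def
      by (rule exI[of _ "X \<union> X'"], rule exI[of _ "Z \<union> Z'"], rule exI[of _ "G \<union> G'"])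
        (intro conjI ballI XX p GG YZ c4 c5 at)
  qed
  have "pd Z2 S2 F2" "{a, b} \<in> Z2" "S2 \<subseteq> S2" "{a, b} \<subseteq> S2" "{} = S2 - S2" "F2 \<subseteq> F2" "Y2 \<subseteq> Z2"
    "\<And>x. x \<in> {} \<Longrightarrow> \<exists>a b. {a, b} \<in> Z2 \<and> a \<noteq> b \<and> {x, a} \<in> F2 \<and> {x, b} \<in> F2" "{} \<inter> \<Union> Y2 = {}"
    using p2 I by blast+
  note base0 = base[OF this(1-8) _ _ this(9)]
  have "card (insert {a, b} (Y1 \<union> Y2)) = Suc (card (Y1 \<union> Y2))" using Y1f Y2f e by simp
  thus "free4 (insert {a, b} (Y1 \<union> Y2)) (S1 \<union> S2) (F1 \<union> F2)" using c3 cY by (intro base0) simp_all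
  show "free4 (Y1 \<union> Y2) (S1 \<union> S2) (F1 \<union> F2)"
  proof (cases "Y2 = {}")
    case False
    hence "card Y2 \<ge> 1" using Y2f by (simp add: Suc_le_eq card_gt_0_iff)
    thus ?thesis using c3 cY by (intro base0) simp_all
  next
    case Y2e: True
    from T[unfolded TB_def] show ?thesis
    proof
      assume "span2 (insert {a, b} Y2) S2 F2"
      then obtain H where H: "H \<subseteq> F2" "tt S2 H" "{a, b} \<in> H" unfolding span2_def by blast
      have "{a, b} \<subset> S2" using I(1) S2 by blast
      hence "card {a, b} < card S2" using fin psubset_card_mono by blast
      hence "card S2 \<ge> 3" using I(2) by simp
      from simp2_avoid[OF H(2) this H(3)] obtain v where v: "v \<in> simp2 S2 H" "v \<noteq> a" "v \<noteq> b" by blast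
      obtain p q where pq: "N H v = {p, q}" "p \<noteq> q" using simp2_N[OF v(1)] by blast
      have vS: "v \<in> S2" using v(1) unfolding simp2_def by blast
      have pqe: "{v, p} \<in> H" "{v, q} \<in> H" "p \<noteq> v" "q \<noteq> v" using pq mem_N[of p H v] mem_N[of q H v] by blast+
      have t: "tt (S2 - {v}) (rs H (S2 - {v}))" by (rule tt_del_simp2[OF H(2) v(1)])
      have pqH: "{p, q} \<in> rs H (S2 - {v})" using tt_del[OF H(2) vS pq] pqe(3,4) tt_edge_sub[OF H(2), of "{p, q}"] unfolding rs_def by blast
      show ?thesis
      proof (rule base[of "rs H (S2 - {v})" "S2 - {v}" "rs H (S2 - {v})" "{v}"])
        show "pd (rs H (S2 - {v})) (S2 - {v}) (rs H (S2 - {v}))" by (rule tt_pd[OF t])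
        show "{a, b} \<in> rs H (S2 - {v})" unfolding rs_def using H(3) I v by blast
        show "{a, b} \<subseteq> S2 - {v}" using I v by blast
        show "{v} = S2 - (S2 - {v})" using vS by blast
        show "rs H (S2 - {v}) \<subseteq> F2" using rs_sub H(1) by blast
        show "\<exists>a b. {a, b} \<in> rs H (S2 - {v}) \<and> a \<noteq> b \<and> {x, a} \<in> F2 \<and> {x, b} \<in> F2" if "x \<in> {v}" for x
          using that pqH pqe pq(2) H(1) by blast
        show "4 \<le> card X + card {v} + card (Y1 \<union> Y2)" using c3 Y2e by simp
      qed (use Y2e in auto)
    next
      assume "free4 (insert {a, b} Y2) S2 F2"
      then obtain X' Z' G' where X': "X' \<subseteq> S2 - \<Union> (insert {a, b} Y2)" "pd Z' (S2 - X') G'" "G' \<subseteq> F2" "insert {a, b} Y2 \<subseteq> Z'"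
        "card X' + card (insert {a, b} Y2) \<ge> 4"
        "\<And>x. x \<in> X' \<Longrightarrow> \<exists>a b. {a, b} \<in> Z' \<and> a \<noteq> b \<and> {x, a} \<in> F2 \<and> {x, b} \<in> F2"
        unfolding free4_def by (elim exE conjE) (rule that, assumption+, erule bspec, assumption)
      show ?thesis
      proof (rule base[OF X'(2)])
        show "{a, b} \<subseteq> S2 - X'" using X'(1) I by blast
        show "X' = S2 - (S2 - X')" using X'(1) by blast
        show "4 \<le> card X + card X' + card (Y1 \<union> Y2)" using c3 X'(5) Y2e by simp
        show "Y2 \<subseteq> Z'" "{a, b} \<in> Z'" using X'(4) by blast+
        show "X' \<inter> \<Union> Y2 = {}" using Y2e by simp
      qed (use X' in auto)
    qed
  qed
qed

text \<open>Two spanning 2-trees through \<open>ab\<close> are glued to one; in all other cases one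
  part has free vertices and \<open>free4_glue\<close> applies, with the roles exchanged if
  necessary.\<close>

lemma TB_glue:
  assumes T1: "TB (insert {a, b} Y1) S1 F1" and T2: "TB (insert {a, b} Y2) S2 F2"
    and p: "pd Z1 S1 F1" "insert {a, b} Y1 \<subseteq> Z1" "pd Z2 S2 F2" "insert {a, b} Y2 \<subseteq> Z2"
    and I: "S1 \<inter> S2 = {a, b}" "a \<noteq> b" and S: "S1 \<noteq> {a, b}" "S2 \<noteq> {a, b}" and e: "{a, b} \<notin> Y1" "{a, b} \<notin> Y2"
  shows "TB (insert {a, b} (Y1 \<union> Y2)) (S1 \<union> S2) (F1 \<union> F2)" "TB (Y1 \<union> Y2) (S1 \<union> S2) (F1 \<union> F2)"
proof -
  note b1 = pd_basic[OF p(1)] and b2 = pd_basic[OF p(3)]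
  have sp: "span2 Y S F" if "span2 (insert e Y) S F" for e :: "'a set" and Y S F using that unfolding span2_def by blast
  have fin: "finite S1" "finite S2" using b1 b2 by blast+
  have YS: "e \<in> Y1 \<Longrightarrow> e \<subseteq> S1" "e \<in> Y2 \<Longrightarrow> e \<subseteq> S2" for e
    using b1 b2 subsetD[OF p(2), of e] subsetD[OF p(4), of e] by blast+
  have I': "S2 \<inter> S1 = {a, b}" using I(1) by blast
  show "TB (insert {a, b} (Y1 \<union> Y2)) (S1 \<union> S2) (F1 \<union> F2)"
  proof (cases "free4 (insert {a, b} Y1) S1 F1")
    case True thus ?thesis using free4_glue(1)[OF True T2 p(3,4) fin(1) YS(1) I S(2) e] unfolding TB_def by blast
  next
    case n1: False
    show ?thesis
    proof (cases "free4 (insert {a, b} Y2) S2 F2")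
      case True thus ?thesis using free4_glue(1)[OF True T1 p(1,2) fin(2) YS(2) I' I(2) S(1) e(2,1)]
        unfolding TB_def Un_commute[of Y2] Un_commute[of S2] Un_commute[of F2] by blast
    next
      case False thus ?thesis using n1 T1 T2 span2_glue[OF _ _ I(1)] unfolding TB_def by blast
    qed
  qed
  show "TB (Y1 \<union> Y2) (S1 \<union> S2) (F1 \<union> F2)"
  proof (cases "free4 (insert {a, b} Y1) S1 F1")
    case True thus ?thesis using free4_glue(2)[OF True T2 p(3,4) fin(1) YS(1) I S(2) e] unfolding TB_def by blast
  next
    case n1: False
    show ?thesis
    proof (cases "free4 (insert {a, b} Y2) S2 F2")
      case True thus ?thesis using free4_glue(2)[OF True T1 p(1,2) fin(2) YS(2) I' I(2) S(1) e(2,1)]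
        unfolding TB_def Un_commute[of Y2] Un_commute[of S2] Un_commute[of F2] by blast
    next
      case False thus ?thesis using n1 T1 T2 span2_glue[OF _ _ I(1)] sp unfolding TB_def by blast
    qed
  qed
qed

lemma span2_sub: "span2 Y S F \<Longrightarrow> Y' \<subseteq> Y \<Longrightarrow> F \<subseteq> F' \<Longrightarrow> span2 Y' S F'"
  unfolding span2_def by (elim exE conjE) (rule exI, intro conjI, erule (1) subset_trans, assumption, erule (1) subset_trans[rotated])

lemma disc_edge_exists:
  assumes "disc Z S F" obtains u v where "{u, v} \<in> Z"
proof -
  obtain e where e: "e \<in> Z" using disc_basic(2)[OF assms] by blast
  have "card e = 2" using disc_basic(3,4)[OF assms] e by blast
  thus ?thesis using e that by (metis card_2_iff)
qed

lemma span2_tri: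
  assumes "a \<noteq> b" "b \<noteq> c" "a \<noteq> c" "Y \<subseteq> {{a, b}, {b, c}, {a, c}}"
  shows "span2 Y {a, b, c} {{a, b}, {b, c}, {a, c}}"
  unfolding span2_def using tt_tri[OF assms(1-3)] assms(4) by blast

text \<open>Without inner vertices every apex lies on the boundary, so the disc is assembled from
  triangles along common edges and no edge is ever dropped.\<close>

lemma disc_span:
  "disc Z S F \<Longrightarrow> S = \<Union> Z \<Longrightarrow> span2 Z S F"
proof (induction "card F" arbitrary: Z S F rule: less_induct)
  case less
  obtain u v where uv: "{u, v} \<in> Z" using disc_edge_exists[OF less.prems(1)] .
  show ?case
  proof (cases rule: disc_at[OF less.prems(1) uv])
    case (1 w) thus ?thesis using less.prems(2) by blast
  next
    case (2 w Z1 S1 F1 Z2 S2 F2)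
    note h1 = half_basic[OF 2(15) 2(3)[symmetric]] and h2 = half_basic[OF 2(16) 2(4)[symmetric]]
    have wS: "w \<in> S1" "w \<in> S2" using 2(9) by blast+
    have U1: "\<Union> Z1 \<subseteq> S1" "\<Union> Z2 \<subseteq> S2" using h1(2,4) h2(2,4) by blast+
    have US: "S1 \<union> S2 = {u, v} \<union> \<Union> Z1 \<union> \<Union> Z2" using less.prems(2) 2(7,8) by auto
    have S1: "S1 = \<Union> (insert {u, w} Z1)"
    proof
      show "\<Union> (insert {u, w} Z1) \<subseteq> S1" using U1 wS 2(10) by blast
      show "S1 \<subseteq> \<Union> (insert {u, w} Z1)"
      proof
        fix t assume t: "t \<in> S1"
        hence "t \<in> {u, v} \<union> \<Union> Z1 \<union> \<Union> Z2" "t \<noteq> v" using US 2(13) by blast+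
        moreover have "t \<in> S2 \<Longrightarrow> t = w" using t 2(9) by blast
        ultimately show "t \<in> \<Union> (insert {u, w} Z1)" using U1(2) by blast
      qed
    qed
    have S2: "S2 = \<Union> (insert {v, w} Z2)"
    proof
      show "\<Union> (insert {v, w} Z2) \<subseteq> S2" using U1 wS 2(11) by blast
      show "S2 \<subseteq> \<Union> (insert {v, w} Z2)"
      proof
        fix t assume t: "t \<in> S2"
        hence "t \<in> {u, v} \<union> \<Union> Z1 \<union> \<Union> Z2" "t \<noteq> u" using US 2(12) by blast+
        moreover have "t \<in> S1 \<Longrightarrow> t = w" using t 2(9) by blast
        ultimately show "t \<in> \<Union> (insert {v, w} Z2)" using U1(1) by blast
      qed
    qed
    have b: "span2 {{p, q}} {p, q} {{p, q}}" if "p \<noteq> q" for p q :: 'a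
      unfolding span2_def using tt.base[OF that] by blast
    have sp1: "span2 (insert {u, w} Z1) S1 F1"
    proof (cases "Z1 = {{u, w}}")
      case True
      thus ?thesis using 2(15) b[OF 2(3)[symmetric]] unfolding half_def by simp
    next
      case False
      hence "disc (insert {u, w} Z1) S1 F1" using 2(15) unfolding half_def by blast
      thus ?thesis by (rule less.hyps[OF 2(17) _ S1])
    qed
    have sp2: "span2 (insert {v, w} Z2) S2 F2"
    proof (cases "Z2 = {{v, w}}")
      case True
      thus ?thesis using 2(16) b[OF 2(4)[symmetric]] unfolding half_def by simp
    next
      case False
      hence "disc (insert {v, w} Z2) S2 F2" using 2(16) unfolding half_def by blast
      thus ?thesis by (rule less.hyps[OF 2(18) _ S2])
    qed
    let ?T = "{{u, v}, {v, w}, {u, w}}"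
    have t: "span2 (insert {u, w} {{u, v}, {v, w}}) {u, v, w} ?T"
      by (rule span2_tri) (use 2 in auto)
    have i1: "{u, v, w} \<inter> S1 = {u, w}" using 2(10,13) wS by blast
    have g: "span2 (insert {u, w} ({{u, v}, {v, w}} \<union> Z1)) ({u, v, w} \<union> S1) (?T \<union> F1)"
      by (rule span2_glue[OF t sp1 i1])
    have g': "span2 (insert {v, w} (insert {u, v} Z1)) ({u, v, w} \<union> S1) (?T \<union> F1)"
      by (rule span2_sub[OF g]) blast+
    have i2: "({u, v, w} \<union> S1) \<inter> S2 = {v, w}" using 2(9,11,12) wS by blast
    have g2: "span2 (insert {v, w} (insert {u, v} Z1 \<union> Z2)) ({u, v, w} \<union> S1 \<union> S2) (?T \<union> F1 \<union> F2)"
      by (rule span2_glue[OF g' sp2 i2])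
    have "{u, v, w} \<union> S1 \<union> S2 = S" using 2(8,10,11) wS by blast
    moreover have "?T \<union> F1 \<union> F2 \<subseteq> F" using 2(5,6) unfolding 2(14) by blast
    moreover have "Z \<subseteq> insert {v, w} (insert {u, v} Z1 \<union> Z2)" unfolding 2(7) by blast
    ultimately show ?thesis using span2_sub[OF g2, of Z F] by simp
  qed
qed

text \<open>Attaches one side piece of a split to the part \<open>SA\<close> built so far, which
  begins as the triangle at \<open>uv\<close>. If the piece is the bare edge \<open>uw\<close>,
  nothing is glued and \<open>uw\<close> may itself be reserved, which is why \<open>T0\<close>
  covers both choices of \<open>W\<close>.\<close>

lemma half_TB:
  assumes p: "pd ZA SA FA" and e: "{u, w} \<in> ZA" "u \<noteq> w" and YA: "YA \<subseteq> ZA" "{u, w} \<notin> YA"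
    and T0: "\<forall>W. W \<subseteq> {{u, w}} \<longrightarrow> TB (W \<union> YA) SA FA"
    and h: "half Z S F u w" and IH0: "disc (insert {u, w} Z) S F \<longrightarrow> (\<forall>Y. Y \<subseteq> insert {u, w} Z \<longrightarrow> TB Y S F)"
    and I: "SA \<inter> S = {u, w}" "SA \<noteq> {u, w}" and Y: "Y \<subseteq> Z"
  shows "TB (YA \<union> Y) (SA \<union> S) (FA \<union> F)" "pd (ZA \<union> Z) (SA \<union> S) (FA \<union> F)"
proof -
  note T = T0[rule_format] and IH = IH0[rule_format]
  have eF: "{u, w} \<in> FA" using e pd_basic[OF p] by blast
  have "TB (YA \<union> Y) (SA \<union> S) (FA \<union> F) \<and> pd (ZA \<union> Z) (SA \<union> S) (FA \<union> F)"
    using h[unfolded half_def]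
  proof (elim disjE conjE)
    assume t: "Z = {{u, w}}" "S = {u, w}" "F = {{u, w}}"
    have "SA \<union> S = SA" "FA \<union> F = FA" "ZA \<union> Z = ZA" using t I(1) e eF by blast+
    moreover have "TB (YA \<union> Y) SA FA" using T[of Y] Y t(1) by (simp add: Un_commute)
    ultimately show ?thesis using p by simp
  next
    assume n: "{u, w} \<notin> Z" and d: "disc (insert {u, w} Z) S F"
    note b = disc_basic[OF d]
    have pz: "pd (insert {u, w} Z) S F" by (rule pd.disc[OF d])
    have "TB (insert {u, w} YA) SA FA" using T[of "{{u, w}}"] by simp
    moreover have "TB (insert {u, w} Y) S F" by (rule IH[OF d]) (use Y in blast)
    moreover have "S \<noteq> {u, w}"
    proof
      assume S: "S = {u, w}"
      obtain x where x: "x \<noteq> u" "{w, x} \<in> insert {u, w} Z" using disc_boundary_next[OF d, of u w] by blast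
      have "{w, x} \<in> F" using subsetD[OF b(3) x(2)] .
      hence "x \<in> S" "card {w, x} = 2" using b(4,5) by blast+
      thus False using S x(1) by auto
    qed
    moreover have "insert {u, w} YA \<subseteq> ZA" "insert {u, w} Y \<subseteq> insert {u, w} Z" "{u, w} \<notin> Y" using e YA Y n by blast+
    ultimately have "TB (YA \<union> Y) (SA \<union> S) (FA \<union> F)"
      using TB_glue(2)[OF _ _ p _ pz _ I(1) e(2) I(2) _ YA(2)] by blast
    moreover have "pd (ZA \<union> insert {u, w} Z) (SA \<union> S) (FA \<union> F)" by (rule pd.glue[OF p pz I(1) e(2,1)]) simp
    moreover have "ZA \<union> insert {u, w} Z = ZA \<union> Z" using e by blast
    ultimately show ?thesis by simp
  qed
  thus "TB (YA \<union> Y) (SA \<union> S) (FA \<union> F)" "pd (ZA \<union> Z) (SA \<union> S) (FA \<union> F)" by blast+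
qed

text \<open>Three steps along the boundary already use three different edges; as there are no
  others, the walk has to close up.\<close>

lemma disc_boundary_tri:
  assumes d: "disc Z S F" and c: "card Z \<le> 3"
  obtains a b c where "a \<noteq> b" "b \<noteq> c" "a \<noteq> c" "Z = {{a, b}, {b, c}, {a, c}}"
proof -
  note b = disc_basic[OF d]
  have fZ: "finite Z" using b(3,6) finite_subset by blast
  have ne: "p \<noteq> q" if "{p, q} \<in> Z" for p q
  proof -
    have "card {p, q} = 2" using b(3,4) that by blast
    thus ?thesis by auto
  qed
  obtain u v where uv: "{u, v} \<in> Z" using disc_edge_exists[OF d] .
  obtain x where x: "x \<noteq> u" "{v, x} \<in> Z" using disc_boundary_next[OF d uv] by blast
  obtain y where y: "y \<noteq> v" "{x, y} \<in> Z" using disc_boundary_next[OF d x(2)] by blast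
  have "{v, u} \<in> Z" using uv by (simp add: insert_commute)
  then obtain t where t: "t \<noteq> v" "{u, t} \<in> Z" using disc_boundary_next[OF d] by blast
  note n = ne[OF uv] ne[OF x(2)] ne[OF y(2)] ne[OF t(2)]
  have d1: "{u, v} \<noteq> {v, x}" "{x, y} \<noteq> {v, x}" "{x, y} \<noteq> {u, v}" using n x(1) y(1) by (metis doubleton_eq_iff)+
  hence c3: "card {{u, v}, {v, x}, {x, y}} = 3" by auto
  have s: "{{u, v}, {v, x}, {x, y}} \<subseteq> Z" using uv x y by blast
  have Z: "{{u, v}, {v, x}, {x, y}} = Z" by (rule card_seteq[OF fZ s]) (use c c3 in simp)
  have "y = u"
  proof -
    have "{u, t} \<noteq> {u, v}" "{u, t} \<noteq> {v, x}" using n x(1) t(1) by (metis doubleton_eq_iff)+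
    hence "{u, t} = {x, y}" using t(2) unfolding Z[symmetric] by blast
    thus ?thesis using x(1) by (metis doubleton_eq_iff)
  qed
  hence "Z = {{u, v}, {v, x}, {u, x}}" using Z by (metis insert_commute)
  thus ?thesis using that n x(1) by metis
qed

text \<open>A boundary edge that is not reserved may be dropped or split at, which leaves smaller
  discs. If all of \<open>Z\<close> is reserved and there is an inner vertex, four boundary edges
  reach the count with \<open>X\<close> empty. For a triangular boundary the corner \<open>v\<close>
  is deleted instead: the rest is a disc with \<open>ux\<close> reserved, and the triangle
  \<open>uvx\<close> is glued back on \<open>ux\<close>, forgetting the other edges at
  \<open>v\<close>.\<close>

lemma disc_TB: "disc Z S F \<Longrightarrow> Y \<subseteq> Z \<Longrightarrow> TB Y S F"
proof (induction "card F" arbitrary: Z S F Y rule: less_induct)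
  case less
  note d = less.prems(1)
  note b = disc_basic[OF d]
  show ?case
  proof (cases "Y = Z")
    case False
    then obtain e where e: "e \<in> Z" "e \<notin> Y" using less.prems(2) by blast
    have "card e = 2" using b(3,4) e by blast
    then obtain u v where uv: "e = {u, v}" by (metis card_2_iff)
    show ?thesis
    proof (cases rule: disc_at[OF d e(1)[unfolded uv]])
      case (1 w)
      have "Y \<subseteq> insert {u, w} (insert {v, w} (Z - {{u, v}}))" using e(2) less.prems(2) uv by blast
      from less.hyps[OF 1(9,8) this] show ?thesis by (rule TB_mono) blast
    next
      case (2 w Z1 S1 F1 Z2 S2 F2)
      note h1 = half_basic[OF 2(15) 2(3)[symmetric]] and h2 = half_basic[OF 2(16) 2(4)[symmetric]]
      have wS: "w \<in> S1" "w \<in> S2" using 2(9) by blast+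
      let ?T = "{{u, v}, {v, w}, {u, w}}"
      let ?A = "{u, v, w}"
      have dis: "u \<noteq> v" "v \<noteq> w" "u \<noteq> w" using 2 by auto
      have pT: "pd ?T ?A ?T" by (rule pd_tri[OF dis])
      have tT: "TB W ?A ?T" if "W \<subseteq> ?T" for W using span2_tri[OF dis that] unfolding TB_def by blast
      have i1: "?A \<inter> S1 = {u, w}" using 2(10,13) wS by blast
      have vwS1: "{v, w} \<notin> Z1" using h1(2,4) 2(13) by blast
      have ne: "{u, w} \<noteq> {v, w}" using dis by (metis doubleton_eq_iff)
      have IH1: "disc (insert {u, w} Z1) S1 F1 \<longrightarrow> (\<forall>Y. Y \<subseteq> insert {u, w} Z1 \<longrightarrow> TB Y S1 F1)"
        using less.hyps[OF 2(17)] by simp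
      have IH2: "disc (insert {v, w} Z2) S2 F2 \<longrightarrow> (\<forall>Y. Y \<subseteq> insert {v, w} Z2 \<longrightarrow> TB Y S2 F2)"
        using less.hyps[OF 2(18)] by simp
      have r1: "TB (W \<union> (Y \<inter> Z1)) (?A \<union> S1) (?T \<union> F1)" "pd (?T \<union> Z1) (?A \<union> S1) (?T \<union> F1)" if W: "W \<subseteq> {{v, w}}" for W
      proof -
        have "v \<in> ?A" "v \<notin> {u, w}" using dis by simp_all
        hence a4: "?A \<noteq> {u, w}" by metis
        have a3: "{u, w} \<notin> W" using subsetD[OF W, of "{u, w}"] ne by auto
        have a1: "{u, w} \<in> ?T" "Y \<inter> Z1 \<subseteq> Z1" by simp_all
        have a2: "W \<subseteq> ?T" by (rule subset_trans[OF W]) simp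
        note a = a1(1) a2 a3 a4 a1(2)
        have t: "\<forall>W'. W' \<subseteq> {{u, w}} \<longrightarrow> TB (W' \<union> W) ?A ?T"
        proof (intro allI impI)
          fix W' assume W': "W' \<subseteq> {{u, w}}"
          have "W' \<subseteq> ?T" by (rule subset_trans[OF W']) simp
          thus "TB (W' \<union> W) ?A ?T" using a(2) by (intro tT Un_least)
        qed
        note h = half_TB[OF pT a(1) dis(3) a(2,3) t 2(15) IH1 i1 a(4,5)]
        show "TB (W \<union> (Y \<inter> Z1)) (?A \<union> S1) (?T \<union> F1)" by (rule h(1))
        show "pd (?T \<union> Z1) (?A \<union> S1) (?T \<union> F1)" by (rule h(2))
      qed
      have i2: "(?A \<union> S1) \<inter> S2 = {v, w}" using 2(9,11,12) wS by blast
      have a: "{v, w} \<in> ?T \<union> Z1" "Y \<inter> Z1 \<subseteq> ?T \<union> Z1" "{v, w} \<notin> Y \<inter> Z1" "Y \<inter> Z2 \<subseteq> Z2" using vwS1 by auto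
      have "u \<in> ?A \<union> S1" "u \<notin> {v, w}" using dis by blast+
      hence a2: "?A \<union> S1 \<noteq> {v, w}" by metis
      have r1': "\<forall>W. W \<subseteq> {{v, w}} \<longrightarrow> TB (W \<union> (Y \<inter> Z1)) (?A \<union> S1) (?T \<union> F1)"
        by (intro allI impI) (rule r1(1))
      have r2: "TB ((Y \<inter> Z1) \<union> (Y \<inter> Z2)) (?A \<union> S1 \<union> S2) (?T \<union> F1 \<union> F2)"
        by (rule half_TB(1)[OF r1(2)[OF subset_refl] a(1) dis(2) a(2,3) r1' 2(16) IH2 i2 a2 a(4)])
      have "Y \<subseteq> Z1 \<union> Z2"
      proof
        fix y assume y: "y \<in> Y"
        hence "y \<in> Z" "y \<noteq> {u, v}" using less.prems(2) e(2) uv by blast+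
        thus "y \<in> Z1 \<union> Z2" unfolding 2(7) by simp
      qed
      hence "Y = (Y \<inter> Z1) \<union> (Y \<inter> Z2)" by blast
      moreover have "?A \<union> S1 \<union> S2 = S" using 2(8,10,11) wS by blast
      moreover have "?T \<union> F1 \<union> F2 \<subseteq> F" using 2(5,6) unfolding 2(14) by blast
      ultimately show ?thesis using TB_mono[OF r2, of F] by simp
    qed
  next
    case YZ: True
    show ?thesis
    proof (cases "S = \<Union> Z")
      case True thus ?thesis using disc_span[OF d] YZ unfolding TB_def by blast
    next
      case nS: False
      have US: "\<Union> Z \<subseteq> S" using b(3,5) by blast
      have fU: "finite (\<Union> Z)" using finite_subset[OF US b(1)] .
      show ?thesis
      proof (cases "card Z \<le> 3")
        case False
        \<comment> \<open>Three vertices span at most three edges, so four boundary edges need four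
          boundary vertices; an inner vertex makes five.\<close>
        have "Z \<subseteq> {e. e \<subseteq> \<Union> Z \<and> card e = 2}" using b(3,4) by blast
        hence "card Z \<le> card {e. e \<subseteq> \<Union> Z \<and> card e = 2}" using fU by (intro card_mono) simp_all
        also have "... = card (\<Union> Z) choose 2" by (rule n_subsets[OF fU])
        finally have "card (\<Union> Z) choose 2 \<ge> 4" using False by simp
        moreover have "card (\<Union> Z) choose 2 \<le> 3" if "card (\<Union> Z) \<le> 3"
        proof -
          have "card (\<Union> Z) = 0 \<or> card (\<Union> Z) = 1 \<or> card (\<Union> Z) = 2 \<or> card (\<Union> Z) = 3" using that by linarith
          thus ?thesis by (elim disjE) (simp_all add: choose_two)
        qed
        ultimately have "card (\<Union> Z) \<ge> 4" by linarith
        moreover have "card (\<Union> Z) < card S" using US nS b(1) by (intro psubset_card_mono) blast+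
        ultimately have "card (S - {}) \<ge> 5" "card {} + card Y \<ge> 4" using False YZ by simp_all
        hence "free4 Y S F" unfolding free4_def
          by (intro exI[of _ "{}"] exI[of _ Z] exI[of _ F]) (use pd.disc[OF d] YZ in simp)
        thus ?thesis unfolding TB_def by simp
      next
        case True
        obtain u v x where uvx: "u \<noteq> v" "v \<noteq> x" "u \<noteq> x" "Z = {{u, v}, {v, x}, {u, x}}"
          using disc_boundary_tri[OF d True] .
        have U: "\<Union> Z = {u, v, x}" unfolding uvx(4) by blast
        have nf: "{v, z} \<notin> F" if "z \<in> \<Union> Z" "z \<noteq> u" "z \<noteq> x" for z
        proof
          assume "{v, z} \<in> F"
          hence "card {v, z} = 2" by (rule b(4))
          thus False using that unfolding U by simp
        qed
        have "{u, v} \<in> Z" "{v, x} \<in> Z" unfolding uvx(4) by simp_all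
        then obtain Z' F' where Z': "disc Z' (S - {v}) F'" "Z - {{u, v}, {v, x}} \<subseteq> Z'" "F' \<subseteq> F"
          using disc_delete[OF d _ _ uvx(3) nf] nS U by metis
        note b' = disc_basic[OF Z'(1)]
        have "{u, v} \<in> F" using b(3) uvx(4) by blast
        moreover have "{u, v} \<notin> F'" using b'(5) by blast
        ultimately have "F' \<subset> F" using Z'(3) by blast
        hence lt: "card F' < card F" using b(6) by (intro psubset_card_mono)
        have "{u, x} \<noteq> {u, v}" "{u, x} \<noteq> {v, x}" using uvx by (metis doubleton_eq_iff)+
        hence ux: "{u, x} \<in> Z'" "{u, x} \<notin> {{u, v}, {v, x}}" using subsetD[OF Z'(2), of "{u, x}"] uvx(4) by simp_all
        have T2: "TB (insert {u, x} {}) (S - {v}) F'" by (rule less.hyps[OF lt Z'(1)]) (use ux in blast)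
        let ?T = "{{u, v}, {v, x}, {u, x}}"
        have T1: "TB (insert {u, x} {{u, v}, {v, x}}) {u, v, x} ?T"
          unfolding TB_def using span2_tri[OF uvx(1-3), of "insert {u, x} {{u, v}, {v, x}}"] by blast
        have us: "u \<in> S" "v \<in> S" "x \<in> S" using US unfolding U by simp_all
        have i: "{u, v, x} \<inter> (S - {v}) = {u, x}" using us uvx by blast
        have "v \<in> {u, v, x}" "v \<notin> {u, x}" using uvx by simp_all
        hence n1: "{u, v, x} \<noteq> {u, x}" by metis
        have n2: "S - {v} \<noteq> {u, x}"
        proof
          assume "S - {v} = {u, x}"
          hence "insert v (S - {v}) = {u, v, x}" by (simp add: insert_commute)
          thus False using us(2) nS U by (simp add: insert_absorb)
        qed
        have sb: "insert {u, x} {{u, v}, {v, x}} \<subseteq> ?T" "insert {u, x} {} \<subseteq> Z'" "{u, x} \<notin> {}" using ux by simp_all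
        have "TB (insert {u, x} ({{u, v}, {v, x}} \<union> {})) ({u, v, x} \<union> (S - {v})) (?T \<union> F')"
          by (rule TB_glue(1)[OF T1 T2 pd_tri[OF uvx(1-3)] sb(1) pd.disc[OF Z'(1)] sb(2) i uvx(3) n1 n2 ux(2) sb(3)])
        moreover have "insert {u, x} ({{u, v}, {v, x}} \<union> {}) = Y" unfolding YZ uvx(4) by blast
        moreover have "{u, v, x} \<union> (S - {v}) = S" using us by blast
        ultimately have "TB Y S (?T \<union> F')" by simp
        moreover have "?T \<union> F' \<subseteq> F" using Z'(3) b(3) uvx(4) by blast
        ultimately show ?thesis by (rule TB_mono)
      qed
    qed
  qed
qed

lemma pd_single:
  assumes p: "pd Z {u, v} F" and e: "{u, v} \<in> Z" "u \<noteq> v"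
  shows "Z = {{u, v}}" "F = {{u, v}}"
proof -
  note b = pd_basic[OF p]
  have "f = {u, v}" if "f \<in> F" for f
  proof -
    have "f \<subseteq> {u, v}" "card f = card {u, v}" using b that e(2) by simp_all
    thus ?thesis by (intro card_subset_eq) simp_all
  qed
  hence sub: "F \<subseteq> {{u, v}}" by (intro subsetI) (simp only: singleton_iff)
  have ZF: "Z \<subseteq> F" by (rule pd_sub[OF p])
  show "F = {{u, v}}" by (rule subset_antisym[OF sub]) (use subsetD[OF ZF e(1)] in simp)
  show "Z = {{u, v}}" by (rule subset_antisym[OF subset_trans[OF ZF sub]]) (use e(1) in simp)
qed

text \<open>Pieces consisting of the edge \<open>uv\<close> alone are split off, because
  \<open>TB_glue\<close> wants a vertex beyond \<open>uv\<close> on both sides.\<close>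

lemma pd_TB: "pd Z S F \<Longrightarrow> Y \<subseteq> Z \<Longrightarrow> TB Y S F"
proof (induction arbitrary: Y rule: pd.induct)
  case (disc Z S F) thus ?case by (rule disc_TB)
next
  case (edge a b)
  have "span2 Y {a, b} {{a, b}}" unfolding span2_def using tt.base[OF edge.hyps] edge.prems by blast
  thus ?case unfolding TB_def by simp
next
  case (glue Z1 S1 F1 Z2 S2 F2 u v)
  have uvS: "{u, v} \<subseteq> S1" "{u, v} \<subseteq> S2" using glue.hyps(3) by blast+
  have eF1: "{u, v} \<in> F1" by (rule subsetD[OF pd_sub[OF glue.hyps(1)] glue.hyps(5)])
  have eF2: "{u, v} \<in> F2" by (rule subsetD[OF pd_sub[OF glue.hyps(2)] glue.hyps(6)])
  show ?case
  proof (cases "S1 = {u, v}")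
    case True
    note s = pd_single[OF glue.hyps(1)[unfolded True] glue.hyps(5,4)]
    have "S1 \<union> S2 = S2" unfolding True by (rule Un_absorb1[OF uvS(2)])
    moreover have "F1 \<union> F2 = F2" unfolding s(2) using eF2 by (simp add: insert_absorb)
    moreover have "Z1 \<union> Z2 = Z2" unfolding s(1) using glue.hyps(6) by (simp add: insert_absorb)
    ultimately show ?thesis using glue.IH(2)[of Y] glue.prems by simp
  next
    case n1: False
    show ?thesis
    proof (cases "S2 = {u, v}")
      case True
      note s = pd_single[OF glue.hyps(2)[unfolded True] glue.hyps(6,4)]
      have "S1 \<union> S2 = S1" unfolding True by (rule Un_absorb2[OF uvS(1)])
      moreover have "F1 \<union> F2 = F1" unfolding s(2) using eF1 by (simp add: insert_absorb)
      moreover have "Z1 \<union> Z2 = Z1" unfolding s(1) using glue.hyps(5) by (simp add: insert_absorb)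
      ultimately show ?thesis using glue.IH(1)[of Y] glue.prems by simp
    next
      case n2: False
      let ?Y1 = "Y \<inter> Z1 - {{u, v}}" and ?Y2 = "Y \<inter> Z2 - {{u, v}}"
      have s: "insert {u, v} ?Y1 \<subseteq> Z1" "insert {u, v} ?Y2 \<subseteq> Z2" using glue.hyps(5,6) by blast+
      have n: "{u, v} \<notin> ?Y1" "{u, v} \<notin> ?Y2" by blast+
      note g = TB_glue[OF glue.IH(1)[OF s(1)] glue.IH(2)[OF s(2)] glue.hyps(1) s(1) glue.hyps(2) s(2) glue.hyps(3,4) n1 n2 n]
      show ?thesis
      proof (cases "{u, v} \<in> Y")
        case True
        hence "Y = insert {u, v} (?Y1 \<union> ?Y2)" using glue.prems by blast
        thus ?thesis using g(1) by simp
      next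
        case False
        hence "Y = ?Y1 \<union> ?Y2" using glue.prems by blast
        thus ?thesis using g(2) by simp
      qed
    qed
  qed
qed

section \<open>Extending orientations\<close>

text \<open>A partial orientation: edges may stay undirected, so distance bounds pass to supergraphs
  at once. \<open>Good_oriented_diam\<close> directs the rest at the end.\<close>

definition arcs_ok :: "'a set \<Rightarrow> 'a set set \<Rightarrow> ('a \<times> 'a) set \<Rightarrow> bool" where
  "arcs_ok S F A \<longleftrightarrow> (\<forall>(u, v) \<in> A. u \<in> S \<and> v \<in> S \<and> {u, v} \<in> F \<and> (v, u) \<notin> A)"

definition reach_in :: "('a \<times> 'a) set \<Rightarrow> nat \<Rightarrow> 'a \<Rightarrow> 'a \<Rightarrow> bool" where
  "reach_in A k u v \<longleftrightarrow> (\<exists>j\<le>k. (u, v) \<in> A ^^ j)"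

definition Good :: "'a set \<Rightarrow> 'a set set \<Rightarrow> nat \<Rightarrow> bool" where
  "Good S F k \<longleftrightarrow> (\<exists>A. arcs_ok S F A \<and> (\<forall>u\<in>S. \<forall>v\<in>S. reach_in A k u v))"

text \<open>This relaxation is what \<open>star\<close> can repair; the stronger \<open>Alm1\<close>
  is what \<open>single\<close> can repair.\<close>

definition AlmS :: "'a set \<Rightarrow> 'a set set \<Rightarrow> nat \<Rightarrow> bool" where
  "AlmS S F k \<longleftrightarrow> (\<exists>A s. arcs_ok S F A \<and> (\<forall>u\<in>S. \<forall>v\<in>S. reach_in A (if u = s then k + 1 else k) u v))"

definition Alm1 :: "'a set \<Rightarrow> 'a set set \<Rightarrow> nat \<Rightarrow> bool" where
  "Alm1 S F k \<longleftrightarrow> (\<exists>A s t. arcs_ok S F A \<and> (\<forall>u\<in>S. \<forall>v\<in>S. reach_in A (if u = s \<and> v = t then k + 1 else k) u v))"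

lemma reach_in_refl: "reach_in A k u u" unfolding reach_in_def by (intro exI[of _ 0]) simp
lemma reach_in_arc: "(u, v) \<in> A \<Longrightarrow> reach_in A 1 u v" unfolding reach_in_def by (intro exI[of _ 1]) simp
lemma reach_in_trans: "reach_in A i u v \<Longrightarrow> reach_in A j v w \<Longrightarrow> i + j \<le> k \<Longrightarrow> reach_in A k u w"
proof -
  assume "reach_in A i u v" "reach_in A j v w" "i + j \<le> k"
  then obtain i' j' where "i' \<le> i" "(u, v) \<in> A ^^ i'" "j' \<le> j" "(v, w) \<in> A ^^ j'" unfolding reach_in_def by blast
  moreover from this have "(u, w) \<in> A ^^ (i' + j')" unfolding relpow_add by blast
  ultimately show ?thesis using \<open>i + j \<le> k\<close> unfolding reach_in_def by (intro exI[of _ "i' + j'"]) simp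
qed
lemma reach_in_mono: "reach_in A i u v \<Longrightarrow> A \<subseteq> B \<Longrightarrow> i \<le> k \<Longrightarrow> reach_in B k u v"
proof -
  assume "reach_in A i u v" and s: "A \<subseteq> B" "i \<le> k"
  then obtain j where j: "j \<le> i" "(u, v) \<in> A ^^ j" unfolding reach_in_def by blast
  have "A ^^ j \<subseteq> B ^^ j"
  proof (induction j)
    case (Suc j) thus ?case using s(1) by (simp add: relcomp_mono)
  qed simp
  thus ?thesis using j s(2) unfolding reach_in_def by (intro exI[of _ j]) auto
qed
lemma reach_in_Suc: "(u, v) \<in> A \<Longrightarrow> reach_in A j v w \<Longrightarrow> Suc j \<le> k \<Longrightarrow> reach_in A k u w"
  by (rule reach_in_trans[OF reach_in_arc, of u v]) simp_all
lemma reach_in_snoc: "reach_in A j u v \<Longrightarrow> (v, w) \<in> A \<Longrightarrow> Suc j \<le> k \<Longrightarrow> reach_in A k u w"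
  by (rule reach_in_trans[OF _ reach_in_arc, of A j u v w]) simp_all
lemma reach_in_first: assumes "reach_in A k u v" "u \<noteq> v" shows "\<exists>w. (u, w) \<in> A \<and> reach_in A (k - 1) w v \<and> k \<ge> 1"
proof -
  obtain j where j: "j \<le> k" "(u, v) \<in> A ^^ j" using assms(1) unfolding reach_in_def by blast
  obtain i where i: "j = Suc i" using j(2) assms(2) by (cases j) auto
  obtain w where "(u, w) \<in> A" "(w, v) \<in> A ^^ i" using j(2) unfolding i by (elim relpow_Suc_E2)
  thus ?thesis using j(1) i unfolding reach_in_def by (intro exI[of _ w] conjI exI[of _ i]) simp_all
qed
lemma reach_in_last: assumes "reach_in A k u v" "u \<noteq> v" shows "\<exists>w. reach_in A (k - 1) u w \<and> (w, v) \<in> A \<and> k \<ge> 1"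
proof -
  obtain j where j: "j \<le> k" "(u, v) \<in> A ^^ j" using assms(1) unfolding reach_in_def by blast
  obtain i where i: "j = Suc i" using j(2) assms(2) by (cases j) auto
  obtain w where "(u, w) \<in> A ^^ i" "(w, v) \<in> A" using j(2) unfolding i by (elim relpow_Suc_E)
  thus ?thesis using j(1) i unfolding reach_in_def by (intro exI[of _ w] conjI exI[of _ i]) simp_all
qed

lemma reach_in_converse: "reach_in (A\<inverse>) k u v \<longleftrightarrow> reach_in A k v u"
proof -
  have "(A\<inverse>) ^^ j = (A ^^ j)\<inverse>" for j
  proof (induction j)
    case (Suc j)
    have "(A\<inverse>) ^^ Suc j = (A O A ^^ j)\<inverse>" using Suc by (simp add: converse_relcomp)
    thus ?case by (simp add: relpow_commute)
  qed simp
  thus ?thesis unfolding reach_in_def by simp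
qed

lemma arcs_ok_converse: "arcs_ok S F A \<Longrightarrow> arcs_ok S F (A\<inverse>)"
  unfolding arcs_ok_def by (auto simp: insert_commute)

lemma arcs_ok_insert:
  assumes "arcs_ok S F A" "{u, v} \<in> F" "u \<in> S" "v \<in> S" "u \<noteq> v" "(v, u) \<notin> A"
  shows "arcs_ok S F (insert (u, v) A)"
  unfolding arcs_ok_def
proof (intro ballI, clarify)
  fix p q assume pq: "(p, q) \<in> insert (u, v) A"
  show "p \<in> S \<and> q \<in> S \<and> {p, q} \<in> F \<and> (q, p) \<notin> insert (u, v) A"
  proof (cases "(p, q) = (u, v)")
    case True thus ?thesis using assms by simp
  next
    case False
    hence "(p, q) \<in> A" using pq by (metis insertE)
    hence 1: "p \<in> S \<and> q \<in> S \<and> {p, q} \<in> F \<and> (q, p) \<notin> A" using assms(1) unfolding arcs_ok_def by fast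
    have "(q, p) \<noteq> (u, v)" using \<open>(p, q) \<in> A\<close> assms(6) by auto
    thus ?thesis using 1 by simp
  qed
qed

lemma arcs_ok_mono: "arcs_ok S F A \<Longrightarrow> S \<subseteq> S' \<Longrightarrow> F \<subseteq> F' \<Longrightarrow> B \<subseteq> A \<Longrightarrow> arcs_ok S' F' B"
  unfolding arcs_ok_def by fast

lemma Good_mono: assumes "Good S F k" "F \<subseteq> F'" "k \<le> k'" shows "Good S F' k'"
proof -
  obtain A where A: "arcs_ok S F A" "\<And>u v. u \<in> S \<Longrightarrow> v \<in> S \<Longrightarrow> reach_in A k u v"
    using assms(1) unfolding Good_def by blast
  have "arcs_ok S F' A" using A(1) assms(2) unfolding arcs_ok_def by fast
  moreover have "reach_in A k' u v" if "u \<in> S" "v \<in> S" for u v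
    by (rule reach_in_mono[OF A(2)[OF that] subset_refl assms(3)])
  ultimately show ?thesis unfolding Good_def by blast
qed

lemma Good_Alm1: assumes "Good S F k" shows "Alm1 S F k"
proof -
  obtain A where A: "arcs_ok S F A" "\<And>u v. u \<in> S \<Longrightarrow> v \<in> S \<Longrightarrow> reach_in A k u v"
    using assms(1) unfolding Good_def by blast
  have "reach_in A (if u = s \<and> v = t then k + 1 else k) u v" if "u \<in> S" "v \<in> S" for u v s t
    by (rule reach_in_mono[OF A(2)[OF that] subset_refl]) simp
  thus ?thesis using A(1) unfolding Alm1_def by blast
qed

lemma Alm1_AlmS: assumes "Alm1 S F k" shows "AlmS S F k"
proof -
  obtain A s t where A: "arcs_ok S F A" "\<forall>u\<in>S. \<forall>v\<in>S. reach_in A (if u = s \<and> v = t then k + 1 else k) u v"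
    using assms unfolding Alm1_def by blast
  have "reach_in A (if u = s then k + 1 else k) u v" if "u \<in> S" "v \<in> S" for u v
    using bspec[OF bspec[OF A(2) that(1)] that(2)] reach_in_mono[of A k u v A "k + 1"] by (auto split: if_splits)
  thus ?thesis using A(1) unfolding AlmS_def by blast
qed

text \<open>Every new \<open>x\<close> is entered from \<open>g x\<close> and left towards
  \<open>f x\<close>, which is chosen different from \<open>s\<close>. A walk from a new vertex thus
  has at most 1 + k + 1 arcs, and a walk from \<open>s\<close> to a new vertex at most (k + 1) +
  1.\<close>

lemma star:
  assumes H: "AlmS S F k" and FF: "F \<subseteq> F'" and dj: "X \<inter> S = {}"
    and X: "\<And>x. x \<in> X \<Longrightarrow> \<exists>a b. a \<noteq> b \<and> a \<in> S \<and> b \<in> S \<and> {x, a} \<in> F' \<and> {x, b} \<in> F'"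
  shows "Good (S \<union> X) F' (k + 2)"
proof -
  obtain A s where A: "arcs_ok S F A" "\<And>u v. u \<in> S \<Longrightarrow> v \<in> S \<Longrightarrow> reach_in A (if u = s then k + 1 else k) u v"
    using H unfolding AlmS_def by blast
  have "\<exists>o' i. o' \<noteq> s \<and> o' \<noteq> i \<and> o' \<in> S \<and> i \<in> S \<and> {x, o'} \<in> F' \<and> {x, i} \<in> F'" if "x \<in> X" for x
    using X[OF that] by metis
  then obtain f g where fg: "\<And>x. x \<in> X \<Longrightarrow> f x \<noteq> s \<and> f x \<noteq> g x \<and> f x \<in> S \<and> g x \<in> S \<and> {x, f x} \<in> F' \<and> {x, g x} \<in> F'"
    by metis
  define B where "B = A \<union> {(x, f x) | x. x \<in> X} \<union> {(g x, x) | x. x \<in> X}"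
  have AS: "(u, v) \<in> A \<Longrightarrow> u \<in> S \<and> v \<in> S \<and> {u, v} \<in> F \<and> (v, u) \<notin> A" for u v using A(1) unfolding arcs_ok_def by blast
  have SX: "u \<in> S \<Longrightarrow> u \<notin> X" for u using dj by blast
  have "arcs_ok (S \<union> X) F' B" unfolding arcs_ok_def
  proof (intro ballI, clarify)
    fix u v assume uv: "(u, v) \<in> B"
    then consider "(u, v) \<in> A" | "u \<in> X" "v = f u" | "v \<in> X" "u = g v" unfolding B_def by blast
    thus "u \<in> S \<union> X \<and> v \<in> S \<union> X \<and> {u, v} \<in> F' \<and> (v, u) \<notin> B"
    proof cases
      case 1
      thus ?thesis using AS[OF 1] FF SX unfolding B_def by blast
    next
      case 2
      have "(v, u) \<notin> A" using AS[of v u] SX[of u] 2 by blast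
      thus ?thesis using 2 fg[of u] SX[of v] unfolding B_def by auto
    next
      case 3
      have "(v, u) \<notin> A" using AS[of v u] SX[of v] 3 by blast
      thus ?thesis using 3 fg[of v] SX[of u] unfolding B_def by (auto simp: insert_commute)
    qed
  qed
  moreover have "reach_in B (k + 2) u v" if "u \<in> S \<union> X" "v \<in> S \<union> X" for u v
  proof -
    have AB: "A \<subseteq> B" unfolding B_def by blast
    have S1: "reach_in B (k + 1) u v" if "u \<in> S" "v \<in> S" for u v
      using A(2)[OF that] reach_in_mono[OF _ AB] by (metis le_add1 order_refl)
    have S0: "reach_in B k u v" if "u \<in> S" "v \<in> S" "u \<noteq> s" for u v
      using A(2)[OF that(1,2)] that(3) reach_in_mono[OF _ AB] by auto
    have out: "(x, f x) \<in> B" and inn: "(g x, x) \<in> B" if "x \<in> X" for x using that unfolding B_def by auto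
    show ?thesis
    proof (cases "u \<in> X")
      case uX: True
      show ?thesis
      proof (cases "v \<in> X")
        case True
        have "reach_in B k (f u) (g v)" using S0 fg uX True by metis
        hence "reach_in B (k + 1) (f u) v" by (rule reach_in_snoc[OF _ inn[OF True]]) simp
        thus ?thesis by (rule reach_in_Suc[OF out[OF uX]]) simp
      next
        case False
        hence "reach_in B k (f u) v" using S0 fg[OF uX] that by blast
        thus ?thesis by (rule reach_in_Suc[OF out[OF uX]]) simp
      qed
    next
      case False
      hence uS: "u \<in> S" using that by blast
      show ?thesis
      proof (cases "v \<in> X")
        case True
        have "reach_in B (k + 1) u (g v)" using S1 uS fg[OF True] by blast
        thus ?thesis by (rule reach_in_snoc[OF _ inn[OF True]]) simp
      next
        case False
        hence "reach_in B (k + 1) u v" using S1 uS that by blast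
        thus ?thesis by (rule reach_in_mono) simp_all
      qed
    qed
  qed
  ultimately show ?thesis unfolding Good_def by blast
qed

text \<open>Only the pair from \<open>s\<close> to \<open>t\<close> is slow, so \<open>x\<close>
  should be left towards a vertex other than \<open>s\<close> and entered from one other than
  \<open>t\<close>. One of the two directions of the path through \<open>x\<close> achieves this
  unless \<open>s = t\<close>, and then the distance in question is 0.\<close>

lemma single:
  assumes H: "Alm1 S F k" and FF: "F \<subseteq> F'" and x: "x \<notin> S"
    and ab: "a \<noteq> b" "a \<in> S" "b \<in> S" "{x, a} \<in> F'" "{x, b} \<in> F'"
  shows "Good (insert x S) F' (k + 1)"
proof -
  obtain A s t where A: "arcs_ok S F A" "\<And>u v. u \<in> S \<Longrightarrow> v \<in> S \<Longrightarrow> reach_in A (if u = s \<and> v = t then k + 1 else k) u v"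
    using H unfolding Alm1_def by blast
  have "\<exists>f g. f \<noteq> g \<and> f \<in> S \<and> g \<in> S \<and> {x, f} \<in> F' \<and> {x, g} \<in> F' \<and> (f = s \<longrightarrow> s = t) \<and> (g = t \<longrightarrow> s = t)"
  proof (cases "(a = s \<longrightarrow> s = t) \<and> (b = t \<longrightarrow> s = t)")
    case True thus ?thesis using ab by blast
  next
    case False
    hence "(b = s \<longrightarrow> s = t) \<and> (a = t \<longrightarrow> s = t)" using ab by metis
    thus ?thesis using ab by metis
  qed
  then obtain f g where fg: "f \<noteq> g" "f \<in> S" "g \<in> S" "{x, f} \<in> F'" "{x, g} \<in> F'" "f = s \<longrightarrow> s = t" "g = t \<longrightarrow> s = t" by blast
  define B where "B = insert (x, f) (insert (g, x) A)"
  have AS: "(u, v) \<in> A \<Longrightarrow> u \<in> S \<and> v \<in> S \<and> {u, v} \<in> F \<and> (v, u) \<notin> A" for u v using A(1) unfolding arcs_ok_def by blast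
  have "arcs_ok (insert x S) F' B" unfolding arcs_ok_def
  proof (intro ballI, clarify)
    fix u v assume "(u, v) \<in> B"
    then consider "(u, v) \<in> A" | "u = x" "v = f" | "v = x" "u = g" unfolding B_def by blast
    thus "u \<in> insert x S \<and> v \<in> insert x S \<and> {u, v} \<in> F' \<and> (v, u) \<notin> B"
    proof cases
      case 1
      thus ?thesis using AS[OF 1] FF x unfolding B_def by auto
    next
      case 2
      thus ?thesis using AS[of v u] fg x unfolding B_def by auto
    next
      case 3
      thus ?thesis using AS[of v u] fg x unfolding B_def by (auto simp: insert_commute)
    qed
  qed
  moreover have "reach_in B (k + 1) u v" if uv: "u \<in> insert x S" "v \<in> insert x S" for u v
  proof -
    have AB: "A \<subseteq> B" unfolding B_def by blast
    have S1: "reach_in B (k + 1) u v" if "u \<in> S" "v \<in> S" for u v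
      using A(2)[OF that] reach_in_mono[OF _ AB] by (metis le_add1 order_refl)
    have S0: "reach_in B k u v" if "u \<in> S" "v \<in> S" "\<not> (u = s \<and> v = t)" for u v
      using A(2)[OF that(1,2)] that(3) reach_in_mono[OF _ AB] by auto
    have f: "reach_in B k f v" if "v \<in> S" for v
      using S0[of f v] that fg(2,6) reach_in_refl[of B k f] by (cases "f = s \<and> v = t") auto
    have g: "reach_in B k v g" if "v \<in> S" for v
      using S0[of v g] that fg(3,7) reach_in_refl[of B k g] by (cases "v = s \<and> g = t") auto
    have xf: "(x, f) \<in> B" "(g, x) \<in> B" unfolding B_def by auto
    show ?thesis
    proof (cases "u = x")
      case ux: True
      show ?thesis
      proof (cases "v = x")
        case True thus ?thesis using ux reach_in_refl by simp
      next
        case False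
        thus ?thesis using reach_in_Suc[OF xf(1) f, of v] uv ux by simp
      qed
    next
      case False
      hence uS: "u \<in> S" using uv by blast
      show ?thesis
      proof (cases "v = x")
        case True thus ?thesis using reach_in_snoc[OF g[OF uS] xf(2)] by simp
      next
        case False thus ?thesis using S1 uS uv by blast
      qed
    qed
  qed
  ultimately show ?thesis unfolding Good_def by blast
qed

text \<open>Two vertices are added for one more step. The only arc into \<open>b\<close> comes from
  \<open>a\<close>, so every vertex except \<open>b\<close> reaches \<open>a\<close> in
  \<open>k - 1\<close> steps, which pays for going on to \<open>y\<close> and \<open>x\<close>. If
  \<open>(z, a)\<close> is an arc, \<open>b\<close> reaches \<open>a\<close> in 2 \<le> k - 1 steps
  as well. If not, the passage from \<open>a\<close> over \<open>b\<close> to \<open>z\<close> is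
  replaced by an arc from \<open>a\<close> to \<open>z\<close>, and \<open>b\<close> is entered from
  \<open>y\<close> and left towards both \<open>a\<close> and \<open>z\<close>.\<close>

lemma path_end_core:
  assumes A: "arcs_ok S F A" "\<And>u v. u \<in> S \<Longrightarrow> v \<in> S \<Longrightarrow> reach_in A k u v" and k: "k \<ge> 3"
    and d: "a \<in> S" "b \<in> S" "z \<in> S" "a \<noteq> b" "a \<noteq> z" "b \<noteq> z" "x \<noteq> y" "x \<notin> S" "y \<notin> S"
    and arcs: "(a, b) \<in> A" "(b, z) \<in> A" and nb: "\<And>u. (u, b) \<in> A \<Longrightarrow> u = a" "\<And>u. (b, u) \<in> A \<Longrightarrow> u = z"
    and FF: "F \<subseteq> F'" and e: "{a, z} \<in> F" "{y, a} \<in> F'" "{y, b} \<in> F'" "{x, y} \<in> F'" "{x, t} \<in> F'" "t = a \<or> t = b"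
  shows "Good (insert x (insert y S)) F' (k + 1)"
proof -
  have AS: "(u, v) \<in> A \<Longrightarrow> u \<in> S \<and> v \<in> S \<and> {u, v} \<in> F \<and> (v, u) \<notin> A" for u v using A(1) unfolding arcs_ok_def by blast
  have nS: "(u, v) \<in> A \<Longrightarrow> u \<noteq> x \<and> u \<noteq> y \<and> v \<noteq> x \<and> v \<noteq> y" for u v using AS d by metis
  have toa: "reach_in A (k - 1) v a" if "v \<in> S" "v \<noteq> b" for v
    using reach_in_last[OF A(2)[OF that(1) d(2)] that(2)] nb(1) by metis
  have fromz: "reach_in A (k - 1) z v" if "v \<in> S" "v \<noteq> b" for v
    using reach_in_first[OF A(2)[OF d(2) that(1)]] that(2) nb(2) by metis
  have ab: "{a, b} \<in> F'" "{b, z} \<in> F'" using AS arcs FF by blast+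
  have e': "{a, y} \<in> F'" "{y, x} \<in> F'" "{b, a} \<in> F'" using e ab by (simp_all add: insert_commute)
  have ntS: "t \<in> S" "t \<noteq> x" "t \<noteq> y" using e(6) d by auto
  have nA: "(u, y) \<notin> A" "(y, u) \<notin> A" "(u, x) \<notin> A" "(x, u) \<notin> A" for u using nS by metis+
  show ?thesis
  proof (cases "(z, a) \<in> A")
    case za: True
    define B where "B = insert (a, y) (insert (y, b) (insert (y, x) (insert (x, t) A)))"
    have "arcs_ok (insert x (insert y S)) F' A" by (rule arcs_ok_mono[OF A(1) _ FF]) auto
    hence "arcs_ok (insert x (insert y S)) F' B" unfolding B_def
      by (intro arcs_ok_insert) (use d e e' ntS nA in auto)
    moreover have "reach_in B (k + 1) u v" if uv: "u \<in> insert x (insert y S)" "v \<in> insert x (insert y S)" for u v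
    proof -
      have AB: "A \<subseteq> B" unfolding B_def by blast
      have old: "reach_in B k u v" if "u \<in> S" "v \<in> S" for u v using A(2)[OF that] reach_in_mono[OF _ AB] by blast
      have n: "(a, y) \<in> B" "(y, b) \<in> B" "(y, x) \<in> B" "(x, t) \<in> B" "(a, b) \<in> B" "(b, z) \<in> B" "(z, a) \<in> B"
        unfolding B_def using arcs za by auto
      have ba: "reach_in B 2 b a" by (rule reach_in_Suc[OF n(6) reach_in_arc[OF n(7)]]) simp
      have to_a: "reach_in B (k - 1) v a" if "v \<in> S" for v
      proof (cases "v = b")
        case True thus ?thesis using reach_in_mono[OF ba subset_refl] k by simp
      next
        case False thus ?thesis using reach_in_mono[OF toa[OF that False] AB] by simp
      qed
      have to_y: "reach_in B k v y" if "v \<in> S" for v by (rule reach_in_snoc[OF to_a[OF that] n(1)]) (use k in simp)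
      have to_x: "reach_in B (k + 1) v x" if "v \<in> S" for v by (rule reach_in_snoc[OF to_y[OF that] n(3)]) simp
      have tS: "t \<in> S" using e(6) d by auto
      have from_y: "reach_in B (k + 1) y v" if "v \<in> S" for v by (rule reach_in_Suc[OF n(2) old[OF d(2) that]]) simp
      have from_x: "reach_in B (k + 1) x v" if "v \<in> S" for v by (rule reach_in_Suc[OF n(4) old[OF tS that]]) simp
      have xy: "reach_in B (k + 1) x y"
        by (rule reach_in_Suc[OF n(4) to_y[OF tS]]) simp
      have yx: "reach_in B (k + 1) y x" by (rule reach_in_mono[OF reach_in_arc[OF n(3)]]) simp_all
      have old': "reach_in B (k + 1) u v" if "u \<in> S" "v \<in> S" for u v by (rule reach_in_mono[OF old[OF that]]) simp_all
      have to_y': "reach_in B (k + 1) v y" if "v \<in> S" for v by (rule reach_in_mono[OF to_y[OF that]]) simp_all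
      show ?thesis using uv by (elim insertE) (simp_all only: xy yx to_x to_y' from_x from_y old' reach_in_refl)
    qed
    ultimately show ?thesis unfolding Good_def by blast
  next
    case za: False
    \<comment> \<open>A walk between other vertices either avoids \<open>b\<close> or passes through
      \<open>a\<close>, \<open>b\<close>, \<open>z\<close> in a row, so replacing that passage by
      one arc does not lengthen it.\<close>
    define A0 where "A0 = insert (a, z) {(u, v) \<in> A. u \<noteq> b \<and> v \<noteq> b}"
    have short: "(u, v) \<in> A ^^ j \<Longrightarrow> u \<noteq> b \<Longrightarrow> v \<noteq> b \<Longrightarrow> reach_in A0 j u v" for u v j
    proof (induction j arbitrary: u rule: less_induct)
      case (less j)
      show ?case
      proof (cases "u = v")
        case True thus ?thesis using reach_in_refl by simp
      next
        case False
        then obtain i where i: "j = Suc i" using less.prems(1) by (cases j) auto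
        obtain w where w: "(u, w) \<in> A" "(w, v) \<in> A ^^ i" using less.prems(1) unfolding i by (elim relpow_Suc_E2)
        show ?thesis
        proof (cases "w = b")
          case False
          have "(u, w) \<in> A0" using w(1) False less.prems(2) unfolding A0_def by simp
          moreover have "reach_in A0 i w v" using less.IH[OF _ w(2) False less.prems(3)] i by simp
          ultimately show ?thesis using reach_in_Suc i by (metis order_refl)
        next
          case True
          hence ua: "u = a" using nb(1) w(1) by simp
          obtain i' where i': "i = Suc i'" using w(2) True less.prems(3) by (cases i) auto
          obtain w' where w': "(b, w') \<in> A" "(w', v) \<in> A ^^ i'" using w(2) unfolding i' True by (elim relpow_Suc_E2)
          have "w' = z" using nb(2) w'(1) by simp
          hence "reach_in A0 i' z v" using less.IH[OF _ w'(2) _ less.prems(3)] d i i' by simp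
          moreover have "(u, z) \<in> A0" unfolding A0_def ua by simp
          ultimately show ?thesis using reach_in_Suc[of u z A0 i' v j] i i' by simp
        qed
      qed
    qed
    have sh: "reach_in A0 j u v" if "reach_in A j u v" "u \<noteq> b" "v \<noteq> b" for u v j
    proof -
      note prem = that
      obtain j' where j': "j' \<le> j" "(u, v) \<in> A ^^ j'" using prem(1) unfolding reach_in_def by blast
      show ?thesis by (rule reach_in_mono[OF short[OF j'(2) prem(2,3)] subset_refl j'(1)])
    qed
    have A0S: "u \<in> S \<and> v \<in> S \<and> u \<noteq> b \<and> v \<noteq> b \<and> {u, v} \<in> F \<and> (v, u) \<notin> A0" if "(u, v) \<in> A0" for u v
      using that AS[of u v] AS[of v u] d e(1) za unfolding A0_def by (auto simp: insert_commute)
    define B where "B = insert (b, a) (insert (b, z) (insert (a, y) (insert (y, b) (insert (y, x) (insert (x, t) A0)))))"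
    have nA0: "(u, y) \<notin> A0" "(y, u) \<notin> A0" "(u, x) \<notin> A0" "(x, u) \<notin> A0" "(u, b) \<notin> A0" "(b, u) \<notin> A0" for u
      using A0S d by metis+
    have "arcs_ok S F A0" unfolding arcs_ok_def using A0S by fast
    hence "arcs_ok (insert x (insert y S)) F' A0" by (rule arcs_ok_mono[OF _ _ FF]) auto
    hence "arcs_ok (insert x (insert y S)) F' B" unfolding B_def
      by (intro arcs_ok_insert) (use d e e' ntS nA0 ab in auto)
    moreover have "reach_in B (k + 1) u v" if uv: "u \<in> insert x (insert y S)" "v \<in> insert x (insert y S)" for u v
    proof -
      have AB: "A0 \<subseteq> B" unfolding B_def by blast
      have n: "(a, y) \<in> B" "(y, b) \<in> B" "(y, x) \<in> B" "(x, t) \<in> B" "(b, a) \<in> B" "(b, z) \<in> B"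
        unfolding B_def by auto
      have old: "reach_in B k u v" if "u \<in> S" "v \<in> S" "u \<noteq> b" "v \<noteq> b" for u v
        using reach_in_mono[OF sh[OF A(2)[OF that(1,2)] that(3,4)] AB] by simp
      have to_a: "reach_in B (k - 1) v a" if "v \<in> S" for v
      proof (cases "v = b")
        case True thus ?thesis using reach_in_mono[OF reach_in_arc[OF n(5)] subset_refl] k by simp
      next
        case False thus ?thesis using reach_in_mono[OF sh[OF toa[OF that False] False] AB] d by simp
      qed
      have to_y: "reach_in B k v y" if "v \<in> S" for v by (rule reach_in_snoc[OF to_a[OF that] n(1)]) (use k in simp)
      have to_x: "reach_in B (k + 1) v x" if "v \<in> S" for v by (rule reach_in_snoc[OF to_y[OF that] n(3)]) simp
      have to_b: "reach_in B (k + 1) v b" if "v \<in> S" for v by (rule reach_in_snoc[OF to_y[OF that] n(2)]) simp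
      have from_b: "reach_in B k b v" if "v \<in> S" for v
      proof (cases "v = b")
        case False
        have "reach_in B (k - 1) z v" using reach_in_mono[OF sh[OF fromz[OF that False] _ False] AB] d by simp
        thus ?thesis by (rule reach_in_Suc[OF n(6)]) (use k in simp)
      qed (simp add: reach_in_refl)
      have from_y: "reach_in B (k + 1) y v" if "v \<in> S" for v by (rule reach_in_Suc[OF n(2) from_b[OF that]]) simp
      have from_x: "reach_in B (k + 1) x v" if v: "v \<in> S" for v
      proof (cases "t = b")
        case True
        show ?thesis by (rule reach_in_Suc[OF n(4)[unfolded True] from_b[OF v]]) simp
      next
        case False
        hence ta: "t = a" using e(6) by simp
        show ?thesis
        proof (cases "v = b")
          case True
          have "reach_in B 2 a b" by (rule reach_in_Suc[OF n(1) reach_in_arc[OF n(2)]]) simp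
          hence "reach_in B 3 x b" by (rule reach_in_Suc[OF n(4)[unfolded ta]]) simp
          thus ?thesis unfolding True by (rule reach_in_mono) (use k in simp_all)
        next
          case False
          show ?thesis by (rule reach_in_Suc[OF n(4)[unfolded ta] old[OF d(1) v d(4) False]]) simp
        qed
      qed
      have tS: "t \<in> S" using e(6) d by auto
      have xy: "reach_in B (k + 1) x y" by (rule reach_in_Suc[OF n(4) to_y[OF tS]]) simp
      have yx: "reach_in B (k + 1) y x" by (rule reach_in_mono[OF reach_in_arc[OF n(3)]]) simp_all
      have to_y': "reach_in B (k + 1) v y" if "v \<in> S" for v by (rule reach_in_mono[OF to_y[OF that]]) simp_all
      have old': "reach_in B (k + 1) u v" if "u \<in> S" "v \<in> S" for u v
      proof (cases "u = b")
        case True show ?thesis unfolding True by (rule reach_in_mono[OF from_b[OF that(2)]]) simp_all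
      next
        case ub: False
        show ?thesis
        proof (cases "v = b")
          case True thus ?thesis using to_b that by simp
        next
          case False show ?thesis by (rule reach_in_mono[OF old[OF that ub False]]) simp_all
        qed
      qed
      show ?thesis using uv by (elim insertE) (simp_all only: xy yx to_x to_y' from_x from_y old' reach_in_refl)
    qed
    ultimately show ?thesis unfolding Good_def by blast
  qed
qed

text \<open>\<open>b\<close> has no neighbours besides \<open>a\<close> and \<open>z\<close>, so
  reachability forces exactly one arc in and one arc out. If they lead from \<open>z\<close> over
  \<open>b\<close> to \<open>a\<close>, the reversed orientation is extended, which obeys the same
  bound.\<close>

lemma path_end:
  assumes H: "Good S F k" and k: "k \<ge> 3"
    and d: "a \<in> S" "b \<in> S" "z \<in> S" "a \<noteq> b" "a \<noteq> z" "b \<noteq> z" "x \<noteq> y" "x \<notin> S" "y \<notin> S"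
    and nb: "\<And>u. {b, u} \<in> F \<Longrightarrow> u = a \<or> u = z"
    and FF: "F \<subseteq> F'" and e: "{a, z} \<in> F" "{y, a} \<in> F'" "{y, b} \<in> F'" "{x, y} \<in> F'" "{x, t} \<in> F'" "t = a \<or> t = b"
  shows "Good (insert x (insert y S)) F' (k + 1)"
proof -
  obtain A where A: "arcs_ok S F A" "\<And>u v. u \<in> S \<Longrightarrow> v \<in> S \<Longrightarrow> reach_in A k u v"
    using H unfolding Good_def by blast
  have AS: "(u, v) \<in> A \<Longrightarrow> {u, v} \<in> F \<and> (v, u) \<notin> A" for u v using A(1) unfolding arcs_ok_def by blast
  obtain p where p: "(p, b) \<in> A" using reach_in_last[OF A(2)[OF d(1,2)] d(4)] by blast
  obtain q where q: "(b, q) \<in> A" using reach_in_first[OF A(2)[OF d(2,1)]] d(4) by metis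
  have inn: "u = a \<or> u = z" if "(u, b) \<in> A" for u using AS[OF that] nb[of u] by (simp add: insert_commute)
  have out: "u = a \<or> u = z" if "(b, u) \<in> A" for u using AS[OF that] nb[of u] by simp
  have pq: "p \<noteq> q" using AS[OF p] q by blast
  have uin: "u = p" if "(u, b) \<in> A" for u using inn[OF that] inn[OF p] out[OF q] AS[OF that] q pq by metis
  have uout: "u = q" if "(b, u) \<in> A" for u using out[OF that] inn[OF p] out[OF q] AS[OF that] p pq by metis
  show ?thesis
  proof (cases "p = a")
    case True
    hence "q = z" using out[OF q] pq by auto
    thus ?thesis using path_end_core[OF A k d _ _ _ _ FF e] p q uin uout True by blast
  next
    case False
    hence pz: "p = z" "q = a" using inn[OF p] out[OF q] pq by auto
    show ?thesis
    proof (rule path_end_core[OF arcs_ok_converse[OF A(1)] _ k d _ _ _ _ FF e])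
      show "reach_in (A\<inverse>) k u v" if "u \<in> S" "v \<in> S" for u v using A(2)[OF that(2,1)] unfolding reach_in_converse .
      show "(a, b) \<in> A\<inverse>" "(b, z) \<in> A\<inverse>" using p q pz by auto
      show "u = a" if "(u, b) \<in> A\<inverse>" for u using that uout pz by auto
      show "u = z" if "(b, u) \<in> A\<inverse>" for u using that uin pz by auto
    qed
  qed
qed

section \<open>Certificates for small graphs\<close>

text \<open>Vertex names for concrete graphs. Ten suffice: the largest graphs checked are
  \<open>G81e\<close> with two more vertices.\<close>

datatype vx = X0 | X1 | X2 | X3 | X4 | X5 | X6 | X7 | X8 | X9

text \<open>Here and below conditionals take the place of conjunctions and disjunctions, so that
  symbolic evaluation enters only the selected branch.\<close>

fun mem :: "'b \<Rightarrow> 'b list \<Rightarrow> bool" where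
  "mem x [] = False"
| "mem x (y # ys) = (if x = y then True else mem x ys)"

fun sub :: "'b list \<Rightarrow> 'b list \<Rightarrow> bool" where
  "sub [] ys = True"
| "sub (x # xs) ys = (if mem x ys then sub xs ys else False)"

text \<open>One round of breadth-first search: targets of arcs that start in \<open>R0\<close> are
  collected into \<open>R\<close>.\<close>

fun stp :: "('b \<times> 'b) list \<Rightarrow> 'b list \<Rightarrow> 'b list \<Rightarrow> 'b list" where
  "stp [] R0 R = R"
| "stp ((a, b) # A) R0 R = (if mem a R0 then if mem b R then stp A R0 R else stp A R0 (b # R) else stp A R0 R)"

fun rch :: "nat \<Rightarrow> ('b \<times> 'b) list \<Rightarrow> 'b list \<Rightarrow> 'b list" where
  "rch 0 A R = R"
| "rch (Suc k) A R = rch k A (stp A R R)"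

text \<open>\<open>ex\<close> lists the ordered pairs that are granted one step more; for them
  another round of \<open>stp\<close> is tried.\<close>

fun reach1 :: "'b \<Rightarrow> 'b list \<Rightarrow> 'b list \<Rightarrow> ('b \<times> 'b) list \<Rightarrow> ('b \<times> 'b) list \<Rightarrow> bool" where
  "reach1 u R [] A ex = True"
| "reach1 u R (v # vs) A ex = (if mem v R then reach1 u R vs A ex
     else if mem (u, v) ex then if mem v (stp A R R) then reach1 u R vs A ex else False else False)"

fun reach_all :: "'b list \<Rightarrow> ('b \<times> 'b) list \<Rightarrow> nat \<Rightarrow> ('b \<times> 'b) list \<Rightarrow> 'b list \<Rightarrow> bool" where
  "reach_all vs A k ex [] = True"
| "reach_all vs A k ex (u # us) = (if reach1 u (rch k A [u]) vs A ex then reach_all vs A k ex us else False)"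

fun arcs_chk :: "'b list \<Rightarrow> ('b \<times> 'b) list \<Rightarrow> ('b \<times> 'b) list \<Rightarrow> ('b \<times> 'b) list \<Rightarrow> bool" where
  "arcs_chk vs xs A [] = True"
| "arcs_chk vs xs A ((u, v) # B) = (if mem (v, u) A then False else if mem u vs then if mem v vs then
     if mem (u, v) xs then arcs_chk vs xs A B else if mem (v, u) xs then arcs_chk vs xs A B else False else False else False)"

definition ori_chk :: "'b list \<Rightarrow> ('b \<times> 'b) list \<Rightarrow> ('b \<times> 'b) list \<Rightarrow> nat \<Rightarrow> ('b \<times> 'b) list \<Rightarrow> bool" where
  "ori_chk vs xs A k ex = (if arcs_chk vs xs A A then reach_all vs A k ex vs else False)"

definition edg :: "('b \<Rightarrow> 'a) \<Rightarrow> ('b \<times> 'b) list \<Rightarrow> 'a set set" where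
  "edg f xs = (\<lambda>(p, q). {f p, f q}) ` set xs"

text \<open>Equality of the edge sets makes this an isomorphism, so that it can identify the
  exceptional graphs themselves.\<close>

definition emb :: "('b \<Rightarrow> 'a) \<Rightarrow> 'b list \<Rightarrow> ('b \<times> 'b) list \<Rightarrow> 'a set \<Rightarrow> 'a set set \<Rightarrow> bool" where
  "emb f vs xs S F \<longleftrightarrow> inj_on f (set vs) \<and> f ` set vs = S \<and> edg f xs = F"

lemma mem_set[simp]: "mem x xs \<longleftrightarrow> x \<in> set xs" by (induction xs) auto
lemma sub_set[simp]: "sub xs ys \<longleftrightarrow> set xs \<subseteq> set ys" by (induction xs) auto

lemma stp_set: "set (stp A R0 R) \<subseteq> set R \<union> {v. \<exists>u\<in>set R0. (u, v) \<in> set A}"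
proof (induction A R0 R rule: stp.induct)
  case (2 a b A R0 R)
  show ?case
  proof (cases "a \<in> set R0 \<and> b \<notin> set R")
    case True
    hence "set (stp A R0 (b # R)) \<subseteq> set (b # R) \<union> {v. \<exists>u\<in>set R0. (u, v) \<in> set A}" using "2.IH"(2) by simp
    moreover have "b \<in> {v. \<exists>u\<in>set R0. (u, v) \<in> set ((a, b) # A)}" using True by auto
    ultimately show ?thesis using True by auto
  next
    case False
    hence eq: "stp ((a, b) # A) R0 R = stp A R0 R" by simp
    have "set (stp A R0 R) \<subseteq> set R \<union> {v. \<exists>u\<in>set R0. (u, v) \<in> set A}"
      using False "2.IH"(1,3) by (cases "a \<in> set R0") simp_all
    thus ?thesis unfolding eq by auto
  qed
qed simp

lemma stp_reach_in:
  assumes "\<And>w. w \<in> set R \<Longrightarrow> reach_in (set A) j u w" "v \<in> set (stp A R R)"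
  shows "reach_in (set A) (Suc j) u v"
proof -
  from subsetD[OF stp_set assms(2)] consider "v \<in> set R" | w where "w \<in> set R" "(w, v) \<in> set A" by blast
  thus ?thesis
  proof cases
    case 1 thus ?thesis using reach_in_mono[OF assms(1)] by simp
  next
    case 2 thus ?thesis using reach_in_snoc[OF assms(1)] by simp
  qed
qed

lemma rch_reach_in:
  "(\<And>w. w \<in> set R \<Longrightarrow> reach_in (set A) j u w) \<Longrightarrow> v \<in> set (rch k A R) \<Longrightarrow> reach_in (set A) (j + k) u v"
proof (induction k arbitrary: R j)
  case (Suc k)
  have "reach_in (set A) (Suc j + k) u v"
    by (rule Suc.IH[OF _ Suc.prems(2)[unfolded rch.simps]]) (rule stp_reach_in[OF Suc.prems(1)])
  thus ?case by simp
qed simp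

lemma reach1_sound:
  assumes "\<And>w. w \<in> set R \<Longrightarrow> reach_in (set A) k u w"
  shows "reach1 u R vs A ex \<Longrightarrow> v \<in> set vs \<Longrightarrow> reach_in (set A) (if (u, v) \<in> set ex then Suc k else k) u v"
proof (induction vs)
  case (Cons w vs)
  have "reach1 u R vs A ex" using Cons.prems(1) by (simp split: if_splits)
  moreover have "reach_in (set A) (if (u, w) \<in> set ex then Suc k else k) u w"
  proof (cases "w \<in> set R")
    case True thus ?thesis using reach_in_mono[OF assms[OF True]] by simp
  next
    case False thus ?thesis using Cons.prems(1) stp_reach_in[OF assms] by (simp split: if_splits)
  qed
  ultimately show ?case using Cons.IH Cons.prems(2) by (cases "v = w") simp_all
qed simp

lemma reach_all_sound:
  "reach_all vs A k ex us \<Longrightarrow> u \<in> set us \<Longrightarrow> v \<in> set vs \<Longrightarrow> reach_in (set A) (if (u, v) \<in> set ex then Suc k else k) u v"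
proof (induction us)
  case (Cons w us)
  have 1: "reach1 w (rch k A [w]) vs A ex" "reach_all vs A k ex us" using Cons.prems(1) by (simp_all split: if_splits)
  show ?case
  proof (cases "u = w")
    case True
    have "reach_in (set A) k w x" if "x \<in> set (rch k A [w])" for x
      using rch_reach_in[of "[w]" A 0 w x k] that reach_in_refl[of "set A" 0 w] by simp
    thus ?thesis using reach1_sound[OF _ 1(1) Cons.prems(3)] True by simp
  next
    case False thus ?thesis using Cons.IH[OF 1(2)] Cons.prems by simp
  qed
qed simp

lemma arcs_chk_sound:
  "arcs_chk vs xs A B \<Longrightarrow> (u, v) \<in> set B \<Longrightarrow>
    u \<in> set vs \<and> v \<in> set vs \<and> (v, u) \<notin> set A \<and> ((u, v) \<in> set xs \<or> (v, u) \<in> set xs)"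
  by (induction vs xs A B rule: arcs_chk.induct) (auto split: if_splits)

lemma ori_chk_sound:
  assumes c: "ori_chk vs xs A k ex" and f: "inj_on f (set vs)" "f ` set vs = S" "edg f xs \<subseteq> F"
  shows "\<exists>B. arcs_ok S F B \<and> (\<forall>u\<in>set vs. \<forall>v\<in>set vs. reach_in B (if (u, v) \<in> set ex then Suc k else k) (f u) (f v))"
proof -
  have c1: "arcs_chk vs xs A A" and c2: "reach_all vs A k ex vs" using c unfolding ori_chk_def by (simp_all split: if_splits)
  define B where "B = (\<lambda>(u, v). (f u, f v)) ` set A"
  have "arcs_ok S F B" unfolding arcs_ok_def
  proof (intro ballI, clarify)
    fix p q assume "(p, q) \<in> B"
    then obtain u v where uv: "(u, v) \<in> set A" "p = f u" "q = f v" unfolding B_def by auto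
    note s = arcs_chk_sound[OF c1 uv(1)]
    have "{f u, f v} \<in> edg f xs" using s unfolding edg_def by (force simp: insert_commute)
    moreover have "(f v, f u) \<notin> B"
    proof
      assume "(f v, f u) \<in> B"
      then obtain u' v' where u': "(u', v') \<in> set A" "f v = f u'" "f u = f v'" unfolding B_def by auto
      have "v = u'" "u = v'" using inj_onD[OF f(1)] u'(2,3) s arcs_chk_sound[OF c1 u'(1)] by blast+
      thus False using u'(1) s by simp
    qed
    ultimately show "p \<in> S \<and> q \<in> S \<and> {p, q} \<in> F \<and> (q, p) \<notin> B" using s f uv by auto
  qed
  moreover have "reach_in B j (f u) (f v)" if "reach_in (set A) j u v" for j u v
  proof -
    have "(f u, f v) \<in> B ^^ i" if "(u, v) \<in> set A ^^ i" for i
      using that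
    proof (induction i arbitrary: v)
      case (Suc i)
      then obtain w where w: "(u, w) \<in> set A ^^ i" "(w, v) \<in> set A" by auto
      have "(f w, f v) \<in> B" using w(2) unfolding B_def by force
      thus ?case using Suc.IH[OF w(1)] by auto
    qed simp
    thus ?thesis using that unfolding reach_in_def by blast
  qed
  ultimately show ?thesis using reach_all_sound[OF c2] by (intro exI[of _ B]) blast
qed

lemma ori_Good:
  assumes c: "ori_chk vs xs A k []" and f: "inj_on f (set vs)" "f ` set vs = S" "edg f xs \<subseteq> F"
  shows "Good S F k"
  using ori_chk_sound[OF assms] f(2) unfolding Good_def by auto

lemma ori_Alm1:
  assumes c: "ori_chk vs xs A k [(s, t)]" and s: "s \<in> set vs" "t \<in> set vs" and f: "inj_on f (set vs)" "f ` set vs = S" "edg f xs \<subseteq> F"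
  shows "Alm1 S F k"
proof -
  obtain B where B: "arcs_ok S F B"
    "\<And>u v. u \<in> set vs \<Longrightarrow> v \<in> set vs \<Longrightarrow> reach_in B (if (u, v) \<in> set [(s, t)] then Suc k else k) (f u) (f v)"
    using ori_chk_sound[OF c f] by blast
  have "reach_in B (if u = f s \<and> v = f t then k + 1 else k) u v" if uv: "u \<in> S" "v \<in> S" for u v
  proof -
    obtain p q where pq: "p \<in> set vs" "q \<in> set vs" "u = f p" "v = f q" using uv f(2) by blast
    have "(u = f s \<and> v = f t) = (p = s \<and> q = t)" using inj_on_eq_iff[OF f(1)] pq s by metis
    moreover have "((p, q) \<in> set [(s, t)]) = (p = s \<and> q = t)" by simp
    ultimately show ?thesis using B(2)[OF pq(1,2)] pq(3,4) by (simp only: Suc_eq_plus1)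
  qed
  thus ?thesis using B(1) unfolding Alm1_def by blast
qed

lemma ori_AlmS:
  assumes c: "ori_chk vs xs A k (map (Pair s) vs)" and s: "s \<in> set vs" and f: "inj_on f (set vs)" "f ` set vs = S" "edg f xs \<subseteq> F"
  shows "AlmS S F k"
proof -
  obtain B where B: "arcs_ok S F B"
    "\<And>u v. u \<in> set vs \<Longrightarrow> v \<in> set vs \<Longrightarrow> reach_in B (if (u, v) \<in> set (map (Pair s) vs) then Suc k else k) (f u) (f v)"
    using ori_chk_sound[OF c f] by blast
  have "reach_in B (if u = f s then k + 1 else k) u v" if uv: "u \<in> S" "v \<in> S" for u v
  proof -
    obtain p q where pq: "p \<in> set vs" "q \<in> set vs" "u = f p" "v = f q" using uv f(2) by blast
    have "(u = f s) = (p = s)" using inj_on_eq_iff[OF f(1)] pq s by metis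
    moreover have "((p, q) \<in> set (map (Pair s) vs)) = (p = s)" using pq(2) by auto
    ultimately show ?thesis using B(2)[OF pq(1,2)] pq(3,4) by (simp only: Suc_eq_plus1)
  qed
  thus ?thesis using B(1) unfolding AlmS_def by blast
qed

section \<open>Checked isomorphisms and complete lists of 2-trees\<close>

fun lk :: "('b \<times> 'c) list \<Rightarrow> 'b \<Rightarrow> 'c" where
  "lk ((a, b) # ps) x = (if x = a then b else lk ps x)"
| "lk [] x = undefined"

fun mpe :: "('b \<times> 'c) list \<Rightarrow> ('b \<times> 'b) list \<Rightarrow> ('c \<times> 'c) list" where
  "mpe ps [] = []"
| "mpe ps ((p, q) # ys) = (lk ps p, lk ps q) # mpe ps ys"

fun esub :: "('b \<times> 'b) list \<Rightarrow> ('b \<times> 'b) list \<Rightarrow> bool" where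
  "esub [] ys = True"
| "esub ((p, q) # xs) ys = (if mem (p, q) ys then esub xs ys else if mem (q, p) ys then esub xs ys else False)"

fun eqv :: "('b \<times> 'b) list \<Rightarrow> ('b \<times> 'b) list \<Rightarrow> bool" where
  "eqv xs ys = (if esub xs ys then esub ys xs else False)"

text \<open>\<open>\<sigma>\<close> lists the images of \<open>vs\<close>. For distinct
  \<open>vs\<close>, equal length and covering \<open>vs\<close> force a permutation, so only the
  images of the edges remain to be compared.\<close>

definition iso_chk :: "'b list \<Rightarrow> ('b \<times> 'b) list \<Rightarrow> ('b \<times> 'b) list \<Rightarrow> 'b list \<Rightarrow> bool" where
  "iso_chk vs ys zs \<sigma> = (if length \<sigma> = length vs then if sub vs \<sigma> then eqv (mpe (zip vs \<sigma>) ys) zs else False else False)"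

lemma mpe_map: "mpe ps ys = map (\<lambda>(p, q). (lk ps p, lk ps q)) ys" by (induction ps ys rule: mpe.induct) auto

lemma esub_edg: "esub xs ys \<Longrightarrow> edg f xs \<subseteq> edg f ys"
proof (induction xs ys rule: esub.induct)
  case (2 p q xs ys)
  have "(p, q) \<in> set ys \<or> (q, p) \<in> set ys" "esub xs ys" using "2.prems" by (simp_all split: if_splits)
  moreover from this have "{f p, f q} \<in> edg f ys" unfolding edg_def by (force simp: insert_commute)
  moreover have "edg f xs \<subseteq> edg f ys" using 2 by (simp split: if_splits)
  ultimately show ?case by (simp add: edg_def)
qed (simp add: edg_def)

lemma lk_zip: "length \<sigma> = length vs \<Longrightarrow> distinct vs \<Longrightarrow> map (lk (zip vs \<sigma>)) vs = \<sigma>"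
proof (induction vs \<sigma> rule: list_induct2')
  case (4 x xs y ys)
  have "map (lk ((x, y) # zip xs ys)) xs = map (lk (zip xs ys)) xs" using 4 by (intro map_cong) auto
  also have "... = ys" using 4 by simp
  finally show ?case unfolding list.map(2) by simp
qed simp_all

lemma iso_chk_emb:
  assumes c: "iso_chk vs ys zs \<sigma>" and d: "distinct vs" and e: "emb f vs zs S F"
  shows "\<exists>g. emb g vs ys S F"
proof -
  let ?h = "lk (zip vs \<sigma>)"
  have c': "length \<sigma> = length vs" "set vs \<subseteq> set \<sigma>" "eqv (mpe (zip vs \<sigma>) ys) zs"
    using c unfolding iso_chk_def by (simp_all split: if_splits)
  have m: "map ?h vs = \<sigma>" by (rule lk_zip[OF c'(1) d])
  have "card (set \<sigma>) \<le> card (set vs)" using c'(1) d by (metis card_length distinct_card)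
  hence s: "set \<sigma> = set vs" using c'(2) by (metis card_seteq finite_set)
  have im: "?h ` set vs = set vs" using m s by (metis set_map)
  have inj: "inj_on ?h (set vs)" using im by (intro eq_card_imp_inj_on) simp_all
  have "edg f (mpe (zip vs \<sigma>) ys) = edg f zs" using c'(3) esub_edg by (auto split: if_splits)
  moreover have "edg f (mpe (zip vs \<sigma>) ys) = edg (f \<circ> ?h) ys" unfolding mpe_map edg_def by force
  ultimately have "emb (f \<circ> ?h) vs ys S F"
    using e im inj comp_inj_on[of ?h "set vs" f] unfolding emb_def image_comp[symmetric] by simp
  thus ?thesis by blast
qed

text \<open>For each edge of \<open>xs\<close> the certificate names a member of \<open>Ts\<close>
  and an isomorphism from it to the graph with \<open>v\<close> added on that edge.\<close>

fun ext_chk :: "'b list \<Rightarrow> 'b \<Rightarrow> ('b \<times> 'b) list list \<Rightarrow> ('b \<times> 'b) list \<Rightarrow> ('b \<times> 'b) list \<Rightarrow> (nat \<times> 'b list) list \<Rightarrow> bool" where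
  "ext_chk vs v Ts xs [] [] = True"
| "ext_chk vs v Ts xs ((p, q) # es) ((j, \<sigma>) # cs) =
    (if j < length Ts then if iso_chk vs (Ts ! j) ((v, p) # (v, q) # xs) \<sigma> then ext_chk vs v Ts xs es cs else False else False)"
| "ext_chk vs v Ts xs [] (c # cs) = False"
| "ext_chk vs v Ts xs (e # es) [] = False"

fun all_ext_chk :: "'b list \<Rightarrow> 'b \<Rightarrow> ('b \<times> 'b) list list \<Rightarrow> ('b \<times> 'b) list list \<Rightarrow> (nat \<times> 'b list) list list \<Rightarrow> bool" where
  "all_ext_chk vs v Ts [] [] = True"
| "all_ext_chk vs v Ts (xs # L) (c # C) = (if ext_chk vs v Ts xs xs c then all_ext_chk vs v Ts L C else False)"
| "all_ext_chk vs v Ts [] (c # C) = False"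
| "all_ext_chk vs v Ts (xs # L) [] = False"

lemma ext_chk_sound: "ext_chk vs v Ts xs es cs \<Longrightarrow> (p, q) \<in> set es \<Longrightarrow>
   \<exists>ys\<in>set Ts. \<exists>\<sigma>. iso_chk vs ys ((v, p) # (v, q) # xs) \<sigma>"
proof (induction vs v Ts xs es cs rule: ext_chk.induct)
  case (2 vs v Ts xs p' q' es j \<sigma> cs)
  thus ?case by (cases "(p, q) = (p', q')") (auto split: if_splits)
qed auto

lemma all_ext_chk_sound: "all_ext_chk vs v Ts L C \<Longrightarrow> xs \<in> set L \<Longrightarrow> (p, q) \<in> set xs \<Longrightarrow>
   \<exists>ys\<in>set Ts. \<exists>\<sigma>. iso_chk vs ys ((v, p) # (v, q) # xs) \<sigma>"
proof (induction vs v Ts L C rule: all_ext_chk.induct)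
  case (2 vs v Ts ys L c C)
  show ?case
  proof (cases "xs = ys")
    case True
    have "ext_chk vs v Ts ys ys c" using "2.prems"(1) by (simp split: if_splits)
    from ext_chk_sound[OF this] obtain zs \<sigma> where "zs \<in> set Ts" "iso_chk vs zs ((v, p) # (v, q) # ys) \<sigma>"
      using "2.prems"(3) True by blast
    thus ?thesis using True by blast
  next
    case False
    thus ?thesis using "2.IH" "2.prems" by (simp split: if_splits)
  qed
qed auto

text \<open>The last vertex of a 2-tree sits on an edge of a 2-tree with one vertex less. Hence a
  complete list for \<open>n\<close>, extended at all edges and reduced up to isomorphism, is
  complete for \<open>n + 1\<close>.\<close>

lemma tt_ext:
  fixes S :: "'a set"
  assumes H: "\<And>(S :: 'a set) F. tt S F \<Longrightarrow> card S = n \<Longrightarrow> \<exists>xs\<in>set L. \<exists>f. emb f vs xs S F"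
    and c: "all_ext_chk (v # vs) v Ts L C" and d: "distinct (v # vs)" and n: "n \<ge> 2"
    and pq: "\<And>xs p q. xs \<in> set L \<Longrightarrow> (p, q) \<in> set xs \<Longrightarrow> p \<in> set vs \<and> q \<in> set vs"
    and t: "tt S F" "card S = Suc n"
  shows "\<exists>xs\<in>set Ts. \<exists>f. emb f (v # vs) xs S F"
  using t(1)
proof (cases rule: tt.cases)
  case (base a b) thus ?thesis using t(2) n by simp
next
  case (add S' F' a b x)
  have "card S' = n" using t(2) add tt_fin[of S' F'] by simp
  then obtain xs f where f: "xs \<in> set L" "emb f vs xs S' F'" using H[OF add(3)] by blast
  obtain p q where e: "(p, q) \<in> set xs" "{a, b} = {f p, f q}" using f(2) add(4) unfolding emb_def edg_def by auto
  obtain ys \<sigma> where ys: "ys \<in> set Ts" "iso_chk (v # vs) ys ((v, p) # (v, q) # xs) \<sigma>"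
    using all_ext_chk_sound[OF c f(1) e(1)] by blast
  define g where "g = f(v := x)"
  have vn: "v \<notin> set vs" using d by simp
  have gf: "g u = f u" if "u \<in> set vs" for u using that vn unfolding g_def by auto
  have im: "g ` set vs = S'" using gf f(2) unfolding emb_def by auto
  have inj: "inj_on g (set vs)" using gf f(2) unfolding emb_def by (metis inj_on_cong)
  have ed: "edg g xs = F'"
  proof -
    have "(case e of (p, q) \<Rightarrow> {g p, g q}) = (case e of (p, q) \<Rightarrow> {f p, f q})" if "e \<in> set xs" for e
      using pq[OF f(1), of "fst e" "snd e"] that gf by (auto simp: split_beta)
    thus ?thesis using f(2) unfolding emb_def edg_def by (metis (no_types, lifting) image_cong)
  qed
  have gv: "g v = x" unfolding g_def by simp
  have "edg g ((v, p) # (v, q) # xs) = insert {x, f p} (insert {x, f q} F')"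
    using ed gv gf pq[OF f(1) e(1)] unfolding edg_def by simp
  also have "... = F"
  proof -
    have "(a = f p \<and> b = f q) \<or> (a = f q \<and> b = f p)" using e(2) by (metis doubleton_eq_iff)
    thus ?thesis using add(2) insert_commute[of "{x, f p}" "{x, f q}" F'] by (elim disjE) simp_all
  qed
  finally have "emb g (v # vs) ((v, p) # (v, q) # xs) S F"
    using inj im gv add(1,6) vn unfolding emb_def by simp
  thus ?thesis using iso_chk_emb[OF ys(2) d] ys(1) by blast
qed

fun good_all :: "'b list \<Rightarrow> nat \<Rightarrow> ('b \<times> 'b) list list \<Rightarrow> ('b \<times> 'b) list list \<Rightarrow> bool" where
  "good_all vs k [] [] = True"
| "good_all vs k (xs # L) (A # C) = (if ori_chk vs xs A k [] then good_all vs k L C else False)"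
| "good_all vs k [] (A # C) = False"
| "good_all vs k (xs # L) [] = False"

lemma good_all_sound: "good_all vs k L C \<Longrightarrow> xs \<in> set L \<Longrightarrow> \<exists>A. ori_chk vs xs A k []"
  by (induction vs k L C rule: good_all.induct) (auto split: if_splits)

lemma good_all_emb: "good_all vs k L C \<Longrightarrow> xs \<in> set L \<Longrightarrow> emb f vs xs S F \<Longrightarrow> F \<subseteq> F' \<Longrightarrow> Good S F' k"
  using good_all_sound ori_Good unfolding emb_def by metis

fun verts_chk :: "'b list \<Rightarrow> ('b \<times> 'b) list \<Rightarrow> bool" where
  "verts_chk vs [] = True"
| "verts_chk vs ((p, q) # xs) = (if mem p vs then if mem q vs then verts_chk vs xs else False else False)"

fun verts_chk_all :: "'b list \<Rightarrow> ('b \<times> 'b) list list \<Rightarrow> bool" where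
  "verts_chk_all vs [] = True"
| "verts_chk_all vs (xs # L) = (if verts_chk vs xs then verts_chk_all vs L else False)"

lemma verts_chk_sound: "verts_chk vs xs \<Longrightarrow> (p, q) \<in> set xs \<Longrightarrow> p \<in> set vs \<and> q \<in> set vs"
  by (induction vs xs rule: verts_chk.induct) (auto split: if_splits)
lemma verts_chk_all_sound: "verts_chk_all vs L \<Longrightarrow> xs \<in> set L \<Longrightarrow> (p, q) \<in> set xs \<Longrightarrow> p \<in> set vs \<and> q \<in> set vs"
  by (induction vs L rule: verts_chk_all.induct) (auto split: if_splits dest: verts_chk_sound)

section \<open>Supergraphs on the same vertex set\<close>

fun nonedges1 :: "'b \<Rightarrow> 'b list \<Rightarrow> ('b \<times> 'b) list \<Rightarrow> ('b \<times> 'b) list" where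
  "nonedges1 v [] xs = []"
| "nonedges1 v (w # ws) xs = (if mem (v, w) xs then nonedges1 v ws xs else if mem (w, v) xs then nonedges1 v ws xs
     else (v, w) # nonedges1 v ws xs)"

fun nonedges :: "'b list \<Rightarrow> ('b \<times> 'b) list \<Rightarrow> ('b \<times> 'b) list" where
  "nonedges [] xs = []"
| "nonedges (v # vs) xs = nonedges1 v vs xs @ nonedges vs xs"

lemma nonedges1_cover: "q \<in> set vs \<Longrightarrow> (p, q) \<in> set (nonedges1 p vs xs) \<or> (p, q) \<in> set xs \<or> (q, p) \<in> set xs"
  by (induction vs) auto

lemma nonedges_cover: "p \<in> set vs \<Longrightarrow> q \<in> set vs \<Longrightarrow> p \<noteq> q \<Longrightarrow> (p, q) \<notin> set xs \<Longrightarrow> (q, p) \<notin> set xs \<Longrightarrow>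
   (p, q) \<in> set (nonedges vs xs) \<or> (q, p) \<in> set (nonedges vs xs)"
proof (induction vs)
  case (Cons v vs)
  show ?case using Cons nonedges1_cover[of q vs p xs] nonedges1_cover[of p vs q xs] by auto
qed simp

lemma emb_super:
  assumes e: "emb f vs xs S F" "F \<subseteq> G" "F \<noteq> G" and G: "\<And>a. a \<in> G \<Longrightarrow> card a = 2 \<and> a \<subseteq> S"
  shows "\<exists>pq\<in>set (nonedges vs xs). \<exists>F'. emb f vs (pq # xs) S F' \<and> F' \<subseteq> G"
proof -
  obtain a where a: "a \<in> G" "a \<notin> F" using e(2,3) by blast
  obtain u v where uv: "a = {u, v}" "u \<noteq> v" using G[OF a(1)] by (metis card_2_iff)
  obtain p q where pq: "p \<in> set vs" "q \<in> set vs" "u = f p" "v = f q" using G[OF a(1)] uv e(1) unfolding emb_def by auto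
  have no: "(p, q) \<notin> set xs" "(q, p) \<notin> set xs"
    using a(2) e(1) uv pq unfolding emb_def edg_def by (force simp: insert_commute)+
  have "p \<noteq> q" using uv pq by auto
  then consider "(p, q) \<in> set (nonedges vs xs)" | "(q, p) \<in> set (nonedges vs xs)" using nonedges_cover[OF pq(1,2) _ no] by blast
  thus ?thesis
  proof cases
    case 1
    have "emb f vs ((p, q) # xs) S (insert a F)" using e(1) uv pq unfolding emb_def edg_def by simp
    thus ?thesis using 1 a(1) e(2) by blast
  next
    case 2
    have "emb f vs ((q, p) # xs) S (insert a F)" using e(1) uv pq unfolding emb_def edg_def by (simp add: insert_commute)
    thus ?thesis using 2 a(1) e(2) by blast
  qed
qed

text \<open>For each missing edge \<open>e\<close> the certificate shows what adding it leads to: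
  \<open>Inl\<close> an orientation within the bound \<open>k\<close>, or \<open>Inr\<close> an
  isomorphism to another exceptional graph in \<open>Ts\<close>, whose own supergraphs are examined
  separately.\<close>

fun sup_chk :: "'b list \<Rightarrow> nat \<Rightarrow> ('b \<times> 'b) list list \<Rightarrow> ('b \<times> 'b) list \<Rightarrow> ('b \<times> 'b) list \<Rightarrow>
    (('b \<times> 'b) list + nat \<times> 'b list) list \<Rightarrow> bool" where
  "sup_chk vs k Ts xs [] [] = True"
| "sup_chk vs k Ts xs (e # es) (Inl A # cs) = (if ori_chk vs (e # xs) A k [] then sup_chk vs k Ts xs es cs else False)"
| "sup_chk vs k Ts xs (e # es) (Inr (j, \<sigma>) # cs) =
    (if j < length Ts then if iso_chk vs (Ts ! j) (e # xs) \<sigma> then sup_chk vs k Ts xs es cs else False else False)"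
| "sup_chk vs k Ts xs [] (c # cs) = False"
| "sup_chk vs k Ts xs (e # es) [] = False"

lemma sup_chk_sound: "sup_chk vs k Ts xs es cs \<Longrightarrow> e \<in> set es \<Longrightarrow>
   (\<exists>A. ori_chk vs (e # xs) A k []) \<or> (\<exists>ys\<in>set Ts. \<exists>\<sigma>. iso_chk vs ys (e # xs) \<sigma>)"
proof (induction vs k Ts xs es cs rule: sup_chk.induct)
  case (2 vs k Ts xs e' es A cs)
  thus ?case by (cases "e = e'") (auto split: if_splits)
next
  case (3 vs k Ts xs e' es j \<sigma> cs)
  thus ?case by (cases "e = e'") (auto split: if_splits)
qed auto

text \<open>It is enough to add one edge at a time, since an orientation that is good for a subgraph
  on the same vertices is good for \<open>G\<close>.\<close>

lemma sup_step:
  assumes c: "sup_chk vs k Ts xs (nonedges vs xs) cs" and d: "distinct vs"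
    and e: "emb f vs xs S F" "F \<subseteq> G" and G: "\<And>a. a \<in> G \<Longrightarrow> card a = 2 \<and> a \<subseteq> S"
  shows "F = G \<or> Good S G k \<or> (\<exists>ys\<in>set Ts. \<exists>f F'. emb f vs ys S F' \<and> F' \<subseteq> G)"
proof (cases "F = G")
  case False
  obtain pq F' where pq: "pq \<in> set (nonedges vs xs)" "emb f vs (pq # xs) S F'" "F' \<subseteq> G"
    using emb_super[OF e False G] by blast
  from sup_chk_sound[OF c pq(1)] show ?thesis
  proof (elim disjE exE bexE)
    fix A assume "ori_chk vs (pq # xs) A k []"
    from ori_Good[OF this] have "Good S G k" using pq(2,3) unfolding emb_def by blast
    thus ?thesis by simp
  next
    fix ys \<sigma> assume "ys \<in> set Ts" "iso_chk vs ys (pq # xs) \<sigma>"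
    thus ?thesis using iso_chk_emb[OF _ d pq(2)] pq(3) by blast
  qed
qed simp

section \<open>Exceptional graphs and lists of all 2-trees on two to eight vertices\<close>

definition "W5e = [(X0, X1), (X1, X2), (X2, X3), (X3, X4), (X4, X0), (X5, X0), (X5, X1), (X5, X2), (X5, X3), (X5, X4)]"
definition "G63e = [(X0, X1), (X1, X2), (X2, X0), (X3, X0), (X3, X1), (X3, X2), (X1, X4), (X2, X4), (X4, X5), (X1, X5)]"
definition "K4e = [(X0, X1), (X0, X2), (X0, X3), (X1, X2), (X1, X3), (X2, X3)]"

definition "K4me = [(X0, X1), (X0, X2), (X0, X3), (X1, X2), (X1, X3)]"
definition "G61e = [(X0, X1), (X1, X2), (X2, X3), (X3, X4), (X5, X0), (X5, X1), (X5, X2), (X5, X3), (X5, X4)]"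
definition "G62e = [(X0, X1), (X1, X2), (X2, X3), (X3, X4), (X4, X5), (X5, X0), (X0, X2), (X0, X3), (X3, X5)]"
text \<open>\<open>X1\<close>, \<open>X2\<close>, \<open>X3\<close> form the three triangles on the
  edge \<open>X4 X5\<close>, and \<open>X0\<close> is the ear on \<open>X3 X5\<close>: the
  exceptional 2-tree that is not a disc.\<close>

definition "B6e = [(X0, X3), (X1, X4), (X2, X4), (X3, X4), (X0, X5), (X1, X5), (X2, X5), (X3, X5), (X4, X5)]"
definition "G81e = [(X0, X1), (X1, X2), (X2, X3), (X3, X4), (X4, X5), (X5, X6), (X6, X7), (X7, X0), (X1, X7), (X2, X7), (X3, X7), (X3, X5), (X3, X6)]"
definition "T2 = [[(X0, X1)]]"

definition "T3 = [[(X0, X1), (X0, X2), (X1, X2)]]"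

definition "T4 = [K4me]"

definition "T5 = [[(X0, X3), (X1, X3), (X2, X3), (X0, X4), (X1, X4), (X2, X4), (X3, X4)],
   [(X0, X2), (X1, X3), (X2, X3), (X0, X4), (X1, X4), (X2, X4), (X3, X4)]]"

text \<open>The exceptional 2-trees stand first, here and in \<open>T8\<close>, so that
  \<open>drop\<close> leaves those that meet the bound.\<close>

definition "T6 = [G61e,
   G62e,
   B6e,
   [(X0, X4), (X1, X4), (X2, X4), (X3, X4), (X0, X5), (X1, X5), (X2, X5), (X3, X5), (X4, X5)],
   [(X0, X3), (X1, X3), (X0, X4), (X2, X4), (X3, X4), (X1, X5), (X2, X5), (X3, X5), (X4, X5)]]"

definition "T7 = [[(X0, X5), (X1, X5), (X2, X5), (X3, X5), (X4, X5), (X0, X6), (X1, X6), (X2, X6), (X3, X6), (X4, X6), (X5, X6)],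
   [(X0, X4), (X1, X5), (X2, X5), (X3, X5), (X4, X5), (X0, X6), (X1, X6), (X2, X6), (X3, X6), (X4, X6), (X5, X6)],
   [(X0, X4), (X1, X4), (X2, X5), (X3, X5), (X4, X5), (X0, X6), (X1, X6), (X2, X6), (X3, X6), (X4, X6), (X5, X6)],
   [(X0, X4), (X1, X4), (X0, X5), (X2, X5), (X3, X5), (X4, X5), (X1, X6), (X2, X6), (X3, X6), (X4, X6), (X5, X6)],
   [(X0, X3), (X1, X4), (X2, X5), (X3, X5), (X4, X5), (X0, X6), (X1, X6), (X2, X6), (X3, X6), (X4, X6), (X5, X6)],
   [(X0, X3), (X1, X4), (X0, X5), (X2, X5), (X3, X5), (X4, X5), (X1, X6), (X2, X6), (X3, X6), (X4, X6), (X5, X6)],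
   [(X0, X3), (X1, X4), (X2, X4), (X0, X5), (X3, X5), (X4, X5), (X1, X6), (X2, X6), (X3, X6), (X4, X6), (X5, X6)],
   [(X0, X3), (X1, X4), (X2, X4), (X1, X5), (X3, X5), (X4, X5), (X0, X6), (X2, X6), (X3, X6), (X4, X6), (X5, X6)],
   [(X0, X3), (X3, X4), (X1, X5), (X2, X5), (X4, X5), (X0, X6), (X1, X6), (X2, X6), (X3, X6), (X4, X6), (X5, X6)],
   [(X0, X2), (X1, X3), (X2, X4), (X3, X5), (X4, X5), (X0, X6), (X1, X6), (X2, X6), (X3, X6), (X4, X6), (X5, X6)],
   [(X0, X2), (X1, X3), (X0, X4), (X2, X4), (X1, X5), (X3, X5), (X4, X5), (X2, X6), (X3, X6), (X4, X6), (X5, X6)],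
   [(X1, X2), (X0, X3), (X2, X4), (X0, X5), (X3, X5), (X4, X5), (X1, X6), (X2, X6), (X3, X6), (X4, X6), (X5, X6)]]"

definition "T8 = [G81e,
   [(X0, X6), (X1, X6), (X2, X6), (X3, X6), (X4, X6), (X5, X6), (X0, X7), (X1, X7), (X2, X7), (X3, X7), (X4, X7), (X5, X7), (X6, X7)],
   [(X0, X5), (X1, X6), (X2, X6), (X3, X6), (X4, X6), (X5, X6), (X0, X7), (X1, X7), (X2, X7), (X3, X7), (X4, X7), (X5, X7), (X6, X7)],
   [(X0, X5), (X1, X5), (X2, X6), (X3, X6), (X4, X6), (X5, X6), (X0, X7), (X1, X7), (X2, X7), (X3, X7), (X4, X7), (X5, X7), (X6, X7)],
   [(X0, X5), (X1, X5), (X0, X6), (X2, X6), (X3, X6), (X4, X6), (X5, X6), (X1, X7), (X2, X7), (X3, X7), (X4, X7), (X5, X7), (X6, X7)],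
   [(X0, X5), (X1, X5), (X2, X5), (X0, X6), (X3, X6), (X4, X6), (X5, X6), (X1, X7), (X2, X7), (X3, X7), (X4, X7), (X5, X7), (X6, X7)],
   [(X0, X5), (X1, X5), (X4, X5), (X2, X6), (X3, X6), (X4, X6), (X0, X7), (X1, X7), (X2, X7), (X3, X7), (X4, X7), (X5, X7), (X6, X7)],
   [(X0, X4), (X1, X5), (X2, X6), (X3, X6), (X4, X6), (X5, X6), (X0, X7), (X1, X7), (X2, X7), (X3, X7), (X4, X7), (X5, X7), (X6, X7)],
   [(X0, X4), (X1, X5), (X0, X6), (X2, X6), (X3, X6), (X4, X6), (X5, X6), (X1, X7), (X2, X7), (X3, X7), (X4, X7), (X5, X7), (X6, X7)],
   [(X0, X4), (X1, X5), (X2, X5), (X3, X6), (X4, X6), (X5, X6), (X0, X7), (X1, X7), (X2, X7), (X3, X7), (X4, X7), (X5, X7), (X6, X7)],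
   [(X0, X4), (X1, X5), (X2, X5), (X0, X6), (X3, X6), (X4, X6), (X5, X6), (X1, X7), (X2, X7), (X3, X7), (X4, X7), (X5, X7), (X6, X7)],
   [(X0, X4), (X1, X5), (X2, X5), (X1, X6), (X3, X6), (X4, X6), (X5, X6), (X0, X7), (X2, X7), (X3, X7), (X4, X7), (X5, X7), (X6, X7)],
   [(X0, X4), (X1, X5), (X2, X5), (X3, X5), (X0, X6), (X1, X6), (X4, X6), (X5, X6), (X2, X7), (X3, X7), (X4, X7), (X5, X7), (X6, X7)],
   [(X0, X4), (X4, X5), (X1, X6), (X2, X6), (X3, X6), (X5, X6), (X0, X7), (X1, X7), (X2, X7), (X3, X7), (X4, X7), (X5, X7), (X6, X7)],
   [(X0, X4), (X0, X5), (X4, X5), (X1, X6), (X2, X6), (X3, X6), (X5, X6), (X1, X7), (X2, X7), (X3, X7), (X4, X7), (X5, X7), (X6, X7)],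
   [(X0, X4), (X1, X5), (X4, X5), (X1, X6), (X2, X6), (X3, X6), (X5, X6), (X0, X7), (X2, X7), (X3, X7), (X4, X7), (X5, X7), (X6, X7)],
   [(X0, X4), (X1, X4), (X2, X5), (X3, X5), (X0, X6), (X4, X6), (X5, X6), (X1, X7), (X2, X7), (X3, X7), (X4, X7), (X5, X7), (X6, X7)],
   [(X0, X4), (X1, X4), (X2, X5), (X3, X5), (X0, X6), (X1, X6), (X4, X6), (X5, X6), (X2, X7), (X3, X7), (X4, X7), (X5, X7), (X6, X7)],
   [(X0, X4), (X1, X4), (X2, X5), (X3, X5), (X0, X6), (X2, X6), (X4, X6), (X5, X6), (X1, X7), (X3, X7), (X4, X7), (X5, X7), (X6, X7)],
   [(X0, X3), (X1, X5), (X2, X5), (X4, X5), (X0, X6), (X3, X6), (X4, X6), (X1, X7), (X2, X7), (X3, X7), (X4, X7), (X5, X7), (X6, X7)],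
   [(X0, X3), (X1, X4), (X2, X5), (X3, X6), (X4, X6), (X5, X6), (X0, X7), (X1, X7), (X2, X7), (X3, X7), (X4, X7), (X5, X7), (X6, X7)],
   [(X0, X3), (X1, X4), (X2, X5), (X0, X6), (X3, X6), (X4, X6), (X5, X6), (X1, X7), (X2, X7), (X3, X7), (X4, X7), (X5, X7), (X6, X7)],
   [(X0, X3), (X1, X4), (X3, X5), (X2, X6), (X4, X6), (X5, X6), (X0, X7), (X1, X7), (X2, X7), (X3, X7), (X4, X7), (X5, X7), (X6, X7)],
   [(X0, X3), (X1, X4), (X0, X5), (X3, X5), (X2, X6), (X4, X6), (X5, X6), (X1, X7), (X2, X7), (X3, X7), (X4, X7), (X5, X7), (X6, X7)],
   [(X0, X3), (X1, X4), (X0, X5), (X3, X5), (X1, X6), (X2, X6), (X4, X6), (X5, X6), (X2, X7), (X3, X7), (X4, X7), (X5, X7), (X6, X7)],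
   [(X0, X3), (X1, X4), (X2, X5), (X3, X5), (X2, X6), (X4, X6), (X5, X6), (X0, X7), (X1, X7), (X3, X7), (X4, X7), (X5, X7), (X6, X7)],
   [(X0, X3), (X1, X4), (X2, X5), (X3, X5), (X1, X6), (X2, X6), (X4, X6), (X5, X6), (X0, X7), (X3, X7), (X4, X7), (X5, X7), (X6, X7)],
   [(X0, X3), (X1, X4), (X3, X5), (X4, X5), (X0, X6), (X2, X6), (X3, X6), (X5, X6), (X1, X7), (X2, X7), (X4, X7), (X5, X7), (X6, X7)],
   [(X0, X3), (X1, X4), (X2, X4), (X0, X5), (X3, X5), (X1, X6), (X4, X6), (X5, X6), (X2, X7), (X3, X7), (X4, X7), (X5, X7), (X6, X7)],
   [(X0, X3), (X1, X4), (X2, X4), (X0, X5), (X3, X5), (X3, X6), (X4, X6), (X5, X6), (X1, X7), (X2, X7), (X4, X7), (X5, X7), (X6, X7)],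
   [(X0, X3), (X3, X4), (X1, X5), (X2, X5), (X1, X6), (X4, X6), (X5, X6), (X0, X7), (X2, X7), (X3, X7), (X4, X7), (X5, X7), (X6, X7)],
   [(X0, X3), (X3, X4), (X1, X5), (X2, X5), (X1, X6), (X2, X6), (X4, X6), (X5, X6), (X0, X7), (X3, X7), (X4, X7), (X5, X7), (X6, X7)],
   [(X0, X3), (X3, X4), (X4, X5), (X1, X6), (X2, X6), (X5, X6), (X0, X7), (X1, X7), (X2, X7), (X3, X7), (X4, X7), (X5, X7), (X6, X7)],
   [(X1, X3), (X0, X4), (X3, X5), (X0, X6), (X2, X6), (X4, X6), (X5, X6), (X1, X7), (X2, X7), (X3, X7), (X4, X7), (X5, X7), (X6, X7)],
   [(X0, X2), (X1, X3), (X0, X5), (X2, X5), (X4, X5), (X1, X6), (X3, X6), (X4, X6), (X2, X7), (X3, X7), (X4, X7), (X5, X7), (X6, X7)],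
   [(X0, X2), (X1, X3), (X2, X4), (X3, X5), (X4, X6), (X5, X6), (X0, X7), (X1, X7), (X2, X7), (X3, X7), (X4, X7), (X5, X7), (X6, X7)],
   [(X0, X2), (X1, X3), (X0, X4), (X2, X4), (X1, X5), (X3, X5), (X2, X6), (X4, X6), (X5, X6), (X3, X7), (X4, X7), (X5, X7), (X6, X7)],
   [(X1, X2), (X0, X3), (X2, X4), (X0, X5), (X3, X5), (X3, X6), (X4, X6), (X5, X6), (X1, X7), (X2, X7), (X4, X7), (X5, X7), (X6, X7)],
   [(X1, X2), (X0, X3), (X2, X4), (X4, X5), (X0, X6), (X3, X6), (X5, X6), (X1, X7), (X2, X7), (X3, X7), (X4, X7), (X5, X7), (X6, X7)]]"

section \<open>Evaluated certificates\<close>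

lemma ext_T3: "all_ext_chk [X2, X1, X0] X2 T3 T2
  [[(0, [X2, X1, X0])]]"
  by code_simp

lemma ext_T4: "all_ext_chk [X3, X2, X1, X0] X3 T4 T3
  [[(0, [X3, X2, X1, X0]), (0, [X3, X1, X2, X0]), (0, [X3, X0, X2, X1])]]"
  by code_simp

lemma ext_T5: "all_ext_chk [X4, X3, X2, X1, X0] X4 T5 T4
  [[(0, [X1, X0, X4, X3, X2]), (1, [X0, X2, X1, X4, X3]), (1, [X0, X3, X1, X4, X2]), (1, [X1, X2, X0, X4, X3]), (1, [X1, X3, X0, X4, X2])]]"
  by code_simp

lemma ext_T6: "all_ext_chk [X5, X4, X3, X2, X1, X0] X5 T6 T5
  [[(2, [X3, X4, X0, X2, X1, X5]), (2, [X3, X4, X1, X2, X0, X5]), (2, [X3, X4, X2, X1, X0, X5]), (2, [X4, X3, X0, X2, X1, X5]), (2, [X4, X3, X1, X2, X0, X5]), (2, [X4, X3, X2, X1, X0, X5]), (3, [X4, X3, X5, X2, X1, X0])],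
   [(1, [X0, X5, X2, X3, X1, X4]), (1, [X1, X5, X3, X2, X0, X4]), (4, [X3, X2, X4, X5, X1, X0]), (0, [X4, X5, X0, X2, X3, X1]), (0, [X4, X5, X1, X3, X2, X0]), (2, [X4, X2, X3, X5, X0, X1]), (2, [X4, X3, X2, X5, X1, X0])]]"
  by code_simp

lemma ext_T7: "all_ext_chk [X6, X5, X4, X3, X2, X1, X0] X6 T7 T6
  [[(11, [X5, X1, X2, X0, X3, X4, X6]), (7, [X5, X2, X1, X3, X0, X6, X4]), (7, [X5, X2, X3, X1, X4, X6, X0]), (11, [X5, X3, X2, X4, X1, X0, X6]), (9, [X5, X1, X2, X0, X3, X6, X4]), (8, [X5, X1, X2, X3, X6, X0, X4]), (4, [X5, X2, X3, X1, X6, X4, X0]), (8, [X5, X3, X2, X1, X6, X4, X0]), (9, [X5, X3, X2, X4, X1, X6, X0])],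
   [(11, [X0, X3, X2, X5, X1, X6, X4]), (10, [X0, X2, X3, X1, X5, X6, X4]), (7, [X3, X0, X2, X5, X6, X1, X4]), (11, [X3, X0, X5, X2, X4, X6, X1]), (10, [X3, X5, X0, X4, X2, X6, X1]), (7, [X0, X3, X5, X2, X6, X4, X1]), (6, [X0, X3, X2, X5, X6, X1, X4]), (5, [X3, X0, X5, X2, X6, X4, X1]), (6, [X3, X0, X5, X2, X6, X4, X1])],
   [(6, [X5, X3, X4, X0, X2, X1, X6]), (5, [X4, X5, X1, X3, X2, X6, X0]), (5, [X4, X5, X2, X3, X1, X6, X0]), (3, [X4, X5, X3, X2, X1, X6, X0]), (8, [X5, X4, X3, X0, X2, X1, X6]), (4, [X5, X4, X1, X3, X2, X6, X0]), (4, [X5, X4, X2, X3, X1, X6, X0]), (2, [X5, X4, X3, X2, X1, X6, X0]), (1, [X5, X4, X3, X6, X2, X1, X0])],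
   [(1, [X4, X5, X0, X3, X2, X1, X6]), (1, [X4, X5, X1, X3, X2, X0, X6]), (1, [X4, X5, X2, X3, X1, X0, X6]), (1, [X4, X5, X3, X2, X1, X0, X6]), (1, [X5, X4, X0, X3, X2, X1, X6]), (1, [X5, X4, X1, X3, X2, X0, X6]), (1, [X5, X4, X2, X3, X1, X0, X6]), (1, [X5, X4, X3, X2, X1, X0, X6]), (0, [X5, X4, X6, X3, X2, X1, X0])],
   [(7, [X3, X4, X5, X0, X1, X2, X6]), (7, [X3, X5, X4, X1, X0, X2, X6]), (7, [X4, X3, X5, X0, X2, X1, X6]), (7, [X4, X5, X3, X2, X0, X1, X6]), (3, [X4, X3, X5, X6, X0, X2, X1]), (7, [X5, X3, X4, X1, X2, X0, X6]), (7, [X5, X4, X3, X2, X1, X0, X6]), (3, [X5, X3, X4, X6, X1, X2, X0]), (3, [X5, X4, X3, X6, X2, X1, X0])]]"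
  by code_simp

lemma ext_T8: "all_ext_chk [X7, X6, X5, X4, X3, X2, X1, X0] X7 T8 T7
  [[(2, [X5, X6, X0, X4, X3, X2, X1, X7]), (2, [X5, X6, X1, X4, X3, X2, X0, X7]), (2, [X5, X6, X2, X4, X3, X1, X0, X7]), (2, [X5, X6, X3, X4, X2, X1, X0, X7]), (2, [X5, X6, X4, X3, X2, X1, X0, X7]), (2, [X6, X5, X0, X4, X3, X2, X1, X7]), (2, [X6, X5, X1, X4, X3, X2, X0, X7]), (2, [X6, X5, X2, X4, X3, X1, X0, X7]), (2, [X6, X5, X3, X4, X2, X1, X0, X7]), (2, [X6, X5, X4, X3, X2, X1, X0, X7]), (1, [X6, X5, X7, X4, X3, X2, X1, X0])],
   [(14, [X6, X5, X4, X0, X3, X2, X1, X7]), (8, [X5, X6, X1, X4, X3, X2, X7, X0]), (8, [X5, X6, X2, X4, X3, X1, X7, X0]), (8, [X5, X6, X3, X4, X2, X1, X7, X0]), (4, [X5, X6, X4, X3, X2, X1, X7, X0]), (13, [X6, X5, X4, X0, X3, X2, X1, X7]), (7, [X6, X5, X1, X4, X3, X2, X7, X0]), (7, [X6, X5, X2, X4, X3, X1, X7, X0]), (7, [X6, X5, X3, X4, X2, X1, X7, X0]), (3, [X6, X5, X4, X3, X2, X1, X7, X0]), (2, [X6, X5, X4, X7, X3, X2, X1, X0])],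
   [(10, [X6, X4, X5, X0, X1, X3, X2, X7]), (10, [X6, X4, X5, X1, X0, X3, X2, X7]), (10, [X6, X5, X4, X2, X3, X1, X0, X7]), (10, [X6, X5, X4, X3, X2, X1, X0, X7]), (5, [X6, X5, X4, X3, X2, X1, X0, X7]), (9, [X6, X4, X5, X0, X1, X3, X2, X7]), (9, [X6, X4, X5, X1, X0, X3, X2, X7]), (9, [X6, X5, X4, X2, X3, X1, X0, X7]), (9, [X6, X5, X4, X3, X2, X1, X0, X7]), (3, [X6, X4, X5, X7, X1, X0, X3, X2]), (3, [X6, X5, X4, X7, X3, X2, X1, X0])],
   [(12, [X5, X4, X6, X0, X3, X2, X1, X7]), (12, [X6, X4, X5, X1, X3, X2, X0, X7]), (15, [X5, X6, X4, X0, X3, X2, X1, X7]), (11, [X5, X6, X4, X2, X3, X0, X1, X7]), (11, [X5, X6, X4, X3, X2, X0, X1, X7]), (5, [X5, X6, X4, X3, X2, X7, X0, X1]), (15, [X6, X5, X4, X1, X3, X2, X0, X7]), (11, [X6, X5, X4, X2, X3, X1, X0, X7]), (11, [X6, X5, X4, X3, X2, X1, X0, X7]), (5, [X6, X5, X4, X3, X2, X7, X1, X0]), (4, [X6, X5, X4, X7, X3, X2, X1, X0])],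
   [(23, [X6, X5, X3, X4, X0, X2, X1, X7]), (23, [X6, X5, X4, X3, X1, X2, X0, X7]), (21, [X6, X5, X4, X3, X2, X1, X0, X7]), (11, [X6, X5, X3, X4, X2, X0, X7, X1]), (11, [X6, X5, X4, X3, X2, X1, X7, X0]), (22, [X6, X5, X3, X4, X0, X2, X1, X7]), (22, [X6, X5, X4, X3, X1, X2, X0, X7]), (20, [X6, X5, X2, X4, X3, X7, X1, X0]), (9, [X6, X5, X3, X4, X2, X7, X0, X1]), (9, [X6, X5, X4, X3, X2, X7, X1, X0]), (7, [X6, X5, X4, X3, X7, X2, X1, X0])],
   [(24, [X5, X6, X3, X4, X0, X2, X1, X7]), (24, [X6, X5, X4, X3, X1, X2, X0, X7]), (33, [X5, X6, X3, X4, X0, X2, X7, X1]), (21, [X5, X6, X2, X3, X4, X7, X0, X1]), (10, [X5, X6, X3, X4, X2, X7, X0, X1]), (11, [X5, X6, X4, X3, X2, X7, X1, X0]), (33, [X6, X5, X4, X3, X1, X2, X7, X0]), (21, [X6, X5, X2, X4, X3, X7, X1, X0]), (11, [X6, X5, X3, X4, X2, X7, X0, X1]), (10, [X6, X5, X4, X3, X2, X7, X1, X0]), (8, [X6, X5, X4, X3, X7, X2, X1, X0])],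
   [(29, [X6, X5, X3, X4, X0, X2, X1, X7]), (24, [X6, X4, X5, X1, X3, X2, X7, X0]), (24, [X6, X4, X5, X2, X3, X1, X7, X0]), (31, [X5, X6, X4, X3, X0, X2, X1, X7]), (17, [X6, X5, X4, X3, X2, X1, X7, X0]), (12, [X6, X5, X4, X3, X2, X1, X7, X0]), (23, [X6, X4, X5, X1, X3, X2, X7, X0]), (23, [X6, X4, X5, X2, X3, X1, X7, X0]), (16, [X6, X5, X4, X3, X2, X1, X7, X0]), (14, [X6, X4, X5, X3, X7, X2, X1, X0]), (10, [X6, X5, X4, X3, X7, X2, X1, X0])],
   [(28, [X6, X5, X3, X4, X0, X2, X1, X7]), (27, [X4, X6, X5, X1, X3, X2, X7, X0]), (26, [X6, X4, X5, X2, X3, X1, X7, X0]), (26, [X5, X6, X4, X3, X1, X2, X0, X7]), (18, [X5, X6, X4, X3, X1, X2, X7, X0]), (12, [X5, X6, X4, X3, X7, X1, X2, X0]), (30, [X6, X5, X4, X3, X0, X2, X1, X7]), (25, [X6, X4, X5, X2, X3, X1, X7, X0]), (16, [X6, X5, X3, X4, X7, X0, X2, X1]), (15, [X6, X4, X5, X3, X7, X2, X1, X0]), (11, [X6, X5, X4, X3, X7, X2, X1, X0])],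
   [(19, [X6, X3, X5, X4, X0, X2, X1, X7]), (16, [X6, X4, X5, X3, X2, X1, X0, X7]), (33, [X6, X5, X4, X1, X3, X2, X0, X7]), (33, [X6, X5, X4, X2, X3, X1, X0, X7]), (15, [X6, X5, X4, X3, X2, X1, X7, X0]), (32, [X6, X5, X4, X3, X0, X2, X1, X7]), (22, [X6, X5, X4, X1, X3, X2, X7, X0]), (22, [X6, X5, X4, X2, X3, X1, X7, X0]), (6, [X6, X5, X3, X4, X2, X1, X7, X0]), (9, [X6, X4, X5, X3, X7, X2, X1, X0]), (13, [X6, X5, X4, X3, X7, X2, X1, X0])],
   [(38, [X6, X2, X4, X5, X0, X3, X1, X7]), (38, [X6, X3, X5, X4, X1, X2, X0, X7]), (30, [X6, X4, X2, X5, X3, X0, X7, X1]), (30, [X6, X5, X3, X4, X2, X1, X7, X0]), (25, [X6, X5, X4, X3, X2, X7, X1, X0]), (35, [X6, X4, X2, X5, X0, X3, X7, X1]), (35, [X6, X5, X3, X4, X1, X2, X7, X0]), (32, [X6, X2, X4, X5, X3, X7, X0, X1]), (32, [X6, X3, X5, X4, X2, X7, X1, X0]), (22, [X6, X4, X5, X2, X3, X7, X0, X1]), (22, [X6, X5, X4, X3, X2, X7, X1, X0])],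
   [(36, [X4, X6, X2, X5, X0, X3, X7, X1]), (36, [X5, X6, X3, X4, X1, X2, X7, X0]), (37, [X4, X6, X5, X2, X3, X0, X7, X1]), (29, [X4, X6, X5, X2, X3, X7, X0, X1]), (37, [X5, X6, X4, X3, X2, X1, X7, X0]), (29, [X5, X6, X4, X3, X2, X7, X1, X0]), (27, [X5, X4, X6, X3, X2, X7, X1, X0]), (28, [X6, X4, X5, X2, X3, X7, X0, X1]), (28, [X6, X5, X4, X3, X2, X7, X1, X0]), (24, [X6, X4, X5, X2, X3, X7, X0, X1]), (24, [X6, X5, X4, X3, X2, X7, X1, X0])],
   [(34, [X6, X2, X5, X4, X1, X3, X7, X0]), (37, [X6, X5, X3, X4, X0, X2, X1, X7]), (28, [X6, X4, X5, X2, X3, X1, X7, X0]), (0, [X6, X3, X0, X7, X5, X4, X2, X1]), (31, [X6, X5, X3, X4, X2, X7, X0, X1]), (26, [X6, X5, X4, X3, X2, X7, X0, X1]), (38, [X6, X5, X4, X2, X3, X1, X7, X0]), (19, [X6, X5, X2, X4, X3, X7, X1, X0]), (30, [X6, X5, X3, X4, X2, X7, X0, X1]), (23, [X6, X4, X5, X2, X3, X7, X1, X0]), (33, [X6, X5, X4, X3, X2, X7, X1, X0])]]"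
  by code_simp

lemma good_T3: "good_all [X2, X1, X0] 2 (drop 0 T3)
  [[(X0, X1), (X2, X0), (X1, X2)]]"
  by code_simp

lemma good_T5: "good_all [X4, X3, X2, X1, X0] 3 (drop 0 T5)
  [[(X0, X3), (X1, X3), (X2, X3), (X4, X0), (X4, X1), (X4, X2), (X3, X4)],
   [(X0, X2), (X3, X1), (X2, X3), (X4, X0), (X1, X4), (X4, X2), (X3, X4)]]"
  by code_simp

lemma good_T6: "good_all [X5, X4, X3, X2, X1, X0] 3 (drop 3 T6)
  [[(X4, X0), (X1, X4), (X2, X4), (X3, X4), (X0, X5), (X5, X1), (X5, X2), (X5, X3), (X4, X5)],
   [(X3, X0), (X3, X1), (X0, X4), (X2, X4), (X4, X3), (X1, X5), (X5, X2), (X5, X3), (X4, X5)]]"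
  by code_simp

lemma good_T7: "good_all [X6, X5, X4, X3, X2, X1, X0] 4 (drop 0 T7)
  [[(X5, X0), (X5, X1), (X2, X5), (X5, X3), (X5, X4), (X0, X6), (X1, X6), (X6, X2), (X3, X6), (X4, X6), (X5, X6)],
   [(X0, X4), (X5, X1), (X2, X5), (X5, X3), (X4, X5), (X6, X0), (X1, X6), (X6, X2), (X3, X6), (X6, X4), (X5, X6)],
   [(X0, X4), (X4, X1), (X2, X5), (X5, X3), (X4, X5), (X6, X0), (X1, X6), (X6, X2), (X3, X6), (X6, X4), (X5, X6)],
   [(X4, X0), (X4, X1), (X0, X5), (X2, X5), (X3, X5), (X4, X5), (X1, X6), (X6, X2), (X6, X3), (X6, X4), (X5, X6)],
   [(X0, X3), (X4, X1), (X2, X5), (X5, X3), (X4, X5), (X6, X0), (X1, X6), (X6, X2), (X3, X6), (X6, X4), (X5, X6)],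
   [(X3, X0), (X4, X1), (X0, X5), (X2, X5), (X3, X5), (X5, X4), (X1, X6), (X6, X2), (X6, X3), (X4, X6), (X5, X6)],
   [(X3, X0), (X4, X1), (X2, X4), (X0, X5), (X3, X5), (X5, X4), (X1, X6), (X6, X2), (X6, X3), (X4, X6), (X5, X6)],
   [(X3, X0), (X4, X1), (X2, X4), (X1, X5), (X3, X5), (X5, X4), (X0, X6), (X6, X2), (X6, X3), (X4, X6), (X5, X6)],
   [(X0, X3), (X3, X4), (X5, X1), (X2, X5), (X4, X5), (X6, X0), (X1, X6), (X6, X2), (X3, X6), (X6, X4), (X5, X6)],
   [(X0, X2), (X1, X3), (X2, X4), (X3, X5), (X4, X5), (X6, X0), (X6, X1), (X2, X6), (X3, X6), (X6, X4), (X5, X6)],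
   [(X2, X0), (X3, X1), (X0, X4), (X2, X4), (X1, X5), (X3, X5), (X5, X4), (X6, X2), (X6, X3), (X4, X6), (X5, X6)],
   [(X2, X1), (X3, X0), (X2, X4), (X0, X5), (X3, X5), (X5, X4), (X1, X6), (X6, X2), (X6, X3), (X4, X6), (X5, X6)]]"
  by code_simp

lemma good_T8: "good_all [X7, X6, X5, X4, X3, X2, X1, X0] 4 (drop 1 T8)
  [[(X6, X0), (X1, X6), (X2, X6), (X3, X6), (X6, X4), (X5, X6), (X0, X7), (X7, X1), (X7, X2), (X7, X3), (X4, X7), (X7, X5), (X6, X7)],
   [(X0, X5), (X6, X1), (X2, X6), (X3, X6), (X4, X6), (X5, X6), (X7, X0), (X1, X7), (X7, X2), (X7, X3), (X7, X4), (X5, X7), (X6, X7)],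
   [(X5, X0), (X1, X5), (X2, X6), (X3, X6), (X6, X4), (X5, X6), (X0, X7), (X7, X1), (X7, X2), (X7, X3), (X4, X7), (X7, X5), (X6, X7)],
   [(X0, X5), (X1, X5), (X6, X0), (X2, X6), (X6, X3), (X6, X4), (X5, X6), (X7, X1), (X7, X2), (X3, X7), (X4, X7), (X5, X7), (X6, X7)],
   [(X5, X0), (X1, X5), (X5, X2), (X0, X6), (X3, X6), (X6, X4), (X5, X6), (X7, X1), (X2, X7), (X7, X3), (X4, X7), (X7, X5), (X6, X7)],
   [(X5, X0), (X5, X1), (X5, X4), (X2, X6), (X3, X6), (X6, X4), (X0, X7), (X1, X7), (X7, X2), (X7, X3), (X4, X7), (X7, X5), (X6, X7)],
   [(X4, X0), (X1, X5), (X2, X6), (X3, X6), (X6, X4), (X5, X6), (X0, X7), (X7, X1), (X7, X2), (X7, X3), (X7, X4), (X5, X7), (X6, X7)],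
   [(X4, X0), (X5, X1), (X0, X6), (X6, X2), (X6, X3), (X4, X6), (X5, X6), (X1, X7), (X2, X7), (X3, X7), (X7, X4), (X7, X5), (X6, X7)],
   [(X4, X0), (X1, X5), (X2, X5), (X3, X6), (X6, X4), (X5, X6), (X0, X7), (X7, X1), (X7, X2), (X7, X3), (X7, X4), (X5, X7), (X6, X7)],
   [(X4, X0), (X5, X1), (X5, X2), (X0, X6), (X3, X6), (X6, X4), (X6, X5), (X1, X7), (X2, X7), (X7, X3), (X7, X4), (X7, X5), (X6, X7)],
   [(X4, X0), (X5, X1), (X5, X2), (X1, X6), (X3, X6), (X6, X4), (X6, X5), (X0, X7), (X2, X7), (X7, X3), (X7, X4), (X7, X5), (X6, X7)],
   [(X4, X0), (X5, X1), (X5, X2), (X3, X5), (X0, X6), (X1, X6), (X6, X4), (X6, X5), (X2, X7), (X7, X3), (X7, X4), (X5, X7), (X6, X7)],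
   [(X0, X4), (X4, X5), (X1, X6), (X2, X6), (X6, X3), (X5, X6), (X7, X0), (X7, X1), (X7, X2), (X3, X7), (X7, X4), (X5, X7), (X6, X7)],
   [(X0, X4), (X5, X0), (X5, X4), (X1, X6), (X2, X6), (X3, X6), (X6, X5), (X7, X1), (X7, X2), (X7, X3), (X4, X7), (X7, X5), (X6, X7)],
   [(X0, X4), (X5, X1), (X5, X4), (X1, X6), (X2, X6), (X3, X6), (X6, X5), (X7, X0), (X7, X2), (X7, X3), (X4, X7), (X7, X5), (X6, X7)],
   [(X4, X0), (X1, X4), (X5, X2), (X3, X5), (X0, X6), (X6, X4), (X5, X6), (X7, X1), (X2, X7), (X7, X3), (X4, X7), (X7, X5), (X6, X7)],
   [(X4, X0), (X4, X1), (X2, X5), (X3, X5), (X0, X6), (X1, X6), (X4, X6), (X6, X5), (X7, X2), (X7, X3), (X7, X4), (X5, X7), (X6, X7)],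
   [(X0, X4), (X1, X4), (X5, X2), (X5, X3), (X6, X0), (X2, X6), (X4, X6), (X6, X5), (X7, X1), (X3, X7), (X7, X4), (X7, X5), (X6, X7)],
   [(X3, X0), (X5, X1), (X5, X2), (X5, X4), (X0, X6), (X3, X6), (X6, X4), (X1, X7), (X2, X7), (X7, X3), (X4, X7), (X7, X5), (X6, X7)],
   [(X3, X0), (X4, X1), (X5, X2), (X3, X6), (X6, X4), (X5, X6), (X0, X7), (X1, X7), (X2, X7), (X7, X3), (X7, X4), (X7, X5), (X6, X7)],
   [(X3, X0), (X4, X1), (X5, X2), (X0, X6), (X3, X6), (X6, X4), (X6, X5), (X1, X7), (X2, X7), (X7, X3), (X7, X4), (X7, X5), (X6, X7)],
   [(X0, X3), (X1, X4), (X5, X3), (X2, X6), (X4, X6), (X6, X5), (X7, X0), (X7, X1), (X7, X2), (X3, X7), (X4, X7), (X7, X5), (X6, X7)],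
   [(X0, X3), (X1, X4), (X5, X0), (X5, X3), (X2, X6), (X6, X4), (X6, X5), (X7, X1), (X7, X2), (X3, X7), (X4, X7), (X7, X5), (X6, X7)],
   [(X3, X0), (X1, X4), (X0, X5), (X3, X5), (X6, X1), (X2, X6), (X4, X6), (X5, X6), (X7, X2), (X7, X3), (X4, X7), (X5, X7), (X6, X7)],
   [(X3, X0), (X1, X4), (X5, X2), (X5, X3), (X2, X6), (X4, X6), (X5, X6), (X0, X7), (X7, X1), (X7, X3), (X4, X7), (X7, X5), (X6, X7)],
   [(X0, X3), (X1, X4), (X5, X2), (X3, X5), (X6, X1), (X2, X6), (X6, X4), (X5, X6), (X7, X0), (X3, X7), (X4, X7), (X7, X5), (X6, X7)],
   [(X0, X3), (X1, X4), (X5, X3), (X4, X5), (X6, X0), (X6, X2), (X3, X6), (X5, X6), (X7, X1), (X2, X7), (X7, X4), (X7, X5), (X6, X7)],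
   [(X3, X0), (X4, X1), (X4, X2), (X0, X5), (X3, X5), (X1, X6), (X6, X4), (X5, X6), (X2, X7), (X7, X3), (X7, X4), (X7, X5), (X6, X7)],
   [(X0, X3), (X1, X4), (X2, X4), (X5, X0), (X5, X3), (X3, X6), (X6, X4), (X5, X6), (X7, X1), (X7, X2), (X4, X7), (X7, X5), (X6, X7)],
   [(X3, X0), (X3, X4), (X5, X1), (X5, X2), (X1, X6), (X4, X6), (X5, X6), (X0, X7), (X2, X7), (X7, X3), (X4, X7), (X7, X5), (X6, X7)],
   [(X3, X0), (X3, X4), (X5, X1), (X5, X2), (X1, X6), (X2, X6), (X4, X6), (X5, X6), (X0, X7), (X7, X3), (X4, X7), (X7, X5), (X6, X7)],
   [(X0, X3), (X3, X4), (X5, X4), (X1, X6), (X2, X6), (X6, X5), (X7, X0), (X7, X1), (X7, X2), (X3, X7), (X4, X7), (X7, X5), (X6, X7)],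
   [(X1, X3), (X4, X0), (X3, X5), (X0, X6), (X2, X6), (X4, X6), (X5, X6), (X7, X1), (X7, X2), (X3, X7), (X7, X4), (X7, X5), (X6, X7)],
   [(X0, X2), (X3, X1), (X5, X0), (X5, X2), (X4, X5), (X1, X6), (X3, X6), (X4, X6), (X2, X7), (X7, X3), (X7, X4), (X7, X5), (X6, X7)],
   [(X0, X2), (X3, X1), (X4, X2), (X5, X3), (X6, X4), (X5, X6), (X7, X0), (X1, X7), (X2, X7), (X7, X3), (X7, X4), (X7, X5), (X6, X7)],
   [(X2, X0), (X3, X1), (X0, X4), (X2, X4), (X1, X5), (X3, X5), (X6, X2), (X4, X6), (X5, X6), (X7, X3), (X4, X7), (X7, X5), (X6, X7)],
   [(X1, X2), (X0, X3), (X4, X2), (X5, X0), (X5, X3), (X3, X6), (X6, X4), (X5, X6), (X7, X1), (X2, X7), (X7, X4), (X7, X5), (X6, X7)],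
   [(X2, X1), (X0, X3), (X2, X4), (X4, X5), (X6, X0), (X6, X3), (X5, X6), (X1, X7), (X7, X2), (X3, X7), (X4, X7), (X7, X5), (X6, X7)]]"
  by code_simp

text \<open>The bound is the default 0: the only larger graph on four vertices is
  \<open>K4e\<close>, exceptional itself, so no orientation is offered.\<close>

lemma sup_K4m: "sup_chk [X3, X2, X1, X0] 0 [K4e] K4me (nonedges [X3, X2, X1, X0] K4me) [Inr (0, [X3, X2, X1, X0])]"
  by code_simp

lemma sup_K4: "sup_chk [X3, X2, X1, X0] 0 [] K4e (nonedges [X3, X2, X1, X0] K4e) []"
  by code_simp

lemma sup_G61: "sup_chk [X5, X4, X3, X2, X1, X0] 3 [W5e, G63e] G61e (nonedges [X5, X4, X3, X2, X1, X0] G61e)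
  [Inr (1, [X0, X1, X4, X2, X5, X3]),
   Inl [(X4, X1), (X1, X0), (X1, X2), (X2, X3), (X4, X3), (X0, X5), (X5, X1), (X2, X5), (X3, X5), (X5, X4)],
   Inr (0, [X5, X4, X3, X2, X1, X0]),
   Inl [(X3, X1), (X0, X1), (X1, X2), (X2, X3), (X4, X3), (X5, X0), (X1, X5), (X5, X2), (X3, X5), (X5, X4)],
   Inl [(X3, X0), (X0, X1), (X1, X2), (X2, X3), (X4, X3), (X5, X0), (X1, X5), (X5, X2), (X3, X5), (X5, X4)],
   Inr (1, [X4, X3, X1, X2, X5, X0])]"
  by code_simp

lemma sup_G62: "sup_chk [X5, X4, X3, X2, X1, X0] 3 [W5e, G63e] G62e (nonedges [X5, X4, X3, X2, X1, X0] G62e)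
  [Inl [(X5, X2), (X1, X0), (X2, X1), (X2, X3), (X3, X4), (X4, X5), (X0, X5), (X2, X0), (X0, X3), (X3, X5)],
   Inl [(X1, X5), (X1, X0), (X2, X1), (X3, X2), (X4, X3), (X5, X4), (X5, X0), (X0, X2), (X0, X3), (X3, X5)],
   Inl [(X2, X4), (X1, X0), (X2, X1), (X3, X2), (X4, X3), (X5, X4), (X5, X0), (X0, X2), (X0, X3), (X3, X5)],
   Inl [(X4, X1), (X0, X1), (X1, X2), (X2, X3), (X3, X4), (X4, X5), (X5, X0), (X2, X0), (X0, X3), (X3, X5)],
   Inr (1, [X1, X2, X5, X3, X0, X4]),
   Inr (1, [X4, X5, X2, X0, X3, X1])]"
  by code_simp

lemma sup_B6: "sup_chk [X5, X4, X3, X2, X1, X0] 3 [W5e, G63e] B6e (nonedges [X5, X4, X3, X2, X1, X0] B6e)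
  [Inl [(X0, X4), (X3, X0), (X1, X4), (X2, X4), (X4, X3), (X0, X5), (X5, X1), (X5, X2), (X5, X3), (X4, X5)],
   Inl [(X3, X2), (X3, X0), (X1, X4), (X2, X4), (X4, X3), (X0, X5), (X5, X1), (X2, X5), (X5, X3), (X4, X5)],
   Inl [(X1, X3), (X0, X3), (X4, X1), (X2, X4), (X3, X4), (X5, X0), (X5, X1), (X5, X2), (X3, X5), (X4, X5)],
   Inr (1, [X0, X3, X2, X4, X5, X1]),
   Inl [(X0, X2), (X3, X0), (X1, X4), (X2, X4), (X4, X3), (X0, X5), (X5, X1), (X5, X2), (X5, X3), (X4, X5)],
   Inl [(X0, X1), (X3, X0), (X1, X4), (X2, X4), (X4, X3), (X0, X5), (X5, X1), (X5, X2), (X5, X3), (X4, X5)]]"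
  by code_simp

text \<open>Here, and likewise for \<open>G63e\<close> and \<open>G81e\<close>, the list of further
  exceptional graphs is empty: any one additional edge admits a good orientation, so the search
  stops.\<close>

lemma sup_W5: "sup_chk [X5, X4, X3, X2, X1, X0] 3 [] W5e (nonedges [X5, X4, X3, X2, X1, X0] W5e)
  [Inl [(X2, X4), (X1, X0), (X2, X1), (X3, X2), (X4, X3), (X4, X0), (X0, X5), (X1, X5), (X5, X2), (X3, X5), (X5, X4)],
   Inl [(X1, X4), (X1, X0), (X2, X1), (X3, X2), (X4, X3), (X4, X0), (X0, X5), (X1, X5), (X5, X2), (X3, X5), (X5, X4)],
   Inl [(X1, X3), (X1, X0), (X2, X1), (X3, X2), (X4, X3), (X4, X0), (X0, X5), (X1, X5), (X5, X2), (X3, X5), (X5, X4)],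
   Inl [(X0, X3), (X1, X0), (X2, X1), (X3, X2), (X4, X3), (X4, X0), (X0, X5), (X1, X5), (X5, X2), (X3, X5), (X5, X4)],
   Inl [(X0, X2), (X0, X1), (X2, X1), (X2, X3), (X3, X4), (X4, X0), (X0, X5), (X1, X5), (X5, X2), (X5, X3), (X5, X4)]]"
  by code_simp

lemma sup_G63: "sup_chk [X5, X4, X3, X2, X1, X0] 3 [] G63e (nonedges [X5, X4, X3, X2, X1, X0] G63e)
  [Inl [(X3, X5), (X1, X0), (X2, X1), (X0, X2), (X0, X3), (X3, X1), (X2, X3), (X4, X1), (X4, X2), (X5, X4), (X1, X5)],
   Inl [(X2, X5), (X1, X0), (X2, X1), (X0, X2), (X0, X3), (X3, X1), (X2, X3), (X4, X1), (X4, X2), (X5, X4), (X1, X5)],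
   Inl [(X0, X5), (X1, X0), (X2, X1), (X0, X2), (X0, X3), (X3, X1), (X2, X3), (X4, X1), (X4, X2), (X5, X4), (X1, X5)],
   Inl [(X3, X4), (X1, X0), (X2, X1), (X0, X2), (X0, X3), (X3, X1), (X2, X3), (X4, X1), (X4, X2), (X5, X4), (X1, X5)],
   Inl [(X0, X4), (X1, X0), (X2, X1), (X0, X2), (X0, X3), (X3, X1), (X2, X3), (X4, X1), (X4, X2), (X5, X4), (X1, X5)]]"
  by code_simp

lemma sup_G81: "sup_chk [X7, X6, X5, X4, X3, X2, X1, X0] 4 [] G81e (nonedges [X7, X6, X5, X4, X3, X2, X1, X0] G81e)
  [Inl [(X7, X5), (X1, X0), (X1, X2), (X2, X3), (X4, X3), (X5, X4), (X6, X5), (X6, X7), (X0, X7), (X7, X1), (X2, X7), (X3, X7), (X5, X3), (X3, X6)],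
   Inl [(X4, X7), (X0, X1), (X2, X1), (X3, X2), (X3, X4), (X5, X4), (X5, X6), (X6, X7), (X7, X0), (X1, X7), (X2, X7), (X7, X3), (X3, X5), (X3, X6)],
   Inl [(X4, X6), (X0, X1), (X2, X1), (X3, X2), (X3, X4), (X5, X4), (X5, X6), (X6, X7), (X7, X0), (X1, X7), (X2, X7), (X7, X3), (X3, X5), (X3, X6)],
   Inl [(X6, X2), (X1, X0), (X2, X1), (X3, X2), (X4, X3), (X5, X4), (X5, X6), (X6, X7), (X0, X7), (X1, X7), (X2, X7), (X7, X3), (X3, X5), (X3, X6)],
   Inl [(X6, X1), (X1, X0), (X2, X1), (X2, X3), (X3, X4), (X4, X5), (X5, X6), (X6, X7), (X0, X7), (X7, X1), (X7, X2), (X7, X3), (X3, X5), (X3, X6)],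
   Inl [(X6, X0), (X0, X1), (X2, X1), (X2, X3), (X4, X3), (X5, X4), (X6, X5), (X7, X6), (X0, X7), (X1, X7), (X7, X2), (X3, X7), (X5, X3), (X3, X6)],
   Inl [(X5, X2), (X1, X0), (X2, X1), (X2, X3), (X3, X4), (X4, X5), (X6, X5), (X6, X7), (X0, X7), (X1, X7), (X7, X2), (X7, X3), (X3, X5), (X3, X6)],
   Inl [(X5, X1), (X1, X0), (X2, X1), (X2, X3), (X3, X4), (X4, X5), (X5, X6), (X6, X7), (X0, X7), (X7, X1), (X7, X2), (X7, X3), (X3, X5), (X3, X6)],
   Inl [(X5, X0), (X0, X1), (X2, X1), (X2, X3), (X4, X3), (X5, X4), (X6, X5), (X7, X6), (X0, X7), (X1, X7), (X7, X2), (X3, X7), (X5, X3), (X3, X6)],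
   Inl [(X4, X2), (X1, X0), (X2, X1), (X2, X3), (X3, X4), (X4, X5), (X5, X6), (X6, X7), (X0, X7), (X7, X1), (X7, X2), (X7, X3), (X3, X5), (X3, X6)],
   Inl [(X4, X1), (X1, X0), (X1, X2), (X2, X3), (X3, X4), (X5, X4), (X5, X6), (X6, X7), (X0, X7), (X7, X1), (X7, X2), (X7, X3), (X3, X5), (X3, X6)],
   Inl [(X4, X0), (X0, X1), (X2, X1), (X2, X3), (X3, X4), (X4, X5), (X6, X5), (X6, X7), (X0, X7), (X1, X7), (X7, X2), (X7, X3), (X5, X3), (X3, X6)],
   Inl [(X3, X1), (X1, X0), (X1, X2), (X2, X3), (X4, X3), (X5, X4), (X6, X5), (X7, X6), (X0, X7), (X1, X7), (X2, X7), (X7, X3), (X5, X3), (X3, X6)],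
   Inl [(X3, X0), (X0, X1), (X1, X2), (X3, X2), (X3, X4), (X4, X5), (X6, X5), (X7, X6), (X0, X7), (X7, X1), (X2, X7), (X7, X3), (X5, X3), (X3, X6)],
   Inl [(X2, X0), (X0, X1), (X2, X1), (X3, X2), (X3, X4), (X4, X5), (X5, X6), (X6, X7), (X0, X7), (X1, X7), (X2, X7), (X7, X3), (X5, X3), (X3, X6)]]"
  by code_simp

text \<open>The exceptional 2-trees miss the bound by so little that they can still be remainders in
  the induction; here all excess is at walks starting in \<open>X4\<close>.\<close>

lemma alm_G61: "ori_chk [X5, X4, X3, X2, X1, X0] G61e
  [(X1, X0), (X1, X2), (X2, X3), (X4, X3), (X0, X5), (X5, X1), (X2, X5), (X3, X5), (X5, X4)] 3 (map (Pair X4) [X5, X4, X3, X2, X1, X0])"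
  by code_simp

lemma alm_G62: "ori_chk [X5, X4, X3, X2, X1, X0] G62e
  [(X1, X0), (X2, X1), (X3, X2), (X4, X3), (X5, X4), (X0, X5), (X2, X0), (X0, X3), (X3, X5)] 3 (map (Pair X5) [X5, X4, X3, X2, X1, X0])"
  by code_simp

lemma alm_B6: "ori_chk [X5, X4, X3, X2, X1, X0] B6e
  [(X0, X3), (X1, X4), (X4, X2), (X3, X4), (X5, X0), (X5, X1), (X2, X5), (X3, X5), (X4, X5)] 3 [(X1, X3)]"
  by code_simp

lemma alm_G81: "ori_chk [X7, X6, X5, X4, X3, X2, X1, X0] G81e
  [(X0, X1), (X1, X2), (X2, X3), (X4, X3), (X5, X4), (X6, X5), (X6, X7), (X7, X0), (X7, X1), (X7, X2), (X3, X7), (X3, X5), (X3, X6)] 4 [(X0, X4)]"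
  by code_simp

text \<open>\<open>path_end\<close> wants a good remainder, which \<open>G81e\<close> is not known
  to be. So every way of adding \<open>X8\<close> on an edge \<open>pq\<close>, and
  \<open>X9\<close> on \<open>X8\<close> and one of \<open>p\<close>, \<open>q\<close>, is checked
  directly against 5, the bound for ten vertices.\<close>

fun ends_chk :: "(vx \<times> vx) list \<Rightarrow> (vx \<times> vx) list \<Rightarrow> ((vx \<times> vx) list \<times> (vx \<times> vx) list) list \<Rightarrow> bool" where
  "ends_chk xs [] [] = True"
| "ends_chk xs ((p, q) # es) ((A, B) # cs) =
    (if ori_chk [X9, X8, X7, X6, X5, X4, X3, X2, X1, X0] ((X8, p) # (X8, q) # (X9, X8) # (X9, p) # xs) A 5 [] then
     if ori_chk [X9, X8, X7, X6, X5, X4, X3, X2, X1, X0] ((X8, p) # (X8, q) # (X9, X8) # (X9, q) # xs) B 5 [] then ends_chk xs es cs else False else False)"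
| "ends_chk xs [] (c # cs) = False"
| "ends_chk xs (e # es) [] = False"

lemma ends_G81: "ends_chk G81e G81e
  [([(X0, X8), (X8, X1), (X9, X8), (X0, X9), (X0, X1), (X2, X1), (X2, X3), (X3, X4), (X4, X5), (X5, X6), (X6, X7), (X7, X0), (X1, X7), (X7, X2), (X7, X3), (X3, X5), (X3, X6)],
    [(X8, X0), (X1, X8), (X9, X8), (X1, X9), (X1, X0), (X1, X2), (X2, X3), (X3, X4), (X4, X5), (X5, X6), (X6, X7), (X0, X7), (X7, X1), (X2, X7), (X7, X3), (X3, X5), (X3, X6)]),
   ([(X8, X1), (X8, X2), (X9, X8), (X1, X9), (X1, X0), (X1, X2), (X2, X3), (X4, X3), (X5, X4), (X5, X6), (X6, X7), (X0, X7), (X7, X1), (X7, X2), (X3, X7), (X3, X5), (X3, X6)],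
    [(X8, X1), (X8, X2), (X9, X8), (X2, X9), (X1, X0), (X1, X2), (X2, X3), (X4, X3), (X5, X4), (X5, X6), (X6, X7), (X0, X7), (X7, X1), (X7, X2), (X3, X7), (X3, X5), (X3, X6)]),
   ([(X8, X2), (X8, X3), (X9, X8), (X2, X9), (X1, X0), (X1, X2), (X2, X3), (X4, X3), (X5, X4), (X5, X6), (X6, X7), (X0, X7), (X7, X1), (X7, X2), (X3, X7), (X3, X5), (X3, X6)],
    [(X8, X2), (X8, X3), (X9, X8), (X3, X9), (X1, X0), (X1, X2), (X2, X3), (X4, X3), (X5, X4), (X5, X6), (X6, X7), (X0, X7), (X7, X1), (X7, X2), (X3, X7), (X3, X5), (X3, X6)]),
   ([(X8, X3), (X8, X4), (X9, X8), (X3, X9), (X1, X0), (X1, X2), (X2, X3), (X4, X3), (X5, X4), (X5, X6), (X6, X7), (X0, X7), (X7, X1), (X7, X2), (X3, X7), (X3, X5), (X3, X6)],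
    [(X3, X8), (X8, X4), (X8, X9), (X9, X4), (X0, X1), (X1, X2), (X2, X3), (X4, X3), (X4, X5), (X6, X5), (X6, X7), (X7, X0), (X1, X7), (X7, X2), (X3, X7), (X5, X3), (X3, X6)]),
   ([(X4, X8), (X8, X5), (X9, X8), (X4, X9), (X0, X1), (X2, X1), (X3, X2), (X3, X4), (X4, X5), (X5, X6), (X6, X7), (X7, X0), (X1, X7), (X2, X7), (X7, X3), (X5, X3), (X3, X6)],
    [(X8, X4), (X5, X8), (X9, X8), (X5, X9), (X0, X1), (X2, X1), (X3, X2), (X4, X3), (X5, X4), (X6, X5), (X7, X6), (X7, X0), (X1, X7), (X7, X2), (X3, X7), (X5, X3), (X3, X6)]),
   ([(X5, X8), (X8, X6), (X9, X8), (X5, X9), (X0, X1), (X2, X1), (X2, X3), (X3, X4), (X4, X5), (X5, X6), (X6, X7), (X7, X0), (X1, X7), (X7, X2), (X7, X3), (X3, X5), (X3, X6)],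
    [(X5, X8), (X8, X6), (X9, X8), (X6, X9), (X0, X1), (X2, X1), (X2, X3), (X3, X4), (X4, X5), (X5, X6), (X6, X7), (X7, X0), (X1, X7), (X7, X2), (X7, X3), (X3, X5), (X3, X6)]),
   ([(X8, X6), (X7, X8), (X8, X9), (X9, X6), (X0, X1), (X2, X1), (X3, X2), (X4, X3), (X5, X4), (X5, X6), (X6, X7), (X7, X0), (X1, X7), (X2, X7), (X7, X3), (X3, X5), (X3, X6)],
    [(X6, X8), (X7, X8), (X8, X9), (X9, X7), (X1, X0), (X2, X1), (X3, X2), (X4, X3), (X5, X4), (X5, X6), (X6, X7), (X0, X7), (X7, X1), (X2, X7), (X7, X3), (X3, X5), (X3, X6)]),
   ([(X7, X8), (X8, X0), (X8, X9), (X9, X7), (X0, X1), (X1, X2), (X3, X2), (X4, X3), (X5, X4), (X5, X6), (X6, X7), (X7, X0), (X1, X7), (X2, X7), (X7, X3), (X3, X5), (X3, X6)],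
    [(X7, X8), (X8, X0), (X8, X9), (X9, X0), (X0, X1), (X1, X2), (X2, X3), (X4, X3), (X5, X4), (X5, X6), (X6, X7), (X0, X7), (X7, X1), (X2, X7), (X7, X3), (X3, X5), (X3, X6)]),
   ([(X8, X1), (X7, X8), (X8, X9), (X9, X1), (X0, X1), (X2, X1), (X3, X2), (X4, X3), (X5, X4), (X5, X6), (X6, X7), (X7, X0), (X1, X7), (X2, X7), (X7, X3), (X3, X5), (X3, X6)],
    [(X1, X8), (X7, X8), (X8, X9), (X9, X7), (X1, X0), (X2, X1), (X3, X2), (X4, X3), (X5, X4), (X5, X6), (X6, X7), (X0, X7), (X7, X1), (X2, X7), (X7, X3), (X3, X5), (X3, X6)]),
   ([(X8, X2), (X8, X7), (X9, X8), (X2, X9), (X1, X0), (X1, X2), (X2, X3), (X4, X3), (X5, X4), (X5, X6), (X6, X7), (X0, X7), (X7, X1), (X7, X2), (X3, X7), (X3, X5), (X3, X6)],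
    [(X8, X2), (X8, X7), (X9, X8), (X7, X9), (X1, X0), (X1, X2), (X2, X3), (X4, X3), (X5, X4), (X5, X6), (X6, X7), (X0, X7), (X7, X1), (X7, X2), (X3, X7), (X3, X5), (X3, X6)]),
   ([(X8, X3), (X8, X7), (X9, X8), (X3, X9), (X1, X0), (X1, X2), (X2, X3), (X4, X3), (X5, X4), (X5, X6), (X6, X7), (X0, X7), (X7, X1), (X7, X2), (X3, X7), (X3, X5), (X3, X6)],
    [(X8, X3), (X8, X7), (X9, X8), (X7, X9), (X1, X0), (X1, X2), (X2, X3), (X4, X3), (X5, X4), (X5, X6), (X6, X7), (X0, X7), (X7, X1), (X7, X2), (X3, X7), (X3, X5), (X3, X6)]),
   ([(X8, X3), (X8, X5), (X9, X8), (X3, X9), (X1, X0), (X1, X2), (X2, X3), (X4, X3), (X5, X4), (X5, X6), (X6, X7), (X0, X7), (X7, X1), (X7, X2), (X3, X7), (X3, X5), (X3, X6)],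
    [(X3, X8), (X8, X5), (X8, X9), (X9, X5), (X0, X1), (X2, X1), (X3, X2), (X3, X4), (X4, X5), (X6, X5), (X6, X7), (X7, X0), (X1, X7), (X7, X2), (X7, X3), (X5, X3), (X3, X6)]),
   ([(X8, X3), (X8, X6), (X9, X8), (X3, X9), (X1, X0), (X1, X2), (X2, X3), (X4, X3), (X5, X4), (X5, X6), (X6, X7), (X0, X7), (X7, X1), (X7, X2), (X3, X7), (X3, X5), (X3, X6)],
    [(X3, X8), (X8, X6), (X8, X9), (X9, X6), (X0, X1), (X2, X1), (X3, X2), (X3, X4), (X4, X5), (X6, X5), (X6, X7), (X7, X0), (X1, X7), (X7, X2), (X7, X3), (X5, X3), (X3, X6)])]"
  by code_simp

section \<open>2-trees on at most eight vertices\<close>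

lemma tt_table2: assumes "tt S F" "card S = 2" shows "\<exists>xs\<in>set T2. \<exists>f. emb f [X1, X0] xs S F"
  using assms(1)
proof (cases rule: tt.cases)
  case (base a b)
  have "emb (\<lambda>v. if v = X0 then a else b) [X1, X0] [(X0, X1)] S F"
    unfolding emb_def edg_def using base by (auto simp: insert_commute)
  thus ?thesis unfolding T2_def by auto
next
  case (add S' F' a b x)
  have "card S = Suc (card S')" using add tt_fin[OF add(3)] by simp
  thus ?thesis using tt_card[OF add(3)] assms(2) by simp
qed

lemma verts_chk_tables:
  "verts_chk_all [X1, X0] T2" "verts_chk_all [X2, X1, X0] T3" "verts_chk_all [X3, X2, X1, X0] T4"
  "verts_chk_all [X4, X3, X2, X1, X0] T5" "verts_chk_all [X5, X4, X3, X2, X1, X0] T6"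
  "verts_chk_all [X6, X5, X4, X3, X2, X1, X0] T7"
  by code_simp+

lemma tt_table3: "tt S F \<Longrightarrow> card S = 3 \<Longrightarrow> \<exists>xs\<in>set T3. \<exists>f. emb f [X2, X1, X0] xs S F"
  by (rule tt_ext[OF tt_table2 ext_T3 _ _ verts_chk_all_sound[OF verts_chk_tables(1)]]) simp_all
lemma tt_table4: "tt S F \<Longrightarrow> card S = 4 \<Longrightarrow> \<exists>xs\<in>set T4. \<exists>f. emb f [X3, X2, X1, X0] xs S F"
  by (rule tt_ext[OF tt_table3 ext_T4 _ _ verts_chk_all_sound[OF verts_chk_tables(2)]]) simp_all
lemma tt_table5: "tt S F \<Longrightarrow> card S = 5 \<Longrightarrow> \<exists>xs\<in>set T5. \<exists>f. emb f [X4, X3, X2, X1, X0] xs S F"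
  by (rule tt_ext[OF tt_table4 ext_T5 _ _ verts_chk_all_sound[OF verts_chk_tables(3)]]) simp_all
lemma tt_table6: "tt S F \<Longrightarrow> card S = 6 \<Longrightarrow> \<exists>xs\<in>set T6. \<exists>f. emb f [X5, X4, X3, X2, X1, X0] xs S F"
  by (rule tt_ext[OF tt_table5 ext_T6 _ _ verts_chk_all_sound[OF verts_chk_tables(4)]]) simp_all
lemma tt_table7: "tt S F \<Longrightarrow> card S = 7 \<Longrightarrow> \<exists>xs\<in>set T7. \<exists>f. emb f [X6, X5, X4, X3, X2, X1, X0] xs S F"
  by (rule tt_ext[OF tt_table6 ext_T7 _ _ verts_chk_all_sound[OF verts_chk_tables(5)]]) simp_all
lemma tt_table8: "tt S F \<Longrightarrow> card S = 8 \<Longrightarrow> \<exists>xs\<in>set T8. \<exists>f. emb f [X7, X6, X5, X4, X3, X2, X1, X0] xs S F"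
  by (rule tt_ext[OF tt_table7 ext_T8 _ _ verts_chk_all_sound[OF verts_chk_tables(6)]]) simp_all

lemma tt_Good3: assumes "tt S F" "card S = 3" shows "Good S F 2"
  using tt_table3[OF assms] good_all_emb[OF good_T3 _ _ subset_refl] by auto

lemma tt_Good5: assumes "tt S F" "card S = 5" shows "Good S F 3"
  using tt_table5[OF assms] good_all_emb[OF good_T5 _ _ subset_refl] by auto

lemma tt_Good7: assumes "tt S F" "card S = 7" shows "Good S F 4"
  using tt_table7[OF assms] good_all_emb[OF good_T7 _ _ subset_refl] by auto

lemma tt_Good6:
  assumes "tt S F" "card S = 6"
  shows "Good S F 3 \<or> (\<exists>xs\<in>{G61e, G62e, B6e}. \<exists>f. emb f [X5, X4, X3, X2, X1, X0] xs S F)"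
proof -
  obtain xs f where xs: "xs \<in> set T6" "emb f [X5, X4, X3, X2, X1, X0] xs S F" using tt_table6[OF assms] by blast
  have "T6 = G61e # G62e # B6e # drop 3 T6" unfolding T6_def by simp
  hence "xs \<in> {G61e, G62e, B6e} \<or> xs \<in> set (drop 3 T6)" using xs(1) by (metis insert_iff list.set(2))
  thus ?thesis using xs(2) good_all_emb[OF good_T6] by blast
qed

lemma tt_Good8:
  assumes "tt S F" "card S = 8"
  shows "Good S F 4 \<or> (\<exists>f. emb f [X7, X6, X5, X4, X3, X2, X1, X0] G81e S F)"
proof -
  obtain xs f where xs: "xs \<in> set T8" "emb f [X7, X6, X5, X4, X3, X2, X1, X0] xs S F" using tt_table8[OF assms] by blast
  have "T8 = G81e # drop 1 T8" unfolding T8_def by simp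
  hence "xs = G81e \<or> xs \<in> set (drop 1 T8)" using xs(1) by (metis insert_iff list.set(2))
  thus ?thesis using xs(2) good_all_emb[OF good_T8] by blast
qed

lemma tt_Alm1_8: assumes "tt S F" "card S = 8" shows "Alm1 S F 4"
proof -
  have "Alm1 S F 4" if e: "emb f [X7, X6, X5, X4, X3, X2, X1, X0] G81e S F" for f
    by (rule ori_Alm1[OF alm_G81, of f]) (use e in \<open>simp_all add: emb_def\<close>)
  thus ?thesis using tt_Good8[OF assms] Good_Alm1 by blast
qed

lemma tt_AlmS_6: assumes "tt S F" "card S = 6" shows "AlmS S F 3"
proof -
  let ?vs = "[X5, X4, X3, X2, X1, X0]"
  have 1: "AlmS S F 3" if e: "emb f ?vs G61e S F" for f
    by (rule ori_AlmS[OF alm_G61, of f]) (use e in \<open>simp_all add: emb_def\<close>)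
  have 2: "AlmS S F 3" if e: "emb f ?vs G62e S F" for f
    by (rule ori_AlmS[OF alm_G62, of f]) (use e in \<open>simp_all add: emb_def\<close>)
  have 3: "AlmS S F 3" if e: "emb f ?vs B6e S F" for f
    by (rule Alm1_AlmS, rule ori_Alm1[OF alm_B6, of f]) (use e in \<open>simp_all add: emb_def\<close>)
  show ?thesis using tt_Good6[OF assms] Alm1_AlmS[OF Good_Alm1] 1 2 3 by blast
qed

text \<open>The base for deleting four vertices: a graph on nine to twelve vertices leaves a
  remainder on five to eight.\<close>

lemma tt_AlmS_small:
  assumes "tt S F" "card S \<ge> 5" "card S \<le> 8" shows "AlmS S F ((card S + 1) div 2)"
proof -
  consider "card S = 5" | "card S = 6" | "card S = 7" | "card S = 8" using assms(2,3) by linarith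
  thus ?thesis
  proof cases
    case 1 thus ?thesis using Alm1_AlmS[OF Good_Alm1[OF tt_Good5[OF assms(1)]]] by simp
  next
    case 2 thus ?thesis using tt_AlmS_6[OF assms(1)] by simp
  next
    case 3 thus ?thesis using Alm1_AlmS[OF Good_Alm1[OF tt_Good7[OF assms(1)]]] by simp
  next
    case 4 thus ?thesis using Alm1_AlmS[OF tt_Alm1_8[OF assms(1)]] by simp
  qed
qed

lemma ends_chk_sound:
  "ends_chk xs es cs \<Longrightarrow> (p, q) \<in> set es \<Longrightarrow> r = p \<or> r = q \<Longrightarrow>
   \<exists>A. ori_chk [X9, X8, X7, X6, X5, X4, X3, X2, X1, X0] ((X8, p) # (X8, q) # (X9, X8) # (X9, r) # xs) A 5 []"
proof (induction xs es cs rule: ends_chk.induct)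
  case (2 xs p' q' es A B cs)
  show ?case
  proof (cases "(p, q) = (p', q')")
    case True thus ?thesis using "2.prems" by (auto split: if_splits)
  next
    case False thus ?thesis using 2 by (auto split: if_splits)
  qed
qed auto

lemma G81_end:
  assumes e: "emb f [X7, X6, X5, X4, X3, X2, X1, X0] G81e S F" and ab: "{a, b} \<in> F" and t: "t = a \<or> t = b"
    and x: "x \<notin> S" "y \<notin> S" "x \<noteq> y" and G: "F \<subseteq> G" "{y, a} \<in> G" "{y, b} \<in> G" "{x, y} \<in> G" "{x, t} \<in> G"
  shows "Good (insert x (insert y S)) G 5"
proof -
  let ?vs = "[X7, X6, X5, X4, X3, X2, X1, X0]"
  obtain p q where pq: "(p, q) \<in> set G81e" "{a, b} = {f p, f q}" using e ab unfolding emb_def edg_def by auto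
  have ab2: "(a = f p \<and> b = f q) \<or> (a = f q \<and> b = f p)" using pq(2) by (metis doubleton_eq_iff)
  then obtain r where r: "r = p \<or> r = q" "t = f r" using t by blast
  obtain A where A: "ori_chk [X9, X8, X7, X6, X5, X4, X3, X2, X1, X0] ((X8, p) # (X8, q) # (X9, X8) # (X9, r) # G81e) A 5 []"
    using ends_chk_sound[OF ends_G81 pq(1) r(1)] by blast
  define g where "g = f(X8 := y, X9 := x)"
  have gf: "g v = f v" if "v \<in> set ?vs" for v using that unfolding g_def by auto
  have b: "verts_chk ?vs G81e" by code_simp
  have ed: "edg g G81e = F"
  proof -
    have "(case e of (p, q) \<Rightarrow> {g p, g q}) = (case e of (p, q) \<Rightarrow> {f p, f q})" if "e \<in> set G81e" for e
      using verts_chk_sound[OF b, of "fst e" "snd e"] that gf by (auto simp: split_beta simp del: set_simps)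
    thus ?thesis using e unfolding emb_def edg_def by (metis (no_types, lifting) image_cong)
  qed
  have gv: "g X8 = y" "g X9 = x" unfolding g_def by simp_all
  note pv = verts_chk_sound[OF b pq(1)]
  have rv: "r \<in> set ?vs" using r(1) pv by blast
  have inj: "inj_on g (set ?vs)" using e gf unfolding emb_def by (metis inj_on_cong)
  have im: "g ` set ?vs = S" using e gf unfolding emb_def by (metis image_cong)
  have n: "X8 \<notin> set ?vs" "X9 \<notin> insert X8 (set ?vs)" by simp_all
  have s: "set [X9, X8, X7, X6, X5, X4, X3, X2, X1, X0] = insert X9 (insert X8 (set ?vs))" by simp
  have "inj_on g (insert X8 (set ?vs))" using inj n(1) im gv x unfolding inj_on_insert by (simp del: set_simps)
  hence i: "inj_on g (set [X9, X8, X7, X6, X5, X4, X3, X2, X1, X0])"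
    unfolding s inj_on_insert using n(2) im gv x by (simp del: set_simps)
  have im2: "g ` set [X9, X8, X7, X6, X5, X4, X3, X2, X1, X0] = insert x (insert y S)"
    unfolding s image_insert im gv by simp
  have "edg g ((X8, p) # (X8, q) # (X9, X8) # (X9, r) # G81e) = insert {y, f p} (insert {y, f q} (insert {x, y} (insert {x, t} F)))"
    using ed gv gf[OF conjunct1[OF pv]] gf[OF conjunct2[OF pv]] gf[OF rv] r(2) unfolding edg_def by simp
  moreover have "{y, f p} \<in> G" "{y, f q} \<in> G" using ab2 G by blast+
  ultimately have "edg g ((X8, p) # (X8, q) # (X9, X8) # (X9, r) # G81e) \<subseteq> G" using G by simp
  from ori_Good[OF A i im2 this] show ?thesis .
qed

lemma pair_other: assumes "A = {p, q}" "p \<noteq> q" "b \<in> A" shows "\<exists>s. A = {b, s} \<and> b \<noteq> s"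
proof (cases "b = p")
  case True thus ?thesis using assms by blast
next
  case False
  hence "b = q" using assms by simp
  thus ?thesis using assms insert_commute[of p q "{}"] by metis
qed

text \<open>Exceptional 2-trees enter only as small remainders. \<open>star\<close> and
  \<open>single\<close> accept them in relaxed form; for \<open>path_end\<close> the one possible
  obstacle is \<open>G81e\<close> when ten vertices are reduced to eight, and that case is covered
  by \<open>G81_end\<close>.\<close>

lemma tt_Good: "tt S F \<Longrightarrow> card S \<ge> 9 \<Longrightarrow> Good S F ((card S + 1) div 2)"
proof (induction "card S" arbitrary: S F rule: less_induct)
  case less
  note t = less.prems(1) and n = less.prems(2)
  have fin: "finite S" by (rule tt_fin[OF t])
  show ?case
  proof (cases "odd (card S)")
    case True
    have "card S \<ge> 4" using n by simp
    then obtain v where v: "v \<in> simp2 S F" using two_simp2[OF t] by blast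
    obtain p q where pq: "N F v = {p, q}" "p \<noteq> q" using simp2_N[OF v] by blast
    have vS: "v \<in> S" using v unfolding simp2_def by blast
    have t': "tt (S - {v}) (rs F (S - {v}))" by (rule tt_del_simp2[OF t v])
    have c: "card (S - {v}) = card S - 1" using vS fin by simp
    \<comment> \<open>For nine vertices the remainder may be \<open>G81e\<close>, so the relaxed
      form is the most that can be claimed.\<close>
    have "Alm1 (S - {v}) (rs F (S - {v})) (card S div 2)"
    proof (cases "card S = 9")
      case True thus ?thesis using tt_Alm1_8[OF t'] c by simp
    next
      case False
      hence "Good (S - {v}) (rs F (S - {v})) ((card (S - {v}) + 1) div 2)" using n c by (intro less.hyps t') linarith+
      thus ?thesis using Good_Alm1 c n by simp
    qed
    moreover have "p \<in> S - {v}" "q \<in> S - {v}" "{v, p} \<in> F" "{v, q} \<in> F"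
      using pq N_S[OF t, of v] mem_N[of p F v] mem_N[of q F v] by auto
    ultimately have "Good (insert v (S - {v})) F (card S div 2 + 1)"
      using single[of "S - {v}" "rs F (S - {v})" "card S div 2" F v p q] rs_sub pq(2) by blast
    moreover have "insert v (S - {v}) = S" using vS by blast
    moreover have "card S div 2 + 1 = (card S + 1) div 2" using True by presburger
    ultimately show ?thesis by simp
  next
    case ev: False
    hence n10: "card S \<ge> 10" using n by presburger
    from star_or_end[OF t n10] show ?thesis
    proof (elim disjE exE conjE)
      assume "card (simp2 S F) \<ge> 4"
      then obtain X where X: "X \<subseteq> simp2 S F" "card X = 4" using obtain_subset_with_card_n by metis
      have XS: "X \<subseteq> S" using X(1) unfolding simp2_def by blast
      hence fX: "finite X" using fin finite_subset by blast
      have c: "card (S - X) = card S - 4" using X(2) XS fX card_Diff_subset by metis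
      have t': "tt (S - X) (rs F (S - X))" by (rule tt_del_set[OF t X(1)]) (use c n10 in simp)
      have A: "AlmS (S - X) (rs F (S - X)) ((card (S - X) + 1) div 2)"
      proof (cases "card (S - X) \<ge> 9")
        case True
        have "card (S - X) < card S" using c n10 by simp
        from less.hyps[OF this t' True] show ?thesis by (intro Alm1_AlmS Good_Alm1)
      next
        case False
        thus ?thesis using c n10 by (intro tt_AlmS_small t') simp_all
      qed
      have at: "\<exists>a b. a \<noteq> b \<and> a \<in> S - X \<and> b \<in> S - X \<and> {x, a} \<in> F \<and> {x, b} \<in> F" if x: "x \<in> X" for x
      proof -
        have xs: "x \<in> simp2 S F" using x X(1) by blast
        obtain p q where pq: "N F x = {p, q}" "p \<noteq> q" using simp2_N[OF xs] by blast
        have "u \<in> S - X \<and> {x, u} \<in> F" if u: "u \<in> N F x" for u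
        proof -
          have "u \<notin> X" using simp2_nonadj[OF t _ _ xs, of u] u n X(1) by auto
          thus ?thesis using u N_S[OF t, of x] unfolding mem_N by (metis DiffI mem_N subsetD u)
        qed
        thus ?thesis using pq by blast
      qed
      have "Good ((S - X) \<union> X) F ((card (S - X) + 1) div 2 + 2)"
        by (rule star[OF A rs_sub _ at]) blast+
      moreover have "(S - X) \<union> X = S" using XS by blast
      moreover have "(card (S - X) + 1) div 2 + 2 = (card S + 1) div 2" using c n10 by presburger
      ultimately show ?thesis by simp
    next
      fix x y b
      let ?S1 = "S - {x}" and ?F1 = "rs F (S - {x})"
      let ?S0 = "S - {x} - {y}" and ?F0 = "rs F (S - {x} - {y})"
      assume x: "x \<in> simp2 S F" and yx: "y \<in> N F x" and y: "y \<in> simp2 ?S1 ?F1"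
        and bNy: "b \<in> N F y" "b \<noteq> x" and b: "b \<in> simp2 ?S0 ?F0"
      have xS: "x \<in> S" and yS: "y \<in> ?S1" and bS: "b \<in> ?S0" using x y b unfolding simp2_def by blast+
      have t1: "tt ?S1 ?F1" by (rule tt_del_simp2[OF t x])
      have F0: "rs ?F1 ?S0 = ?F0" unfolding rs_rs by (metis Diff_subset inf.absorb2)
      have t0: "tt ?S0 ?F0" using tt_del_simp2[OF t1 y] unfolding F0 .
      have Ny: "N ?F1 y = N F y \<inter> ?S1" by (rule N_rs[OF yS])
      have bN: "b \<in> N ?F1 y" unfolding Ny using bNy bS by blast
      obtain p q where pq: "N ?F1 y = {p, q}" "p \<noteq> q" using simp2_N[OF y] by blast
      obtain a where "N ?F1 y = {b, a}" "b \<noteq> a" using pair_other[OF pq bN] by (elim exE conjE)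
      hence a: "N ?F1 y = {a, b}" "a \<noteq> b" using insert_commute[of a b "{}"] by simp_all
      have ab1: "{a, b} \<in> ?F1" using tt_del[OF t1 yS a] by blast
      have aS: "a \<in> ?S0" using N_S[OF t1, of y] a mem_N[of a ?F1 y] by blast
      have ab0: "{a, b} \<in> ?F0" using ab1 aS bS unfolding rs_def by blast
      obtain p' q' where pq': "N F x = {p', q'}" "p' \<noteq> q'" using simp2_N[OF x] by blast
      obtain s where s: "N F x = {y, s}" "y \<noteq> s" using pair_other[OF pq' yx] by (elim exE conjE)
      have "{y, s} \<in> F" using tt_del[OF t xS s] by blast
      hence "s \<in> N F y" using s(2) unfolding mem_N by simp
      moreover have sx: "s \<noteq> x" using s(1) mem_N[of s F x] by blast
      moreover have "s \<in> S" using N_S[OF t, of x] s(1) by blast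
      \<comment> \<open>The second neighbour \<open>s\<close> of \<open>x\<close> is adjacent to
        \<open>y\<close>, hence it is one of the two neighbours that \<open>y\<close> has besides
        \<open>x\<close>.\<close>
      ultimately have sab: "s = a \<or> s = b" using a(1) unfolding Ny by blast
      have ed: "{y, a} \<in> F" "{y, b} \<in> F" "{x, y} \<in> F" "{x, s} \<in> F"
        using a(1) s(1) mem_N[of a F y] mem_N[of b F y] mem_N[of y F x] mem_N[of s F x] unfolding Ny by blast+
      have FF: "?F0 \<subseteq> F" by (rule rs_sub)
      have xy: "x \<noteq> y" using yS by blast
      have nin: "x \<notin> ?S0" "y \<notin> ?S0" by blast+
      have c: "card ?S0 = card S - 2" using xS yS fin by simp
      have eqS: "insert x (insert y ?S0) = S" using xS yS by blast
      show ?thesis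
      proof (cases "\<exists>f. emb f [X7, X6, X5, X4, X3, X2, X1, X0] G81e ?S0 ?F0")
        case True
        then obtain f where f: "emb f [X7, X6, X5, X4, X3, X2, X1, X0] G81e ?S0 ?F0" by blast
        have "card ?S0 \<le> 8"
        proof -
          have "?S0 = f ` set [X7, X6, X5, X4, X3, X2, X1, X0]" using f unfolding emb_def by simp
          also have "card ... \<le> card (set [X7, X6, X5, X4, X3, X2, X1, X0])" by (rule card_image_le) simp
          finally show ?thesis by simp
        qed
        hence "card S = 10" using c n10 by linarith
        moreover have "Good (insert x (insert y ?S0)) F 5" by (rule G81_end[OF f ab0 sab nin xy FF ed])
        ultimately show ?thesis unfolding eqS by simp
      next
        case False
        have G: "Good ?S0 ?F0 ((card ?S0 + 1) div 2)"
        proof (cases "card S = 10")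
          case True
          thus ?thesis using tt_Good8[OF t0] False c by simp
        next
          case False
          hence "card ?S0 \<ge> 9" "card ?S0 < card S" using c n10 ev by presburger+
          thus ?thesis by (intro less.hyps t0)
        qed
        obtain p1 q1 where pq1: "N ?F0 b = {p1, q1}" "p1 \<noteq> q1" using simp2_N[OF b] by blast
        have ba: "a \<in> N ?F0 b" using ab0 a(2) insert_commute[of a b "{}"] unfolding mem_N by simp
        obtain z where z: "N ?F0 b = {a, z}" "a \<noteq> z" using pair_other[OF pq1 ba] by (elim exE conjE)
        have az: "{a, z} \<in> ?F0" using tt_del[OF t0 bS z] by blast
        have zS: "z \<in> ?S0" "b \<noteq> z" using N_S[OF t0, of b] z mem_N[of z ?F0 b] by blast+
        have nb: "u = a \<or> u = z" if "{b, u} \<in> ?F0" for u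
        proof -
          have "u \<noteq> b" using tt_edge2[OF t0 that] by blast
          hence "u \<in> N ?F0 b" using that unfolding mem_N by simp
          thus ?thesis using z by blast
        qed
        have "Good (insert x (insert y ?S0)) F ((card ?S0 + 1) div 2 + 1)"
          by (rule path_end[OF G _ aS bS zS(1) a(2) z(2) zS(2) xy nin nb FF az ed sab]) (use c n10 in linarith)
        moreover have "(card ?S0 + 1) div 2 + 1 = (card S + 1) div 2" using c n10 by presburger
        ultimately show ?thesis unfolding eqS by simp
      qed
    qed
  qed
qed

text \<open>\<open>free4\<close> may offer more than four vertices, while the arithmetic of the
  induction wants exactly four. The surplus is returned to the remainder as triangles glued on edges
  of \<open>Z\<close>.\<close>

lemma pd_ears:
  assumes "finite X" "pd Z S F" "F \<subseteq> G" "X \<inter> S = {}"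
    "\<And>x. x \<in> X \<Longrightarrow> \<exists>a b. {a, b} \<in> Z \<and> a \<noteq> b \<and> {x, a} \<in> G \<and> {x, b} \<in> G"
  shows "\<exists>Z' F'. pd Z' (S \<union> X) F' \<and> F' \<subseteq> G \<and> Z \<subseteq> Z'"
  using assms(1,4,5)
proof (induction X rule: finite_induct)
  case empty thus ?case using assms(2,3) by auto
next
  case (insert x X)
  have "X \<inter> S = {}" using insert.prems(1) by blast
  then obtain Z' F' where *: "pd Z' (S \<union> X) F'" "F' \<subseteq> G" "Z \<subseteq> Z'"
    using insert.IH insert.prems(2) by (metis insertCI)
  obtain a b where ab: "{a, b} \<in> Z" "a \<noteq> b" "{x, a} \<in> G" "{x, b} \<in> G" using insert.prems(2)[of x] by blast
  have "x \<notin> S \<union> X" using insert.prems(1) insert.hyps(2) by blast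
  from pd_ear[OF *(1) _ ab(2) this] *(3) ab(1)
  have "pd (insert {x, a} (insert {x, b} Z')) (insert x (S \<union> X)) (insert {x, a} (insert {x, b} F'))" by blast
  moreover have "insert x (S \<union> X) = S \<union> insert x X" by simp
  moreover have "insert {x, a} (insert {x, b} F') \<subseteq> G" using *(2) ab by simp
  ultimately show ?case using *(3) by (metis subset_insertI2)
qed

text \<open>Four deleted vertices and a remainder of at least five would make nine, so on at most
  eight vertices the spanning 2-tree must exist.\<close>

lemma pd_span2:
  assumes "pd Z S F" "card S \<le> 8" shows "\<exists>F'\<subseteq>F. tt S F'"
proof -
  have "TB {} S F" by (rule pd_TB[OF assms(1)]) simp
  moreover have "\<not> free4 {} S F"
  proof
    assume "free4 {} S F"
    then obtain X where X: "X \<subseteq> S" "card X \<ge> 4" "card (S - X) \<ge> 5" unfolding free4_def by (elim exE conjE) (rule that, simp_all)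
    have "finite S" by (rule pd_finite[OF assms(1)])
    hence "card (S - X) = card S - card X" using X(1) finite_subset card_Diff_subset by metis
    thus False using X assms(2) by simp
  qed
  ultimately show ?thesis unfolding TB_def span2_def by blast
qed

text \<open>The induction is over glued discs, because what is left of a disc after the deletions
  need not be a disc.\<close>

lemma pd_Good: "pd Z S F \<Longrightarrow> card S \<ge> 9 \<Longrightarrow> Good S F ((card S + 1) div 2)"
proof (induction "card S" arbitrary: Z S F rule: less_induct)
  case less
  have fin: "finite S" by (rule pd_finite[OF less.prems(1)])
  have "TB {} S F" by (rule pd_TB[OF less.prems(1)]) simp
  thus ?case unfolding TB_def
  proof
    assume "span2 {} S F"
    then obtain F' where "F' \<subseteq> F" "tt S F'" unfolding span2_def by blast
    thus ?thesis using tt_Good[OF _ less.prems(2)] Good_mono by blast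
  next
    assume "free4 {} S F"
    then obtain X Z' F' where X: "X \<subseteq> S" "pd Z' (S - X) F'" "F' \<subseteq> F" "card X \<ge> 4" "card (S - X) \<ge> 5"
      "\<forall>x\<in>X. \<exists>a b. {a, b} \<in> Z' \<and> a \<noteq> b \<and> {x, a} \<in> F \<and> {x, b} \<in> F"
      unfolding free4_def by (elim exE conjE) (rule that, simp_all)
    have XS: "X \<subseteq> S" using X(1) by simp
    have "card X \<ge> 4" using X(4) by simp
    then obtain W where W: "W \<subseteq> X" "card W = 4" using obtain_subset_with_card_n by metis
    have fX: "finite X" by (rule finite_subset[OF XS fin])
    have fXW: "finite (X - W)" using fX by simp
    have dis: "(X - W) \<inter> (S - X) = {}" by blast
    have at0: "\<exists>a b. {a, b} \<in> Z' \<and> a \<noteq> b \<and> {x, a} \<in> F \<and> {x, b} \<in> F" if "x \<in> X - W" for x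
      using bspec[OF X(6), of x] that by simp
    have "\<exists>Z'' F''. pd Z'' ((S - X) \<union> (X - W)) F'' \<and> F'' \<subseteq> F \<and> Z' \<subseteq> Z''"
      by (rule pd_ears[OF fXW X(2,3) dis]) (rule at0)
    then obtain Z'' F'' where p: "pd Z'' ((S - X) \<union> (X - W)) F''" "F'' \<subseteq> F" by (elim exE conjE)
    have eq: "(S - X) \<union> (X - W) = S - W" using XS W(1) by blast
    have fW: "finite W" by (rule finite_subset[OF W(1) fX])
    have c: "card (S - W) = card S - 4" using card_Diff_subset[OF fW subset_trans[OF W(1) XS]] W(2) by simp
    obtain F3 where A: "F3 \<subseteq> F" "AlmS (S - W) F3 ((card (S - W) + 1) div 2)"
    proof (cases "card (S - W) \<ge> 9")
      case True
      have "card (S - W) < card S" using c less.prems(2) by simp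
      from less.hyps[OF this p(1)[unfolded eq] True] show ?thesis by (intro that[OF p(2)] Alm1_AlmS Good_Alm1)
    next
      case False
      hence "card (S - W) \<le> 8" by simp
      from pd_span2[OF p(1)[unfolded eq] this] obtain F3 where F3: "F3 \<subseteq> F''" "tt (S - W) F3" by (elim exE conjE)
      have n: "card (S - W) \<ge> 5" "card (S - W) \<le> 8" using c less.prems(2) False by simp_all
      show ?thesis by (rule that[OF subset_trans[OF F3(1) p(2)] tt_AlmS_small[OF F3(2) n]])
    qed
    have at: "\<exists>a b. a \<noteq> b \<and> a \<in> S - W \<and> b \<in> S - W \<and> {x, a} \<in> F \<and> {x, b} \<in> F" if x: "x \<in> W" for x
    proof -
      obtain a b where ab: "{a, b} \<in> Z'" "a \<noteq> b" "{x, a} \<in> F" "{x, b} \<in> F" using bspec[OF X(6) subsetD[OF W(1) x]] by (elim exE conjE)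
      have "{a, b} \<subseteq> S - X" by (rule pd_edge_sub[OF X(2) subsetD[OF pd_sub[OF X(2)] ab(1)]])
      hence "a \<in> S - W" "b \<in> S - W" using W(1) by auto
      thus ?thesis using ab(2-4) by (intro exI[of _ a] exI[of _ b] conjI)
    qed
    have "Good ((S - W) \<union> W) F ((card (S - W) + 1) div 2 + 2)" by (rule star[OF A(2,1) _ at]) blast+
    moreover have "(S - W) \<union> W = S" using XS W(1) by blast
    moreover have "(card (S - W) + 1) div 2 + 2 = (card S + 1) div 2" using c less.prems(2) by presburger
    ultimately show ?thesis by simp
  qed
qed

section \<open>Discs on at most eight vertices\<close>

lemma deg2_boundary:
  assumes d: "disc Z V F" and c: "c \<in> V" and N: "\<And>z. {c, z} \<in> F \<Longrightarrow> z = s \<or> z = t"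
  shows "{c, s} \<in> Z \<and> {c, t} \<in> Z"
proof -
  note b = disc_basic[OF d]
  have "c \<in> \<Union> Z" using disc_inner_deg[OF d c] N by metis
  then obtain e where e: "e \<in> Z" "c \<in> e" by blast
  have "card e = 2" using b(3,4) e by blast
  then obtain p q where "e = {p, q}" by (metis card_2_iff)
  then obtain x where x: "{c, x} \<in> Z" using e by (metis insert_commute insertE singletonD)
  hence "{x, c} \<in> Z" by (simp add: insert_commute)
  then obtain y where y: "y \<noteq> x" "{c, y} \<in> Z" using disc_boundary_next[OF d] by blast
  have "x = s \<or> x = t" "y = s \<or> y = t" using N[OF subsetD[OF b(3) x]] N[OF subsetD[OF b(3) y(2)]] by simp_all
  thus ?thesis using x y by metis
qed

lemma B6_not_disc:
  assumes e: "emb f [X5, X4, X3, X2, X1, X0] B6e S F" and d: "disc Z S F"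
  shows False
proof -
  let ?vs = "[X5, X4, X3, X2, X1, X0]"
  have inj: "f i = f j \<longleftrightarrow> i = j" if "i \<in> set ?vs" "j \<in> set ?vs" for i j
    using e that unfolding emb_def by (metis inj_on_eq_iff)
  have S: "f X0 \<in> S" "f X1 \<in> S" "f X2 \<in> S" using e unfolding emb_def by auto
  have b: "verts_chk ?vs B6e" by code_simp
  have nb: "\<exists>j. z = f j \<and> ((i, j) \<in> set B6e \<or> (j, i) \<in> set B6e)" if i: "i \<in> set ?vs" "{f i, z} \<in> F" for i z
  proof -
    have "{f i, z} \<in> edg f B6e" using e i(2) unfolding emb_def by simp
    then obtain p q where pq: "(p, q) \<in> set B6e" "{f i, z} = {f p, f q}" unfolding edg_def by auto
    note v = verts_chk_sound[OF b pq(1)]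
    from pq(2) consider "f i = f p" "z = f q" | "f i = f q" "z = f p" by (metis doubleton_eq_iff)
    thus ?thesis
    proof cases
      case 1 thus ?thesis using inj[OF i(1), of p] v pq(1) by blast
    next
      case 2 thus ?thesis using inj[OF i(1), of q] v pq(1) by blast
    qed
  qed
  have n0: "z = f X3 \<or> z = f X5" if "{f X0, z} \<in> F" for z using nb[OF _ that] unfolding B6e_def by auto
  have n1: "z = f X4 \<or> z = f X5" if "{f X1, z} \<in> F" for z using nb[OF _ that] unfolding B6e_def by auto
  have n2: "z = f X4 \<or> z = f X5" if "{f X2, z} \<in> F" for z using nb[OF _ that] unfolding B6e_def by auto
  have "{f X0, f X5} \<in> Z" "{f X1, f X5} \<in> Z" "{f X2, f X5} \<in> Z"
    using deg2_boundary[OF d S(1) n0] deg2_boundary[OF d S(2) n1] deg2_boundary[OF d S(3) n2] by blast+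
  hence "f X0 = f X1 \<or> f X0 = f X2 \<or> f X1 = f X2"
    using disc_boundary_deg[OF d, of "f X0" "f X5" "f X1" "f X2"] by (simp add: insert_commute)
  thus False using inj[of X0 X1] inj[of X0 X2] inj[of X1 X2] by simp
qed

text \<open>There is a spanning 2-tree. If it is exceptional and not the whole graph, one more edge
  either makes it good or leads to \<open>K4e\<close>, \<open>W5e\<close> or \<open>G63e\<close>,
  where the same argument is repeated. \<open>B6e\<close> as the whole graph is impossible, which
  leaves the seven excluded graphs.\<close>

lemma disc_small:
  assumes d: "disc Z V F" and n: "card V \<ge> 3" "card V \<le> 8"
  shows "Good V F ((card V + 1) div 2) \<or>
    (\<exists>f. \<exists>xs\<in>{K4me, K4e}. emb f [X3, X2, X1, X0] xs V F) \<or>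
    (\<exists>f. \<exists>xs\<in>{G61e, G62e, W5e, G63e}. emb f [X5, X4, X3, X2, X1, X0] xs V F) \<or>
    (\<exists>f. emb f [X7, X6, X5, X4, X3, X2, X1, X0] G81e V F)"
proof -
  obtain F' where F': "F' \<subseteq> F" "tt V F'" using pd_span2[OF pd.disc[OF d] n(2)] by (elim exE conjE)
  have G: "card a = 2 \<and> a \<subseteq> V" if "a \<in> F" for a using disc_basic(4,5)[OF d that] by (rule conjI)
  consider "card V = 3" | "card V = 4" | "card V = 5" | "card V = 6" | "card V = 7" | "card V = 8" using n by linarith
  thus ?thesis
  proof cases
    case 1 thus ?thesis using Good_mono[OF tt_Good3[OF F'(2)] F'(1)] by simp
  next
    case 3 thus ?thesis using Good_mono[OF tt_Good5[OF F'(2)] F'(1)] by simp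
  next
    case 5 thus ?thesis using Good_mono[OF tt_Good7[OF F'(2)] F'(1)] by simp
  next
    case 2
    have ds: "distinct [X3, X2, X1, X0]" by simp
    obtain f where f: "emb f [X3, X2, X1, X0] K4me V F'" using tt_table4[OF F'(2) 2] unfolding T4_def by auto
    from sup_step[OF sup_K4m ds f F'(1) G] consider "F' = F" | "Good V F 0" |
      g H where "emb g [X3, X2, X1, X0] K4e V H" "H \<subseteq> F" by auto
    thus ?thesis
    proof cases
      case 1 thus ?thesis using f by blast
    next
      case 2 thus ?thesis using Good_mono[OF _ subset_refl] by blast
    next
      case 3
      from sup_step[OF sup_K4 ds 3 G] have "H = F \<or> Good V F 0" by simp
      thus ?thesis using 3 Good_mono[OF _ subset_refl] by blast
    qed
  next
    case 4
    let ?vs = "[X5, X4, X3, X2, X1, X0]"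
    have ds: "distinct ?vs" by simp
    have k: "(card V + 1) div 2 = 3" using 4 by simp
    have W: "?thesis" if e: "emb g ?vs ys V H" "H \<subseteq> F" "ys \<in> {W5e, G63e}" for g ys H
    proof -
      have "H = F \<or> Good V F 3" using e(3) sup_step[OF sup_W5 ds _ e(2) G] sup_step[OF sup_G63 ds _ e(2) G] e(1) by auto
      thus ?thesis using e(1,3) unfolding k by blast
    qed
    from tt_Good6[OF F'(2) 4] show ?thesis
    proof (elim disjE bexE exE)
      assume "Good V F' 3" thus ?thesis using Good_mono[OF _ F'(1)] unfolding k by blast
    next
      fix xs f assume x: "xs \<in> {G61e, G62e, B6e}" and f: "emb f ?vs xs V F'"
      have "F' = F \<or> Good V F 3 \<or> (\<exists>ys\<in>set [W5e, G63e]. \<exists>g H. emb g ?vs ys V H \<and> H \<subseteq> F)"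
        using x f sup_step[OF sup_G61 ds _ F'(1) G] sup_step[OF sup_G62 ds _ F'(1) G] sup_step[OF sup_B6 ds _ F'(1) G] by blast
      moreover have "F' = F \<Longrightarrow> ?thesis" using x f B6_not_disc[OF _ d, of f] by blast
      moreover have "Good V F 3 \<Longrightarrow> ?thesis" unfolding k by blast
      moreover have "\<exists>ys\<in>set [W5e, G63e]. \<exists>g H. emb g ?vs ys V H \<and> H \<subseteq> F \<Longrightarrow> ?thesis" using W by auto
      ultimately show ?thesis by blast
    qed
  next
    case 6
    have ds: "distinct [X7, X6, X5, X4, X3, X2, X1, X0]" by simp
    have k: "(card V + 1) div 2 = 4" using 6 by simp
    from tt_Good8[OF F'(2) 6] show ?thesis
    proof (elim disjE exE)
      assume "Good V F' 4" thus ?thesis using Good_mono[OF _ F'(1)] unfolding k by blast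
    next
      fix f assume f: "emb f [X7, X6, X5, X4, X3, X2, X1, X0] G81e V F'"
      from sup_step[OF sup_G81 ds f F'(1) G] have "F' = F \<or> Good V F 4" by simp
      thus ?thesis using f unfolding k by blast
    qed
  qed
qed

section \<open>Oriented diameter\<close>

text \<open>The edges left undirected are directed by an injective numbering \<open>g\<close> of the
  vertices. More arcs never increase a distance, and one strongly connected orientation bounds the
  minimum.\<close>

lemma Good_oriented_diam:
  fixes E :: "'a \<Rightarrow> 'a \<Rightarrow> bool"
  assumes s: "simple_graph V E" and ne: "V \<noteq> {}" and G: "Good V {{u, v} | u v. E u v} k"
  shows "oriented_diam V E \<le> k"
proof -
  have fin: "finite V" and Ed: "E u v \<Longrightarrow> u \<in> V \<and> v \<in> V \<and> u \<noteq> v \<and> E v u" for u v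
    using s unfolding simple_graph_def by blast+
  obtain A where A: "arcs_ok V {{u, v} | u v. E u v} A" and W: "\<And>u v. u \<in> V \<Longrightarrow> v \<in> V \<Longrightarrow> reach_in A k u v"
    using G unfolding Good_def by blast
  have AE: "E u v" "(v, u) \<notin> A" if "(u, v) \<in> A" for u v
  proof -
    have "{u, v} \<in> {{u, v} | u v. E u v}" "(v, u) \<notin> A" using A that unfolding arcs_ok_def by blast+
    then obtain p q where "{u, v} = {p, q}" "E p q" by blast
    thus "E u v" using Ed by (metis doubleton_eq_iff)
    show "(v, u) \<notin> A" by fact
  qed
  obtain g :: "'a \<Rightarrow> nat" where g: "inj_on g V" using finite_imp_inj_to_nat_seg[OF fin] by blast
  define B where "B = A \<union> {(u, v). E u v \<and> (u, v) \<notin> A \<and> (v, u) \<notin> A \<and> g u < g v}"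
  have BE: "E u v" if "(u, v) \<in> B" for u v using that AE(1)[of u v] unfolding B_def by auto
  have "B \<subseteq> edge_rel V E"
  proof (rule subrelI)
    fix u v assume "(u, v) \<in> B"
    from Ed[OF BE[OF this]] show "(u, v) \<in> edge_rel V E" using BE[OF \<open>(u, v) \<in> B\<close>] unfolding edge_rel_def by simp
  qed
  moreover have "(u, v) \<in> B \<longleftrightarrow> (v, u) \<notin> B" if "E u v" for u v
  proof -
    have "g u \<noteq> g v" using g Ed[OF that] inj_onD by metis
    thus ?thesis unfolding B_def using AE that Ed[OF that] by auto
  qed
  ultimately have O: "B \<in> orientations V E" unfolding orientations_def by blast
  have WB: "reach_in B k u v" if "u \<in> V" "v \<in> V" for u v
    by (rule reach_in_mono[OF W[OF that]]) (auto simp: B_def)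
  have "(u, v) \<in> B\<^sup>*" if "u \<in> V" "v \<in> V" for u v
    using WB[OF that] unfolding reach_in_def by (metis relpow_imp_rtrancl)
  hence sc: "strongly_connected V B" unfolding strongly_connected_def by blast
  have "dir_dist B u v \<le> k" if "u \<in> V" "v \<in> V" for u v
  proof -
    have "\<exists>j\<le>k. (u, v) \<in> B ^^ j" using WB[OF that] unfolding reach_in_def .
    then obtain j where "j \<le> k" "(u, v) \<in> B ^^ j" by blast
    thus ?thesis unfolding dir_dist_def using Least_le[of "\<lambda>k. (u, v) \<in> B ^^ k" j] by linarith
  qed
  moreover have "{dir_dist B u v | u v. u \<in> V \<and> v \<in> V} = (\<lambda>(u, v). dir_dist B u v) ` (V \<times> V)" by auto
  ultimately have "dir_diam V B \<le> k" unfolding dir_diam_def using fin ne by (subst Max_le_iff) auto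
  moreover have "finite {dir_diam V A | A. A \<in> orientations V E \<and> strongly_connected V A}"
  proof -
    have "edge_rel V E \<subseteq> V \<times> V" unfolding edge_rel_def by auto
    hence "finite (Pow (edge_rel V E))" using fin by (metis finite_Pow_iff finite_SigmaI finite_subset)
    moreover have "orientations V E \<subseteq> Pow (edge_rel V E)" unfolding orientations_def by blast
    ultimately have "finite (orientations V E)" using finite_subset by blast
    hence "finite (dir_diam V ` orientations V E)" by simp
    thus ?thesis by (rule finite_subset[rotated]) blast
  qed
  hence "oriented_diam V E \<le> dir_diam V B" unfolding oriented_diam_def using O sc by (intro Min_le) blast+
  ultimately show ?thesis by linarith
qed

section \<open>Translation to the excluded graphs on natural numbers\<close>

fun idx :: "vx \<Rightarrow> nat" where
  "idx X0 = 0" | "idx X1 = 1" | "idx X2 = 2" | "idx X3 = 3" | "idx X4 = 4"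
| "idx X5 = 5" | "idx X6 = 6" | "idx X7 = 7" | "idx X8 = 8" | "idx X9 = 9"

lemma idx_inj: "idx x = idx y \<longleftrightarrow> x = y" by (cases x; cases y) simp_all

lemma emb_iso:
  assumes e: "emb f vs xs V {{u, v} | u v. E u v}" and s: "simple_graph V E" and b: "verts_chk vs xs"
    and n: "idx ` set vs = {..<n}" and es: "es = map (\<lambda>(p, q). (idx p, idx q)) xs"
  shows "iso_to V E (graph_of n es)"
proof -
  let ?F = "{{u, v} | u v. E u v}"
  have f: "inj_on f (set vs)" "f ` set vs = V" "edg f xs = ?F" using e unfolding emb_def by auto
  have bij: "bij_betw f (set vs) V" using f unfolding bij_betw_def by simp
  have bi: "bij_betw (inv_into (set vs) f) V (set vs)" by (rule bij_betw_inv_into[OF bij])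
  have "bij_betw idx (set vs) {..<n}" using n idx_inj unfolding bij_betw_def inj_on_def by blast
  hence h: "bij_betw (idx \<circ> inv_into (set vs) f) V {..<n}" using bi bij_betw_trans by blast
  have iff: "E (f p) (f q) \<longleftrightarrow> (p, q) \<in> set xs \<or> (q, p) \<in> set xs" if pq: "p \<in> set vs" "q \<in> set vs" for p q
  proof
    assume "E (f p) (f q)"
    hence "{f p, f q} \<in> edg f xs" unfolding f(3) by blast
    then obtain p' q' where q': "(p', q') \<in> set xs" "{f p, f q} = {f p', f q'}" unfolding edg_def by auto
    note v = verts_chk_sound[OF b q'(1)]
    from q'(2) consider "f p = f p'" "f q = f q'" | "f p = f q'" "f q = f p'" by (metis doubleton_eq_iff)
    thus "(p, q) \<in> set xs \<or> (q, p) \<in> set xs"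
    proof cases
      case 1 thus ?thesis using inj_onD[OF f(1)] pq v q'(1) by metis
    next
      case 2 thus ?thesis using inj_onD[OF f(1)] pq v q'(1) by metis
    qed
  next
    have "E (f p) (f q)" if "(p, q) \<in> set xs \<or> (q, p) \<in> set xs"
    proof -
      have "{f p, f q} \<in> edg f xs" using that unfolding edg_def by (force simp: insert_commute)
      then obtain u v where uv: "{f p, f q} = {u, v}" "E u v" unfolding f(3) by blast
      have "E v u" using uv(2) s unfolding simple_graph_def by blast
      thus ?thesis using uv by (metis doubleton_eq_iff)
    qed
    thus "(p, q) \<in> set xs \<or> (q, p) \<in> set xs \<Longrightarrow> E (f p) (f q)" .
  qed
  have mem: "(idx p, idx q) \<in> set es \<longleftrightarrow> (p, q) \<in> set xs" for p q
    unfolding es using idx_inj by auto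
  have "E u v \<longleftrightarrow> snd (graph_of n es) ((idx \<circ> inv_into (set vs) f) u) ((idx \<circ> inv_into (set vs) f) v)"
    if uv: "u \<in> V" "v \<in> V" for u v
  proof -
    obtain p q where pq: "p \<in> set vs" "q \<in> set vs" "u = f p" "v = f q" using uv f(2) by blast
    have "inv_into (set vs) f u = p" "inv_into (set vs) f v = q" using pq f(1) by simp_all
    thus ?thesis using iff[OF pq(1,2)] mem pq(3,4) unfolding graph_of_def by simp
  qed
  thus ?thesis using h unfolding iso_to_def isomorphic_def graph_of_def by (intro exI[of _ "idx \<circ> inv_into (set vs) f"]) simp
qed

lemma idx_range:
  "idx ` set [X3, X2, X1, X0] = {..<4}" "idx ` set [X5, X4, X3, X2, X1, X0] = {..<6}"
  "idx ` set [X7, X6, X5, X4, X3, X2, X1, X0] = {..<8}"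
  by (auto simp: lessThan_nat_numeral lessThan_Suc)

lemma iso_K4_minus:
  assumes "emb f [X3, X2, X1, X0] K4me V {{u, v} | u v. E u v}" "simple_graph V E"
  shows "iso_to V E K4_minus"
proof -
  have "verts_chk [X3, X2, X1, X0] K4me" by code_simp
  moreover have "[(0,1),(0,2),(0,3),(1,2),(1,3)] = map (\<lambda>(p, q). (idx p, idx q)) K4me"
    unfolding K4me_def by simp
  ultimately show ?thesis unfolding K4_minus_def by (rule emb_iso[OF assms _ idx_range(1)])
qed

lemma iso_K4:
  assumes "emb f [X3, X2, X1, X0] K4e V {{u, v} | u v. E u v}" "simple_graph V E"
  shows "iso_to V E K4"
proof -
  have "verts_chk [X3, X2, X1, X0] K4e" by code_simp
  moreover have "[(0,1),(0,2),(0,3),(1,2),(1,3),(2,3)] = map (\<lambda>(p, q). (idx p, idx q)) K4e"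
    unfolding K4e_def by simp
  ultimately show ?thesis unfolding K4_def by (rule emb_iso[OF assms _ idx_range(1)])
qed

lemma iso_W5:
  assumes "emb f [X5, X4, X3, X2, X1, X0] W5e V {{u, v} | u v. E u v}" "simple_graph V E"
  shows "iso_to V E W5"
proof -
  have "verts_chk [X5, X4, X3, X2, X1, X0] W5e" by code_simp
  moreover have "[(0,1),(1,2),(2,3),(3,4),(4,0),(5,0),(5,1),(5,2),(5,3),(5,4)] = map (\<lambda>(p, q). (idx p, idx q)) W5e"
    unfolding W5e_def by simp
  ultimately show ?thesis unfolding W5_def by (rule emb_iso[OF assms _ idx_range(2)])
qed

lemma iso_G61:
  assumes "emb f [X5, X4, X3, X2, X1, X0] G61e V {{u, v} | u v. E u v}" "simple_graph V E"
  shows "iso_to V E G61"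
proof -
  have "verts_chk [X5, X4, X3, X2, X1, X0] G61e" by code_simp
  moreover have "[(0,1),(1,2),(2,3),(3,4),(5,0),(5,1),(5,2),(5,3),(5,4)] = map (\<lambda>(p, q). (idx p, idx q)) G61e"
    unfolding G61e_def by simp
  ultimately show ?thesis unfolding G61_def by (rule emb_iso[OF assms _ idx_range(2)])
qed

lemma iso_G62:
  assumes "emb f [X5, X4, X3, X2, X1, X0] G62e V {{u, v} | u v. E u v}" "simple_graph V E"
  shows "iso_to V E G62"
proof -
  have "verts_chk [X5, X4, X3, X2, X1, X0] G62e" by code_simp
  moreover have "[(0,1),(1,2),(2,3),(3,4),(4,5),(5,0),(0,2),(0,3),(3,5)] = map (\<lambda>(p, q). (idx p, idx q)) G62e"
    unfolding G62e_def by simp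
  ultimately show ?thesis unfolding G62_def by (rule emb_iso[OF assms _ idx_range(2)])
qed

lemma iso_G63:
  assumes "emb f [X5, X4, X3, X2, X1, X0] G63e V {{u, v} | u v. E u v}" "simple_graph V E"
  shows "iso_to V E G63"
proof -
  have "verts_chk [X5, X4, X3, X2, X1, X0] G63e" by code_simp
  moreover have "[(0,1),(1,2),(2,0),(3,0),(3,1),(3,2),(1,4),(2,4),(4,5),(1,5)] = map (\<lambda>(p, q). (idx p, idx q)) G63e"
    unfolding G63e_def by simp
  ultimately show ?thesis unfolding G63_def by (rule emb_iso[OF assms _ idx_range(2)])
qed

lemma iso_G81:
  assumes "emb f [X7, X6, X5, X4, X3, X2, X1, X0] G81e V {{u, v} | u v. E u v}" "simple_graph V E"
  shows "iso_to V E G81"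
proof -
  have "verts_chk [X7, X6, X5, X4, X3, X2, X1, X0] G81e" by code_simp
  moreover have "[(0,1),(1,2),(2,3),(3,4),(4,5),(5,6),(6,7),(7,0), (1,7),(2,7),(3,7),(3,5),(3,6)] = map (\<lambda>(p, q). (idx p, idx q)) G81e"
    unfolding G81e_def by simp
  ultimately show ?thesis unfolding G81_def by (rule emb_iso[OF assms _ idx_range(3)])
qed

lemma half_le_ceiling: "int ((n + 1) div 2) \<le> \<lceil>real n / 2\<rceil>"
proof -
  have "2 * ((n + 1) div 2) \<le> n + 1" by presburger
  hence "real (2 * ((n + 1) div 2)) \<le> real (n + 1)" by (simp only: of_nat_le_iff)
  thus ?thesis unfolding le_ceiling_iff by simp
qed

theorem theorem1p3:
  fixes V :: "'a set" and E :: "'a \<Rightarrow> 'a \<Rightarrow> bool"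
    and p :: "'a \<Rightarrow> complex" and c :: "'a \<Rightarrow> 'a \<Rightarrow> real \<Rightarrow> complex"
  assumes "simple_graph V E"
    and "plane_embedding V E p c"
    and "near_triangulation V E p c"
    and "two_connected V E"
    and "\<not> iso_to V E K4_minus" and "\<not> iso_to V E K4" and "\<not> iso_to V E W5"
    and "\<not> iso_to V E G61" and "\<not> iso_to V E G62" and "\<not> iso_to V E G63"
    and "\<not> iso_to V E G81"
  shows "int (oriented_diam V E) \<le> \<lceil>real (card V) / 2\<rceil>"
proof -
  interpret near_tri V E p c by unfold_locales (use assms in simp_all)
  obtain Z where Z: "disc Z V EE" using near_tri_disc by blast
  have n3: "card V \<ge> 3" using assms(4) unfolding two_connected_def by simp
  hence ne: "V \<noteq> {}" by auto
  note iso = iso_K4_minus iso_K4 iso_W5 iso_G61 iso_G62 iso_G63 iso_G81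
  have "Good V EE ((card V + 1) div 2)"
  proof (cases "card V \<ge> 9")
    case True thus ?thesis by (rule pd_Good[OF pd.disc[OF Z]])
  next
    case False
    hence "card V \<le> 8" by simp
    from disc_small[OF Z n3 this] show ?thesis
      using iso[OF _ assms(1), folded EE_def] assms(5-11) by blast
  qed
  hence "oriented_diam V E \<le> (card V + 1) div 2" unfolding EE_def by (rule Good_oriented_diam[OF assms(1) ne])
  hence "int (oriented_diam V E) \<le> int ((card V + 1) div 2)" by simp
  also have "... \<le> \<lceil>real (card V) / 2\<rceil>" by (rule half_le_ceiling)
  finally show ?thesis .
qed

end
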